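(* Let $(\iota,\pi)\colon N\rightarrowtail R\twoheadrightarrow A$ be a universal analytically nilpotent extension, let $(j,p)\colon K\rightarrowtail E\twoheadrightarrow Q$ be an analytically nilpotent extension, and let $\phi\colon A\to Q$ be a bounded homomorphism. Then there is a morphism of extensions $(\xi,\psi,\phi)$ from $N\rightarrowtail R\twoheadrightarrow A$ to $K\rightarrowtail E\twoheadrightarrow Q$ lifting $\phi$. This lifting is unique up to smooth homotopy relative to $\phi$. More generally, let $(\xi_t,\psi_t,\phi_t)$, $t=0,1$, be morphisms of extensions from $N\rightarrowtail R\twoheadrightarrow A$ to $K\rightarrowtail E\twoheadrightarrow Q$ and let $\Phi\colon A\to C^\infty([0,1];Q)$ be a smooth homotopy between $\phi_0$ and $\phi_1$. Then $\Phi$ can be lifted to a smooth homotopy $(\Xi,\Psi,\Phi)$ between $(\xi_0,\psi_0,\phi_0)$ and $(\xi_1,\psi_1,\phi_1)$. An analogous statement holds for absolutely continuous homotopies instead of smooth homotopies.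
   Context: Bornologies. A convex bornology on a complex vector space $V$ is a family of subsets, called small, containing the points and closed under subsets, sums and circled convex hulls; $V$ is a complete bornological vector space if every small set lies in a small disk (circled convex set) whose linear span with the gauge norm is a Banach space. (Multi)linear maps are bounded if they preserve smallness. $\hat\otimes$ is the completed tensor product (universal for bounded bilinear maps into complete spaces). A complete bornological algebra is a complete bornological vector space with a bounded associative multiplication (unit not required). An allowable extension $K\rightarrowtail E\twoheadrightarrow Q$ of complete bornological algebras consists of bounded homomorphisms $i\colon K\to E$, $p\colon E\to Q$ with $i$ a bornological isomorphism onto $\operatorname{Ker}p$, and such that $p$ has a bounded linear section. Analytic tensor algebra. $\Omega A$ is the algebra of non-commutative differential forms $\langle a_0\rangle da_1\dots da_n$ ($=a_0da_1\dots da_n$ or $da_1\dots da_n$) over the non-unital algebra $A$; $\Omega_{an}A$ is its completion (universal for bounded linear maps into complete spaces) for the convex bornology generated by the sets $\{a_0\}\cup\{\langle a_0\rangle da_1\dots da_n:n\ge1\}$, all $a_j\in S$, $S\subset A$ small. $\mathcal TA$ is the even part of $\Omega_{an}A$ with product $x\odot y=xy-(-1)^{\deg x}dx\,dy$; $\tau_A\colon\mathcal TA\to A$ is the projection onto 0-forms. A complete bornological algebra $N$ is analytically nilpotent if $S^\infty=\bigcup_{n\ge1}S^n$ is small for every small $S\subset N$. $R$ is analytically quasi-free if there is a bounded homomorphism $\upsilon\colon R\to\mathcal TR$ with $\tau_R\circ\upsilon=\mathrm{id}_R$. An analytically nilpotent extension is an allowable extension of complete bornological algebras with analytically nilpotent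 kernel; it is a universal analytically nilpotent extension if in addition its middle algebra is analytically quasi-free. Homotopies. $C^\infty([0,1];B)=C^\infty([0,1])\hat\otimes B$, where $C^\infty([0,1])$ has its bounded bornology as a Fréchet space; $\mathrm{ev}_t$ are the evaluations. A smooth homotopy is a bounded homomorphism $A\to C^\infty([0,1];B)$. A morphism of extensions is a triple $(\xi,\psi,\phi)$ of bounded homomorphisms between kernels, middle terms and quotients making the evident diagram commute. A smooth homotopy of morphisms of extensions into $K\rightarrowtail E\twoheadrightarrow Q$ is a morphism of extensions $(\Xi,\Psi,\Phi)$ into $C^\infty([0,1];K)\rightarrowtail C^\infty([0,1];E)\twoheadrightarrow C^\infty([0,1];Q)$, joining its evaluations at $0$ and $1$; it is relative to $\phi$ if $\mathrm{ev}_t\circ\Phi=\phi$ for all $t\in[0,1]$. Absolutely continuous homotopies are defined in the same way with $C^\infty([0,1])$ replaced by the Banach algebra $AC([0,1])$ of absolutely continuous functions with norm $|f(0)|+\int_0^1|f'(t)|dt$ (norm bounded sets being small). *)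

theory Defs
  imports
    "HOL-Analysis.Analysis"
    "HOL-Library.Poly_Mapping"
    "HOL-Algebra.AbelCoset"
    "HOL-Algebra.Module"
begin

section \<open>Bornological vector spaces and algebras\<close>

text \<open>Vector spaces are carrier-based modules over the complex numbers in the sense of
  HOL-Algebra, enriched by a family of small sets. The record field \<open>mult\<close> is ignored for vector
  spaces and is the multiplication of an algebra; algebras need not be unital, so the field \<open>one\<close> is
  ignored throughout. All maps matter on carriers only.\<close>

definition complex_ring :: "complex ring" where
  "complex_ring = \<lparr>carrier = UNIV, monoid.mult = (*), one = 1, zero = 0, add = (+)\<rparr>"

record 'a bvs = "(complex, 'a) module" +
  small :: "'a set set"

definition disk :: "'a bvs \<Rightarrow> 'a set \<Rightarrow> bool" where
  "disk V D \<longleftrightarrow> D \<subseteq> carrier V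
    \<and> (\<forall>c. \<forall>x\<in>D. cmod c \<le> 1 \<longrightarrow> c \<odot>\<^bsub>V\<^esub> x \<in> D)
    \<and> (\<forall>x\<in>D. \<forall>y\<in>D. \<forall>t\<in>{0..1::real}.
        (complex_of_real t \<odot>\<^bsub>V\<^esub> x) \<oplus>\<^bsub>V\<^esub> (complex_of_real (1 - t) \<odot>\<^bsub>V\<^esub> y) \<in> D)"

definition disk_hull :: "'a bvs \<Rightarrow> 'a set \<Rightarrow> 'a set" where
  "disk_hull V S = \<Inter> {D. disk V D \<and> S \<subseteq> D}"

definition lin_span :: "'a bvs \<Rightarrow> 'a set \<Rightarrow> 'a set" where
  "lin_span V S = \<Inter> {W. submodule W complex_ring V \<and> S \<subseteq> W}"

definition disk_gauge :: "'a bvs \<Rightarrow> 'a set \<Rightarrow> 'a \<Rightarrow> real" where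
  "disk_gauge V D x = Inf {r. 0 < r \<and> (\<exists>y\<in>D. x = complex_of_real r \<odot>\<^bsub>V\<^esub> y)}"

text \<open>For a non-empty disk the gauge is automatically a seminorm on the linear span, so that being a
  Banach space amounts to definiteness and convergence of Cauchy sequences.\<close>

definition complete_disk :: "'a bvs \<Rightarrow> 'a set \<Rightarrow> bool" where
  "complete_disk V D \<longleftrightarrow> disk V D \<and> D \<noteq> {}
    \<and> (\<forall>x\<in>lin_span V D. disk_gauge V D x = 0 \<longrightarrow> x = \<zero>\<^bsub>V\<^esub>)
    \<and> (\<forall>X. (\<forall>n. X n \<in> lin_span V D)
          \<and> (\<forall>e>0. \<exists>M. \<forall>m\<ge>M. \<forall>n\<ge>M. disk_gauge V D (X m \<ominus>\<^bsub>V\<^esub> X n) < e)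
        \<longrightarrow> (\<exists>x\<in>lin_span V D. (\<lambda>n::nat. disk_gauge V D (X n \<ominus>\<^bsub>V\<^esub> x)) \<longlonglongrightarrow> 0))"

locale convex_bornology = Module.module complex_ring V for V :: "'a bvs" (structure) +
  assumes small_subset_carrier: "S \<in> small V \<Longrightarrow> S \<subseteq> carrier V"
    and small_point: "x \<in> carrier V \<Longrightarrow> {x} \<in> small V"
    and small_subset: "\<lbrakk>S \<in> small V; T \<subseteq> S\<rbrakk> \<Longrightarrow> T \<in> small V"
    and small_sum: "\<lbrakk>S \<in> small V; T \<in> small V\<rbrakk> \<Longrightarrow> S <+> T \<in> small V"
    and small_disk_hull: "S \<in> small V \<Longrightarrow> disk_hull V S \<in> small V"

locale complete_bvs = convex_bornology +
  assumes small_complete: "S \<in> small V \<Longrightarrow> \<exists>D \<in> small V. complete_disk V D \<and> S \<subseteq> D"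

definition bornology_generated :: "'a bvs \<Rightarrow> 'a set set \<Rightarrow> 'a set set" where
  "bornology_generated V G =
    \<Inter> {B. convex_bornology (V\<lparr>small := B\<rparr>) \<and> G \<subseteq> B}"

definition linear_on :: "('a, 'm) bvs_scheme \<Rightarrow> ('b, 'n) bvs_scheme \<Rightarrow> ('a \<Rightarrow> 'b) \<Rightarrow> bool" where
  "linear_on V W f \<longleftrightarrow> f \<in> carrier V \<rightarrow> carrier W
    \<and> (\<forall>x\<in>carrier V. \<forall>y\<in>carrier V. f (x \<oplus>\<^bsub>V\<^esub> y) = f x \<oplus>\<^bsub>W\<^esub> f y)
    \<and> (\<forall>c. \<forall>x\<in>carrier V. f (c \<odot>\<^bsub>V\<^esub> x) = c \<odot>\<^bsub>W\<^esub> f x)"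

definition bdd_linear :: "'a bvs \<Rightarrow> 'b bvs \<Rightarrow> ('a \<Rightarrow> 'b) \<Rightarrow> bool" where
  "bdd_linear V W f \<longleftrightarrow> linear_on V W f \<and> (\<forall>S\<in>small V. f ` S \<in> small W)"

definition bdd_bilinear :: "'a bvs \<Rightarrow> 'b bvs \<Rightarrow> 'c bvs \<Rightarrow> ('a \<Rightarrow> 'b \<Rightarrow> 'c) \<Rightarrow> bool" where
  "bdd_bilinear V W X f \<longleftrightarrow>
    (\<forall>x\<in>carrier V. linear_on W X (f x))
    \<and> (\<forall>y\<in>carrier W. linear_on V X (\<lambda>x. f x y))
    \<and> (\<forall>S\<in>small V. \<forall>T\<in>small W. {f x y | x y. x \<in> S \<and> y \<in> T} \<in> small X)"

locale complete_balg = complete_bvs A for A :: "'a bvs" (structure) +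
  assumes bdd_mult: "bdd_bilinear A A A (mult A)"
    and mult_assoc: "\<lbrakk>x \<in> carrier A; y \<in> carrier A; z \<in> carrier A\<rbrakk>
      \<Longrightarrow> (x \<otimes> y) \<otimes> z = x \<otimes> (y \<otimes> z)"

definition bdd_hom :: "'a bvs \<Rightarrow> 'b bvs \<Rightarrow> ('a \<Rightarrow> 'b) \<Rightarrow> bool" where
  "bdd_hom A B f \<longleftrightarrow> bdd_linear A B f
    \<and> (\<forall>x\<in>carrier A. \<forall>y\<in>carrier A. f (x \<otimes>\<^bsub>A\<^esub> y) = f x \<otimes>\<^bsub>B\<^esub> f y)"


section \<open>Completions and completed tensor products\<close>

text \<open>Every element of the completion of \<open>V\<close> is the limit of a Cauchy sequence in the linear span of
  a small disk of \<open>V\<close>. Hence the completion has a copy whose carrier is a set of sequences in \<open>V\<close>, and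
  it is characterised by its universal property for targets living on that type: the copy of the
  completion is itself among these targets.\<close>

definition is_completion :: "'v bvs \<Rightarrow> (nat \<Rightarrow> 'v) bvs \<Rightarrow> ('v \<Rightarrow> nat \<Rightarrow> 'v) \<Rightarrow> bool" where
  "is_completion V C \<eta> \<longleftrightarrow> complete_bvs C \<and> bdd_linear V C \<eta>
    \<and> (\<forall>(X :: (nat \<Rightarrow> 'v) bvs) f. complete_bvs X \<and> bdd_linear V X f \<longrightarrow>
        (\<exists>g. bdd_linear C X g \<and> (\<forall>v\<in>carrier V. g (\<eta> v) = f v)
          \<and> (\<forall>g'. bdd_linear C X g' \<and> (\<forall>v\<in>carrier V. g' (\<eta> v) = f v)
                \<longrightarrow> (\<forall>x\<in>carrier C. g' x = g x))))"

definition completion_pair :: "'v bvs \<Rightarrow> (nat \<Rightarrow> 'v) bvs \<times> ('v \<Rightarrow> nat \<Rightarrow> 'v)" where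
  "completion_pair V = (SOME (C, \<eta>). is_completion V C \<eta>)"

definition completion :: "'v bvs \<Rightarrow> (nat \<Rightarrow> 'v) bvs" where
  "completion V = fst (completion_pair V)"

definition completion_map :: "'v bvs \<Rightarrow> 'v \<Rightarrow> nat \<Rightarrow> 'v" where
  "completion_map V = snd (completion_pair V)"

definition completion_lift :: "'v bvs \<Rightarrow> 'x bvs \<Rightarrow> ('v \<Rightarrow> 'x) \<Rightarrow> (nat \<Rightarrow> 'v) \<Rightarrow> 'x" where
  "completion_lift V X f = (SOME g. bdd_linear (completion V) X g
    \<and> (\<forall>v\<in>carrier V. g (completion_map V v) = f v))"

text \<open>Likewise, every element of the completed tensor product of complete spaces is a sum
  \<open>\<Sum>n. v n \<otimes> w n\<close>, so that it has a copy whose carrier is a set of sequences of pairs.\<close>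

definition is_ctensor ::
  "'a bvs \<Rightarrow> 'b bvs \<Rightarrow> (nat \<Rightarrow> 'a \<times> 'b) bvs \<Rightarrow> ('a \<Rightarrow> 'b \<Rightarrow> nat \<Rightarrow> 'a \<times> 'b) \<Rightarrow> bool" where
  "is_ctensor V W T \<theta> \<longleftrightarrow> complete_bvs T \<and> bdd_bilinear V W T \<theta>
    \<and> (\<forall>(X :: (nat \<Rightarrow> 'a \<times> 'b) bvs) f. complete_bvs X \<and> bdd_bilinear V W X f \<longrightarrow>
        (\<exists>g. bdd_linear T X g \<and> (\<forall>v\<in>carrier V. \<forall>w\<in>carrier W. g (\<theta> v w) = f v w)
          \<and> (\<forall>g'. bdd_linear T X g' \<and> (\<forall>v\<in>carrier V. \<forall>w\<in>carrier W. g' (\<theta> v w) = f v w)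
                \<longrightarrow> (\<forall>x\<in>carrier T. g' x = g x))))"

definition ctensor_pair ::
  "'a bvs \<Rightarrow> 'b bvs \<Rightarrow> (nat \<Rightarrow> 'a \<times> 'b) bvs \<times> ('a \<Rightarrow> 'b \<Rightarrow> nat \<Rightarrow> 'a \<times> 'b)" where
  "ctensor_pair V W = (SOME (T, \<theta>). is_ctensor V W T \<theta>)"

definition ctensor :: "'a bvs \<Rightarrow> 'b bvs \<Rightarrow> (nat \<Rightarrow> 'a \<times> 'b) bvs" where
  "ctensor V W = fst (ctensor_pair V W)"

definition elem_tensor :: "'a bvs \<Rightarrow> 'b bvs \<Rightarrow> 'a \<Rightarrow> 'b \<Rightarrow> nat \<Rightarrow> 'a \<times> 'b" where
  "elem_tensor V W = snd (ctensor_pair V W)"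

definition ctensor_lift ::
  "'a bvs \<Rightarrow> 'b bvs \<Rightarrow> 'x bvs \<Rightarrow> ('a \<Rightarrow> 'b \<Rightarrow> 'x) \<Rightarrow> (nat \<Rightarrow> 'a \<times> 'b) \<Rightarrow> 'x" where
  "ctensor_lift V W X f = (SOME g. bdd_linear (ctensor V W) X g
    \<and> (\<forall>v\<in>carrier V. \<forall>w\<in>carrier W. g (elem_tensor V W v w) = f v w))"

definition ctensor_alg :: "'a bvs \<Rightarrow> 'b bvs \<Rightarrow> (nat \<Rightarrow> 'a \<times> 'b) bvs" where
  "ctensor_alg A B = (ctensor A B)\<lparr>mult :=
    (SOME m. bdd_bilinear (ctensor A B) (ctensor A B) (ctensor A B) m
      \<and> (\<forall>a\<in>carrier A. \<forall>b\<in>carrier B. \<forall>a'\<in>carrier A. \<forall>b'\<in>carrier B.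
          m (elem_tensor A B a b) (elem_tensor A B a' b')
            = elem_tensor A B (a \<otimes>\<^bsub>A\<^esub> a') (b \<otimes>\<^bsub>B\<^esub> b')))\<rparr>"


section \<open>Non-commutative differential forms\<close>

text \<open>The pair \<open>(Some a\<^sub>0, [a\<^sub>1, \<dots>, a\<^sub>n])\<close> stands for \<open>a\<^sub>0 da\<^sub>1 \<dots> da\<^sub>n\<close> and
  \<open>(None, [a\<^sub>1, \<dots>, a\<^sub>n])\<close> stands for \<open>da\<^sub>1 \<dots> da\<^sub>n\<close>, where \<open>n \<ge> 1\<close> in the second case because
  zero-forms are elements of the non-unital algebra \<open>A\<close>. The space of forms is the quotient of the free
  vector space on these words by multilinearity in all entries; that is, \<open>\<Omega>\<^sup>nA\<close> is the algebraic
  tensor product of \<open>A\<^sup>+\<close> with \<open>n\<close> copies of \<open>A\<close> for \<open>n \<ge> 1\<close>.\<close>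

type_synonym 'a fword = "'a option \<times> 'a list"
type_synonym 'a fform = "'a fword \<Rightarrow>\<^sub>0 complex"

definition fwords :: "'a set \<Rightarrow> 'a fword set" where
  "fwords S = {(x, as). set_option x \<subseteq> S \<and> set as \<subseteq> S \<and> (x = None \<longrightarrow> as \<noteq> [])}"

abbreviation fmono :: "'a fword \<Rightarrow> 'a fform" where
  "fmono w \<equiv> Poly_Mapping.single w 1"

definition pm_scale :: "complex \<Rightarrow> ('x \<Rightarrow>\<^sub>0 complex) \<Rightarrow> ('x \<Rightarrow>\<^sub>0 complex)" where
  "pm_scale c f = Poly_Mapping.map ((*) c) f"

definition pm_extend :: "('x \<Rightarrow> ('y \<Rightarrow>\<^sub>0 complex)) \<Rightarrow> ('x \<Rightarrow>\<^sub>0 complex) \<Rightarrow> ('y \<Rightarrow>\<^sub>0 complex)" where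
  "pm_extend h f = (\<Sum>w\<in>Poly_Mapping.keys f. pm_scale (Poly_Mapping.lookup f w) (h w))"

definition free_forms :: "'a bvs \<Rightarrow> 'a fform bvs" where
  "free_forms A = \<lparr>carrier = {f. Poly_Mapping.keys f \<subseteq> fwords (carrier A)},
    monoid.mult = undefined, one = undefined, zero = 0, add = (+),
    smult = pm_scale, small = {}\<rparr>"

definition multilinear_relations :: "'a bvs \<Rightarrow> 'a fform set" where
  "multilinear_relations A =
    {fmono (Some ((c \<odot>\<^bsub>A\<^esub> x) \<oplus>\<^bsub>A\<^esub> y), as) - pm_scale c (fmono (Some x, as)) - fmono (Some y, as)
      | c x y as. x \<in> carrier A \<and> y \<in> carrier A \<and> set as \<subseteq> carrier A}
    \<union> {fmono (z, as @ ((c \<odot>\<^bsub>A\<^esub> x) \<oplus>\<^bsub>A\<^esub> y) # bs)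
          - pm_scale c (fmono (z, as @ x # bs)) - fmono (z, as @ y # bs)
      | c x y z as bs. x \<in> carrier A \<and> y \<in> carrier A \<and> set_option z \<subseteq> carrier A
          \<and> set as \<subseteq> carrier A \<and> set bs \<subseteq> carrier A}"

definition relation_space :: "'a bvs \<Rightarrow> 'a fform set" where
  "relation_space A = lin_span (free_forms A) (multilinear_relations A)"

definition form_class :: "'a bvs \<Rightarrow> 'a fform \<Rightarrow> 'a fform set" where
  "form_class A f = relation_space A +>\<^bsub>free_forms A\<^esub> f"

text \<open>\<open>form_rmult A x as b\<close> is \<open>\<langle>x\<rangle>da\<^sub>1 \<dots> da\<^sub>n \<cdot> b\<close>, where \<open>as = [a\<^sub>n, \<dots>, a\<^sub>1]\<close> is in
  reversed order; the recursion is the Leibniz rule \<open>(\<omega> da) b = \<omega> d(ab) - (\<omega> a) db\<close>.\<close>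

definition append_d :: "'a list \<Rightarrow> 'a fform \<Rightarrow> 'a fform" where
  "append_d bs = pm_extend (\<lambda>(x, as). fmono (x, as @ bs))"

fun form_rmult :: "'a bvs \<Rightarrow> 'a option \<Rightarrow> 'a list \<Rightarrow> 'a \<Rightarrow> 'a fform" where
  "form_rmult A None [] b = fmono (Some b, [])"
| "form_rmult A (Some a) [] b = fmono (Some (a \<otimes>\<^bsub>A\<^esub> b), [])"
| "form_rmult A x (a # as) b =
    fmono (x, rev ((a \<otimes>\<^bsub>A\<^esub> b) # as)) - append_d [b] (form_rmult A x as a)"

fun word_mult :: "'a bvs \<Rightarrow> 'a fword \<Rightarrow> 'a fword \<Rightarrow> 'a fform" where
  "word_mult A (x, as) (None, bs) = fmono (x, as @ bs)"
| "word_mult A (x, as) (Some b, bs) = append_d bs (form_rmult A x (rev as) b)"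

definition free_mult :: "'a bvs \<Rightarrow> 'a fform \<Rightarrow> 'a fform \<Rightarrow> 'a fform" where
  "free_mult A f g = pm_extend (\<lambda>v. pm_extend (word_mult A v) g) f"

definition free_d :: "'a fform \<Rightarrow> 'a fform" where
  "free_d = pm_extend (\<lambda>(x, as). case x of None \<Rightarrow> 0 | Some a \<Rightarrow> fmono (None, a # as))"

definition free_grading :: "'a fform \<Rightarrow> 'a fform" where
  "free_grading = pm_extend (\<lambda>(x, as). pm_scale ((-1) ^ length as) (fmono (x, as)))"

definition free_degree0 :: "'a bvs \<Rightarrow> 'a fform \<Rightarrow> 'a" where
  "free_degree0 A f = (\<Oplus>\<^bsub>A\<^esub>a\<in>{a. (Some a, []) \<in> Poly_Mapping.keys f}.
    Poly_Mapping.lookup f (Some a, []) \<odot>\<^bsub>A\<^esub> a)"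

text \<open>The forms \<open>\<Omega>A\<close> with the bornology generated by the sets
  \<open>{a\<^sub>0} \<union> {\<langle>a\<^sub>0\<rangle>da\<^sub>1 \<dots> da\<^sub>n : n \<ge> 1}\<close> with entries in a small set. Elements are cosets of
  the space of relations and operations are induced from representatives.\<close>

definition forms_plain :: "'a bvs \<Rightarrow> 'a fform set bvs" where
  "forms_plain A = \<lparr>carrier = a_rcosets\<^bsub>free_forms A\<^esub> (relation_space A),
    monoid.mult = (\<lambda>C D. \<Union>f\<in>C. \<Union>g\<in>D. form_class A (free_mult A f g)),
    one = undefined,
    zero = relation_space A,
    add = set_add (free_forms A),
    smult = (\<lambda>c C. \<Union>f\<in>C. form_class A (pm_scale c f)),
    small = {}\<rparr>"

definition forms :: "'a bvs \<Rightarrow> 'a fform set bvs" where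
  "forms A = (forms_plain A)\<lparr>small := bornology_generated (forms_plain A)
    {(\<lambda>w. form_class A (fmono w)) ` fwords S | S. S \<in> small A}\<rparr>"

definition forms_d :: "'a bvs \<Rightarrow> 'a fform set \<Rightarrow> 'a fform set" where
  "forms_d A C = (\<Union>f\<in>C. form_class A (free_d f))"

definition forms_grading :: "'a bvs \<Rightarrow> 'a fform set \<Rightarrow> 'a fform set" where
  "forms_grading A C = (\<Union>f\<in>C. form_class A (free_grading f))"

definition forms_degree0 :: "'a bvs \<Rightarrow> 'a fform set \<Rightarrow> 'a" where
  "forms_degree0 A C = the_elem (free_degree0 A ` C)"


section \<open>The analytic tensor algebra\<close>

type_synonym 'a anform = "nat \<Rightarrow> 'a fform set"

definition an_forms :: "'a bvs \<Rightarrow> 'a anform bvs" where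
  "an_forms A = (let C = completion (forms A); \<eta> = completion_map (forms A) in
    C\<lparr>mult := (SOME m. bdd_bilinear C C C m
      \<and> (\<forall>x\<in>carrier (forms A). \<forall>y\<in>carrier (forms A).
          m (\<eta> x) (\<eta> y) = \<eta> (x \<otimes>\<^bsub>forms A\<^esub> y)))\<rparr>)"

definition an_d :: "'a bvs \<Rightarrow> 'a anform \<Rightarrow> 'a anform" where
  "an_d A = completion_lift (forms A) (completion (forms A))
    (\<lambda>x. completion_map (forms A) (forms_d A x))"

text \<open>The grading operator is multiplication by \<open>(-1)\<^sup>n\<close> on \<open>n\<close>-forms; its fixed points are the even
  forms.\<close>

definition an_grading :: "'a bvs \<Rightarrow> 'a anform \<Rightarrow> 'a anform" where
  "an_grading A = completion_lift (forms A) (completion (forms A))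
    (\<lambda>x. completion_map (forms A) (forms_grading A x))"

definition even_an_forms :: "'a bvs \<Rightarrow> 'a anform set" where
  "even_an_forms A = {x \<in> carrier (an_forms A). an_grading A x = x}"

text \<open>The sign in \<open>x \<odot> y = xy - (-1)\<^bsup>deg x\<^esup> dx dy\<close> is trivial on even forms.\<close>

definition tensor_alg :: "'a bvs \<Rightarrow> 'a anform bvs" where
  "tensor_alg A = (an_forms A)
    \<lparr>carrier := even_an_forms A,
     mult := (\<lambda>x y. (x \<otimes>\<^bsub>an_forms A\<^esub> y) \<ominus>\<^bsub>an_forms A\<^esub> (an_d A x \<otimes>\<^bsub>an_forms A\<^esub> an_d A y)),
     small := {S \<in> small (an_forms A). S \<subseteq> even_an_forms A}\<rparr>"

definition tensor_alg_proj :: "'a bvs \<Rightarrow> 'a anform \<Rightarrow> 'a" where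
  "tensor_alg_proj A = completion_lift (forms A) A (forms_degree0 A)"


section \<open>Analytically nilpotent extensions\<close>

fun set_power :: "'a bvs \<Rightarrow> 'a set \<Rightarrow> nat \<Rightarrow> 'a set" where
  "set_power A S 0 = S"
| "set_power A S (Suc n) = set_power A S n <#>\<^bsub>A\<^esub> S"

text \<open>The exponents are shifted by one: \<open>set_power A S n\<close> consists of the products of \<open>n + 1\<close>
  elements of \<open>S\<close>.\<close>

definition analytically_nilpotent :: "'a bvs \<Rightarrow> bool" where
  "analytically_nilpotent N \<longleftrightarrow>
    complete_balg N \<and> (\<forall>S\<in>small N. (\<Union>n. set_power N S n) \<in> small N)"

definition analytically_quasi_free :: "'a bvs \<Rightarrow> bool" where
  "analytically_quasi_free R \<longleftrightarrow> complete_balg R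
    \<and> (\<exists>\<upsilon>. bdd_hom R (tensor_alg R) \<upsilon> \<and> (\<forall>r\<in>carrier R. tensor_alg_proj R (\<upsilon> r) = r))"

record ('k, 'e, 'q) extn =
  ker :: "'k bvs"
  mid :: "'e bvs"
  quo :: "'q bvs"
  inc :: "'k \<Rightarrow> 'e"
  prj :: "'e \<Rightarrow> 'q"

definition allowable_extension :: "('k, 'e, 'q) extn \<Rightarrow> bool" where
  "allowable_extension X \<longleftrightarrow>
    complete_balg (ker X) \<and> complete_balg (mid X) \<and> complete_balg (quo X)
    \<and> bdd_hom (ker X) (mid X) (inc X) \<and> bdd_hom (mid X) (quo X) (prj X)
    \<and> bij_betw (inc X) (carrier (ker X)) (a_kernel (mid X) (quo X) (prj X))
    \<and> (\<forall>S. S \<subseteq> carrier (ker X) \<and> inc X ` S \<in> small (mid X) \<longrightarrow> S \<in> small (ker X))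
    \<and> (\<exists>s. bdd_linear (quo X) (mid X) s \<and> (\<forall>q\<in>carrier (quo X). prj X (s q) = q))"

definition an_nilpotent_extension :: "('k, 'e, 'q) extn \<Rightarrow> bool" where
  "an_nilpotent_extension X \<longleftrightarrow> allowable_extension X \<and> analytically_nilpotent (ker X)"

definition universal_an_nilpotent_extension :: "('k, 'e, 'q) extn \<Rightarrow> bool" where
  "universal_an_nilpotent_extension X \<longleftrightarrow>
    an_nilpotent_extension X \<and> analytically_quasi_free (mid X)"

definition extn_morphism ::
  "('n, 'r, 'a) extn \<Rightarrow> ('k, 'e, 'q) extn \<Rightarrow> ('n \<Rightarrow> 'k) \<Rightarrow> ('r \<Rightarrow> 'e) \<Rightarrow> ('a \<Rightarrow> 'q) \<Rightarrow> bool" where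
  "extn_morphism U X \<xi> \<psi> \<phi> \<longleftrightarrow>
    bdd_hom (ker U) (ker X) \<xi> \<and> bdd_hom (mid U) (mid X) \<psi> \<and> bdd_hom (quo U) (quo X) \<phi>
    \<and> (\<forall>n\<in>carrier (ker U). \<psi> (inc U n) = inc X (\<xi> n))
    \<and> (\<forall>r\<in>carrier (mid U). prj X (\<psi> r) = \<phi> (prj U r))"


section \<open>Function algebras on the unit interval\<close>

text \<open>Functions on \<open>[0,1]\<close> are extensional, so that equality of elements is equality on \<open>[0,1]\<close>.
  Derivatives are one-sided at the end points.\<close>

definition fun_alg :: "(real \<Rightarrow> complex) set \<Rightarrow> (real \<Rightarrow> complex) set set \<Rightarrow> (real \<Rightarrow> complex) bvs" where
  "fun_alg C B = \<lparr>carrier = C,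
    monoid.mult = (\<lambda>f g. \<lambda>t\<in>{0..1}. f t * g t),
    one = (\<lambda>t\<in>{0..1}. 1),
    zero = (\<lambda>t\<in>{0..1}. 0),
    add = (\<lambda>f g. \<lambda>t\<in>{0..1}. f t + g t),
    smult = (\<lambda>c f. \<lambda>t\<in>{0..1}. c * f t),
    small = B\<rparr>"

definition deriv01 :: "(real \<Rightarrow> complex) \<Rightarrow> real \<Rightarrow> complex" where
  "deriv01 f t = vector_derivative f (at t within {0..1})"

definition smooth01 :: "(real \<Rightarrow> complex) set" where
  "smooth01 = {f \<in> extensional {0..1}.
    \<forall>k. \<forall>t\<in>{0..1}. (deriv01 ^^ k) f differentiable (at t within {0..1})}"

definition smooth_functions :: "(real \<Rightarrow> complex) bvs" where
  "smooth_functions = fun_alg smooth01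
    {S. S \<subseteq> smooth01 \<and> (\<forall>k. \<exists>M. \<forall>f\<in>S. \<forall>t\<in>{0..1}. cmod ((deriv01 ^^ k) f t) \<le> M)}"

definition abs_cont01 :: "(real \<Rightarrow> complex) set" where
  "abs_cont01 = {f \<in> extensional {0..1}. \<forall>e>0. \<exists>d>0. \<forall>I :: (real \<times> real) set.
    finite I \<and> (\<forall>(a, b)\<in>I. 0 \<le> a \<and> a \<le> b \<and> b \<le> 1)
    \<and> disjoint_family_on (\<lambda>(a, b). {a<..<b}) I \<and> (\<Sum>(a, b)\<in>I. b - a) < d
    \<longrightarrow> (\<Sum>(a, b)\<in>I. cmod (f b - f a)) < e}"

text \<open>An absolutely continuous function is differentiable almost everywhere; the junk value of
  \<open>vector_derivative\<close> on the remaining null set does not affect the integral.\<close>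

definition ac_norm :: "(real \<Rightarrow> complex) \<Rightarrow> real" where
  "ac_norm f = cmod (f 0) + (LINT t|lebesgue_on {0..1}. cmod (deriv01 f t))"

definition ac_functions :: "(real \<Rightarrow> complex) bvs" where
  "ac_functions = fun_alg abs_cont01
    {S. S \<subseteq> abs_cont01 \<and> (\<exists>M. \<forall>f\<in>S. ac_norm f \<le> M)}"


section \<open>Homotopies\<close>

text \<open>The parameter \<open>F\<close> is one of the function algebras \<open>smooth_functions\<close> and \<open>ac_functions\<close>.\<close>

type_synonym 'b paths = "nat \<Rightarrow> (real \<Rightarrow> complex) \<times> 'b"

definition path_ev :: "(real \<Rightarrow> complex) bvs \<Rightarrow> 'b bvs \<Rightarrow> real \<Rightarrow> 'b paths \<Rightarrow> 'b" where
  "path_ev F B t = ctensor_lift F B B (\<lambda>f b. f t \<odot>\<^bsub>B\<^esub> b)"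

definition path_map ::
  "(real \<Rightarrow> complex) bvs \<Rightarrow> 'b bvs \<Rightarrow> 'c bvs \<Rightarrow> ('b \<Rightarrow> 'c) \<Rightarrow> 'b paths \<Rightarrow> 'c paths" where
  "path_map F B C h = ctensor_lift F B (ctensor F C) (\<lambda>f b. elem_tensor F C f (h b))"

definition path_extn ::
  "(real \<Rightarrow> complex) bvs \<Rightarrow> ('k, 'e, 'q) extn \<Rightarrow> ('k paths, 'e paths, 'q paths) extn" where
  "path_extn F X = \<lparr>ker = ctensor_alg F (ker X), mid = ctensor_alg F (mid X),
    quo = ctensor_alg F (quo X), inc = path_map F (ker X) (mid X) (inc X),
    prj = path_map F (mid X) (quo X) (prj X)\<rparr>"

definition homotopy_between ::
  "(real \<Rightarrow> complex) bvs \<Rightarrow> 'a bvs \<Rightarrow> 'b bvs \<Rightarrow> ('a \<Rightarrow> 'b paths) \<Rightarrow> ('a \<Rightarrow> 'b) \<Rightarrow> ('a \<Rightarrow> 'b) \<Rightarrow> bool"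
  where
  "homotopy_between F A B \<Phi> \<phi>\<^sub>0 \<phi>\<^sub>1 \<longleftrightarrow> bdd_hom A (ctensor_alg F B) \<Phi>
    \<and> (\<forall>a\<in>carrier A. path_ev F B 0 (\<Phi> a) = \<phi>\<^sub>0 a \<and> path_ev F B 1 (\<Phi> a) = \<phi>\<^sub>1 a)"

definition extn_homotopy_between ::
  "(real \<Rightarrow> complex) bvs \<Rightarrow> ('n, 'r, 'a) extn \<Rightarrow> ('k, 'e, 'q) extn
    \<Rightarrow> ('n \<Rightarrow> 'k paths) \<Rightarrow> ('r \<Rightarrow> 'e paths) \<Rightarrow> ('a \<Rightarrow> 'q paths)
    \<Rightarrow> ('n \<Rightarrow> 'k) \<Rightarrow> ('r \<Rightarrow> 'e) \<Rightarrow> ('a \<Rightarrow> 'q) \<Rightarrow> ('n \<Rightarrow> 'k) \<Rightarrow> ('r \<Rightarrow> 'e) \<Rightarrow> ('a \<Rightarrow> 'q) \<Rightarrow> bool" where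
  "extn_homotopy_between F U X \<Xi> \<Psi> \<Phi> \<xi>\<^sub>0 \<psi>\<^sub>0 \<phi>\<^sub>0 \<xi>\<^sub>1 \<psi>\<^sub>1 \<phi>\<^sub>1 \<longleftrightarrow>
    extn_morphism U (path_extn F X) \<Xi> \<Psi> \<Phi>
    \<and> homotopy_between F (ker U) (ker X) \<Xi> \<xi>\<^sub>0 \<xi>\<^sub>1
    \<and> homotopy_between F (mid U) (mid X) \<Psi> \<psi>\<^sub>0 \<psi>\<^sub>1
    \<and> homotopy_between F (quo U) (quo X) \<Phi> \<phi>\<^sub>0 \<phi>\<^sub>1"

definition homotopy_relative_to ::
  "(real \<Rightarrow> complex) bvs \<Rightarrow> 'a bvs \<Rightarrow> 'b bvs \<Rightarrow> ('a \<Rightarrow> 'b paths) \<Rightarrow> ('a \<Rightarrow> 'b) \<Rightarrow> bool" where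
  "homotopy_relative_to F A B \<Phi> \<phi> \<longleftrightarrow> (\<forall>t\<in>{0..1}. \<forall>a\<in>carrier A. path_ev F B t (\<Phi> a) = \<phi> a)"

end

theory Submission
  imports Defs "HOL-Library.Function_Algebras"
begin

text \<open>The curvature of a bounded linear map \<open>l\<close> from \<open>R\<close> to \<open>E\<close> is \<open>\<omega>(x, y) = l(xy) - l(x)l(y)\<close>. If products of
  curvatures of elements of a small set stay in a small set, then
  \<open>\<langle>a\<^sub>0\<rangle>da\<^sub>1 \<dots> da\<^sub>2\<^sub>n \<mapsto> l\<langle>a\<^sub>0\<rangle> \<omega>(a\<^sub>1, a\<^sub>2) \<dots>\<close> is a bounded homomorphism on the analytic tensor algebra; composed with
  \<open>\<upsilon>\<close> it turns \<open>l\<close> into a homomorphism \<open>R \<rightarrow> E\<close> without changing \<open>q \<circ> l\<close> for any homomorphism \<open>q\<close> such that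
  \<open>q \<circ> l\<close> is multiplicative. Over an extension with analytically nilpotent kernel every \<open>l\<close> that is
  multiplicative modulo the kernel qualifies. With a section \<open>s\<close>, \<open>l = s\<phi>\<pi>\<close> gives the lifting, and
  \<open>l = (1 - t)(\<psi>\<^sub>0 - s\<phi>\<^sub>0\<pi>) + t(\<psi>\<^sub>1 - s\<phi>\<^sub>1\<pi>) + s\<Phi>\<pi>\<close> gives the homotopy, because paths in the kernel again form an
  analytically nilpotent algebra: small sets of functions have bounded powers after rescaling.\<close>

text \<open>\<open>completion\<close> and \<open>ctensor\<close> are picked by choice among objects
  universal for targets on one fixed type of sequences, so a model must first be built on that type.
  Both models are quotients of a space of absolutely summable families of generators by the smallest
  bornologically closed subspace containing the relations. Such families have countable support,
  hence can be encoded by sequences; the model is universal for targets of every type, and the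
  chosen object inherits this by isomorphism.

  Multiplicativity is an identity on even forms, which come without generators. The even projection
  extends it to a bilinear identity on all analytic forms, to be compared on words, where the
  Leibniz recursion meets the cocycle identity of the curvature.

  Paths in an extension are treated through a splitting by bounded linear maps, because its
  equations survive completed tensor products. The norm of an absolutely continuous function
  integrates a pointwise derivative, so bounded multiplication rests on differentiability almost
  everywhere, obtained from Vitali coverings, and on the fundamental theorem of calculus.\<close>

abbreviation (input) car where "car == carrier"
abbreviation (input) on01 (binder "PATH " [3] 3) where "on01 f == restrict f {0..1::real}"
abbreviation (input) coef where "coef == Poly_Mapping.lookup"
abbreviation (input) supp where "supp == Poly_Mapping.keys"
abbreviation (input) cplx where "cplx == complex_of_real"
abbreviation (input) zero_of ("\<zero>[_]") where "\<zero>[V] == zero V"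
abbreviation (input) add_of ("(_ +[_] _)" [65, 0, 66] 65) where "x +[V] y == add V x y"
abbreviation (input) minus_of ("(_ -[_] _)" [65, 0, 66] 65) where "x -[V] y == a_minus V x y"
abbreviation (input) neg_of ("(-[_] _)" [0, 81] 80) where "-[V] x == a_inv V x"
abbreviation (input) mult_of ("(_ *[_] _)" [70, 0, 71] 70) where "x *[V] y == monoid.mult V x y"
abbreviation (input) smult_of ("(_ .[_] _)" [71, 0, 70] 70) where "c .[V] x == smult V c x"

context convex_bornology begin
lemmas born = convex_bornology_axioms
end

section \<open>Complex vector spaces and complete disks\<close>

lemma complex_ring_simps [simp]:
 "car complex_ring = UNIV" "mult complex_ring = (*)" "one complex_ring = 1"
 "zero complex_ring = 0" "add complex_ring = (+)"
 by (simp_all add: complex_ring_def)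

lemma cring_complex_ring: "cring complex_ring"
proof (rule cringI)
 show "abelian_group complex_ring"
 by (rule abelian_groupI) (auto simp: algebra_simps intro: exI[of _ "- _"])
 show "Group.comm_monoid complex_ring"
 by (rule comm_monoidI) (auto simp: algebra_simps)
qed (auto simp: algebra_simps)

lemma complex_ring_minus [simp]: "a_inv complex_ring c = - c"
proof -
 interpret cring complex_ring by (rule cring_complex_ring)
 show ?thesis using minus_equality[of "-c" c] by simp
qed

locale cvs = Module.module complex_ring V for V :: "'a bvs" (structure)
begin

lemma smult_cl [simp]: "x : car V ==> c \<odot> x : car V"
 by (simp add: smult_closed)

lemma smult_radd: "x : car V ==> y : car V ==> c \<odot> (x \<oplus> y) = c \<odot> x \<oplus> c \<odot> y"
 by (simp add: smult_r_distr)

lemma smult_ladd: "x : car V ==> (c + d) \<odot> x = c \<odot> x \<oplus> d \<odot> x"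
 using smult_l_distr[of c d x] by simp

lemma smult_smult: "x : car V ==> c \<odot> (d \<odot> x) = (c * d) \<odot> x"
 using smult_assoc1[of c d x] by simp

lemma smult_one' [simp]: "x : car V ==> 1 \<odot> x = x"
 using smult_one[of x] by simp

lemma smult_lzero [simp]: "x : car V ==> 0 \<odot> x = \<zero>"
 using smult_l_null[of x] by simp

lemma neg_zero [simp]: "\<ominus> \<zero> = \<zero>"
 by (metis M.r_neg M.l_zero M.a_inv_closed M.zero_closed)

lemma smult_rneg: "x : car V ==> c \<odot> (\<ominus> x) = \<ominus> (c \<odot> x)"
 using smult_r_minus by simp

lemma smult_lneg: "x : car V ==> (- c) \<odot> x = \<ominus> (c \<odot> x)"
 using smult_l_minus[of c x] by simp

lemma smult_m1: "x : car V ==> (- 1) \<odot> x = \<ominus> x"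
 using smult_lneg[of x 1] by simp

lemma smult_rzero [simp]: "c \<odot> \<zero> = \<zero>"
 by simp

text \<open>Normalisation rules for the method \<open>algebra\<close>, which settles identities
  between sums, differences and multiples below.\<close>

lemmas vec_simps =
 M.a_closed M.zero_closed M.a_inv_closed M.minus_closed smult_cl
 a_minus_def M.l_zero M.r_zero M.l_neg M.r_neg M.r_neg1 M.r_neg2 M.minus_add M.minus_minus
 neg_zero M.a_assoc M.a_comm M.a_lcomm smult_radd smult_rneg smult_rzero
lemmas [algebra cvs "zero V" "add V" "a_inv V" "a_minus V" "smult V"] = vec_simps

lemma minus_smult: "x : car V ==> y : car V ==> c \<odot> (x \<ominus> y) = c \<odot> x \<ominus> c \<odot> y"
 by algebra

lemma minus_minus_cancel:
 "a : car V ==> b : car V ==> c : car V ==> (a \<ominus> c) \<ominus> (b \<ominus> c) = a \<ominus> b"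
 by algebra

lemma minus_trans:
 "a : car V ==> b : car V ==> c : car V ==> (a \<ominus> b) \<oplus> (b \<ominus> c) = a \<ominus> c"
 by algebra

lemma minus_plus:
 "a : car V ==> b : car V ==> c : car V ==> (a \<ominus> c) \<ominus> b = a \<ominus> (b \<oplus> c)"
 by algebra

lemma minus_shift:
 "a : car V ==> b : car V ==> c : car V ==> y : car V
    ==> (a \<ominus> b) \<ominus> (y \<ominus> (b \<ominus> c)) = a \<ominus> (y \<oplus> c)"
 by algebra

lemma minus_eq_zero: "x : car V ==> y : car V ==> x \<ominus> y = \<zero> \<longleftrightarrow> x = y"
 by (metis M.r_neg M.minus_equality M.minus_minus M.a_inv_closed a_minus_def M.a_comm)

lemma finsum_smult:
 "finite F ==> f : F \<rightarrow> car V ==> c \<odot> finsum V f F = (\<Oplus>p\<in>F. c \<odot> f p)"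
 by (induction rule: finite_induct) (auto simp: M.finsum_insert smult_radd Pi_iff M.finsum_closed)

text \<open>Dilates stand in for the gauge: for positive \<open>r\<close>, on the span of
  \<open>D\<close>, a gauge below \<open>r\<close> gives membership in \<open>sc r D\<close>, and
  membership gives a gauge of at most \<open>r\<close>. Estimates then involve no infima.\<close>

definition sc :: "real => 'a set => 'a set" where
 "sc r D = (%x. cplx r \<odot> x) ` D"

end

lemma cvs_bvs [intro]: "convex_bornology V ==> cvs V"
 by (simp add: convex_bornology_def cvs_def)

locale cdisk = cvs V for V :: "'a bvs" (structure) +
 fixes D
 assumes disk: "disk V D" and ne: "D ~= {}"
begin

lemma D_carrier: "x : D ==> x : car V"
 using disk by (auto simp: disk_def)

lemma D_scale: "x : D ==> cmod c <= 1 ==> c \<odot> x : D"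
 using disk by (auto simp: disk_def)

lemma D_convex: "x : D ==> y : D ==> 0 <= t ==> t <= 1 ==>
   (cplx t \<odot> x) \<oplus> (cplx (1 - t) \<odot> y) : D"
 using disk by (auto simp: disk_def)

lemma sc_carrier: "x : sc r D ==> x : car V"
 by (auto simp: sc_def D_carrier)

lemma sc_one [simp]: "sc 1 D = D"
 by (auto simp: sc_def D_carrier image_iff)

lemma D_zero: "\<zero> : D"
 using ne D_scale[of _ 0] D_carrier by fastforce

lemma sc_zero: "\<zero> : sc r D"
 unfolding sc_def using D_zero by (force intro: image_eqI[of _ _ \<zero>])

lemma sc_smult: assumes "x : sc r D" "cmod c * r <= s" "0 <= r" shows "c \<odot> x : sc s D"
proof -
 obtain y where y: "y : D" "x = cplx r \<odot> y"
 using assms by (auto simp: sc_def)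
 have s0: "s >= 0" using assms by (meson mult_nonneg_nonneg norm_ge_zero order_trans)
 show ?thesis
 proof (cases "s = 0")
 case True
 hence "cmod c * r = 0" using assms by (intro antisym) auto
 hence "c * cplx r = 0" by auto
 moreover have "c \<odot> x = (c * cplx r) \<odot> y" using y by (simp add: smult_smult D_carrier)
 ultimately have "c \<odot> x = \<zero>" using y D_carrier by (simp only: smult_lzero)
 thus ?thesis using sc_zero by simp
 next
 case False
 hence s: "s > 0" using s0 by simp
 let ?d = "c * cplx (r / s)"
 have "cmod ?d = cmod c * r / s" using assms s by (simp add: norm_mult norm_divide)
 hence "cmod ?d <= 1" using assms s by simp
 hence "?d \<odot> y : D" using y D_scale by blast
 moreover have "c \<odot> x = cplx s \<odot> (?d \<odot> y)"
 using y s by (simp add: smult_smult D_carrier)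
 ultimately show ?thesis by (auto simp: sc_def)
 qed
qed

lemma sc_mono: assumes "x : sc r D" "0 <= r" "r <= s" shows "x : sc s D"
 using sc_smult[of x r 1 s] assms sc_carrier[of x r] by simp

lemma sc_neg: assumes "x : sc r D" "0 <= r" shows "\<ominus> x : sc r D"
 using sc_smult[of x r "-1" r] assms sc_carrier[of x r] by (simp add: smult_m1)

text \<open>The sum is \<open>r + s\<close> times the convex combination with weights
  \<open>r / (r + s)\<close> and \<open>s / (r + s)\<close>, which leaves only
  \<open>r = s = 0\<close> to treat apart.\<close>

lemma sc_add: assumes "x : sc r D" "y : sc s D" "0 <= r" "0 <= s" shows "x \<oplus> y : sc (r + s) D"
proof (cases "r + s = 0")
 case True
 hence "r = 0" "s = 0" using assms by auto
 hence "x = \<zero>" "y = \<zero>" using assms by (auto simp: sc_def D_carrier)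
 thus ?thesis using sc_zero by simp
next
 case False
 hence rs: "r + s > 0" using assms by simp
 obtain x' y' where x': "x' : D" "x = cplx r \<odot> x'" and y': "y' : D" "y = cplx s \<odot> y'"
 using assms by (auto simp: sc_def)
 let ?t = "r / (r + s)"
 have t1: "1 - ?t = s / (r + s)" using rs by (simp add: field_simps)
 have "(cplx ?t \<odot> x') \<oplus> (cplx (1 - ?t) \<odot> y') : D"
 by (rule D_convex) (use x' y' assms rs in auto)
 moreover have "x \<oplus> y = cplx (r + s) \<odot> ((cplx ?t \<odot> x') \<oplus> (cplx (1 - ?t) \<odot> y'))"
 proof -
 have "cplx (r + s) * cplx ?t = cplx r"
 using rs unfolding of_real_mult[symmetric] by simp
 moreover have "cplx (r + s) * cplx (1 - ?t) = cplx s"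
 using rs unfolding of_real_mult[symmetric] t1 by simp
 ultimately show ?thesis
 using x' y' D_carrier by (simp add: smult_radd smult_smult del: of_real_add of_real_divide of_real_diff)
 qed
 ultimately show ?thesis by (auto simp: sc_def)
qed

lemma sc_minus: assumes "x : sc r D" "y : sc s D" "0 <= r" "0 <= s" shows "x \<ominus> y : sc (r + s) D"
 using sc_add[OF assms(1) sc_neg[OF assms(2,4)] assms(3,4)] by (simp add: a_minus_def)

text \<open>The bound on \<open>f p\<close> is asked only where the coefficient is nonzero, because
  a summable family is controlled only on a small set that supports it.\<close>

lemma sc_finsum:
 assumes "finite F" "!!p. p : F ==> f p : car V" "!!p. p : F ==> c p ~= 0 ==> f p : sc s D" "0 <= s"
 shows "(\<Oplus>p\<in>F. c p \<odot> f p) : sc ((SUM p:F. cmod (c p)) * s) D"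
 using assms(1,2,3)
proof (induction rule: finite_induct)
 case empty
 thus ?case using sc_zero by simp
next
 case (insert p F)
 have "c p \<odot> f p : sc (cmod (c p) * s) D"
 proof (cases "c p = 0")
 case True
 thus ?thesis using sc_zero insert.prems by simp
 next
 case False
 thus ?thesis using sc_smult[of "f p" s "c p"] insert.prems assms(4) by simp
 qed
 hence "c p \<odot> f p \<oplus> (\<Oplus>p\<in>F. c p \<odot> f p) : sc (cmod (c p) * s + (SUM p:F. cmod (c p)) * s) D"
 by (rule sc_add) (use insert assms(4) in "auto intro!: mult_nonneg_nonneg sum_nonneg")
 thus ?case
 using insert by (simp add: M.finsum_insert Pi_iff distrib_right)
qed

lemma sc_sc: "sc r (sc s D) = sc (r * s) D"
 by (auto simp: sc_def image_iff smult_smult D_carrier) 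

lemma gauge_set: "{r. 0 < r & (EX y:D. x = cplx r \<odot> y)} = {r. 0 < r & x : sc r D}"
 by (auto simp: sc_def)

lemma gauge_nonneg: assumes "x : sc s D" "s > 0" shows "0 <= disk_gauge V D x"
 unfolding disk_gauge_def gauge_set by (rule cInf_greatest) (use assms in auto)

lemma gauge_le: assumes "x : sc s D" "s > 0" shows "disk_gauge V D x <= s"
 unfolding disk_gauge_def gauge_set by (rule cInf_lower) (use assms in "auto intro: bdd_belowI[of _ 0]")

lemma gauge_less: assumes "x : sc s D" "s > 0" "disk_gauge V D x < r" shows "x : sc r D"
proof -
 obtain t where "0 < t" "x : sc t D" "t < r"
 using cInf_lessD[of "{r. 0 < r & x : sc r D}" r] assms unfolding disk_gauge_def gauge_set by auto
 thus ?thesis using sc_mono by auto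
qed

lemma submodule_span: "submodule {x. EX r>0. x : sc r D} complex_ring V"
proof (rule module.module_incl_imp_submodule[OF module_axioms])
 show "{x. EX r>0. x : sc r D} <= car V" using sc_carrier by auto
 let ?W = "V\<lparr>carrier := {x. EX r>0. x : sc r D}\<rparr>"
 have c: "!!x. x : car ?W ==> x : car V" using sc_carrier by auto
 show "Module.module complex_ring ?W"
 proof (rule moduleI)
 show "cring complex_ring" by (rule cring_complex_ring)
 show "abelian_group ?W"
 proof (rule abelian_groupI)
 fix x y z assume "x : car ?W" "y : car ?W" "z : car ?W"
 hence xc: "x : car V" "y : car V" "z : car V" using c by blast+
 thus "x +[?W] y +[?W] z = x +[?W] (y +[?W] z)" by (simp add: M.a_assoc)
 show "x +[?W] y = y +[?W] x" using xc by (simp add: M.a_comm)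
 next
 fix x y assume "x : car ?W" "y : car ?W"
 then obtain r s where "r > 0" "s > 0" "x : sc r D" "y : sc s D" by auto
 thus "x +[?W] y : car ?W" using sc_add[of x r y s] by (auto intro: exI[of _ "r + s"])
 show "EX z:car ?W. z +[?W] x = \<zero>[?W]"
 by (rule bexI[of _ "\<ominus> x"]) (use sc_neg[of x r] \<open>r>0\<close> \<open>x \<in> sc r D\<close> sc_carrier[of x r] in "auto simp: M.l_neg")
 qed (use c sc_zero[of 1] in "auto intro: exI[of _ 1]")
 fix a x assume "x : car ?W"
 then obtain r where "r > 0" "x : sc r D" by auto
 hence "a \<odot> x : sc (cmod a * r + 1) D"
 using sc_smult by auto
 thus "a .[?W] x : car ?W" using \<open>r > 0\<close> 
 by (auto intro!: exI[of _ "cmod a * r + 1"] add_nonneg_pos)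
 qed (use c in "auto simp: smult_ladd smult_radd smult_smult")
qed

text \<open>A disk absorbs its span: being circled and convex, it has dilates whose union is already
  a subspace.\<close>

lemma lin_span_eq: "lin_span V D = {x. EX r>0. x : sc r D}"
proof
 show "lin_span V D <= {x. EX r>0. x : sc r D}"
 unfolding lin_span_def using submodule_span by (intro Inter_lower) (auto intro: exI[of _ 1])
 show "{x. EX r>0. x : sc r D} <= lin_span V D"
 unfolding lin_span_def
 by (auto simp: sc_def intro!: submodule.smult_closed)
qed

text \<open>A normed space is complete once the series whose terms decrease like powers of 1/2
  converge; \<open>2 * (1/2)^n\<close> is the remainder of the geometric series. Quotients of ell^1
  balls meet exactly this condition, since such a series can be lifted term by term.\<close>

lemma complete_diskI:
 assumes def: "!!x. x : car V ==> (!!e. e > 0 ==> x : sc e D) ==> x = \<zero>"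
 and ser: "!!d. (!!k. d k : sc ((1/2)^k) D) ==> EX y:car V. ALL n. y \<ominus> (\<Oplus>k\<in>{..<n}. d k) : sc (2 * (1/2)^n) D"
 shows "complete_disk V D"
 unfolding complete_disk_def
proof (intro conjI ballI allI impI)
 show "disk V D" "D ~= {}" using disk ne by auto
next
 fix x assume x: "x : lin_span V D" "disk_gauge V D x = 0"
 then obtain r where r: "r > 0" "x : sc r D" unfolding lin_span_eq by blast
 show "x = \<zero>"
 proof (rule def)
 show "x : car V" using r sc_carrier by blast
 show "x : sc e D" if "e > 0" for e using gauge_less[OF r(2,1)] x(2) that by simp
 qed
next
 fix X :: "nat => 'a"
 assume "(ALL n. X n : lin_span V D) & (ALL e>0. EX M. ALL m>=M. ALL n>=M. disk_gauge V D (X m \<ominus> X n) < e)"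
 hence X: "!!n. EX r>0. X n : sc r D" and Cau: "!!e. e > 0 ==> EX M. ALL m>=M. ALL n>=M. disk_gauge V D (X m \<ominus> X n) < e"
 by (auto simp: lin_span_eq)
 have Xc [simp]: "X n : car V" for n using X sc_carrier by blast
 have dif: "EX r>0. X m \<ominus> X n : sc r D" for m n
 proof -
 obtain r s where "r > 0" "s > 0" "X m : sc r D" "X n : sc s D" using X by meson
 thus ?thesis using sc_minus[of "X m" r "X n" s] by (intro exI[of _ "r + s"]) auto
 qed
 have Cau': "EX M. ALL m>=M. ALL n>=M. X m \<ominus> X n : sc e D" if e: "e > 0" for e
 proof -
 obtain M where "ALL m>=M. ALL n>=M. disk_gauge V D (X m \<ominus> X n) < e" using Cau[OF e] by blast
 moreover have "X m \<ominus> X n : sc e D" if "disk_gauge V D (X m \<ominus> X n) < e" for m n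
 using dif[of m n] gauge_less that by blast
 ultimately show ?thesis by blast
 qed
 hence "ALL k. EX M. ALL m>=M. ALL n>=M. X m \<ominus> X n : sc ((1/2)^k) D" by simp
 from choice[OF this] obtain M where "ALL k. ALL m>=M k. ALL n>=M k. X m \<ominus> X n : sc ((1/2)^k) D"
 by blast
 hence M: "!!k m n. m >= M k ==> n >= M k ==> X m \<ominus> X n : sc ((1/2)^k) D"
 by blast
 \<comment> \<open>Partial sums make the subsequence monotone while keeping
   \<open>N k >= M k\<close>.\<close>
 define N where "N k = (\<Sum>i\<le>k. M i)" for k
 have NM: "N k >= M k" for k unfolding N_def by (rule member_le_sum) auto
 have NS: "N (Suc k) >= N k" for k by (simp add: N_def)
 define d where "d k = X (N (Suc k)) \<ominus> X (N k)" for k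
 have "d k : sc ((1/2)^k) D" for k
 unfolding d_def by (rule M) (use NM[of k] NS[of k] in auto)
 from ser[of d, OF this] obtain y where y: "y : car V" "!!n. y \<ominus> (\<Oplus>k\<in>{..<n}. d k) : sc (2 * (1/2)^n) D"
 by blast
 have tel: "(\<Oplus>k\<in>{..<n}. d k) = X (N n) \<ominus> X (N 0)" for n
 proof (induction n)
 case 0
 thus ?case by (simp add: a_minus_def M.r_neg)
 next
 case (Suc n)
 have "(\<Oplus>k\<in>{..<Suc n}. d k) = d n \<oplus> (\<Oplus>k\<in>{..<n}. d k)"
 unfolding lessThan_Suc by (rule M.finsum_insert) (auto simp: d_def)
 also have "... = X (N (Suc n)) \<ominus> X (N 0)"
 unfolding Suc.IH unfolding d_def by (rule minus_trans) auto
 finally show ?case .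
 qed
 let ?x = "y \<oplus> X (N 0)"
 \<comment> \<open>One dilate from the Cauchy property at \<open>N k\<close>, two from the remainder
   of the series.\<close>
 have lim: "X n \<ominus> ?x : sc (3 * (1/2)^k) D" if "n >= N k" for n k
 proof -
 have "X n \<ominus> X (N k) : sc ((1/2)^k) D" by (rule M) (use NM[of k] that in auto)
 from sc_minus[OF this y(2)[of k]]
 have "(X n \<ominus> X (N k)) \<ominus> (y \<ominus> (X (N k) \<ominus> X (N 0))) : sc ((1/2)^k + 2 * (1/2)^k) D"
 by (simp add: tel)
 moreover have "(X n \<ominus> X (N k)) \<ominus> (y \<ominus> (X (N k) \<ominus> X (N 0))) = X n \<ominus> ?x"
 using y(1) by (intro minus_shift) auto
 ultimately show ?thesis by simp
 qed
 show "EX x:lin_span V D. (%n. disk_gauge V D (X n \<ominus> x)) \<longlonglongrightarrow> 0"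
 proof (rule bexI[of _ ?x])
 show "?x : lin_span V D"
 proof -
 have "y : sc 2 D" using y(2)[of 0] y(1) by (simp add: a_minus_def)
 moreover obtain r where "r > 0" "X (N 0) : sc r D" using X by blast
 ultimately have "?x : sc (2 + r) D" using sc_add by auto
 thus ?thesis unfolding lin_span_eq using \<open>r > 0\<close> by (auto intro!: exI[of _ "2 + r"])
 qed
 show "(%n. disk_gauge V D (X n \<ominus> ?x)) \<longlonglongrightarrow> 0"
 proof (rule LIMSEQ_I)
 fix r :: real assume "r > 0"
 then obtain k where k: "(1/2)^k < r / 3" using real_arch_pow_inv[of "r/3" "1/2"] by auto
 have "norm (disk_gauge V D (X n \<ominus> ?x) - 0) < r" if "n >= N k" for n
 using gauge_le[OF lim[OF that]] gauge_nonneg[OF lim[OF that]] k by simp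
 thus "EX no. ALL n>=no. norm (disk_gauge V D (X n \<ominus> ?x) - 0) < r" by blast
 qed
 qed
qed

end

locale ccdisk = cdisk +
 assumes complete: "complete_disk V D"
begin

lemma complete_gauge:
 "x : lin_span V D ==> disk_gauge V D x = 0 ==> x = \<zero>"
 using complete unfolding complete_disk_def by blast

lemma complete_limit:
 "[|!!n. Y n : lin_span V D; !!e. e > 0 ==> EX M. ALL m>=M. ALL n>=M. disk_gauge V D (Y m \<ominus> Y n) < e|]
     ==> EX x:lin_span V D. (%n. disk_gauge V D (Y n \<ominus> x)) \<longlonglongrightarrow> 0"
 using complete unfolding complete_disk_def by (elim conjE allE[of _ Y]) simp

lemma definite: assumes "x : car V" "!!e. e > 0 ==> x : sc e D" shows "x = \<zero>"
proof -
 have "disk_gauge V D x <= e" if "e > 0" for e by (rule gauge_le[OF assms(2)[OF that] that])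
 hence "disk_gauge V D x <= 0" by (rule field_le_epsilon, simp)
 moreover have "disk_gauge V D x >= 0" using gauge_nonneg[of x 1] assms(2)[of 1] by simp
 moreover have "x : lin_span V D" using assms(2)[of 1] unfolding lin_span_eq by (auto intro: exI[of _ 1])
 ultimately show ?thesis using complete_gauge by simp
qed

text \<open>The terms themselves may lie outside the span of \<open>D\<close>; only their
  differences are controlled. Completeness is therefore applied to the sequence shifted by one of
  its terms.\<close>

lemma cauchy_limit:
 assumes Xc [simp]: "!!n. X n : car V" and Cau: "!!e. e > 0 ==> EX M. ALL m>=M. ALL n>=M. X m \<ominus> X n : sc e D"
 shows "EX x:car V. ALL e>0. EX M. ALL n>=M::nat. X n \<ominus> x : sc e D"
proof -
 obtain M0 where M0: "!!m n. m >= M0 ==> n >= M0 ==> X m \<ominus> X n : sc 1 D" using Cau[of 1] by auto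
 define Y where "Y n = X (n + M0) \<ominus> X M0" for n
 have Y1: "Y n : sc 1 D" for n unfolding Y_def by (rule M0) auto
 have Yd: "Y m \<ominus> Y n = X (m + M0) \<ominus> X (n + M0)" for m n
 unfolding Y_def by (rule minus_minus_cancel) auto
 have sp: "Y n : lin_span V D" for n using Y1 unfolding lin_span_eq by (auto intro: exI[of _ 1])
 have "EX x:lin_span V D. (%n. disk_gauge V D (Y n \<ominus> x)) \<longlonglongrightarrow> 0"
 proof -
 have "EX M. ALL m>=M. ALL n>=M. disk_gauge V D (Y m \<ominus> Y n) < e" if e: "e > 0" for e
 proof -
 obtain M where "!!m n. m >= M ==> n >= M ==> X m \<ominus> X n : sc (e/2) D" using Cau[OF half_gt_zero[OF e]] by blast
 hence "ALL m>=M. ALL n>=M. disk_gauge V D (Y m \<ominus> Y n) <= e/2" unfolding Yd using gauge_le[of _ "e/2"] e by auto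
 moreover have "e/2 < e" using e by simp
 ultimately show ?thesis by (meson le_less_trans)
 qed
 with sp show ?thesis by (intro complete_limit)
 qed
 then obtain y where y: "y : lin_span V D" "(%n. disk_gauge V D (Y n \<ominus> y)) \<longlonglongrightarrow> 0" by blast
 obtain t where t: "t > 0" "y : sc t D" using y unfolding lin_span_eq by auto
 have yc: "y : car V" using t sc_carrier by blast
 show ?thesis
 proof (rule bexI[of _ "y \<oplus> X M0"], intro allI impI)
 fix e :: real assume e: "e > 0"
 have "EX M. ALL n>=M. disk_gauge V D (Y n \<ominus> y) < e"
 using LIMSEQ_D[OF y(2) e] by (auto simp: abs_less_iff)
 then obtain M where M: "!!n. n >= M ==> disk_gauge V D (Y n \<ominus> y) < e" by blast
 have "X n \<ominus> (y \<oplus> X M0) : sc e D" if n: "n >= M + M0" for n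
 proof -
 have "Y (n - M0) \<ominus> y : sc e D"
 using gauge_less[OF sc_minus[OF Y1 t(2)] _ M, of "n - M0"] t n by simp
 moreover have "Y (n - M0) \<ominus> y = X n \<ominus> (y \<oplus> X M0)"
 proof -
 have "Y (n - M0) = X n \<ominus> X M0" using n by (simp add: Y_def)
 thus ?thesis using yc by (simp add: minus_plus)
 qed
 ultimately show ?thesis by simp
 qed
 thus "EX M. ALL n>=M. X n \<ominus> (y \<oplus> X M0) : sc e D" by blast
 qed (use yc in auto)
qed

end

section \<open>Bornologies and sums over small sets\<close>

sublocale convex_bornology \<subseteq> cvs V
 by (rule cvs_bvs, rule born)

lemma disk_Inter:
 assumes "!!D. D : \<D> ==> disk V D" "\<D> ~= {}"
 shows "disk V (\<Inter>\<D>)"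
 unfolding disk_def
proof (intro conjI allI ballI impI)
 show "\<Inter>\<D> <= car V" using assms unfolding disk_def by blast
next
 fix c x assume "x : \<Inter>\<D>" "cmod c <= 1"
 thus "c .[V] x : \<Inter>\<D>" using assms(1) by (auto simp: disk_def)
next
 fix x y and t :: real assume "x : \<Inter>\<D>" "y : \<Inter>\<D>" "t : {0..1}"
 thus "(cplx t .[V] x) +[V] (cplx (1 - t) .[V] y) : \<Inter>\<D>"
 using assms(1) by (auto simp: disk_def)
qed

context cvs begin

lemma disk_carrier [simp]: "disk V (car V)"
 by (auto simp: disk_def)

lemma disk_hull_disk: "S <= car V ==> disk V (disk_hull V S)"
 unfolding disk_hull_def by (rule disk_Inter) (use disk_carrier in blast)+

lemma disk_hull_subset: "S <= disk_hull V S"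
 unfolding disk_hull_def by auto

lemma disk_hull_least: "disk V D ==> S <= D ==> disk_hull V S <= D"
 unfolding disk_hull_def by auto

text \<open>Unconditional summation: beyond the finite set \<open>F0\<close> every finite partial
  sum is within \<open>e\<close> of \<open>x\<close>, measured by \<open>D\<close>. Working with the
  net of finite sets avoids enumerating the index set.\<close>

definition tail_sums :: "'p set => ('p => 'a) => ('p => complex) => 'a => 'a set => real => 'p set => bool" where
 "tail_sums P f c x D e F0 \<longleftrightarrow> finite F0 & F0 <= P &
     (ALL F. finite F & F0 <= F & F <= P --> x \<ominus> (\<Oplus>p\<in>F. c p \<odot> f p) : sc e D)"

lemma tail_sumsI:
 "finite F0 ==> F0 <= P ==> (!!F. finite F ==> F0 <= F ==> F <= P ==> x \<ominus> (\<Oplus>p\<in>F. c p \<odot> f p) : sc e D)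
    ==> tail_sums P f c x D e F0"
 unfolding tail_sums_def by blast

lemma tail_sumsD:
 "tail_sums P f c x D e F0 ==> finite F ==> F0 <= F ==> F <= P ==> x \<ominus> (\<Oplus>p\<in>F. c p \<odot> f p) : sc e D"
 unfolding tail_sums_def by blast

lemma tail_sums_fin: "tail_sums P f c x D e F0 ==> finite F0" "tail_sums P f c x D e F0 ==> F0 <= P"
 unfolding tail_sums_def by blast+

lemma tail_sums_mono:
 assumes "tail_sums P f c x D e F0" "finite F1" "F0 <= F1" "F1 <= P" "D <= E" 
 shows "tail_sums P f c x E e F1"
proof (rule tail_sumsI[OF assms(2,4)])
 fix F assume "finite F" "F1 <= F" "F <= P"
 hence "x \<ominus> (\<Oplus>p\<in>F. c p \<odot> f p) : sc e D" using tail_sumsD[OF assms(1)] assms(3) by simp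
 thus "x \<ominus> (\<Oplus>p\<in>F. c p \<odot> f p) : sc e E" using assms(5) unfolding sc_def by blast
qed

text \<open>Bornological (Mackey) convergence: one small disk measures the error for every
  \<open>e\<close>.\<close>

definition has_bsum :: "'p set => ('p => 'a) => ('p => complex) => 'a => bool" where
 "has_bsum P f c x \<longleftrightarrow> x : car V
    & (EX D:small V. cdisk V D & (ALL e>0. EX F0. tail_sums P f c x D e F0))"

lemma has_bsumI:
 "x : car V ==> D : small V ==> cdisk V D ==> (!!e. e > 0 ==> EX F0. tail_sums P f c x D e F0)
    ==> has_bsum P f c x"
 unfolding has_bsum_def by blast

lemma has_bsum_carrier: "has_bsum P f c x ==> x : car V"
 unfolding has_bsum_def by blast

lemma bsum_closed: "f ` P <= car V ==> F <= P ==> (\<Oplus>p\<in>F. c p \<odot> f p) : car V"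
 by (rule M.finsum_closed) (meson Pi_I image_subset_iff smult_cl subsetD)

end

context convex_bornology begin

lemma small_empty: "{} : small V"
 by (rule small_subset[OF small_point[OF M.zero_closed]]) simp

lemma small_disk:
 assumes "S : small V" obtains D where "D : small V" "cdisk V D" "S <= D"
proof -
 \<comment> \<open>Only a nonempty disk contains 0, so the empty set is replaced by the
   origin.\<close>
 let ?S = "if S = {} then {\<zero>} else S"
 have s: "?S : small V" using assms small_point[OF M.zero_closed] by simp
 show thesis
 proof (rule that[of "disk_hull V ?S"])
 show "disk_hull V ?S : small V" using s by (rule small_disk_hull)
 show "S <= disk_hull V ?S" using disk_hull_subset[of ?S] by (auto split: if_splits)
 show "cdisk V (disk_hull V ?S)"
 using disk_hull_disk[OF small_subset_carrier[OF s]] disk_hull_subset[of ?S]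
 by unfold_locales (auto split: if_splits)
 qed
qed

text \<open>Unions are not among the axioms; both sets lie in the sum of two disks around them, as a
  nonempty disk contains 0.\<close>

lemma small_Un: assumes "S : small V" "T : small V" shows "S Un T : small V"
proof -
 obtain D where D: "D : small V" "cdisk V D" "S <= D" using assms small_disk by blast
 obtain E where E: "E : small V" "cdisk V E" "T <= E" using assms small_disk by blast
 interpret D: cdisk V D by fact
 interpret E: cdisk V E by fact
 have "S Un T <= D <+>\<^bsub>V\<^esub> E"
 proof
 fix x assume "x : S Un T"
 thus "x : D <+>\<^bsub>V\<^esub> E"
 proof
 assume "x : S"
 hence "x = x \<oplus> \<zero>" "x : D" using D D.D_carrier by auto
 thus ?thesis unfolding set_add_def' using E.D_zero by blast
 next
 assume "x : T"
 hence "x = \<zero> \<oplus> x" "x : E" using E E.D_carrier by auto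
 thus ?thesis unfolding set_add_def' using D.D_zero by blast
 qed
 qed
 thus ?thesis using small_subset small_sum[OF D(1) E(1)] by blast
qed

text \<open>Multiples are not among the axioms either: \<open>n + 1\<close> times \<open>D\<close>
  lies in \<open>sc n D\<close> plus \<open>D\<close>. Disks being circled, an arbitrary complex
  multiple is then contained in a natural one.\<close>

lemma small_sc_nat: assumes "D : small V" "cdisk V D" shows "sc (real n) D : small V"
proof -
 interpret D: cdisk V D by fact
 show ?thesis
 proof (induction n)
 case 0
 have "sc 0 D <= {\<zero>}" by (auto simp: sc_def D.D_carrier)
 thus ?case using small_subset small_point by fastforce
 next
 case (Suc n)
 have "sc (real (Suc n)) D <= sc (real n) D <+>\<^bsub>V\<^esub> D"
 proof
 fix x assume "x : sc (real (Suc n)) D"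
 then obtain y where y: "y : D" "x = cplx (real n + 1) \<odot> y" by (auto simp: sc_def add.commute)
 hence "x = (cplx (real n) \<odot> y) \<oplus> y"
 using D.D_carrier by (simp add: smult_ladd)
 thus "x : sc (real n) D <+>\<^bsub>V\<^esub> D" unfolding set_add_def' using y(1) by (auto simp: sc_def)
 qed
 thus ?case using small_subset small_sum[OF Suc assms(1)] by blast
 qed
qed

lemma small_scale: assumes "S : small V" shows "(%x. c \<odot> x) ` S : small V"
proof -
 obtain D where D: "D : small V" "cdisk V D" "S <= D" using assms small_disk by blast
 interpret D: cdisk V D by fact
 obtain n where n: "cmod c <= real n" using real_arch_simple by blast
 have "(%x. c \<odot> x) ` S <= sc (real n) D"
 using D(3) n D.sc_smult[of _ 1 c "real n"] by auto
 thus ?thesis using small_subset small_sc_nat[OF D(1,2)] by blast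
qed

lemma small_sc: "S : small V ==> sc r S : small V"
 unfolding sc_def by (rule small_scale)

lemma small_insert: "x : car V ==> S : small V ==> insert x S : small V"
 using small_Un[OF small_point] by (metis insert_is_Un)

text \<open>Each sum comes with its own disk; a disk around both measures both errors, beyond the
  union of the two finite sets.\<close>

lemma has_bsum_common:
 assumes "has_bsum P f c x" "has_bsum P g d y"
 obtains D where "D : small V" "cdisk V D"
 "!!e. e > 0 ==> EX F0. tail_sums P f c x D e F0 & tail_sums P g d y D e F0"
proof -
 obtain D where D: "D\<in>small V" "cdisk V D" and D': "ALL e>0. EX F0. tail_sums P f c x D e F0"
 using assms(1) unfolding has_bsum_def by blast
 obtain E where E: "E\<in>small V" "cdisk V E" and E': "ALL e>0. EX F0. tail_sums P g d y E e F0"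
 using assms(2) unfolding has_bsum_def by blast
 obtain H where H: "H\<in>small V" "cdisk V H" "D Un E <= H"
 using small_disk[OF small_Un[OF D(1) E(1)]] by blast
 show thesis
 proof (rule that[OF H(1,2)])
 fix e :: real assume e: "e > 0"
 obtain F0 where F0: "tail_sums P f c x D e F0" using D' e by blast
 obtain F1 where F1: "tail_sums P g d y E e F1" using E' e by blast
 have "finite (F0 Un F1)" "F0 Un F1 <= P" "D <= H" "E <= H"
 using tail_sums_fin[OF F0] tail_sums_fin[OF F1] H(3) by auto
 hence "tail_sums P f c x H e (F0 Un F1)" "tail_sums P g d y H e (F0 Un F1)"
 using tail_sums_mono[OF F0, of "F0 Un F1" H] tail_sums_mono[OF F1, of "F0 Un F1" H] by simp_all
 thus "EX F0. tail_sums P f c x H e F0 & tail_sums P g d y H e F0" by blast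
 qed
qed

lemma has_bsum_add:
 assumes "has_bsum P f c x" "has_bsum P f d y" "f ` P <= car V"
 shows "has_bsum P f (%p. c p + d p) (x \<oplus> y)"
proof (rule has_bsum_common[OF assms(1,2)])
 fix D assume D: "D : small V" "cdisk V D"
 and lim: "!!e. e > 0 ==> EX F0. tail_sums P f c x D e F0 & tail_sums P f d y D e F0"
 interpret D: cdisk V D by fact
 have xy: "x : car V" "y : car V" using assms(1,2) has_bsum_carrier by blast+
 have key: "(a \<oplus> b) \<ominus> (u \<oplus> v) = (a \<ominus> u) \<oplus> (b \<ominus> v)" 
 if "a : car V" "b : car V" "u : car V" "v : car V" for a b u v
 using that by algebra
 show ?thesis
 proof (rule has_bsumI[OF _ D])
 fix e :: real assume e: "e > 0"
 obtain F0 where F0: "tail_sums P f c x D (e/2) F0" "tail_sums P f d y D (e/2) F0"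
 using lim[OF half_gt_zero[OF e]] by blast
 have "tail_sums P f (%p. c p + d p) (x \<oplus> y) D e F0"
 proof (rule tail_sumsI[OF tail_sums_fin[OF F0(1)]])
 fix F assume F: "finite F" "F0 <= F" "F <= P"
 have fc: "p : F ==> f p : car V" for p using F(3) assms(3) by blast
 have "(\<Oplus>p\<in>F. (c p + d p) \<odot> f p) = (\<Oplus>p\<in>F. c p \<odot> f p \<oplus> d p \<odot> f p)"
 using fc by (intro M.finsum_cong') (auto simp: smult_ladd)
 also have "... = (\<Oplus>p\<in>F. c p \<odot> f p) \<oplus> (\<Oplus>p\<in>F. d p \<odot> f p)"
 using fc by (intro M.finsum_addf) auto
 finally have "(x \<oplus> y) \<ominus> (\<Oplus>p\<in>F. (c p + d p) \<odot> f p)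
         = (x \<ominus> (\<Oplus>p\<in>F. c p \<odot> f p)) \<oplus> (y \<ominus> (\<Oplus>p\<in>F. d p \<odot> f p))"
 using xy bsum_closed[OF assms(3) F(3)] by (simp add: key)
 thus "(x \<oplus> y) \<ominus> (\<Oplus>p\<in>F. (c p + d p) \<odot> f p) : sc e D"
 using D.sc_add[OF tail_sumsD[OF F0(1) F] tail_sumsD[OF F0(2) F]] e by simp
 qed
 thus "EX F0. tail_sums P f (%p. c p + d p) (x \<oplus> y) D e F0" by blast
 qed (use xy in simp)
qed

lemma has_bsum_smult:
 assumes "has_bsum P f c x" "f ` P <= car V"
 shows "has_bsum P f (%p. a * c p) (a \<odot> x)"
proof (rule has_bsum_common[OF assms(1,1)])
 fix D assume D: "D : small V" "cdisk V D"
 and lim: "!!e. e > 0 ==> EX F0. tail_sums P f c x D e F0 & tail_sums P f c x D e F0"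
 interpret D: cdisk V D by fact
 have x: "x : car V" using assms(1) has_bsum_carrier by blast
 show ?thesis
 proof (rule has_bsumI[OF _ D])
 fix e :: real assume e: "e > 0"
 let ?e = "e / (cmod a + 1)"
 have a1: "cmod a + 1 > 0" by (simp add: add_nonneg_pos)
 have e': "?e > 0" using e a1 by simp
 have ae: "cmod a * ?e <= e" using e a1 by (simp add: divide_simps algebra_simps)
 obtain F0 where F0: "tail_sums P f c x D ?e F0" using lim[OF e'] by blast
 have "tail_sums P f (%p. a * c p) (a \<odot> x) D e F0"
 proof (rule tail_sumsI[OF tail_sums_fin[OF F0]])
 fix F assume F: "finite F" "F0 <= F" "F <= P"
 have fc: "p : F ==> f p : car V" for p using F(3) assms(2) by blast
 have "(\<Oplus>p\<in>F. (a * c p) \<odot> f p) = (\<Oplus>p\<in>F. a \<odot> (c p \<odot> f p))"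
 using fc by (intro M.finsum_cong') (auto simp: smult_smult)
 also have "... = a \<odot> (\<Oplus>p\<in>F. c p \<odot> f p)"
 using fc F(1) by (intro finsum_smult[symmetric]) auto
 finally have "(a \<odot> x) \<ominus> (\<Oplus>p\<in>F. (a * c p) \<odot> f p) = a \<odot> (x \<ominus> (\<Oplus>p\<in>F. c p \<odot> f p))"
 using x bsum_closed[OF assms(2) F(3)] by (simp add: minus_smult)
 thus "(a \<odot> x) \<ominus> (\<Oplus>p\<in>F. (a * c p) \<odot> f p) : sc e D"
 using D.sc_smult[OF tail_sumsD[OF F0 F] ae] e' by simp
 qed
 thus "EX F0. tail_sums P f (%p. a * c p) (a \<odot> x) D e F0" by blast
 qed (use x in simp)
qed

text \<open>Past \<open>A\<close> all partial sums agree, so any small disk measures the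
  error.\<close>

lemma has_bsum_finite:
 assumes "finite A" "A <= P" "f ` P <= car V" "!!p. p : P ==> p \<notin> A ==> c p = 0"
 shows "has_bsum P f c (\<Oplus>p\<in>A. c p \<odot> f p)"
proof -
 obtain D where D: "D : small V" "cdisk V D" using small_disk[OF small_empty] by blast
 interpret D: cdisk V D by fact
 have cl: "(\<Oplus>p\<in>A. c p \<odot> f p) : car V" by (rule bsum_closed[OF assms(3,2)])
 have "tail_sums P f c (\<Oplus>p\<in>A. c p \<odot> f p) D e A" for e
 proof (rule tail_sumsI[OF assms(1,2)])
 fix F assume F: "finite F" "A <= F" "F <= P"
 have "(\<Oplus>p\<in>F. c p \<odot> f p) = (\<Oplus>p\<in>A. c p \<odot> f p)"
 proof (rule M.add.finprod_mono_neutral_cong_right[OF F(1,2)])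
 fix p assume "p : F - A"
 hence "p : P" "p \<notin> A" using F(3) by auto
 thus "c p \<odot> f p = \<zero>[V]" using assms(3,4) by (simp add: image_subset_iff)
 next
 show "(%p. c p \<odot> f p) : F \<rightarrow> car V" using assms(3) F(3) by (auto simp: subset_iff)
 qed simp
 thus "(\<Oplus>p\<in>A. c p \<odot> f p) \<ominus> (\<Oplus>p\<in>F. c p \<odot> f p) : sc e D"
 using D.sc_zero cl by (simp add: a_minus_def M.r_neg)
 qed
 thus ?thesis using has_bsumI[OF cl D] by blast
qed

end

context complete_bvs begin

lemma small_ccdisk:
 assumes "S : small V" obtains D where "D : small V" "ccdisk V D" "S <= D"
proof -
 obtain D where D: "D : small V" "complete_disk V D" "S <= D" using small_complete[OF assms] by blast
 have "ccdisk V D" by unfold_locales (use D(2) in "auto simp: complete_disk_def")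
 thus ?thesis using D that by blast
qed

text \<open>Two sums differ by an element of every dilate of a complete disk, and such an element
  vanishes because the gauge is definite.\<close>

lemma has_bsum_unique:
 assumes "has_bsum P f c x" "has_bsum P f c y" "f ` P <= car V"
 shows "x = y"
proof (rule has_bsum_common[OF assms(1,2)])
 fix D assume D: "D : small V" "cdisk V D"
 and lim: "!!e. e > 0 ==> EX F0. tail_sums P f c x D e F0 & tail_sums P f c y D e F0"
 interpret D: cdisk V D by fact
 have xy: "x : car V" "y : car V" using assms(1,2) has_bsum_carrier by blast+
 obtain E where E: "E : small V" "ccdisk V E" "D <= E" using small_ccdisk[OF D(1)] by blast
 interpret E: ccdisk V E by fact
 have "x \<ominus> y : sc e E" if e: "e > 0" for e
 proof -
 obtain F0 where F0: "tail_sums P f c x D (e/2) F0" "tail_sums P f c y D (e/2) F0"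
 using lim[OF half_gt_zero[OF e]] by blast
 let ?s = "\<Oplus>p\<in>F0. c p \<odot> f p"
 have fin: "finite F0" "F0 <= P" using tail_sums_fin[OF F0(1)] by auto
 have s: "?s : car V" by (rule bsum_closed[OF assms(3) fin(2)])
 have "(x \<ominus> ?s) \<ominus> (y \<ominus> ?s) : sc (e/2 + e/2) D"
 using D.sc_minus[OF tail_sumsD[OF F0(1) fin(1) subset_refl fin(2)] tail_sumsD[OF F0(2) fin(1) subset_refl fin(2)]] e by simp
 hence "x \<ominus> y : sc e D" using minus_minus_cancel[OF xy s] by simp
 thus ?thesis using E(3) unfolding sc_def by blast
 qed
 hence "x \<ominus> y = \<zero>[V]" using E.definite xy by simp
 thus ?thesis using minus_eq_zero xy by simp
qed

end

text \<open>The ball of radius \<open>r\<close> in ell^1 of \<open>S\<close>, expressed by finite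
  partial sums so that summability never appears as a side condition.\<close>

definition l1ball :: "'p set => real => ('p => complex) set" where
 "l1ball S r = {c. (ALL p. c p ~= 0 --> p : S) & (ALL F. finite F --> (SUM p:F. cmod (c p)) <= r)}"

lemma l1ball_nonneg: "c : l1ball S r ==> 0 <= r"
 unfolding l1ball_def by (force dest: spec[of _ "{}"])

lemma l1ball_mono: "c : l1ball S r ==> S <= T ==> r <= s ==> c : l1ball T s"
 unfolding l1ball_def by (force intro: order_trans)

lemma l1ball_add:
 assumes "c : l1ball S r" "d : l1ball T s" shows "c + d : l1ball (S Un T) (r + s)"
 unfolding l1ball_def
proof (clarify, intro conjI allI impI)
 show "p : S Un T" if "(c + d) p ~= 0" for p
 using that assms by (cases "c p = 0") (auto simp: l1ball_def)
 fix F :: "'a set" assume F: "finite F"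
 have "(SUM p:F. cmod ((c + d) p)) <= (SUM p:F. cmod (c p) + cmod (d p))"
 by (intro sum_mono) (auto intro: norm_triangle_ineq)
 also have "... = (SUM p:F. cmod (c p)) + (SUM p:F. cmod (d p))" by (rule sum.distrib)
 also have "... <= r + s" using assms F by (intro add_mono) (auto simp: l1ball_def)
 finally show "(SUM p:F. cmod ((c + d) p)) <= r + s" .
qed

lemma l1ball_scale:
 assumes "c : l1ball S r" shows "(%p. a * c p) : l1ball S (cmod a * r)"
 using assms unfolding l1ball_def
 by (auto simp: norm_mult sum_distrib_left[symmetric] intro: mult_left_mono)

lemma l1ball_zero: "0 <= r ==> 0 : l1ball S r"
 by (auto simp: l1ball_def)

lemma l1ball_uminus: "c : l1ball S r ==> - c : l1ball S r"
 by (auto simp: l1ball_def)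

lemma l1ball_diff:
 assumes "c : l1ball S r" "d : l1ball T s" shows "c - d : l1ball (S Un T) (r + s)"
 using l1ball_add[OF assms(1) l1ball_uminus[OF assms(2)]] by simp

text \<open>A finite set whose partial sum comes within \<open>e\<close> of the supremum leaves at
  most \<open>e\<close> for any finite set disjoint from it.\<close>

lemma l1ball_tail:
 assumes c: "c : l1ball S r" and e: "e > 0"
 obtains F0 where "finite F0" "F0 <= S" "!!F. finite F ==> F Int F0 = {} ==> (SUM p:F. cmod (c p)) <= e"
proof -
 let ?A = "(%F. SUM p:F. cmod (c p)) ` {F. finite F & F <= S}"
 have bdd: "bdd_above ?A" using c by (intro bdd_aboveI[of _ r]) (auto simp: l1ball_def)
 have "?A ~= {}" by auto
 then obtain F0 where F0: "finite F0" "F0 <= S" "Sup ?A - e < (SUM p:F0. cmod (c p))"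
 using less_cSup_iff[OF _ bdd, of "Sup ?A - e"] e by auto
 show thesis
 proof (rule that[OF F0(1,2)])
 fix F assume F: "finite F" "F Int F0 = {}"
 have "(SUM p:F0. cmod (c p)) + (SUM p:F. cmod (c p)) = (SUM p:F0. cmod (c p)) + (SUM p:F Int S. cmod (c p))"
 using F c by (intro arg_cong2[of _ _ _ _ "(+)"] sum.mono_neutral_right refl) (auto simp: l1ball_def)
 also have "... = (SUM p:F0 Un (F Int S). cmod (c p))"
 using F F0 by (intro sum.union_disjoint[symmetric]) auto
 also have "... <= Sup ?A" by (rule cSup_upper[OF _ bdd]) (use F F0 in auto)
 finally show "(SUM p:F. cmod (c p)) <= e" using F0(3) by simp
 qed
qed

lemma l1ball_tail_ex:
 assumes "c : l1ball S r" "e > 0"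
 shows "EX F0. finite F0 & F0 <= S & (ALL F. finite F & F Int F0 = {} --> (SUM p:F. cmod (c p)) <= e)"
 by (rule l1ball_tail[OF assms]) blast

text \<open>Outside a finite set all coefficients are below \<open>1 / (n + 1)\<close>, for each
  \<open>n\<close>. Countable supports are what allows summable families to be encoded by
  sequences.\<close>

lemma l1ball_countable:
 assumes "c : l1ball S r" shows "countable {p. c p ~= 0}"
proof -
 have "EX F. finite F & (ALL p. p \<notin> F --> cmod (c p) <= inverse (real (Suc n)))" for n
 proof -
 obtain F0 where F0: "finite F0" "ALL F. finite F & F Int F0 = {} --> (SUM p:F. cmod (c p)) <= inverse (real (Suc n))"
 using l1ball_tail_ex[OF assms, of "inverse (real (Suc n))"] by (metis of_nat_0_less_iff positive_imp_inverse_positive zero_less_Suc)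
 have "cmod (c p) <= inverse (real (Suc n))" if "p \<notin> F0" for p
 using F0(2)[rule_format, of "{p}"] that by simp
 thus ?thesis using F0(1) by blast
 qed
 then obtain F where F: "!!n. finite (F n)" "!!n p. p \<notin> F n ==> cmod (c p) <= inverse (real (Suc n))"
 by metis
 have "{p. c p ~= 0} <= (\<Union>n. F n)"
 proof
 fix p assume "p : {p. c p ~= 0}"
 then obtain n where "inverse (real (Suc n)) < cmod (c p)" using reals_Archimedean[of "cmod (c p)"] by auto
 hence "p : F n" using F(2)[of p n] by fastforce
 thus "p : (\<Union>n. F n)" by blast
 qed
 moreover have "countable (\<Union>n. F n)" using F(1) by (simp add: countable_finite)
 ultimately show ?thesis by (rule countable_subset)
qed

context complete_bvs begin

text \<open>The sums over an increasing sequence of finite sets \<open>H n\<close>, with remainders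
  below \<open>1 / (n + 1)\<close>, form a Cauchy sequence for the disk, and its limit is the sum of
  the whole net. The disk is fixed in advance so that the value can be bounded in it.\<close>

lemma has_bsum_exists_disk:
 assumes c: "c : l1ball S r" and SP: "S <= P" and f: "f ` P <= car V"
 and D: "ccdisk V D" and fS: "f ` S <= sc s D" and s: "0 < s" "0 < r"
 shows "EX x:sc (2 * r * s) D. ALL e>0. EX F0. tail_sums P f c x D e F0"
proof -
 interpret D: ccdisk V D by fact
 have fc: "p : P ==> f p : car V" for p using f by blast
 have fin_bd: "(\<Oplus>p\<in>F. c p \<odot> f p) : sc ((SUM p:F. cmod (c p)) * s) D" if "finite F" "F <= P" for F
 proof (rule D.sc_finsum)
 show "f p : sc s D" if "c p ~= 0" for p using c fS that by (auto simp: l1ball_def)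
 qed (use that f s in auto)
 have fin_cl: "(\<Oplus>p\<in>F. c p \<odot> f p) : car V" if "F <= P" for F
 by (rule bsum_closed[OF f that])
 have "EX F0. finite F0 & F0 <= S & (ALL F. finite F & F Int F0 = {} --> (SUM p:F. cmod (c p)) <= inverse (real (Suc n)))" for n
 using l1ball_tail_ex[OF c, of "inverse (real (Suc n))"] by (metis of_nat_0_less_iff positive_imp_inverse_positive zero_less_Suc)
 then obtain G where G: "!!n. finite (G n)" "!!n. G n <= S"
 "!!n F. finite F ==> F Int G n = {} ==> (SUM p:F. cmod (c p)) <= inverse (real (Suc n))"
 by metis
 define H where "H n = (\<Union>i\<le>n. G i)" for n
 have H: "finite (H n)" "H n <= P" "G n <= H n" for n using G(1,2) SP by (auto simp: H_def)
 have Hm: "H m <= H n" if "m <= n" for m n using that by (fastforce simp: H_def)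
 have tail: "(\<Oplus>p\<in>F. c p \<odot> f p) \<ominus> (\<Oplus>p\<in>H n. c p \<odot> f p) : sc (inverse (real (Suc n)) * s) D"
 if F: "finite F" "F <= P" "H n <= F" for F n
 proof -
 have "F = H n Un (F - H n)" using F by auto
 hence "(\<Oplus>p\<in>F. c p \<odot> f p) = (\<Oplus>p\<in>H n Un (F - H n). c p \<odot> f p)" by simp
 also have "... = (\<Oplus>p\<in>H n. c p \<odot> f p) \<oplus> (\<Oplus>p\<in>F - H n. c p \<odot> f p)"
 by (rule M.finsum_Un_disjoint) (use F fc H[of n] in auto)
 finally have 1: "(\<Oplus>p\<in>F. c p \<odot> f p) = (\<Oplus>p\<in>H n. c p \<odot> f p) \<oplus> (\<Oplus>p\<in>F - H n. c p \<odot> f p)" .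
 have "(a \<oplus> b) \<ominus> a = b" if "a : car V" "b : car V" for a b using that by algebra
 hence 2: "(\<Oplus>p\<in>F. c p \<odot> f p) \<ominus> (\<Oplus>p\<in>H n. c p \<odot> f p) = (\<Oplus>p\<in>F - H n. c p \<odot> f p)"
 unfolding 1 using fin_cl H(2)[of n] F(2) by (meson Diff_subset order_trans)
 have "(SUM p:F - H n. cmod (c p)) <= inverse (real (Suc n))"
 by (rule G(3)) (use F H(3)[of n] in auto)
 hence "(SUM p:F - H n. cmod (c p)) * s <= inverse (real (Suc n)) * s" 
 using s by (intro mult_right_mono) auto
 moreover have "0 <= (SUM p:F - H n. cmod (c p)) * s" using s by (intro mult_nonneg_nonneg sum_nonneg) auto
 moreover have "finite (F - H n)" "F - H n <= P" using F by auto
 ultimately show ?thesis unfolding 2 using D.sc_mono[OF fin_bd] by blast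
 qed
 have inv0: "EX n0. ALL n>=n0. inverse (real (Suc n)) * s <= e" if e: "e > 0" for e
 proof -
 obtain n0 where "inverse (real (Suc n0)) < e / s" using reals_Archimedean[of "e / s"] e s by auto
 moreover have "inverse (real (Suc n)) <= inverse (real (Suc n0))" if "n >= n0" for n using that by simp
 ultimately show ?thesis using s by (intro exI[of _ n0]) (smt (verit) pos_less_divide_eq mult_right_mono)
 qed
 let ?X = "%n. \<Oplus>p\<in>H n. c p \<odot> f p"
 have Cau: "EX M. ALL m>=M. ALL n>=M. ?X m \<ominus> ?X n : sc e D" if e: "e > 0" for e
 proof -
 obtain n0 where n0: "!!n. n\<ge>n0 ==> inverse (real (Suc n)) * s <= e/2" using inv0[OF half_gt_zero[OF e]] by blast
 have "?X m \<ominus> ?X n : sc e D" if "m >= n0" "n >= n0" for m n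
 proof -
 have b: "0 <= inverse (real (Suc n0)) * s" "inverse (real (Suc n0)) * s <= e/2" using n0[of n0] s by auto
 have "?X m \<ominus> ?X n0 : sc (e/2) D" "?X n \<ominus> ?X n0 : sc (e/2) D"
 using D.sc_mono[OF tail[OF H(1,2) Hm[OF that(1)]] b] D.sc_mono[OF tail[OF H(1,2) Hm[OF that(2)]] b] by blast+
 from D.sc_minus[OF this] have "(?X m \<ominus> ?X n0) \<ominus> (?X n \<ominus> ?X n0) : sc e D" using e by simp
 thus ?thesis using minus_minus_cancel fin_cl H(2) by simp
 qed
 thus ?thesis by blast
 qed
 obtain x where x: "x : car V" "!!e. e > 0 ==> EX M. ALL n>=M. ?X n \<ominus> x : sc e D"
 using D.cauchy_limit[of ?X, OF fin_cl[OF H(2)] Cau] by blast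
 have lim: "EX F0. tail_sums P f c x D e F0" if e: "e > 0" for e
 proof -
 obtain n0 where n0: "!!n. n\<ge>n0 ==> inverse (real (Suc n)) * s <= e/2" using inv0[OF half_gt_zero[OF e]] by blast
 obtain M where M: "!!n. n\<ge>M ==> ?X n \<ominus> x : sc (e/2) D" using x(2)[OF half_gt_zero[OF e]] by blast
 let ?n = "max n0 M"
 have "x \<ominus> (\<Oplus>p\<in>F. c p \<odot> f p) : sc e D" if F: "finite F" "H ?n <= F" "F <= P" for F
 proof -
 have t: "(\<Oplus>p\<in>F. c p \<odot> f p) \<ominus> ?X ?n : sc (e/2) D"
 using D.sc_mono[OF tail[OF F(1,3,2)], of "e/2"] n0[of ?n] s by simp
 have m: "?X ?n \<ominus> x : sc (e/2) D" using M by simp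
 have "((\<Oplus>p\<in>F. c p \<odot> f p) \<ominus> ?X ?n) \<oplus> (?X ?n \<ominus> x) : sc e D" using D.sc_add[OF t m] e by simp
 hence "(\<Oplus>p\<in>F. c p \<odot> f p) \<ominus> x : sc e D" using minus_trans x(1) fin_cl H(2) F(3) by simp
 hence "\<ominus> ((\<Oplus>p\<in>F. c p \<odot> f p) \<ominus> x) : sc e D" using D.sc_neg e by simp
 moreover have "\<ominus> (a \<ominus> x) = x \<ominus> a" if "a : car V" for a using that x(1) by algebra
 ultimately show ?thesis using fin_cl F(3) by simp
 qed
 hence "tail_sums P f c x D e (H ?n)" by (rule tail_sumsI[OF H(1,2)])
 thus ?thesis by blast
 qed
 \<comment> \<open>One \<open>r * s\<close> bounds a finite partial sum, the other the distance from
   it. The factor 2 is crude, but it is the same for all families.\<close>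
 have "x : sc (2 * r * s) D"
 proof -
 obtain F0 where F0': "tail_sums P f c x D (r * s) F0"
 using lim[of "r * s"] s by auto
 have F0: "finite F0" "F0 <= P" using tail_sums_fin[OF F0'] by auto
 have F03: "x \<ominus> (\<Oplus>p\<in>F0. c p \<odot> f p) : sc (r * s) D" using tail_sumsD[OF F0'] F0 by simp
 have "(\<Oplus>p\<in>F0. c p \<odot> f p) : sc (r * s) D"
 proof (rule D.sc_mono[OF fin_bd[OF F0(1,2)]])
 show "0 <= (SUM p:F0. cmod (c p)) * s" using s by (intro mult_nonneg_nonneg sum_nonneg) auto
 show "(SUM p:F0. cmod (c p)) * s <= r * s" using c F0(1) s by (intro mult_right_mono) (auto simp: l1ball_def)
 qed
 from D.sc_add[OF F03 this] have "(x \<ominus> (\<Oplus>p\<in>F0. c p \<odot> f p)) \<oplus> (\<Oplus>p\<in>F0. c p \<odot> f p) : sc (2 * r * s) D"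
 using s by (simp add: mult.assoc)
 moreover have "(x \<ominus> a) \<oplus> a = x" if "a : car V" for a using that x(1) by algebra
 ultimately show ?thesis using fin_cl[OF F0(2)] by simp
 qed
 thus ?thesis using lim by blast
qed

lemma has_bsum_bound:
 assumes "c : l1ball S r" "S <= P" "f ` P <= car V"
 "D : small V" "ccdisk V D" "f ` S <= sc s D" "0 < s" "0 < r" "has_bsum P f c x"
 shows "x : sc (2 * r * s) D"
proof -
 interpret D: ccdisk V D by fact
 obtain y where y: "y : sc (2 * r * s) D" and l: "ALL e>0. EX F0. tail_sums P f c y D e F0"
 using has_bsum_exists_disk[OF assms(1-3,5-8)] by blast
 have "has_bsum P f c y" using has_bsumI[OF D.sc_carrier[OF y] assms(4) D.cdisk_axioms] l by blast
 thus ?thesis using has_bsum_unique[OF assms(9) _ assms(3)] y by simp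
qed

lemma has_bsum_exists:
 assumes "c : l1ball S r" "S <= P" "f ` P <= car V" "f ` S : small V"
 shows "EX x. has_bsum P f c x"
proof -
 obtain D where D: "D : small V" "ccdisk V D" "f ` S <= D" using small_ccdisk[OF assms(4)] by blast
 interpret D: ccdisk V D by fact
 have c: "c : l1ball S (max r 1)" using assms(1) by (rule l1ball_mono) auto
 have "f ` S <= sc 1 D" using D(3) by simp
 from has_bsum_exists_disk[OF c assms(2,3) D(2) this] 
 obtain y where y: "y : sc (2 * max r 1 * 1) D" and l: "ALL e>0. EX F0. tail_sums P f c y D e F0"
 by (metis less_max_iff_disj zero_less_one)
 have "has_bsum P f c y" using has_bsumI[OF D.sc_carrier[OF y] D(1) D.cdisk_axioms] l by blast
 thus ?thesis by blast
qed

end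

section \<open>Quotients of spaces of absolutely summable families\<close>

definition ell1 :: "'p set set => ('p => complex) set" where
 "ell1 B = {c. EX S:B. EX r. c : l1ball S r}"

definition delta :: "'p => 'p => complex" where
 "delta p = (%q. if q = p then 1 else 0)"

text \<open>Closed means closed for bornological limits: the approximation errors of
  \<open>c\<close> are all supported in one \<open>S\<close> of the bornology. Such subspaces are
  stable under intersections, so there is a smallest one containing given relations.\<close>

definition closed_sub :: "'p set set => ('p => complex) set => bool" where
 "closed_sub B M \<longleftrightarrow> M <= ell1 B & 0 : M & (ALL c:M. ALL d:M. c + d : M)
    & (ALL a. ALL c:M. (%p. a * c p) : M)
    & (ALL c:ell1 B. ALL S:B. (ALL e>0. EX m:M. c - m : l1ball S e) --> c : M)"

text \<open>Dividing by the bare span of the relations could leave nonzero elements of gauge 0; the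
  closure removes them.\<close>

definition closed_rel :: "'p set set => ('p \<Rightarrow>\<^sub>0 complex) set => ('p => complex) set" where
 "closed_rel B Rel = \<Inter> {M. closed_sub B M & coef ` Rel <= M}"

definition pmsum :: "('x, 'm) bvs_scheme => ('p => 'x) => ('p \<Rightarrow>\<^sub>0 complex) => 'x" where
 "pmsum X f r = (\<Oplus>\<^bsub>X\<^esub>p\<in>supp r. coef r p .[X] f p)"

text \<open>A bornology on a bare set of generators; linear structure enters only through
  \<open>ell1\<close>.\<close>

locale bornology_set =
 fixes B :: "'p set set"
 assumes B_empty: "{} : B"
 and B_sub: "S : B ==> T <= S ==> T : B"
 and B_Un: "S : B ==> T : B ==> S Un T : B"
begin

lemma point: "p : \<Union>B ==> {p} : B"
 using B_sub by blast

lemma finite_B: "finite F ==> F <= \<Union>B ==> F : B"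
 by (induction rule: finite_induct) (use B_empty B_Un[OF point] in auto)

lemma ell1_ball: "S : B ==> c : l1ball S r ==> c : ell1 B"
 by (auto simp: ell1_def)

lemma ell1_zero: "0 : ell1 B"
 using ell1_ball[OF B_empty l1ball_zero[of 0]] by simp

lemma ell1_add: "c : ell1 B ==> d : ell1 B ==> c + d : ell1 B"
 unfolding ell1_def using l1ball_add B_Un by blast

lemma ell1_scale: "c : ell1 B ==> (%p. a * c p) : ell1 B"
 unfolding ell1_def using l1ball_scale by blast

lemma ell1_diff: "c : ell1 B ==> d : ell1 B ==> c - d : ell1 B"
 unfolding ell1_def using l1ball_diff B_Un by blast

lemma delta_ball: "delta p : l1ball {p} 1"
proof -
 have "(SUM q:F. cmod (delta p q)) <= 1" if "finite F" for F
 proof -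
 have "(SUM q:F. cmod (delta p q)) = (SUM q:F. if q = p then 1 else 0)"
 by (intro sum.cong) (auto simp: delta_def)
 thus ?thesis using that by simp
 qed
 thus ?thesis by (auto simp: l1ball_def delta_def split: if_splits)
qed

lemma delta_ell1: "p : \<Union>B ==> delta p : ell1 B"
 using ell1_ball[OF point delta_ball] .

lemma lookup_ell1: "supp r <= \<Union>B ==> coef r : ell1 B"
proof (rule ell1_ball[OF finite_B])
 show "coef r : l1ball (supp r) (SUM p:supp r. cmod (coef r p))"
 unfolding l1ball_def
 proof (clarify, intro conjI allI impI)
 fix F :: "'p set" assume F: "finite F"
 have "(SUM p:F. cmod (coef r p)) = (SUM p:F Int supp r. cmod (coef r p))"
 by (rule sum.mono_neutral_right) (use F in "auto simp: in_keys_iff")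
 also have "... <= (SUM p:supp r. cmod (coef r p))"
 by (rule sum_mono2) auto
 finally show "(SUM p:F. cmod (coef r p)) <= (SUM p:supp r. cmod (coef r p))" .
 qed (auto simp: in_keys_iff)
qed auto

lemma closed_sub_ell1: "closed_sub B (ell1 B)"
 unfolding closed_sub_def using ell1_zero ell1_add ell1_scale by auto

lemma closed_sub_Inter:
 assumes "!!M. M : \<M> ==> closed_sub B M" "\<M> ~= {}"
 shows "closed_sub B (\<Inter>\<M>)"
 unfolding closed_sub_def
proof (intro conjI ballI allI impI)
 fix c S assume c: "c : ell1 B" "S : B" "ALL e>0. EX m:\<Inter>\<M>. c - m : l1ball S e"
 show "c : \<Inter>\<M>"
 proof
 fix M assume M: "M : \<M>"
 have "ALL c:ell1 B. ALL S:B. (ALL e>0. EX m:M. c - m : l1ball S e) --> c : M"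
 using assms(1)[OF M] unfolding closed_sub_def by (elim conjE)
 moreover have "ALL e>0. EX m:M. c - m : l1ball S e" using c(3) M by blast
 ultimately show "c : M" using c(1,2) by blast
 qed
next
 obtain M where M: "M : \<M>" using assms(2) by blast
 thus "\<Inter>\<M> <= ell1 B" using assms(1)[OF M] unfolding closed_sub_def by blast
next
 show "0 : \<Inter>\<M>" using assms(1) unfolding closed_sub_def by blast
next
 fix c d assume "c : \<Inter>\<M>" "d : \<Inter>\<M>"
 thus "c + d : \<Inter>\<M>" using assms(1) unfolding closed_sub_def by blast
next
 fix a c assume "c : \<Inter>\<M>"
 thus "(%p. a * c p) : \<Inter>\<M>" using assms(1) unfolding closed_sub_def by blast
qed

lemma closed_sub_closed_rel:
 assumes "!!r. r : Rel ==> supp r <= \<Union>B" 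
 shows "closed_sub B (closed_rel B Rel)"
 unfolding closed_rel_def 
 by (rule closed_sub_Inter) (use closed_sub_ell1 assms lookup_ell1 in blast)+

end

text \<open>Completeness of ell^1 in the form asked for by \<open>complete_diskI\<close>: the series
  is summed coefficientwise, and finite sums of norms are exchanged with it.\<close>

lemma l1_series:
 fixes g :: "nat => 'p => complex"
 assumes g: "!!k. g k : l1ball S ((1/2)^k * r)"
 shows "EX h : l1ball S (2 * r). ALL n. h - (\<Sum>k<n. g k) : l1ball S (2 * (1/2)^n * r)"
proof -
 have r: "0 <= r" using l1ball_nonneg[OF g[of 0]] by simp
 have gb: "cmod (g k p) <= (1/2)^k * r" for k p
 using g[of k] unfolding l1ball_def by (auto dest: spec[of _ "{p}"])
 have geo: "summable (%k. (1/2)^(k + n) * r)" for n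
 by (intro summable_mult2 summable_ignore_initial_segment) simp
 have geos: "(suminf (%k. (1/2)^(k + n) * r)) = 2 * (1/2)^n * r" for n
 proof -
 have "(%k. (1/2::real)^k) sums 2" using geometric_sums[of "1/2::real"] by simp
 hence "(%k. (1/2::real)^k * ((1/2)^n * r)) sums (2 * ((1/2)^n * r))" by (rule sums_mult2)
 thus ?thesis by (simp add: power_add sums_iff mult.assoc)
 qed
 have sm: "summable (%k. cmod (g (k + n) p))" for n p
 by (rule summable_comparison_test'[OF geo[of n], of 0]) (use gb in auto)
 define h where "h p = (suminf (%k. g k p))" for p
 have hn: "h - (\<Sum>k<n. g k) : l1ball S (2 * (1/2)^n * r)" for n
 proof -
 have eq: "(h - (\<Sum>k<n. g k)) p = suminf (%k. g (k + n) p)" for p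
 proof -
 have "summable (%k. g k p)" using summable_norm_cancel[of "%k. g k p"] sm[of 0 p] by simp
 from suminf_split_initial_segment[OF this, of n] 
 have "h p = suminf (%k. g (k + n) p) + (\<Sum>i<n. g i p)" by (simp add: h_def)
 moreover have "(\<Sum>k<n. g k) p = (\<Sum>i<n. g i p)" by (induction n) (auto simp: zero_fun_def)
 ultimately show ?thesis by simp
 qed
 show ?thesis
 unfolding l1ball_def
 proof (clarify, intro conjI allI impI)
 fix p assume nz: "(h - (\<Sum>k<n. g k)) p ~= 0"
 have "EX k. g (k + n) p ~= 0"
 proof (rule ccontr)
 assume "\<not> (EX k. g (k + n) p ~= 0)"
 hence "(%k. g (k + n) p) = (%k. 0)" by auto
 with nz show False unfolding eq by simp
 qed
 then obtain k where "g (k + n) p ~= 0" by blast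
 thus "p : S" using g[of "k+n"] by (auto simp: l1ball_def)
 next
 fix F :: "'p set" assume F: "finite F"
 have "(SUM p:F. cmod ((h - (\<Sum>k<n. g k)) p)) <= (SUM p:F. suminf (%k. cmod (g (k + n) p)))"
 unfolding eq by (intro sum_mono summable_norm sm)
 also have "... = suminf (%k. SUM p:F. cmod (g (k + n) p))"
 by (rule suminf_sum[symmetric]) (rule sm)
 also have "... <= (suminf (%k. (1/2)^(k + n) * r))"
 proof (rule suminf_le)
 show "(SUM p:F. cmod (g (k + n) p)) <= (1/2)^(k + n) * r" for k
 using g[of "k+n"] F by (auto simp: l1ball_def)
 show "summable (%k. SUM p:F. cmod (g (k + n) p))" by (intro summable_sum sm)
 qed (rule geo)
 finally show "(SUM p:F. cmod ((h - (\<Sum>k<n. g k)) p)) <= 2 * (1/2)^n * r" unfolding geos .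
 qed
 qed
 show ?thesis by (rule bexI[of _ h]) (use hn hn[of 0] in auto)
qed

text \<open>\<open>V\<close> is the complete space generated by the points of \<open>B\<close>, with
  the members of \<open>B\<close> small, subject to \<open>Rel\<close>: ell^1 modulo the closure of
  the relations, with images of balls as small sets. Completions and completed tensor products are
  both of this kind, so their universal properties have a common proof.\<close>

locale presentation = bornology_set B + cvs V
 for B :: "'p set set" and V :: "'a bvs" (structure) +
 fixes Rel :: "('p \<Rightarrow>\<^sub>0 complex) set" and kp :: "('p => complex) => 'a"
 assumes Rel_keys: "r : Rel ==> supp r <= \<Union>B"
 and kp_onto: "kp ` ell1 B = car V"
 and kp_add: "c : ell1 B ==> d : ell1 B ==> kp (c + d) = kp c \<oplus> kp d"
 and kp_scale: "c : ell1 B ==> kp (%p. a * c p) = a \<odot> kp c"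
 and kp_zero_iff: "c : ell1 B ==> kp c = \<zero> \<longleftrightarrow> c : closed_rel B Rel"
 and small_eq: "small V = {Y. EX S:B. EX r. Y <= kp ` l1ball S r}"
begin

definition gen :: "'p => 'a" where "gen p = kp (delta p)"

lemma kp_carrier: "c : ell1 B ==> kp c : car V"
 using kp_onto by blast

lemma kp_neg: "c : ell1 B ==> kp (- c) = \<ominus> kp c"
 using kp_scale[of c "-1"] kp_carrier[of c] by (simp add: smult_m1 fun_Compl_def)

lemma kp_diff: assumes "c : ell1 B" "d : ell1 B" shows "kp (c - d) = kp c \<ominus> kp d"
proof -
 have "- d : ell1 B" using ell1_scale[of d "-1"] assms by (simp add: fun_Compl_def)
 thus ?thesis using kp_add[of c "- d"] kp_neg assms by (simp add: a_minus_def)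
qed

lemma kp_zero: "kp 0 = \<zero>"
 using kp_scale[OF ell1_zero, of 0] kp_carrier[OF ell1_zero] by (simp add: zero_fun_def)

lemma kp_eq_iff: "c : ell1 B ==> d : ell1 B ==> kp c = kp d \<longleftrightarrow> c - d : closed_rel B Rel"
 using kp_zero_iff[of "c - d"] kp_diff[of c d] ell1_diff[of c d] minus_eq_zero kp_carrier by auto

lemma gen_carrier: "p : \<Union>B ==> gen p : car V"
 unfolding gen_def using kp_carrier delta_ell1 by blast

lemma kp_restrict:
 assumes "finite F" "F <= \<Union>B"
 shows "(%p. if p : F then c p else 0) : ell1 B & kp (%p. if p : F then c p else 0) = (\<Oplus>p\<in>F. c p \<odot> gen p)"
 using assms
proof (induction rule: finite_induct)
 case empty
 thus ?case using kp_zero ell1_zero by (simp add: zero_fun_def)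
next
 case (insert q F)
 have e: "(%p. if p : insert q F then c p else 0) = (%p. c q * delta q p) + (%p. if p : F then c p else 0)"
 using insert.hyps by (auto simp: delta_def fun_eq_iff)
 have d: "delta q : ell1 B" using insert.prems delta_ell1 by blast
 hence d': "(%p. c q * delta q p) : ell1 B" by (rule ell1_scale)
 have "kp (%p. if p : insert q F then c p else 0) = c q \<odot> gen q \<oplus> (\<Oplus>p\<in>F. c p \<odot> gen p)"
 unfolding e using insert kp_add[OF d'] kp_scale[OF d] by (simp add: gen_def)
 also have "... = (\<Oplus>p\<in>insert q F. c p \<odot> gen p)"
 proof (rule M.finsum_insert[symmetric])
 show "(%p. c p \<odot> gen p) : F \<rightarrow> car V"
 proof
 fix p assume "p : F"
 hence "p : \<Union>B" using insert.prems by blast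
 thus "c p \<odot> gen p : car V" using gen_carrier by simp
 qed
 show "c q \<odot> gen q : car V" using insert.prems gen_carrier by simp
 qed (use insert in auto)
 finally show ?case unfolding e using ell1_add[OF d'] insert by simp
qed

lemma cdisk_ball:
 assumes "S : B" "0 <= r" shows "cdisk V (kp ` l1ball S r)"
proof
 show "kp ` l1ball S r ~= {}" using l1ball_zero[OF assms(2)] by blast
 have e: "c : ell1 B" if "c : l1ball S r" for c using ell1_ball assms that by blast
 show "disk V (kp ` l1ball S r)"
 unfolding disk_def
 proof (intro conjI ballI allI impI)
 show "kp ` l1ball S r <= car V" using e kp_carrier by blast
 next
 fix a x assume "x : kp ` l1ball S r" "cmod a <= 1"
 then obtain c where c: "c : l1ball S r" "x = kp c" by blast
 have "(%p. a * c p) : l1ball S r"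
 using l1ball_mono[OF l1ball_scale[OF c(1)] subset_refl] \<open>cmod a \<le> 1\<close> assms(2) by (simp add: mult_left_le_one_le)
 thus "a \<odot> x : kp ` l1ball S r" using c e kp_scale by (metis imageI)
 next
 fix x y t assume "x : kp ` l1ball S r" "y : kp ` l1ball S r" and t: "t : {0..1::real}"
 then obtain c d where c: "c : l1ball S r" "x = kp c" and d: "d : l1ball S r" "y = kp d" by blast
 have "(%p. cplx t * c p) + (%p. cplx (1 - t) * d p) : l1ball (S Un S) (t * r + (1 - t) * r)"
 using l1ball_add[OF l1ball_scale[OF c(1), of "cplx t"] l1ball_scale[OF d(1), of "cplx (1-t)"]] t
 by (simp del: of_real_diff add: norm_of_real)
 hence "(%p. cplx t * c p) + (%p. cplx (1 - t) * d p) : l1ball S r"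
 by (simp add: algebra_simps)
 moreover have "kp ((%p. cplx t * c p) + (%p. cplx (1 - t) * d p))
        = cplx t \<odot> x \<oplus> cplx (1 - t) \<odot> y"
 using c d e ell1_scale by (simp add: kp_add kp_scale del: of_real_diff)
 ultimately show "cplx t \<odot> x \<oplus> cplx (1 - t) \<odot> y : kp ` l1ball S r"
 by (metis imageI)
 qed
qed

lemma sc_ball:
 assumes "S : B" "0 < e" shows "sc e (kp ` l1ball S r) = kp ` l1ball S (e * r)"
proof -
 have 1: "(%p. cplx e * c p) : l1ball S (e * r)" if "c : l1ball S r" for c
 using l1ball_scale[OF that, of "cplx e"] assms by simp
 have 2: "(%p. cplx (1/e) * c p) : l1ball S r" if "c : l1ball S (e * r)" for c
 using l1ball_scale[OF that, of "cplx (1/e)"] assms by (simp add: norm_divide)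
 show ?thesis
 proof
 show "sc e (kp ` l1ball S r) <= kp ` l1ball S (e * r)"
 proof
 fix x assume "x : sc e (kp ` l1ball S r)"
 then obtain c where c: "c : l1ball S r" "x = cplx e \<odot> kp c" unfolding sc_def by blast
 hence "x = kp (%p. cplx e * c p)" using kp_scale[OF ell1_ball[OF assms(1) c(1)]] by simp
 thus "x : kp ` l1ball S (e * r)" using 1[OF c(1)] by blast
 qed
 show "kp ` l1ball S (e * r) <= sc e (kp ` l1ball S r)"
 proof
 fix x assume "x : kp ` l1ball S (e * r)"
 then obtain c where c: "c : l1ball S (e * r)" "x = kp c" by blast
 let ?d = "%p. cplx (1/e) * c p"
 have "c = (%p. cplx e * ?d p)" using assms by (simp add: mult.assoc[symmetric] del: of_real_divide of_real_mult add: of_real_mult[symmetric])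
 hence "x = cplx e \<odot> kp ?d"
 using kp_scale[OF ell1_ball[OF assms(1) 2[OF c(1)]], of "cplx e"] c(2) by simp
 thus "x : sc e (kp ` l1ball S r)" using 2[OF c(1)] by (auto simp: sc_def)
 qed
 qed
qed

lemma small_ball: "S : B ==> kp ` l1ball S r : small V"
 unfolding small_eq by blast

text \<open>An element of every dilate has arbitrarily small representatives, so each of its
  representatives is a limit of relations and hence belongs to the closed subspace. A rapidly
  convergent series is lifted term by term and summed by \<open>l1_series\<close>.\<close>

lemma ccdisk_ball:
 assumes S: "S : B" and r: "0 < r" shows "ccdisk V (kp ` l1ball S r)"
proof -
 let ?D = "kp ` l1ball S r"
 interpret D: cdisk V ?D using cdisk_ball[OF S] r by simp
 have cl: "closed_sub B (closed_rel B Rel)" using closed_sub_closed_rel Rel_keys by blast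
 have e1: "c : ell1 B" if "c : l1ball S t" for c t using ell1_ball[OF S that] .
 have "complete_disk V ?D"
 proof (rule D.complete_diskI)
 fix x assume x: "x : car V" "!!e. e > 0 ==> x : sc e ?D"
 obtain c where c: "c : ell1 B" "x = kp c" using x(1) kp_onto by blast
 have "EX m:closed_rel B Rel. c - m : l1ball S e" if e: "e > 0" for e
 proof -
 have "x : kp ` l1ball S e" using x(2)[of "e / r"] e r sc_ball[OF S, of "e/r" r] by simp
 then obtain d where d: "d : l1ball S e" "kp c = kp d" using c(2) by auto
 hence "c - d : closed_rel B Rel" using kp_eq_iff c(1) e1 by blast
 moreover have "c - (c - d) : l1ball S e" using d(1) by simp
 ultimately show ?thesis by blast
 qed
 hence "c : closed_rel B Rel" using cl c(1) S unfolding closed_sub_def by blast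
 thus "x = \<zero>" using kp_zero_iff c by simp
 next
 fix d :: "nat => 'a" assume d: "!!k. d k : sc ((1/2)^k) ?D"
 have "EX g. g : l1ball S ((1/2)^k * r) & d k = kp g" for k
 using d[of k] sc_ball[OF S, of "(1/2)^k" r] by auto
 then obtain g where g: "!!k. g k : l1ball S ((1/2)^k * r)" "!!k. d k = kp (g k)" by metis
 obtain h where h: "h : l1ball S (2 * r)" "!!n. h - (\<Sum>k<n. g k) : l1ball S (2 * (1/2)^n * r)"
 using l1_series[OF g(1)] by blast
 have dc: "d k : car V" for k unfolding g(2) by (rule kp_carrier[OF e1[OF g(1)]])
 have sums: "(\<Sum>k<n. g k) : ell1 B & kp (\<Sum>k<n. g k) = (\<Oplus>k\<in>{..<n}. d k)" for n
 proof (induction n)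
 case 0
 thus ?case using kp_zero ell1_zero by (simp add: zero_fun_def)
 next
 case (Suc n)
 have gn: "g n : ell1 B" using g(1) e1 by blast
 have "(\<Oplus>k\<in>{..<Suc n}. d k) = d n \<oplus> (\<Oplus>k\<in>{..<n}. d k)"
 unfolding lessThan_Suc by (rule M.finsum_insert) (use dc in auto)
 also have "... = kp (g n + (\<Sum>k<n. g k))" using kp_add[OF gn] Suc g(2) by simp
 finally have f: "(\<Oplus>k\<in>{..<Suc n}. d k) = kp (g n + (\<Sum>k<n. g k))" .
 have e: "(\<Sum>k<Suc n. g k) = g n + (\<Sum>k<n. g k)" by (rule trans[OF sum.lessThan_Suc add.commute])
 have h: "g n + (\<Sum>k<n. g k) : ell1 B" using ell1_add[OF gn] Suc by blast
 show ?case unfolding e by (rule conjI[OF h f[symmetric]])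
 qed
 show "EX y:car V. ALL n. y \<ominus> (\<Oplus>k\<in>{..<n}. d k) : sc (2 * (1/2)^n) ?D"
 proof (rule bexI[of _ "kp h"], intro allI)
 fix n
 have "kp h \<ominus> (\<Oplus>k\<in>{..<n}. d k) = kp (h - (\<Sum>k<n. g k))"
 using sums[of n] kp_diff e1[OF h(1)] by simp
 thus "kp h \<ominus> (\<Oplus>k\<in>{..<n}. d k) : sc (2 * (1/2)^n) ?D"
 using h(2)[of n] by (subst sc_ball[OF S]) auto
 qed (use e1[OF h(1)] kp_carrier in blast)
 qed
 thus ?thesis by unfold_locales
qed

sublocale complete_bvs V
proof unfold_locales
 fix Y assume Y: "Y : small V"
 then obtain S r where Sr: "S : B" "Y <= kp ` l1ball S r" unfolding small_eq by blast
 have e: "c : ell1 B" if "c : l1ball S t" for c t using ell1_ball[OF Sr(1) that] .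
 show "Y <= car V" using Sr e kp_carrier by blast
 have Y1: "Y <= kp ` l1ball S (max r 1)" using Sr(2) l1ball_mono[of _ S r S "max r 1"] by auto
 interpret D: ccdisk V "kp ` l1ball S (max r 1)" by (rule ccdisk_ball[OF Sr(1)]) simp
 show "EX D:small V. complete_disk V D & Y <= D"
 using Y1 D.complete small_ball[OF Sr(1)] by blast
 show "disk_hull V Y : small V"
 using disk_hull_least[OF D.disk Y1] Sr(1) unfolding small_eq by blast
 show "T : small V" if "T <= Y" for T using Sr that unfolding small_eq by blast
 fix T assume "T : small V"
 then obtain S' r' where Sr': "S' : B" "T <= kp ` l1ball S' r'" unfolding small_eq by blast
 have "Y <+>\<^bsub>V\<^esub> T <= kp ` l1ball (S Un S') (r + r')"
 proof
 fix x assume "x : Y <+>\<^bsub>V\<^esub> T"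
 then obtain c d where "c : l1ball S r" "d : l1ball S' r'" "x = kp c \<oplus> kp d"
 using Sr Sr' unfolding set_add_def' by blast
 thus "x : kp ` l1ball (S Un S') (r + r')"
 using kp_add[of c d] l1ball_add e ell1_ball[OF Sr'(1)] by (metis imageI)
 qed
 thus "Y <+>\<^bsub>V\<^esub> T : small V" unfolding small_eq using B_Un[OF Sr(1) Sr'(1)] by blast
next
 fix x assume "x : car V"
 then obtain c where "c : ell1 B" "x = kp c" using kp_onto by blast
 thus "{x} : small V" unfolding small_eq ell1_def by blast
qed

lemma gen_small: assumes "S : B" shows "gen ` S : small V"
proof -
 have "gen ` S <= kp ` l1ball S 1"
 unfolding gen_def using l1ball_mono[OF delta_ball, of _ S 1] by auto
 thus ?thesis unfolding small_eq using assms by blast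
qed

text \<open>Every element is the convergent sum of the generators weighted by its coefficients, so
  bounded linear maps are determined by their values on generators.\<close>

lemma kp_has_bsum:
 assumes c: "c : ell1 B" shows "has_bsum (\<Union>B) gen c (kp c)"
proof -
 obtain S r where S: "S : B" "c : l1ball S r" using c unfolding ell1_def by blast
 show ?thesis
 proof (rule has_bsumI[OF kp_carrier[OF c] small_ball[OF S(1), of 1]])
 show "cdisk V (kp ` l1ball S 1)" by (rule cdisk_ball[OF S(1)]) simp
 fix e :: real assume e: "e > 0"
 obtain F0 where F0: "finite F0" "F0 <= S" "ALL F. finite F & F Int F0 = {} --> (SUM p:F. cmod (c p)) <= e"
 using l1ball_tail_ex[OF S(2) e] by blast
 have "tail_sums (\<Union>B) gen c (kp c) (kp ` l1ball S 1) e F0"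
 proof (rule tail_sumsI)
 fix F assume F: "finite F" "F0 <= F" "F <= \<Union>B"
 let ?d = "c - (%p. if p : F then c p else 0)"
 have "?d : l1ball S e"
 unfolding l1ball_def
 proof (clarify, intro conjI allI impI)
 show "p : S" if "?d p ~= 0" for p using S(2) that by (auto simp: l1ball_def split: if_splits)
 fix G :: "'p set" assume G: "finite G"
 have "(SUM p:G. cmod (?d p)) = (SUM p:G - F. cmod (c p))"
 using G by (intro sum.mono_neutral_cong_right) auto
 also have "... <= e" using F0(3)[rule_format, of "G - F"] G F by auto
 finally show "(SUM p:G. cmod (?d p)) <= e" .
 qed
 hence "kp ?d : sc e (kp ` l1ball S 1)" using sc_ball[OF S(1) e, of 1] by auto
 thus "kp c \<ominus> (\<Oplus>p\<in>F. c p \<odot> gen p) : sc e (kp ` l1ball S 1)"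
 using kp_diff[OF c] kp_restrict[OF F(1,3), of c] by simp
 qed (use F0 S(1) in auto)
 thus "EX F0. tail_sums (\<Union>B) gen c (kp c) (kp ` l1ball S 1) e F0" by blast
 qed
qed

end

lemma linear_onD:
 assumes "linear_on V W g"
 shows "x : car V ==> g x : car W"
 "x : car V ==> y : car V ==> g (x +[V] y) = g x +[W] g y"
 "x : car V ==> g (c .[V] x) = c .[W] g x"
 using assms by (auto simp: linear_on_def)

lemma bdd_linearD:
 assumes "bdd_linear V W g"
 shows "linear_on V W g" "x : car V ==> g x : car W"
 "x : car V ==> y : car V ==> g (x +[V] y) = g x +[W] g y"
 "x : car V ==> g (c .[V] x) = c .[W] g x"
 "S : small V ==> g ` S : small W"
 using assms by (auto simp: bdd_linear_def linear_on_def)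

lemma bdd_linearI:
 assumes "!!x. x : car V ==> g x : car W"
 "!!x y. x : car V ==> y : car V ==> g (x +[V] y) = g x +[W] g y"
 "!!c x. x : car V ==> g (c .[V] x) = c .[W] g x"
 "!!S. S : small V ==> g ` S : small W"
 shows "bdd_linear V W g"
 using assms by (auto simp: bdd_linear_def linear_on_def)

locale cvs_pair = V: cvs V + W: cvs W for V :: "'a bvs" and W :: "'b bvs"
begin

lemma lin_zero: "linear_on V W g ==> g \<zero>[V] = \<zero>[W]"
 using linear_onD(3)[of V W g "\<zero>[V]" 0] linear_onD(1)[of V W g "\<zero>[V]"] by simp

lemma lin_neg: "linear_on V W g ==> x : car V ==> g (\<ominus>\<^bsub>V\<^esub> x) = -[W] g x"
 using linear_onD(3)[of V W g x "-1"] linear_onD(1)[of V W g x] by (simp add: V.smult_m1 W.smult_m1)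

lemma lin_minus: "linear_on V W g ==> x : car V ==> y : car V ==> g (x -[V] y) = g x -[W] g y"
 using linear_onD(2)[of V W g x "-[V] y"] lin_neg by (simp add: a_minus_def)

lemma lin_finsum:
 assumes "linear_on V W g" "finite F" "!!p. p : F ==> f p : car V"
 shows "g (\<Oplus>\<^bsub>V\<^esub>p\<in>F. f p) = (\<Oplus>\<^bsub>W\<^esub>p\<in>F. g (f p))"
 using assms(2,3)
proof (induction F rule: finite_induct)
 case (insert q F)
 have c: "finsum V f F : car V" using insert by (intro V.M.finsum_closed) auto
 have "g (\<Oplus>\<^bsub>V\<^esub>p\<in>insert q F. f p) = g (f q +[V] finsum V f F)"
 using insert by (subst V.M.finsum_insert) auto
 also have "... = g (f q) +[W] (\<Oplus>\<^bsub>W\<^esub>p\<in>F. g (f p))"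
 using linear_onD(2)[OF assms(1) _ c] insert by simp
 also have "... = (\<Oplus>\<^bsub>W\<^esub>p\<in>insert q F. g (f p))"
 using insert linear_onD(1)[OF assms(1)] by (subst W.M.finsum_insert) auto
 finally show ?case .
qed (simp add: lin_zero assms(1))

lemma lin_sc: "linear_on V W g ==> D <= car V ==> x : V.sc e D ==> g x : W.sc e (g ` D)"
 unfolding V.sc_def W.sc_def using linear_onD(3)[of V W g] by (auto simp: subset_iff)

text \<open>A bounded linear map carries the measuring disk into a small set, and hence into a small
  disk that measures the image.\<close>

lemma has_bsum_map:
 assumes V: "convex_bornology V" and W: "convex_bornology W" and g: "bdd_linear V W g"
 and f: "f ` P <= car V" and x: "V.has_bsum P f c x"
 shows "W.has_bsum P (%p. g (f p)) c (g x)"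
proof -
 interpret bV: convex_bornology V by fact
 interpret bW: convex_bornology W by fact
 have l: "linear_on V W g" using g bdd_linearD by blast
 obtain D where D: "D : small V" "cdisk V D" and lim: "ALL e>0. EX F0. V.tail_sums P f c x D e F0"
 using x unfolding V.has_bsum_def by blast
 interpret D: cdisk V D by fact
 obtain E where E: "E : small W" "cdisk W E" "g ` D <= E" using bW.small_disk[OF bdd_linearD(5)[OF g D(1)]] by blast
 have xc: "x : car V" using x V.has_bsum_carrier by blast
 show ?thesis
 proof (rule W.has_bsumI[OF _ E(1,2)])
 fix e :: real assume e: "e > 0"
 obtain F0 where F0: "V.tail_sums P f c x D e F0" using lim e by blast
 have "W.tail_sums P (%p. g (f p)) c (g x) E e F0"
 proof (rule W.tail_sumsI[OF V.tail_sums_fin[OF F0]])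
 fix F assume F: "finite F" "F0 <= F" "F <= P"
 have fc: "p : F ==> f p : car V" for p using F(3) f by blast
 have "g (x -[V] (\<Oplus>\<^bsub>V\<^esub>p\<in>F. c p .[V] f p)) : W.sc e (g ` D)"
 by (rule lin_sc[OF l _ V.tail_sumsD[OF F0 F]]) (use D.D_carrier in blast)
 moreover have "g (x -[V] (\<Oplus>\<^bsub>V\<^esub>p\<in>F. c p .[V] f p)) = g x -[W] (\<Oplus>\<^bsub>W\<^esub>p\<in>F. g (c p .[V] f p))"
 using lin_minus[OF l xc V.bsum_closed[OF f F(3)]] lin_finsum[OF l F(1), of "%p. c p .[V] f p"] fc by simp
 moreover have "(\<Oplus>\<^bsub>W\<^esub>p\<in>F. g (c p .[V] f p)) = (\<Oplus>\<^bsub>W\<^esub>p\<in>F. c p .[W] g (f p))"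
 using fc linear_onD(1,3)[OF l] by (intro W.M.finsum_cong') auto
 ultimately show "g x -[W] (\<Oplus>\<^bsub>W\<^esub>p\<in>F. c p .[W] g (f p)) : W.sc e E"
 using E(3) unfolding W.sc_def by auto
 qed
 thus "EX F0. W.tail_sums P (%p. g (f p)) c (g x) E e F0" by blast
 qed (use linear_onD(1)[OF l xc] in simp)
qed

end

lemma bdd_linear_zero:
 assumes "cvs V" "convex_bornology W" shows "bdd_linear V W (%x. \<zero>[W])"
proof -
 interpret W: convex_bornology W by fact
 show ?thesis
 by (rule bdd_linearI) (use W.small_point[OF W.M.zero_closed] W.small_empty in "auto simp: image_constant_conv")
qed

lemma bdd_linear_add:
 assumes V: "cvs V" "small V <= Pow (car V)" and W: "convex_bornology W" and g: "bdd_linear V W g" "bdd_linear V W h"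
 shows "bdd_linear V W (%x. g x +[W] h x)"
proof -
 interpret V: cvs V by fact
 interpret W: convex_bornology W by fact
 note G = bdd_linearD[OF g(1)] and H = bdd_linearD[OF g(2)]
 show ?thesis
 proof (rule bdd_linearI)
 fix S assume S: "S : small V"
 have "(%x. g x +[W] h x) ` S <= g ` S <+>\<^bsub>W\<^esub> h ` S"
 unfolding set_add_def' by blast
 thus "(%x. g x +[W] h x) ` S : small W"
 using W.small_subset[OF W.small_sum[OF G(5)[OF S] H(5)[OF S]]] by blast
 next
 fix x y assume "x : car V" "y : car V"
 thus "g (x +[V] y) +[W] h (x +[V] y) = g x +[W] h x +[W] (g y +[W] h y)"
 using G H by (simp add: W.M.a_ac)
 qed (use G H W.smult_radd in simp_all)
qed

lemma bdd_linear_smult: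
 assumes V: "cvs V" and W: "convex_bornology W" and g: "bdd_linear V W g"
 shows "bdd_linear V W (%x. a .[W] g x)"
proof -
 interpret V: cvs V by fact
 interpret W: convex_bornology W by fact
 note G = bdd_linearD[OF g(1)]
 show ?thesis
 proof (rule bdd_linearI)
 fix S assume S: "S : small V"
 have "(%x. a .[W] g x) ` S = (%x. a .[W] x) ` (g ` S)" by auto
 thus "(%x. a .[W] g x) ` S : small W" using W.small_scale[OF G(5)[OF S]] by simp
 qed (use G W.smult_radd W.smult_smult in "simp_all add: mult.commute")
qed

lemma bdd_linear_minus:
 assumes V: "cvs V" "small V <= Pow (car V)" and W: "convex_bornology W" and g: "bdd_linear V W g" "bdd_linear V W h"
 shows "bdd_linear V W (%x. g x -[W] h x)"
proof -
 interpret W: convex_bornology W by fact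
 have "bdd_linear V W (%x. g x +[W] ((-1) .[W] h x))"
 by (rule bdd_linear_add[OF V W g(1) bdd_linear_smult[OF V(1) W g(2)]])
 moreover have "g x -[W] h x = g x +[W] ((-1) .[W] h x)" if "x : car V" for x
 using bdd_linearD(2)[OF g(2) that] by (simp add: W.smult_m1 a_minus_def)
 moreover interpret V: cvs V by fact
 have "(%x. g x -[W] h x) ` S = (%x. g x +[W] ((-1) .[W] h x)) ` S" if "S : small V" for S
 using V(2) that calculation(2) by (intro image_cong) auto
 ultimately show ?thesis unfolding bdd_linear_def linear_on_def by (simp add: Pi_iff)
qed

lemma bdd_linear_comp: "bdd_linear V W g ==> bdd_linear W X h ==> bdd_linear V X (%x. h (g x))"
 by (auto simp: bdd_linear_def linear_on_def Pi_iff) (metis image_image)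

lemma bdd_linear_id: "bdd_linear V V (%x. x)"
 by (auto simp: bdd_linear_def linear_on_def)

text \<open>Off the carrier of \<open>V\<close> the value \<open>g p x\<close> may lie outside the
  carrier of \<open>W\<close>, where finite sums cannot be expanded; the default value zero keeps
  the sum meaningful for every \<open>x\<close>.\<close>

lemma bdd_linear_finsum:
 assumes V: "cvs V" "small V <= Pow (car V)" and W: "convex_bornology W"
 and "finite F" "!!p. p : F ==> bdd_linear V W (g p)"
 shows "bdd_linear V W (%x. \<Oplus>\<^bsub>W\<^esub>p\<in>F. if x : car V then g p x else \<zero>[W])"
 using assms(4,5)
proof (induction F rule: finite_induct)
 interpret W: convex_bornology W by fact
 case empty
 thus ?case using bdd_linear_zero[OF V(1) W] by simp
next
 interpret W: convex_bornology W by fact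
 interpret V: cvs V by fact
 case (insert q F)
 have e: "(\<Oplus>\<^bsub>W\<^esub>p\<in>insert q F. if x : car V then g p x else \<zero>[W])
      = (if x : car V then g q x else \<zero>[W]) +[W] (\<Oplus>\<^bsub>W\<^esub>p\<in>F. if x : car V then g p x else \<zero>[W])" for x
 by (rule W.M.finsum_insert) (use insert bdd_linearD(2)[of V W] in auto)
 have q: "bdd_linear V W (%x. if x : car V then g q x else \<zero>[W])"
 proof -
 have "(%x. if x : car V then g q x else \<zero>[W]) ` S = g q ` S" if "S : small V" for S
 using V(2) that by (intro image_cong) auto
 thus ?thesis using bdd_linearD[OF insert.prems, of q] by (intro bdd_linearI) auto
 qed
 show ?case unfolding e by (rule bdd_linear_add[OF V W q insert.IH]) (use insert in auto)
qed

context presentation begin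

lemma P_carrier_small: "small V <= Pow (car V)"
 using small_subset_carrier by blast

lemma bdd_linear_bsum:
 assumes "convex_bornology X" "bdd_linear V X g" "c : ell1 B"
 shows "cvs.has_bsum X (\<Union>B) (%p. g (gen p)) c (g (kp c))"
proof -
 interpret X: convex_bornology X by fact
 interpret cvs_pair V X by unfold_locales
 show ?thesis by (rule has_bsum_map[OF born assms(1,2) _ kp_has_bsum[OF assms(3)]]) (use gen_carrier in blast)
qed

text \<open>Both values are sums of one and the same family of images of generators.\<close>

lemma extension_unique:
 assumes "complete_bvs X" "bdd_linear V X g" "bdd_linear V X h" "!!p. p : \<Union>B ==> g (gen p) = h (gen p)"
 and x: "x : car V"
 shows "g x = h x"
proof -
 interpret X: complete_bvs X by fact
 obtain c where c: "c : ell1 B" "x = kp c" using x kp_onto by blast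
 have gc: "(%p. g (gen p)) ` \<Union>B <= car X" using bdd_linearD(2)[OF assms(2)] gen_carrier by blast
 have "X.has_bsum (\<Union>B) (%p. h (gen p)) c (h x)" 
 using bdd_linear_bsum[OF X.born assms(3) c(1)] c(2) by simp
 hence "X.has_bsum (\<Union>B) (%p. g (gen p)) c (h x)"
 proof -
 assume a: "X.has_bsum (\<Union>B) (%p. h (gen p)) c (h x)"
 have hc: "(%p. h (gen p)) ` \<Union>B <= car X" using bdd_linearD(2)[OF assms(3)] gen_carrier by blast
 have "(\<Oplus>\<^bsub>X\<^esub>p\<in>F. c p .[X] h (gen p)) = (\<Oplus>\<^bsub>X\<^esub>p\<in>F. c p .[X] g (gen p))" if "F <= \<Union>B" for F
 using that assms(4) gc by (intro X.M.finsum_cong') (auto simp: subset_iff image_subset_iff)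
 hence "X.tail_sums (\<Union>B) (%p. h (gen p)) c = X.tail_sums (\<Union>B) (%p. g (gen p)) c"
 by (intro ext) (simp add: X.tail_sums_def cong: conj_cong)
 thus ?thesis using a unfolding X.has_bsum_def by simp
 qed
 moreover have "X.has_bsum (\<Union>B) (%p. g (gen p)) c (g x)"
 using bdd_linear_bsum[OF X.born assms(2) c(1)] c(2) by simp
 ultimately show ?thesis using X.has_bsum_unique gc by blast
qed

lemma ball_bound:
 assumes "complete_bvs X" "bdd_linear V X h" "S : B" "c : l1ball S r"
 "D : small X" "ccdisk X D" "!!p. p : S ==> h (gen p) : cvs.sc X s D" "0 < s" "0 < r"
 shows "h (kp c) : cvs.sc X (2 * r * s) D"
proof -
 interpret X: complete_bvs X by fact
 have gc: "(%p. h (gen p)) ` \<Union>B <= car X" using bdd_linearD(2)[OF assms(2)] gen_carrier by blast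
 show ?thesis
 by (rule X.has_bsum_bound[OF assms(4) _ gc assms(5,6) _ assms(8,9)
 bdd_linear_bsum[OF X.born assms(2) ell1_ball[OF assms(3,4)]]])
 (use assms(3,7) in auto)
qed

text \<open>\<open>f\<close> is extended to ell^1 by summation. The kernel of this extension is
  closed, because a family close to the kernel within one \<open>S\<close> has a small sum; it
  contains the relations and therefore their closure.\<close>

lemma extension:
 assumes X: "complete_bvs X" and fb: "!!S. S : B ==> f ` S : small X"
 and fr: "!!r. r : Rel ==> pmsum X f r = \<zero>[X]"
 shows "EX g. bdd_linear V X g & (ALL p:\<Union>B. g (gen p) = f p)"
proof -
 interpret X: complete_bvs X by fact
 let ?P = "\<Union>B"
 have fP: "f ` ?P <= car X" using fb X.small_subset_carrier by blast
 define E where "E c = (THE x. X.has_bsum ?P f c x)" for c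
 have ex: "EX x. X.has_bsum ?P f c x" if "c : ell1 B" for c
 using that X.has_bsum_exists[OF _ _ fP fb] unfolding ell1_def by blast
 have Eq: "E c = x" if "X.has_bsum ?P f c x" for c x
 unfolding E_def by (rule the_equality[of _ x]) (use that X.has_bsum_unique[OF _ _ fP] in blast)+
 have E: "X.has_bsum ?P f c (E c)" if "c : ell1 B" for c
 using ex[OF that] Eq by blast
 have Ec: "E c : car X" if "c : ell1 B" for c using E[OF that] X.has_bsum_carrier by blast
 have E_add: "E (c + d) = E c +[X] E d" if "c : ell1 B" "d : ell1 B" for c d
 using Eq[OF X.has_bsum_add[OF E[OF that(1)] E[OF that(2)] fP]] by (simp add: plus_fun_def)
 have E_scale: "E (%p. a * c p) = a .[X] E c" if "c : ell1 B" for a c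
 using Eq[OF X.has_bsum_smult[OF E[OF that] fP]] .
 have E_fin: "E c = (\<Oplus>\<^bsub>X\<^esub>p\<in>A. c p .[X] f p)" if "finite A" "A <= ?P" "!!p. p \<notin> A ==> c p = 0" for c A
 by (rule Eq[OF X.has_bsum_finite[OF that(1,2) fP]]) (use that(3) in simp)
 have E_bound: "E c : X.sc (2 * r * s) D" if "S : B" "c : l1ball S r" "D : small X" "ccdisk X D" "f ` S <= X.sc s D" "0 < s" "0 < r"
 for S c r D s
 by (rule X.has_bsum_bound[OF that(2) _ fP that(3-7) E[OF ell1_ball[OF that(1,2)]]]) (use that(1) in blast)
 let ?M = "{c : ell1 B. E c = \<zero>[X]}"
 have E0: "E 0 = \<zero>[X]" using E_fin[of "{}" 0] by simp
 have M: "closed_sub B ?M"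
 unfolding closed_sub_def
 proof (intro conjI ballI allI impI)
 fix c S assume c: "c : ell1 B" and S: "S : B" and ap: "ALL e>0. EX m:?M. c - m : l1ball S e"
 obtain D where D: "D : small X" "ccdisk X D" "f ` S <= D" using X.small_ccdisk[OF fb[OF S]] by blast
 interpret D: ccdisk X D by fact
 have "E c : X.sc e D" if e: "e > 0" for e
 proof -
 obtain m where m: "m : ell1 B" "E m = \<zero>[X]" "c - m : l1ball S (e/2)"
 using ap[rule_format, of "e/2"] e by auto
 have "E c = E (c - m) +[X] E m" using E_add[OF ell1_diff[OF c m(1)] m(1)] by simp
 also have "... = E (c - m)" using m(2) Ec[OF ell1_diff[OF c m(1)]] by simp
 finally show ?thesis using E_bound[OF S m(3) D(1,2), of 1] D(3) e by simp
 qed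
 hence "E c = \<zero>[X]" using D.definite Ec[OF c] by blast
 thus "c : ?M" using c by simp
 qed (use E0 ell1_zero ell1_add ell1_scale E_add E_scale in auto)
 have "coef ` Rel <= ?M"
 proof clarify
 fix r assume r: "r : Rel"
 have "E (coef r) = pmsum X f r"
 unfolding pmsum_def by (rule E_fin) (use Rel_keys[OF r] in "auto simp: in_keys_iff")
 thus "coef r : ell1 B & E (coef r) = \<zero>[X]"
 using fr[OF r] lookup_ell1[OF Rel_keys[OF r]] by simp
 qed
 with M have NM: "closed_rel B Rel <= ?M" unfolding closed_rel_def by blast
 define g where "g x = E (SOME c. c : ell1 B & kp c = x)" for x
 have gkp: "g (kp c) = E c" if c: "c : ell1 B" for c
 proof -
 let ?d = "SOME d. d : ell1 B & kp d = kp c"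
 have d: "?d : ell1 B & kp ?d = kp c" by (rule someI[of _ c]) (use c in simp)
 hence "?d - c : closed_rel B Rel" using kp_eq_iff c by blast
 hence z: "?d - c : ell1 B" "E (?d - c) = \<zero>[X]" using NM by auto
 have "E ?d = E (?d - c) +[X] E c" using E_add[OF z(1) c] by simp
 thus ?thesis using z(2) Ec[OF c] by (simp add: g_def)
 qed
 have rep: "EX c:ell1 B. x = kp c" if "x : car V" for x using that kp_onto by blast
 have "bdd_linear V X g"
 proof (rule bdd_linearI)
 fix x assume "x : car V"
 then obtain c where c: "c : ell1 B" "x = kp c" using rep by blast
 thus "g x : car X" using gkp Ec by simp
 show "g (a \<odot> x) = a .[X] g x" for a
 using gkp[OF ell1_scale[OF c(1)], of a] kp_scale[OF c(1)] E_scale[OF c(1)] gkp[OF c(1)] c(2) by simp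
 fix y assume "y : car V"
 then obtain d where d: "d : ell1 B" "y = kp d" using rep by blast
 show "g (x \<oplus> y) = g x +[X] g y"
 using gkp[OF ell1_add[OF c(1) d(1)]] kp_add[OF c(1) d(1)] E_add[OF c(1) d(1)] gkp[OF c(1)] gkp[OF d(1)] c(2) d(2) by simp
 next
 fix Y assume "Y : small V"
 then obtain S r where Sr: "S : B" "Y <= kp ` l1ball S r" unfolding small_eq by blast
 obtain D where D: "D : small X" "ccdisk X D" "f ` S <= D" using X.small_ccdisk[OF fb[OF Sr(1)]] by blast
 interpret D: ccdisk X D by fact
 have "g ` Y <= X.sc (2 * max r 1 * 1) D"
 proof
 fix z assume "z : g ` Y"
 then obtain c where c: "c : l1ball S r" "z = g (kp c)" using Sr(2) by blast
 have "c : l1ball S (max r 1)" using c(1) by (rule l1ball_mono) auto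
 hence "E c : X.sc (2 * max r 1 * 1) D"
 by (rule E_bound[OF Sr(1) _ D(1,2)]) (use D(3) in auto)
 thus "z : X.sc (2 * max r 1 * 1) D" using c(2) gkp[OF ell1_ball[OF Sr(1) c(1)]] by simp
 qed
 thus "g ` Y : small X" using X.small_subset[OF X.small_sc[OF D(1)]] by blast
 qed
 moreover have "g (gen p) = f p" if p: "p : ?P" for p
 proof -
 have "g (gen p) = E (delta p)" unfolding gen_def using gkp[OF delta_ell1[OF p]] .
 also have "... = (\<Oplus>\<^bsub>X\<^esub>q\<in>{p}. delta p q .[X] f q)" by (rule E_fin) (use p in "auto simp: delta_def")
 also have "... = f p"
 proof -
 have "f p : car X" using fP p by blast
 thus ?thesis by (simp add: delta_def)
 qed
 finally show ?thesis .
 qed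
 ultimately show ?thesis by blast
qed

end

locale presentation2 = A: presentation B V Rel kp + A': presentation B' V' Rel' kp'
 for B :: "'p set set" and V :: "'a bvs" and Rel kp and B' :: "'q set set" and V' :: "'b bvs" and Rel' kp'
begin

text \<open>One variable at a time: each generator \<open>p\<close> first gets a map
  \<open>g p\<close> on \<open>V'\<close>, then \<open>p \<mapsto> g p t\<close> is extended for
  each \<open>t\<close>. Linearity of the outcome in \<open>t\<close> is an identity of bounded maps
  on \<open>V\<close>, so generators decide it; joint boundedness comes from the bounds
  \<open>gb\<close>, which are uniform in \<open>p\<close>.\<close>

lemma bilinear_extension:
 assumes X: "complete_bvs X"
 and fb: "!!S S'. S : B ==> S' : B' ==> {f p q | p q. p : S & q : S'} : small X"
 and fr: "!!q r. q : \<Union>B' ==> r : Rel ==> pmsum X (%p. f p q) r = \<zero>[X]"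
 and fr': "!!p r. p : \<Union>B ==> r : Rel' ==> pmsum X (f p) r = \<zero>[X]"
 shows "EX m. bdd_bilinear V V' X m & (ALL p:\<Union>B. ALL q:\<Union>B'. m (A.gen p) (A'.gen q) = f p q)"
proof -
 interpret X: complete_bvs X by fact
 have "EX g. bdd_linear V' X g & (ALL q:\<Union>B'. g (A'.gen q) = f p q)" if p: "p : \<Union>B" for p
 proof (rule A'.extension[OF X _ fr'[OF p]])
 fix S' assume S': "S' : B'"
 show "f p ` S' : small X"
 by (rule X.small_subset[OF fb[OF A.point[OF p] S']]) blast
 qed
 hence "ALL p:\<Union>B. EX g. bdd_linear V' X g & (ALL q:\<Union>B'. g (A'.gen q) = f p q)" by blast
 from bchoice[OF this] obtain g
 where G: "ALL p:\<Union>B. bdd_linear V' X (g p) & (ALL q:\<Union>B'. g p (A'.gen q) = f p q)" by (elim exE) (rule that)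
 have g: "bdd_linear V' X (g p)" if "p : \<Union>B" for p using G that by blast
 have gf: "g p (A'.gen q) = f p q" if "p : \<Union>B" "q : \<Union>B'" for p q using G that by blast
 have gb: "g p (kp' c) : X.sc (2 * r * 1) D"
 if "S : B" "S' : B'" "p : S" "c : l1ball S' r" "0 < r" "D : small X" "ccdisk X D" "{f p q | p q. p : S & q : S'} <= D"
 for p c r S S' D
 proof -
 interpret D: ccdisk X D by fact
 have p: "p : \<Union>B" using that by blast
 show ?thesis
 by (rule A'.ball_bound[OF X g[OF p] that(2,4,6,7) _ _ that(5)])
 (use gf[OF p] that(2,3,8) in auto)
 qed
 have "EX h. bdd_linear V X h & (ALL p:\<Union>B. h (A.gen p) = g p t)" if t: "t : car V'" for t
 proof (rule A.extension[OF X])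
 fix S assume S: "S : B"
 obtain c where c: "c : ell1 B'" "t = kp' c" using t A'.kp_onto by blast
 then obtain S' r where S': "S' : B'" "c : l1ball S' r" unfolding ell1_def by blast
 have c': "c : l1ball S' (max r 1)" using S'(2) by (rule l1ball_mono) auto
 obtain D where D: "D : small X" "ccdisk X D" "{f p q | p q. p : S & q : S'} <= D"
 using X.small_ccdisk[OF fb[OF S S'(1)]] by blast
 have "(%p. g p t) ` S <= X.sc (2 * max r 1 * 1) D"
 using gb[OF S S'(1) _ c' _ D] c(2) by auto
 thus "(%p. g p t) ` S : small X" using X.small_subset[OF X.small_sc[OF D(1)]] by blast
 next
 fix r assume r: "r : Rel"
 \<comment> \<open>For fixed \<open>r\<close> the relation to be checked is a bounded linear
   function of \<open>t\<close> that vanishes on the generators of \<open>V'\<close>, hence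
   everywhere.\<close>
 let ?L = "%t. \<Oplus>\<^bsub>X\<^esub>p\<in>supp r. if t : car V' then coef r p .[X] g p t else \<zero>[X]"
 have L: "bdd_linear V' X ?L"
 by (rule bdd_linear_finsum[OF A'.cvs_axioms A'.P_carrier_small X.born])
 (use bdd_linear_smult[OF A'.cvs_axioms X.born g] A.Rel_keys[OF r] in "simp, blast")
 have L0: "?L (A'.gen q) = \<zero>[X]" if q: "q : \<Union>B'" for q
 proof -
 have "?L (A'.gen q) = pmsum X (%p. f p q) r"
 unfolding pmsum_def
 proof (rule X.M.finsum_cong'[OF refl])
 show "(%p. coef r p .[X] f p q) : supp r \<rightarrow> car X"
 proof
 fix p assume "p : supp r"
 hence p: "p : \<Union>B" using A.Rel_keys[OF r] by blast
 have "f p q : car X"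
 using X.small_subset_carrier[OF fb[OF A.point[OF p] A'.point[OF q]]] by blast
 thus "coef r p .[X] f p q : car X" by simp
 qed
 fix p assume "p : supp r"
 hence p: "p : \<Union>B" using A.Rel_keys[OF r] by blast
 show "(if A'.gen q : car V' then coef r p .[X] g p (A'.gen q) else \<zero>[X]) = coef r p .[X] f p q"
 using gf[OF p q] A'.gen_carrier[OF q] by simp
 qed
 thus ?thesis using fr[OF q r] by simp
 qed
 have "?L t = \<zero>[X]"
 using A'.extension_unique[OF X L bdd_linear_zero[OF A'.cvs_axioms X.born] L0 t] .
 thus "pmsum X (%p. g p t) r = \<zero>[X]" using t by (simp add: pmsum_def)
 qed
 hence "ALL t:car V'. EX h. bdd_linear V X h & (ALL p:\<Union>B. h (A.gen p) = g p t)" by blast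
 from bchoice[OF this] obtain h
 where H: "ALL t:car V'. bdd_linear V X (h t) & (ALL p:\<Union>B. h t (A.gen p) = g p t)" by (elim exE) (rule that)
 have h: "bdd_linear V X (h t)" if "t : car V'" for t using H that by blast
 have hg: "h t (A.gen p) = g p t" if "t : car V'" "p : \<Union>B" for t p using H that by blast
 note cv = A.cvs_axioms A.P_carrier_small X.born
 have "bdd_bilinear V V' X (%x t. h t x)"
 unfolding bdd_bilinear_def
 proof (intro conjI ballI)
 fix t assume "t : car V'"
 thus "linear_on V X (%x. h t x)" using bdd_linearD(1)[OF h] by simp
 next
 fix x assume x: "x : car V"
 show "linear_on V' X (%t. h t x)"
 unfolding linear_on_def
 proof (intro conjI ballI allI)
 show "(%t. h t x) : car V' \<rightarrow> car X" using bdd_linearD(2)[OF h] x by auto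
 next
 fix s t assume s: "s : car V'" and t: "t : car V'"
 hence st: "s +[V'] t : car V'" by simp
 show "h (s +[V'] t) x = h s x +[X] h t x"
 by (rule A.extension_unique[OF X h[OF st] bdd_linear_add[OF cv h[OF s] h[OF t]] _ x])
 (use hg s t st bdd_linearD(3)[OF g] in simp)
 next
 fix a t assume t: "t : car V'"
 hence at: "a .[V'] t : car V'" by simp
 show "h (a .[V'] t) x = a .[X] h t x"
 by (rule A.extension_unique[OF X h[OF at] bdd_linear_smult[OF cv(1,3) h[OF t]] _ x])
 (use hg t at bdd_linearD(4)[OF g] in simp)
 qed
 next
 fix T T' assume T: "T : small V" and T': "T' : small V'"
 obtain S r where S: "S : B" "T <= kp ` l1ball S r" using T unfolding A.small_eq by blast
 obtain S' r' where S': "S' : B'" "T' <= kp' ` l1ball S' r'" using T' unfolding A'.small_eq by blast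
 obtain D where D: "D : small X" "ccdisk X D" "{f p q | p q. p : S & q : S'} <= D"
 using X.small_ccdisk[OF fb[OF S(1) S'(1)]] by blast
 have "h t x : X.sc (2 * max r 1 * (2 * max r' 1 * 1)) D" if x: "x : T" and t: "t : T'" for x t
 proof -
 obtain c where c: "c : l1ball S r" "x = kp c" using S(2) x by blast
 obtain d where d: "d : l1ball S' r'" "t = kp' d" using S'(2) t by blast
 have c1: "c : l1ball S (max r 1)" using c(1) by (rule l1ball_mono) auto
 have d1: "d : l1ball S' (max r' 1)" using d(1) by (rule l1ball_mono) auto
 have tc: "t : car V'" using t T' A'.P_carrier_small by blast
 show ?thesis unfolding c(2)
 proof (rule A.ball_bound[OF X h[OF tc] S(1) c1 D(1,2)])
 fix p assume p: "p : S"
 hence "h t (A.gen p) = g p t" using hg[OF tc] S(1) by blast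
 thus "h t (A.gen p) : X.sc (2 * max r' 1 * 1) D"
 using gb[OF S(1) S'(1) p d1 _ D] d(2) by simp
 qed auto
 qed
 hence "{h t x | x t. x : T & t : T'} <= X.sc (2 * max r 1 * (2 * max r' 1 * 1)) D" by blast
 thus "{h t x | x t. x : T & t : T'} : small X" using X.small_subset[OF X.small_sc[OF D(1)]] by blast
 qed
 moreover have "h (A'.gen q) (A.gen p) = f p q" if "p : \<Union>B" "q : \<Union>B'" for p q
 using hg[OF A'.gen_carrier[OF that(2)] that(1)] gf[OF that] by simp
 ultimately show ?thesis by (intro exI[of _ "%x t. h t x"]) blast
qed

end

text \<open>A complex number is determined by the Dedekind cuts of its real and imaginary parts,
  stored at even and odd positions. Bits are wanted because the carrier of a model consists of
  sequences in the type of generators, which offers no room for complex coefficients.\<close>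

lemma complex_code: "EX \<beta> :: complex => nat => bool. inj \<beta>"
proof -
 define \<beta> where "\<beta> z n = (if even n then of_rat (from_nat (n div 2)) < Re z else of_rat (from_nat (n div 2)) < Im z)"
 for z n
 have cut: "x = y" if "!!q::rat. of_rat q < (x::real) \<longleftrightarrow> of_rat q < y" for x y
 proof (rule ccontr)
 assume "x ~= y"
 then consider "x < y" | "y < x" by linarith
 thus False
 by cases (metis of_rat_dense less_asym that less_le_not_le)+
 qed
 have "inj \<beta>"
 proof (rule injI)
 fix z w assume e: "\<beta> z = \<beta> w"
 have "of_rat q < Re z \<longleftrightarrow> of_rat q < Re w" for q
 using fun_cong[OF e, of "2 * to_nat q"] by (simp add: \<beta>_def)
 moreover have "of_rat q < Im z \<longleftrightarrow> of_rat q < Im w" for q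
 using fun_cong[OF e, of "2 * to_nat q + 1"] by (simp add: \<beta>_def)
 ultimately show "z = w" using cut complex_eqI by blast
 qed
 thus ?thesis by blast
qed

text \<open>Even positions enumerate the support, odd positions spell out the coefficients bit by
  bit, with the distinct points \<open>a\<close> and \<open>b\<close> as bits. An empty support is
  enumerated by the constant \<open>a\<close>, where the recorded coefficient is 0.\<close>

lemma countable_support_code:
 assumes ab: "(a::'p) ~= b"
 shows "EX enc :: ('p => complex) => nat => 'p. inj_on enc {c. countable {p. c p ~= 0}}"
proof -
 obtain \<beta> :: "complex => nat => bool" where \<beta>: "inj \<beta>" using complex_code by blast
 define s where "s c = (if {p. c p ~= 0} = {} then (%n. a) else from_nat_into {p. c p ~= 0})"
 for c :: "'p => complex"
 define enc where "enc c n = (if even n then s c (n div 2)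
     else if \<beta> (c (s c (fst (prod_decode (n div 2))))) (snd (prod_decode (n div 2))) then a else b)" for c n
 have ran: "p : range (s c)" if "countable {p. c p ~= 0}" "c p ~= 0" for c p
 using that range_from_nat_into[of "{p. c p ~= 0}"] by (auto simp: s_def)
 have "inj_on enc {c. countable {p. c p ~= 0}}"
 proof (rule inj_onI)
 fix c d assume c: "c : {c. countable {p. c p ~= 0}}" and d: "d : {c. countable {p. c p ~= 0}}"
 and e: "enc c = enc d"
 have s: "s c = s d"
 proof
 fix n show "s c n = s d n" using fun_cong[OF e, of "2 * n"] by (simp add: enc_def)
 qed
 have "c (s c i) = d (s c i)" for i
 proof (rule injD[OF \<beta>], rule ext)
 fix k
 show "\<beta> (c (s c i)) k = \<beta> (d (s c i)) k"
 using fun_cong[OF e, of "2 * prod_encode (i, k) + 1"] ab s by (simp add: enc_def split: if_splits)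
 qed
 hence "c p = d p" if "p : range (s c)" for p using that by auto
 moreover have "c p = 0" "d p = 0" if "p \<notin> range (s c)" for p
 using that ran[of c p] ran[of d p] c d s by auto
 ultimately show "c = d" by (metis ext)
 qed
 thus ?thesis by blast
qed

context bornology_set begin

text \<open>Each class modulo the closed relations is represented by one chosen family, which is
  then encoded. A type with a single element offers no bits, so there the quotient has to be
  zero.\<close>

lemma ell1_quotient_code:
 assumes Rel: "!!r. r : Rel ==> supp r <= \<Union>B"
 and nt: "(EX a b::'p. a ~= b) \<or> ell1 B <= closed_rel B Rel"
 shows "EX kp :: ('p => complex) => nat => 'p. ALL c:ell1 B. ALL d:ell1 B. kp c = kp d \<longleftrightarrow> c - d : closed_rel B Rel"
 using nt
proof
 assume "ell1 B <= closed_rel B Rel"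
 thus ?thesis using ell1_diff by (intro exI[of _ "%c n. undefined"]) blast
next
 assume "EX a b::'p. a ~= b"
 then obtain a b :: 'p where ab: "a ~= b" by blast
 from countable_support_code[OF this]
 obtain enc :: "('p => complex) => nat => 'p" where enc: "inj_on enc {c. countable {p. c p ~= 0}}"
 by (elim exE) (rule that)
 let ?N = "closed_rel B Rel"
 have N: "closed_sub B ?N" using closed_sub_closed_rel[OF Rel] .
 have N0: "0 : ?N" and Nadd: "!!c d. c : ?N ==> d : ?N ==> c + d : ?N"
 and Nsc: "!!a c. c : ?N ==> (%p. a * c p) : ?N"
 using N unfolding closed_sub_def by blast+
 have Nneg: "- c : ?N" if "c : ?N" for c using Nsc[OF that, of "-1"] by (simp add: fun_Compl_def)
 have sym: "d - c : ?N" if "c - d : ?N" for c d using Nneg[OF that] by simp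
 have trans: "c - e : ?N" if "c - d : ?N" "d - e : ?N" for c d e using Nadd[OF that] by simp
 define rep where "rep c = (SOME d. d : ell1 B & c - d : ?N)" for c
 have rep: "rep c : ell1 B & c - rep c : ?N" if "c : ell1 B" for c
 unfolding rep_def by (rule someI[of _ c]) (use that N0 in "simp add: zero_fun_def")
 have cnt: "c : {c. countable {p. c p ~= 0}}" if "c : ell1 B" for c
 using that l1ball_countable unfolding ell1_def by blast
 show ?thesis
 proof (intro exI[of _ "%c. enc (rep c)"] ballI iffI)
 fix c d assume c: "c : ell1 B" and d: "d : ell1 B"
 show "c - d : ?N" if "enc (rep c) = enc (rep d)"
 proof -
 have "rep c : {c. countable {p. c p ~= 0}}" "rep d : {c. countable {p. c p ~= 0}}" using cnt rep c d by blast+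
 hence "rep c = rep d" using enc that unfolding inj_on_def by blast
 thus ?thesis using trans[of c "rep c" d] sym[of d "rep d"] rep[OF c] rep[OF d] by simp
 qed
 show "enc (rep c) = enc (rep d)" if cd: "c - d : ?N"
 proof -
 have "(c - e : ?N) = (d - e : ?N)" for e using trans cd sym[OF cd] by blast
 thus ?thesis by (simp add: rep_def)
 qed
 qed
qed

text \<open>The operations on codes are those of chosen representatives; every vector space identity
  is inherited from ell^1.\<close>

lemma presentation_exists:
 assumes Rel: "!!r. r : Rel ==> supp r <= \<Union>B"
 and nt: "(EX a b::'p. a ~= b) \<or> ell1 B <= closed_rel B Rel"
 shows "EX (V :: (nat => 'p) bvs) kp. presentation B V Rel kp"
proof -
 let ?N = "closed_rel B Rel"
 obtain kp :: "('p => complex) => nat => 'p" where kp: "ALL c:ell1 B. ALL d:ell1 B. kp c = kp d \<longleftrightarrow> c - d : ?N"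
 using ell1_quotient_code[OF Rel nt] by blast
 have N: "closed_sub B ?N" using closed_sub_closed_rel[OF Rel] .
 have Nadd: "!!c d. c : ?N ==> d : ?N ==> c + d : ?N"
 and Nsc: "!!a c. c : ?N ==> (%p. a * c p) : ?N"
 using N unfolding closed_sub_def by blast+
 define rp where "rp x = (SOME c. c : ell1 B & kp c = x)" for x
 have rp: "rp (kp c) : ell1 B" "kp (rp (kp c)) = kp c" if "c : ell1 B" for c
 using someI[of "%d. d : ell1 B & kp d = kp c" c] that unfolding rp_def by blast+
 have rpN: "rp (kp c) - c : ?N" if "c : ell1 B" for c using rp[OF that] kp that by blast
 define V :: "(nat => 'p) bvs" where "V = \<lparr>carrier = kp ` ell1 B, monoid.mult = undefined, one = undefined,
     zero = kp 0, add = (%x y. kp (rp x + rp y)), smult = (%a x. kp (%p. a * rp x p)),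
     small = {Y. EX S:B. EX r. Y <= kp ` l1ball S r}\<rparr>"
 have add: "add V (kp c) (kp d) = kp (c + d)" if "c : ell1 B" "d : ell1 B" for c d
 proof -
 have "(rp (kp c) + rp (kp d)) - (c + d) = (rp (kp c) - c) + (rp (kp d) - d)" by simp
 hence "(rp (kp c) + rp (kp d)) - (c + d) : ?N" using Nadd[OF rpN[OF that(1)] rpN[OF that(2)]] by metis
 hence "kp (rp (kp c) + rp (kp d)) = kp (c + d)"
 using kp ell1_add[OF rp(1)[OF that(1)] rp(1)[OF that(2)]] ell1_add[OF that] by blast
 thus ?thesis by (simp add: V_def)
 qed
 have smult: "smult V a (kp c) = kp (%p. a * c p)" if "c : ell1 B" for a c
 proof -
 have "(%p. a * rp (kp c) p) - (%p. a * c p) = (%p. a * (rp (kp c) - c) p)" by (auto simp: algebra_simps fun_diff_def)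
 hence "(%p. a * rp (kp c) p) - (%p. a * c p) : ?N" using Nsc[OF rpN[OF that]] by metis
 hence "kp (%p. a * rp (kp c) p) = kp (%p. a * c p)"
 using kp ell1_scale[OF rp(1)[OF that]] ell1_scale[OF that] by blast
 thus ?thesis by (simp add: V_def)
 qed
 have carr: "car V = kp ` ell1 B" and zero: "zero V = kp 0" by (simp_all add: V_def)
 have ab: "abelian_group V"
 proof (rule abelian_groupI)
 show "\<zero>[V] : car V" using ell1_zero carr zero by auto
 next
 fix x y z assume "x : car V" "y : car V" "z : car V"
 then obtain c d e where x: "c : ell1 B" "x = kp c" "d : ell1 B" "y = kp d" "e : ell1 B" "z = kp e"
 unfolding carr by blast
 show "x +[V] y +[V] z = x +[V] (y +[V] z)"
 using x ell1_add by (simp add: add add.assoc del: plus_fun_apply)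
 next
 fix x y assume "x : car V" "y : car V"
 then obtain c d where x: "c : ell1 B" "x = kp c" "d : ell1 B" "y = kp d" unfolding carr by blast
 show "x +[V] y = y +[V] x" using x by (simp add: add add.commute)
 show "x +[V] y : car V" using x ell1_add carr by (auto simp: add)
 show "\<zero>[V] +[V] x = x" using x ell1_zero by (simp add: add zero)
 have mc: "(%p. -1 * c p) : ell1 B" by (rule ell1_scale[OF x(1)])
 moreover have "(%p. -1 * c p) + c = 0" by (auto simp: fun_eq_iff)
 ultimately show "EX y:car V. y +[V] x = \<zero>[V]"
 using x add[OF mc x(1)] zero carr by (intro bexI[of _ "kp (%p. -1 * c p)"]) auto
 qed
 have "Module.module complex_ring V"
 proof (rule moduleI[OF cring_complex_ring ab])
 fix a b :: complex and x assume "x : car V"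
 then obtain c where x: "c : ell1 B" "x = kp c" unfolding carr by blast
 note sc = ell1_scale[OF x(1)]
 show "a .[V] x : car V" using x sc carr by (auto simp: smult)
 show "(a +[complex_ring] b) .[V] x = a .[V] x +[V] b .[V] x"
 using x sc by (simp add: smult add plus_fun_def algebra_simps)
 show "(a *[complex_ring] b) .[V] x = a .[V] (b .[V] x)"
 using x sc by (simp add: smult mult.assoc)
 show "\<one>\<^bsub>complex_ring\<^esub> .[V] x = x" using x by (simp add: smult)
 fix y assume "y : car V"
 then obtain d where y: "d : ell1 B" "y = kp d" unfolding carr by blast
 show "a .[V] (x +[V] y) = a .[V] x +[V] a .[V] y"
 proof -
 have "(%p. a * (c + d) p) = (%p. a * c p) + (%p. a * d p)" by (auto simp: algebra_simps)
 thus ?thesis using x y add[OF x(1) y(1)] smult[OF ell1_add[OF x(1) y(1)], of a] smult[OF x(1), of a]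
 smult[OF y(1), of a] add[OF ell1_scale[OF x(1), of a] ell1_scale[OF y(1), of a]] by simp
 qed
 qed
 hence "presentation B V Rel kp"
 unfolding presentation_def presentation_axioms_def cvs_def
 proof (intro conjI allI impI)
 show "bornology_set B" by (rule bornology_set_axioms)
 show "kp c = \<zero>[V] \<longleftrightarrow> c : ?N" if "c : ell1 B" for c
 using kp that ell1_zero zero by (metis diff_zero)
 qed (use Rel carr add smult in "auto simp: V_def")
 thus ?thesis by blast
qed

end

text \<open>The object selected by choice is only isomorphic to the constructed one; this moves the
  presentation along the isomorphism.\<close>

lemma presentation_transport:
 assumes "presentation B C Rel kp" "complete_bvs C'" "bdd_linear C C' u" "bdd_linear C' C w"
 "!!x. x : car C ==> w (u x) = x" "!!x. x : car C' ==> u (w x) = x"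
 shows "presentation B C' Rel (%c. u (kp c))"
proof -
 interpret presentation B C Rel kp by fact
 interpret C': complete_bvs C' by fact
 note u = bdd_linearD[OF assms(3)] and w = bdd_linearD[OF assms(4)]
 interpret cvs_pair C C' by unfold_locales
 show ?thesis
 proof unfold_locales
 show "(%c. u (kp c)) ` ell1 B = car C'"
 proof
 show "car C' <= (%c. u (kp c)) ` ell1 B"
 proof
 fix x assume x: "x : car C'"
 then obtain c where "c : ell1 B" "w x = kp c" using w(2)[OF x] kp_onto by blast
 thus "x : (%c. u (kp c)) ` ell1 B" using assms(6)[OF x] by (metis imageI)
 qed
 qed (use u(2) kp_carrier in blast)
 show "u (kp (c + d)) = u (kp c) +[C'] u (kp d)" if "c : ell1 B" "d : ell1 B" for c d
 using that u(3) kp_add kp_carrier by simp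
 show "u (kp (%p. a * c p)) = a .[C'] u (kp c)" if "c : ell1 B" for a c
 using that u(4) kp_scale kp_carrier by simp
 show "(u (kp c) = \<zero>[C']) = (c : closed_rel B Rel)" if "c : ell1 B" for c
 using kp_zero_iff[OF that] lin_zero[OF u(1)] assms(5)[OF kp_carrier[OF that]] assms(5)[OF M.zero_closed] by metis
 show "small C' = {Y. EX S:B. EX r. Y <= (%c. u (kp c)) ` l1ball S r}"
 proof (rule equalityI; rule subsetI)
 fix Y assume Y: "Y : small C'"
 then obtain S r where S: "S : B" "w ` Y <= kp ` l1ball S r" using w(5)[OF Y] unfolding small_eq by blast
 have "Y <= (%c. u (kp c)) ` l1ball S r"
 proof
 fix y assume y: "y : Y"
 then obtain c where "c : l1ball S r" "w y = kp c" using S(2) by blast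
 thus "y : (%c. u (kp c)) ` l1ball S r"
 using assms(6) y C'.small_subset_carrier[OF Y] by (metis imageI subsetD)
 qed
 thus "Y : {Y. EX S:B. EX r. Y <= (%c. u (kp c)) ` l1ball S r}" using S(1) by blast
 next
 fix Y assume "Y : {Y. EX S:B. EX r. Y <= (%c. u (kp c)) ` l1ball S r}"
 then obtain S r where S: "S : B" "Y <= (%c. u (kp c)) ` l1ball S r" by blast
 have "u ` (kp ` l1ball S r) : small C'" using u(5) small_ball[OF S(1)] by blast
 thus "Y : small C'" using C'.small_subset S(2) by (simp add: image_image)
 qed
 qed (use Rel_keys in blast)
qed

section \<open>Evaluation of formal linear combinations\<close>

lemma lookup_pm_scale [simp]: "coef (pm_scale c f) k = c * coef f k"
 unfolding pm_scale_def by (simp add: map.rep_eq when_def)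

lemma keys_pm_scale: "supp (pm_scale c f) <= supp f"
 by (auto simp: in_keys_iff)

context cvs begin

lemma pmsum_superset:
 assumes "finite A" "supp r <= A" "!!p. p : A ==> f p : car V"
 shows "pmsum V f r = (\<Oplus>p\<in>A. coef r p \<odot> f p)"
 unfolding pmsum_def
proof (rule M.add.finprod_mono_neutral_cong_left[OF assms(1,2)])
 fix i assume "i : A - supp r"
 thus "coef r i \<odot> f i = \<zero>" using assms(3) by (simp add: in_keys_iff)
qed (use assms(3) in auto)

lemma pmsum_closed: "(!!p. p : supp r ==> f p : car V) ==> pmsum V f r : car V"
 unfolding pmsum_def by (rule M.finsum_closed) simp

lemma pmsum_add:
 assumes "!!p. p : supp r Un supp s ==> f p : car V"
 shows "pmsum V f (r + s) = pmsum V f r \<oplus> pmsum V f s"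
proof -
 let ?A = "supp r Un supp s"
 have A: "finite ?A" by simp
 have "pmsum V f (r + s) = (\<Oplus>p\<in>?A. coef (r + s) p \<odot> f p)"
 by (rule pmsum_superset[OF A Poly_Mapping.keys_add assms])
 also have "... = (\<Oplus>p\<in>?A. coef r p \<odot> f p \<oplus> coef s p \<odot> f p)"
 using assms by (intro M.finsum_cong') (auto simp: lookup_add smult_ladd)
 also have "... = (\<Oplus>p\<in>?A. coef r p \<odot> f p) \<oplus> (\<Oplus>p\<in>?A. coef s p \<odot> f p)"
 using assms by (intro M.finsum_addf) auto
 also have "... = pmsum V f r \<oplus> pmsum V f s"
 using pmsum_superset[OF A _ assms, of r] pmsum_superset[OF A _ assms, of s] by simp
 finally show ?thesis .
qed

lemma pmsum_scale:
 assumes "!!p. p : supp r ==> f p : car V"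
 shows "pmsum V f (pm_scale a r) = a \<odot> pmsum V f r"
proof -
 have "pmsum V f (pm_scale a r) = (\<Oplus>p\<in>supp r. coef (pm_scale a r) p \<odot> f p)"
 by (rule pmsum_superset[OF _ keys_pm_scale assms]) simp
 also have "... = (\<Oplus>p\<in>supp r. a \<odot> (coef r p \<odot> f p))"
 using assms by (intro M.finsum_cong') (auto simp: smult_smult)
 also have "... = a \<odot> pmsum V f r"
 unfolding pmsum_def using assms by (intro finsum_smult[symmetric]) auto
 finally show ?thesis .
qed

lemma pmsum_single: "f p : car V ==> pmsum V f (Poly_Mapping.single p c) = c \<odot> f p"
 using pmsum_superset[of "{p}" "Poly_Mapping.single p c" f] by simp

lemma pmsum_zero [simp]: "pmsum V f 0 = \<zero>"
 unfolding pmsum_def by simp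

lemma pm_minus_eq: "r - s = r + pm_scale (- 1) s" for r s :: "'p \<Rightarrow>\<^sub>0 complex"
 by (rule poly_mapping_eqI) (simp add: lookup_minus lookup_add)

lemma pmsum_diff:
 assumes "!!p. p : supp r Un supp s ==> f p : car V"
 shows "pmsum V f (r - s) = pmsum V f r \<ominus> pmsum V f s"
proof -
 have "pmsum V f (r - s) = pmsum V f r \<oplus> pmsum V f (pm_scale (- 1) s)"
 unfolding pm_minus_eq using assms keys_pm_scale[of "-1" s] by (intro pmsum_add) auto
 thus ?thesis using pmsum_scale[of s f "-1"] pmsum_closed[of s f] assms by (simp add: smult_m1 a_minus_def)
qed

end

text \<open>The formal combination that becomes zero when \<open>z\<close> is interpreted as
  \<open>c x + y\<close>. Linearity, bilinearity and multilinearity all consist of relations of this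
  shape.\<close>

definition lin_rel :: "'p => complex => 'p => 'p => 'p \<Rightarrow>\<^sub>0 complex" where
 "lin_rel z c x y = Poly_Mapping.single z 1 - pm_scale c (Poly_Mapping.single x 1) - Poly_Mapping.single y 1"

lemma keys_lin_rel: "supp (lin_rel z c x y) <= {z, x, y}"
proof
 fix p assume "p : supp (lin_rel z c x y)"
 thus "p : {z, x, y}"
 by (auto simp: lin_rel_def in_keys_iff lookup_minus lookup_single when_def split: if_splits)
qed

context cvs begin

lemma pmsum_lin_rel:
 assumes "f z : car V" "f x : car V" "f y : car V"
 shows "pmsum V f (lin_rel z c x y) = f z \<ominus> c \<odot> f x \<ominus> f y"
proof -
 have k: "supp (pm_scale c (Poly_Mapping.single x 1)) <= {x}"
 using keys_pm_scale[of c "Poly_Mapping.single x 1"] by simp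
 have k': "supp (Poly_Mapping.single z 1 - pm_scale c (Poly_Mapping.single x 1)) <= {z, x}"
 using keys_diff[of "Poly_Mapping.single z 1" "pm_scale c (Poly_Mapping.single x 1)"] k by auto
 have s: "pmsum V f (Poly_Mapping.single z 1) = f z" "pmsum V f (Poly_Mapping.single y 1) = f y"
 using assms by (auto simp: pmsum_single)
 have sx: "pmsum V f (pm_scale c (Poly_Mapping.single x 1)) = c \<odot> f x"
 using assms pmsum_scale[of "Poly_Mapping.single x 1" f c] by (simp add: pmsum_single)
 have 1: "pmsum V f (Poly_Mapping.single z 1 - pm_scale c (Poly_Mapping.single x 1)) = f z \<ominus> c \<odot> f x"
 using pmsum_diff[of "Poly_Mapping.single z 1" "pm_scale c (Poly_Mapping.single x 1)" f] k assms s sx by (auto simp: subset_iff)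
 show ?thesis
 unfolding lin_rel_def using pmsum_diff[of "Poly_Mapping.single z 1 - pm_scale c (Poly_Mapping.single x 1)" "Poly_Mapping.single y 1" f]
 k' assms s 1 by (auto simp: subset_iff)
qed

lemma pmsum_lin_rel_zero:
 assumes "f z : car V" "f x : car V" "f y : car V"
 shows "pmsum V f (lin_rel z c x y) = \<zero> \<longleftrightarrow> f z = c \<odot> f x \<oplus> f y"
proof -
 have "f z \<ominus> c \<odot> f x \<ominus> f y = f z \<ominus> (c \<odot> f x \<oplus> f y)"
 using assms by algebra
 thus ?thesis using pmsum_lin_rel[where f=f and z=z and x=x and y=y, OF assms] minus_eq_zero assms by simp
qed

end

lemma linear_onI':
 assumes "cvs V" "cvs W" "!!x. x : car V ==> f x : car W"
 "!!c x y. x : car V ==> y : car V ==> f (c .[V] x +[V] y) = c .[W] f x +[W] f y"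
 shows "linear_on V W f"
proof -
 interpret V: cvs V by fact
 interpret W: cvs W by fact
 have add: "f (x +[V] y) = f x +[W] f y" if "x : car V" "y : car V" for x y
 using assms(4)[OF that, of 1] that assms(3) by simp
 have "f \<zero>[V] = f \<zero>[V] +[W] f \<zero>[V]" using add[of "\<zero>[V]" "\<zero>[V]"] by simp
 hence z: "f \<zero>[V] = \<zero>[W]" using assms(3)[OF V.M.zero_closed] by (metis W.M.add.l_cancel_one')
 have "f (c .[V] x) = c .[W] f x" if "x : car V" for c x
 using assms(4)[OF that V.M.zero_closed, of c] that z assms(3)[OF that] by simp
 thus ?thesis using add assms(3) by (auto simp: linear_on_def)
qed

lemma (in presentation) pmsum_gen:
 assumes "r : Rel" shows "pmsum V gen r = \<zero>"
proof -
 have k: "finite (supp r)" "supp r <= \<Union>B" using Rel_keys[OF assms] by auto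
 have "(%p. if p : supp r then coef r p else 0) = coef r"
 by (auto simp: in_keys_iff)
 hence "pmsum V gen r = kp (coef r)"
 using kp_restrict[OF k, of "coef r"] by (simp add: pmsum_def)
 moreover have "coef r : closed_rel B Rel" using assms unfolding closed_rel_def by blast
 ultimately show ?thesis using kp_zero_iff[OF lookup_ell1[OF k(2)]] by simp
qed

lemma (in presentation) gen_lin_rel:
 assumes "lin_rel z c x y : Rel" "z : \<Union>B" "x : \<Union>B" "y : \<Union>B"
 shows "gen z = c \<odot> gen x \<oplus> gen y"
 using pmsum_gen[OF assms(1)] pmsum_lin_rel_zero[of gen z x y c] gen_carrier assms by auto

section \<open>Completions and completed tensor products\<close>

context convex_bornology begin

lemma bornology_set_small: "bornology_set (small V)"
 by unfold_locales (use small_empty small_subset small_Un in blast)+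

lemma Union_small: "\<Union>(small V) = car V"
 using small_subset_carrier small_point by blast

end

definition lin_rels :: "'a bvs => ('a \<Rightarrow>\<^sub>0 complex) set" where
 "lin_rels V = {lin_rel (c .[V] x +[V] y) c x y | c x y. x : car V & y : car V}"

text \<open>Over a one-element type every family is a multiple of any nonzero relation, so the
  quotient is zero. This is the case left open by the encoding.\<close>

lemma (in bornology_set) ell1_trivial:
 assumes one: "!!p q :: 'p. p = q" and r: "r : Rel" "coef r p ~= 0"
 and Rel: "!!r. r : Rel ==> supp r <= \<Union>B"
 shows "ell1 B <= closed_rel B Rel"
proof
 fix c assume "c : ell1 B"
 have "c = (%q. (c p / coef r p) * coef r q)"
 proof
 fix q have "q = p" by (rule one)
 thus "c q = (c p / coef r p) * coef r q" using r(2) by simp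
 qed
 moreover have "coef r : closed_rel B Rel" using r(1) unfolding closed_rel_def by blast
 ultimately show "c : closed_rel B Rel"
 using closed_sub_closed_rel[OF Rel] unfolding closed_sub_def by metis
qed

text \<open>The coefficient at \<open>p\<close> is \<open>1 - 1 - 1\<close>.\<close>

lemma lin_rel_degenerate: "coef (lin_rel p 1 p p) p ~= 0"
 by (simp add: lin_rel_def lookup_minus)

lemma completion_model:
 assumes V: "convex_bornology (V :: 'v bvs)"
 shows "EX (C :: (nat => 'v) bvs) kp. presentation (small V) C (lin_rels V) kp"
proof -
 interpret V: convex_bornology V by fact
 interpret bornology_set "small V" by (rule V.bornology_set_small)
 have keys: "supp r <= \<Union>(small V)" if "r : lin_rels V" for r
 using that keys_lin_rel unfolding lin_rels_def V.Union_small by fastforce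
 have "(EX a b::'v. a ~= b) \<or> ell1 (small V) <= closed_rel (small V) (lin_rels V)"
 proof (cases "EX a b::'v. a ~= b")
 case False
 let ?z = "\<zero>[V]"
 have "lin_rel (1 .[V] ?z +[V] ?z) 1 ?z ?z : lin_rels V" unfolding lin_rels_def by blast
 hence "lin_rel ?z 1 ?z ?z : lin_rels V" by simp
 from ell1_trivial[OF _ this lin_rel_degenerate keys] show ?thesis using False by blast
 qed auto
 thus ?thesis using presentation_exists[OF keys] by blast
qed

lemma kills_lin_rels:
 assumes "cvs V" "cvs X" "linear_on V X f" "r : lin_rels V"
 shows "pmsum X f r = \<zero>[X]"
proof -
 interpret V: cvs V by fact
 interpret X: cvs X by fact
 note f = linear_onD[OF assms(3)]
 obtain c x y where r: "r = lin_rel (c .[V] x +[V] y) c x y" "x : car V" "y : car V"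
 using assms(4) unfolding lin_rels_def by blast
 show ?thesis unfolding r(1) by (subst X.pmsum_lin_rel_zero) (use f r in auto)
qed

locale completion_presentation = V: convex_bornology V + presentation "small V" C "lin_rels V" kp
 for V :: "'v bvs" and C :: "'c bvs" and kp
begin

lemma gen_bdd_linear: "bdd_linear V C gen"
proof -
 have "linear_on V C gen"
 proof (rule linear_onI'[OF V.cvs_axioms cvs_axioms])
 show "gen x : car C" if "x : car V" for x using gen_carrier that V.Union_small by blast
 fix c x y assume "x : car V" "y : car V"
 thus "gen (c .[V] x +[V] y) = c .[C] gen x +[C] gen y"
 by (intro gen_lin_rel) (unfold V.Union_small lin_rels_def, auto)
 qed
 thus ?thesis using gen_small by (simp add: bdd_linear_def)
qed

lemma lift_exists:
 assumes X: "complete_bvs X" and f: "bdd_linear V X f"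
 shows "EX g. bdd_linear C X g & (ALL v:car V. g (gen v) = f v)"
proof -
 interpret X: complete_bvs X by fact
 show ?thesis
 using extension[OF X bdd_linearD(5)[OF f] kills_lin_rels[OF V.cvs_axioms X.cvs_axioms bdd_linearD(1)[OF f]]]
 unfolding V.Union_small .
qed

lemma lift_unique:
 assumes "complete_bvs X" "bdd_linear C X g" "bdd_linear C X h" "!!v. v : car V ==> g (gen v) = h (gen v)" "x : car C"
 shows "g x = h x"
 using extension_unique[OF assms(1-3) _ assms(5)] assms(4) unfolding V.Union_small by blast

end

text \<open>The property that defines \<open>completion V\<close> quantifies only over targets on
  the type of sequences. Both the chosen object and the model live there, so the usual argument
  makes them isomorphic, and the presentation then yields the property for targets of any
  type.\<close>

lemma completion_presentation_exists:
 assumes V: "convex_bornology (V :: 'v bvs)"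
 shows "EX kp. completion_presentation V (completion V) kp & (ALL v:car V. kp (delta v) = completion_map V v)"
proof -
 interpret V: convex_bornology V by fact
 obtain C :: "(nat => 'v) bvs" and kp where P: "presentation (small V) C (lin_rels V) kp"
 using completion_model[OF V] by blast
 interpret C: completion_presentation V C kp by (rule completion_presentation.intro[OF V P])
 have univ: "EX g. bdd_linear C X g & (ALL v:car V. g (C.gen v) = f v)
          & (ALL g'. bdd_linear C X g' & (ALL v:car V. g' (C.gen v) = f v)
                --> (ALL x:car C. g' x = g x))"
 if X: "complete_bvs X" and f: "bdd_linear V X f" for X :: "(nat => 'v) bvs" and f
 proof -
 obtain g where g: "bdd_linear C X g" "ALL v:car V. g (C.gen v) = f v" using C.lift_exists[OF X f] by blast
 have "g' x = g x" if "bdd_linear C X g'" "ALL v:car V. g' (C.gen v) = f v" "x : car C" for g' x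
 by (rule C.lift_unique[OF X that(1) g(1) _ that(3)]) (use that(2) g(2) in simp)
 thus ?thesis using g by blast
 qed
 have "is_completion V C C.gen"
 unfolding is_completion_def using C.complete_bvs_axioms C.gen_bdd_linear univ by blast
 hence ex: "EX p. (%(C, \<eta>). is_completion V C \<eta>) p" by (intro exI[of _ "(C, C.gen)"]) simp
 have "is_completion V (completion V) (completion_map V)"
 using someI_ex[OF ex] unfolding completion_def completion_map_def completion_pair_def case_prod_unfold .
 hence c: "complete_bvs (completion V)" "bdd_linear V (completion V) (completion_map V)"
 and un: "!!(X :: (nat => 'v) bvs) f. complete_bvs X ==> bdd_linear V X f ==>
        (EX g. bdd_linear (completion V) X g & (ALL v:car V. g (completion_map V v) = f v)
          & (ALL g'. bdd_linear (completion V) X g' & (ALL v:car V. g' (completion_map V v) = f v)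
                --> (ALL x:car (completion V). g' x = g x)))"
 unfolding is_completion_def by blast+
 obtain u where u: "bdd_linear C (completion V) u" "!!v. v : car V ==> u (C.gen v) = completion_map V v"
 using C.lift_exists[OF c] by blast
 obtain w where w: "bdd_linear (completion V) C w" "!!v. v : car V ==> w (completion_map V v) = C.gen v"
 using un[OF C.complete_bvs_axioms C.gen_bdd_linear] by blast
 have wu: "w (u x) = x" if "x : car C" for x
 by (rule C.lift_unique[OF C.complete_bvs_axioms bdd_linear_comp[OF u(1) w(1)] bdd_linear_id _ that]) (simp add: u w)
 have uw: "u (w x) = x" if x: "x : car (completion V)" for x
 proof -
 obtain g where g: "!!g'. bdd_linear (completion V) (completion V) g' ==> (ALL v:car V. g' (completion_map V v) = completion_map V v)
                ==> (ALL x:car (completion V). g' x = g x)"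
 using un[OF c] by blast
 show ?thesis
 using g[OF bdd_linear_comp[OF w(1) u(1)]] g[OF bdd_linear_id] x by (simp add: u w)
 qed
 have "presentation (small V) (completion V) (lin_rels V) (%c. u (kp c))"
 by (rule presentation_transport[where u=u and w=w, OF P c(1) u(1) w(1) wu uw])
 hence "completion_presentation V (completion V) (%c. u (kp c))" by (rule completion_presentation.intro[OF V])
 moreover have "u (kp (delta v)) = completion_map V v" if "v : car V" for v
 using u(2)[OF that] unfolding C.gen_def .
 ultimately show ?thesis by blast
qed

context
 fixes V :: "'v bvs" assumes V: "convex_bornology V"
begin

lemma completion_complete: "complete_bvs (completion V)"
proof -
 obtain kp where "completion_presentation V (completion V) kp" using completion_presentation_exists[OF V] by blast
 then interpret completion_presentation V "completion V" kp .
 show ?thesis by (rule complete_bvs_axioms)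
qed

lemma completion_map_bdd_linear: "bdd_linear V (completion V) (completion_map V)"
proof -
 obtain kp where P: "completion_presentation V (completion V) kp" and d: "ALL v:car V. kp (delta v) = completion_map V v"
 using completion_presentation_exists[OF V] by blast
 interpret completion_presentation V "completion V" kp by fact
 have g: "gen v = completion_map V v" if "v : car V" for v using d that by (simp add: gen_def)
 have "gen ` S = completion_map V ` S" if "S : small V" for S
 using g V.small_subset_carrier[OF that] by (intro image_cong) auto
 thus ?thesis using gen_bdd_linear g unfolding bdd_linear_def linear_on_def by (auto simp: Pi_iff)
qed

lemma completion_lift:
 assumes X: "complete_bvs X" and f: "bdd_linear V X f"
 shows "bdd_linear (completion V) X (completion_lift V X f)"
 "v : car V ==> completion_lift V X f (completion_map V v) = f v"
proof -
 obtain kp where P: "completion_presentation V (completion V) kp" and d: "ALL v:car V. kp (delta v) = completion_map V v"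
 using completion_presentation_exists[OF V] by blast
 interpret completion_presentation V "completion V" kp by fact
 obtain g where "bdd_linear (completion V) X g" "ALL v:car V. g (gen v) = f v"
 using lift_exists[OF X f] by blast
 hence "EX g. bdd_linear (completion V) X g & (ALL v:car V. g (completion_map V v) = f v)"
 using d by (auto simp: gen_def)
 from someI_ex[OF this]
 show "bdd_linear (completion V) X (completion_lift V X f)"
 "v : car V ==> completion_lift V X f (completion_map V v) = f v"
 unfolding completion_lift_def by blast+
qed

lemma completion_unique:
 assumes "complete_bvs X" "bdd_linear (completion V) X g" "bdd_linear (completion V) X h"
 "!!v. v : car V ==> g (completion_map V v) = h (completion_map V v)" "x : car (completion V)"
 shows "g x = h x"
proof -
 obtain kp where P: "completion_presentation V (completion V) kp" and d: "ALL v:car V. kp (delta v) = completion_map V v"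
 using completion_presentation_exists[OF V] by blast
 interpret completion_presentation V "completion V" kp by fact
 show ?thesis by (rule lift_unique[OF assms(1-3) _ assms(5)]) (use assms(4) d in "simp add: gen_def")
qed

end

lemma completion_bilinear:
 assumes V: "convex_bornology V" and W: "convex_bornology W" and X: "complete_bvs X" and f: "bdd_bilinear V W X f"
 shows "EX m. bdd_bilinear (completion V) (completion W) X m
    & (ALL v:car V. ALL w:car W. m (completion_map V v) (completion_map W w) = f v w)"
proof -
 obtain kp where P: "completion_presentation V (completion V) kp" and d: "ALL v:car V. kp (delta v) = completion_map V v"
 using completion_presentation_exists[OF V] by blast
 obtain kp' where P': "completion_presentation W (completion W) kp'" and d': "ALL v:car W. kp' (delta v) = completion_map W v"
 using completion_presentation_exists[OF W] by blast
 interpret A: completion_presentation V "completion V" kp by fact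
 interpret A': completion_presentation W "completion W" kp' by fact
 interpret X: complete_bvs X by fact
 interpret presentation2 "small V" "completion V" "lin_rels V" kp "small W" "completion W" "lin_rels W" kp'
 by unfold_locales
 have "EX m. bdd_bilinear (completion V) (completion W) X m & (ALL p:\<Union>(small V). ALL q:\<Union>(small W). m (A.gen p) (A'.gen q) = f p q)"
 proof (rule bilinear_extension[OF X])
 show "{f p q | p q. p : S & q : S'} : small X" if "S : small V" "S' : small W" for S S'
 using f that unfolding bdd_bilinear_def by blast
 show "pmsum X (%p. f p q) r = \<zero>[X]" if "q : \<Union>(small W)" "r : lin_rels V" for q r
 by (rule kills_lin_rels[OF A.V.cvs_axioms X.cvs_axioms _ that(2)])
 (use f that(1) A'.V.Union_small in "auto simp: bdd_bilinear_def")
 show "pmsum X (f p) r = \<zero>[X]" if "p : \<Union>(small V)" "r : lin_rels W" for p r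
 by (rule kills_lin_rels[OF A'.V.cvs_axioms X.cvs_axioms _ that(2)])
 (use f that(1) A.V.Union_small in "auto simp: bdd_bilinear_def")
 qed
 thus ?thesis using d d' A.V.Union_small A'.V.Union_small by (auto simp: A.gen_def A'.gen_def)
qed

lemma linear_on_cong:
 assumes "cvs Z" "!!x. x : car Z ==> f x = h x" "linear_on Z T f" shows "linear_on Z T h"
proof -
 interpret Z: cvs Z by fact
 show ?thesis using assms(2,3) by (auto simp: linear_on_def Pi_iff)
qed

section \<open>Completed tensor products\<close>

definition tensor_born :: "'a bvs => 'b bvs => ('a \<times> 'b) set set" where
 "tensor_born V W = {U. EX S:small V. EX T:small W. U <= S \<times> T}"

definition bilin_rels :: "'a bvs => 'b bvs => ('a \<times> 'b \<Rightarrow>\<^sub>0 complex) set" where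
 "bilin_rels V W =
    {lin_rel (c .[V] x +[V] y, w) c (x, w) (y, w) | c x y w. x : car V & y : car V & w : car W}
    Un {lin_rel (v, c .[W] x +[W] y) c (v, x) (v, y) | c x y v. x : car W & y : car W & v : car V}"

locale cb_pair = V: convex_bornology V + W: convex_bornology W for V :: "'a bvs" and W :: "'b bvs"
begin

lemma tensor_born_set: "bornology_set (tensor_born V W)"
proof
 show "{} : tensor_born V W" unfolding tensor_born_def using V.small_empty W.small_empty by blast
 show "T : tensor_born V W" if "S : tensor_born V W" "T <= S" for S T
 using that unfolding tensor_born_def by blast
 fix U U' assume "U : tensor_born V W" "U' : tensor_born V W"
 then obtain S T S' T' where "S : small V" "T : small W" "U <= S \<times> T" "S' : small V" "T' : small W" "U' <= S' \<times> T'"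
 unfolding tensor_born_def by blast
 hence "U Un U' <= (S Un S') \<times> (T Un T')" "S Un S' : small V" "T Un T' : small W"
 using V.small_Un W.small_Un by auto
 thus "U Un U' : tensor_born V W" unfolding tensor_born_def by blast
qed

lemma Union_tensor_born: "\<Union>(tensor_born V W) = car V \<times> car W"
proof
 show "\<Union>(tensor_born V W) <= car V \<times> car W"
 unfolding tensor_born_def using V.small_subset_carrier W.small_subset_carrier by blast
 show "car V \<times> car W <= \<Union>(tensor_born V W)"
 proof clarify
 fix v w assume "v : car V" "w : car W"
 hence "{(v, w)} : tensor_born V W"
 unfolding tensor_born_def using V.small_point W.small_point by blast
 thus "(v, w) : \<Union>(tensor_born V W)" by blast
 qed
qed

lemma keys_bilin_rels: "r : bilin_rels V W ==> supp r <= \<Union>(tensor_born V W)"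
 unfolding bilin_rels_def Union_tensor_born using keys_lin_rel by fastforce

lemma ctensor_model: "EX (T :: (nat => 'a \<times> 'b) bvs) kp. presentation (tensor_born V W) T (bilin_rels V W) kp"
proof -
 interpret bornology_set "tensor_born V W" by (rule tensor_born_set)
 have "(EX a b::'a \<times> 'b. a ~= b) \<or> ell1 (tensor_born V W) <= closed_rel (tensor_born V W) (bilin_rels V W)"
 proof (cases "EX a b::'a \<times> 'b. a ~= b")
 case False
 let ?z = "\<zero>[V]" and ?w = "\<zero>[W]"
 have "lin_rel (1 .[V] ?z +[V] ?z, ?w) 1 (?z, ?w) (?z, ?w) : bilin_rels V W" unfolding bilin_rels_def by blast
 hence "lin_rel (?z, ?w) 1 (?z, ?w) (?z, ?w) : bilin_rels V W" by simp
 from ell1_trivial[OF _ this lin_rel_degenerate keys_bilin_rels] show ?thesis using False by blast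
 qed auto
 thus ?thesis using presentation_exists[OF keys_bilin_rels] by blast
qed

lemma kills_bilin_rels:
 assumes "cvs X" "!!v. v : car V ==> linear_on W X (f v)" "!!w. w : car W ==> linear_on V X (%v. f v w)"
 "r : bilin_rels V W"
 shows "pmsum X (%(v, w). f v w) r = \<zero>[X]"
proof -
 interpret X: cvs X by fact
 consider (l) c x y w where "r = lin_rel (c .[V] x +[V] y, w) c (x, w) (y, w)" "x : car V" "y : car V" "w : car W"
 | (r) c x y v where "r = lin_rel (v, c .[W] x +[W] y) c (v, x) (v, y)" "x : car W" "y : car W" "v : car V"
 using assms(4) unfolding bilin_rels_def by blast
 thus ?thesis
 proof cases
 case l
 note f = linear_onD[OF assms(3)[OF l(4)]]
 show ?thesis unfolding l(1) by (subst X.pmsum_lin_rel_zero) (use f l in auto)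
 next
 case r
 note f = linear_onD[OF assms(2)[OF r(4)]]
 show ?thesis unfolding r(1) by (subst X.pmsum_lin_rel_zero) (use f r in auto)
 qed
qed

end

locale ctensor_presentation = cb_pair V W + presentation "tensor_born V W" T "bilin_rels V W" kp
 for V :: "'a bvs" and W :: "'b bvs" and T :: "'c bvs" and kp
begin

lemma gen_bdd_bilinear: "bdd_bilinear V W T (%v w. gen (v, w))"
 unfolding bdd_bilinear_def
proof (intro conjI ballI)
 fix v assume v: "v : car V"
 show "linear_on W T (%w. gen (v, w))"
 proof (rule linear_onI'[OF W.cvs_axioms cvs_axioms])
 show "gen (v, x) : car T" if "x : car W" for x
 by (rule gen_carrier) (use that v in "simp add: Union_tensor_born")
 fix c x y assume "x : car W" "y : car W"
 thus "gen (v, c .[W] x +[W] y) = c .[T] gen (v, x) +[T] gen (v, y)"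
 using v by (intro gen_lin_rel) (unfold Union_tensor_born bilin_rels_def, auto)
 qed
next
 fix v assume v: "v : car W"
 show "linear_on V T (%w. gen (w, v))"
 proof (rule linear_onI'[OF V.cvs_axioms cvs_axioms])
 show "gen (x, v) : car T" if "x : car V" for x
 by (rule gen_carrier) (use that v in "simp add: Union_tensor_born")
 fix c x y assume "x : car V" "y : car V"
 thus "gen (c .[V] x +[V] y, v) = c .[T] gen (x, v) +[T] gen (y, v)"
 using v by (intro gen_lin_rel) (unfold Union_tensor_born bilin_rels_def, auto)
 qed
next
 fix S S' assume "S : small V" "S' : small W"
 hence "S \<times> S' : tensor_born V W" unfolding tensor_born_def by blast
 from gen_small[OF this] show "{gen (x, y) | x y. x : S & y : S'} : small T"
 by (rule small_subset) blast
qed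

lemma lift_exists:
 assumes X: "complete_bvs X" and f: "bdd_bilinear V W X f"
 shows "EX g. bdd_linear T X g & (ALL v:car V. ALL w:car W. g (gen (v, w)) = f v w)"
proof -
 interpret X: complete_bvs X by fact
 have "EX g. bdd_linear T X g & (ALL p:\<Union>(tensor_born V W). g (gen p) = (%(v, w). f v w) p)"
 proof (rule extension[OF X])
 fix U assume "U : tensor_born V W"
 then obtain S S' where S: "S : small V" "S' : small W" "U <= S \<times> S'" unfolding tensor_born_def by blast
 hence "{f x y | x y. x : S & y : S'} : small X" using f unfolding bdd_bilinear_def by blast
 thus "(%(v, w). f v w) ` U : small X" by (rule X.small_subset) (use S in auto)
 next
 fix r assume "r : bilin_rels V W"
 thus "pmsum X (%(v, w). f v w) r = \<zero>[X]"
 by (intro kills_bilin_rels[OF X.cvs_axioms]) (use f in "auto simp: bdd_bilinear_def")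
 qed
 thus ?thesis unfolding Union_tensor_born by auto
qed

lemma lift_unique:
 assumes "complete_bvs X" "bdd_linear T X g" "bdd_linear T X h"
 "!!v w. v : car V ==> w : car W ==> g (gen (v, w)) = h (gen (v, w))" "x : car T"
 shows "g x = h x"
 using extension_unique[OF assms(1-3) _ assms(5)] assms(4) unfolding Union_tensor_born by blast

end

context cb_pair begin

text \<open>The same passage as for completions, with bounded bilinear maps in place of bounded
  linear ones.\<close>

lemma ctensor_presentation_exists:
 shows "EX kp. ctensor_presentation V W (ctensor V W) kp
    & (ALL v:car V. ALL w:car W. kp (delta (v, w)) = elem_tensor V W v w)"
proof -
 obtain T :: "(nat => 'a \<times> 'b) bvs" and kp where P: "presentation (tensor_born V W) T (bilin_rels V W) kp"
 using ctensor_model by blast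
 interpret C: ctensor_presentation V W T kp by (rule ctensor_presentation.intro[OF cb_pair_axioms P])
 let ?\<theta> = "%v w. C.gen (v, w)"
 have univ: "EX g. bdd_linear T X g & (ALL v:car V. ALL w:car W. g (?\<theta> v w) = f v w)
          & (ALL g'. bdd_linear T X g' & (ALL v:car V. ALL w:car W. g' (?\<theta> v w) = f v w)
                --> (ALL x:car T. g' x = g x))"
 if X: "complete_bvs X" and f: "bdd_bilinear V W X f" for X :: "(nat => 'a \<times> 'b) bvs" and f
 proof -
 obtain g where g: "bdd_linear T X g" "ALL v:car V. ALL w:car W. g (?\<theta> v w) = f v w"
 using C.lift_exists[OF X f] by blast
 have "g' x = g x" if "bdd_linear T X g'" "ALL v:car V. ALL w:car W. g' (?\<theta> v w) = f v w" "x : car T" for g' x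
 by (rule C.lift_unique[OF X that(1) g(1) _ that(3)]) (use that(2) g(2) in simp)
 thus ?thesis using g by blast
 qed
 have "is_ctensor V W T ?\<theta>"
 unfolding is_ctensor_def using C.complete_bvs_axioms C.gen_bdd_bilinear univ by blast
 hence ex: "EX p. (%(T, \<theta>). is_ctensor V W T \<theta>) p" by (intro exI[of _ "(T, ?\<theta>)"]) simp
 let ?T = "ctensor V W" and ?e = "elem_tensor V W"
 have "is_ctensor V W ?T ?e"
 using someI_ex[OF ex] unfolding ctensor_def elem_tensor_def ctensor_pair_def case_prod_unfold .
 hence c: "complete_bvs ?T" "bdd_bilinear V W ?T ?e"
 and un: "!!(X :: (nat => 'a \<times> 'b) bvs) f. complete_bvs X ==> bdd_bilinear V W X f ==>
        (EX g. bdd_linear ?T X g & (ALL v:car V. ALL w:car W. g (?e v w) = f v w)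
          & (ALL g'. bdd_linear ?T X g' & (ALL v:car V. ALL w:car W. g' (?e v w) = f v w)
                --> (ALL x:car ?T. g' x = g x)))"
 unfolding is_ctensor_def by blast+
 obtain u where u: "bdd_linear T ?T u" and u2: "ALL v:car V. ALL w:car W. u (?\<theta> v w) = ?e v w"
 using C.lift_exists[OF c] by blast
 obtain w where w: "bdd_linear ?T T w" and w2: "ALL v:car V. ALL x:car W. w (?e v x) = ?\<theta> v x"
 using un[OF C.complete_bvs_axioms C.gen_bdd_bilinear] by blast
 have wu: "w (u x) = x" if "x : car T" for x
 by (rule C.lift_unique[OF C.complete_bvs_axioms bdd_linear_comp[OF u w] bdd_linear_id _ that]) (simp add: u2 w2)
 have uw: "u (w x) = x" if x: "x : car ?T" for x
 proof -
 obtain g where g: "!!g'. bdd_linear ?T ?T g' ==> (ALL v:car V. ALL w:car W. g' (?e v w) = ?e v w)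
                ==> (ALL x:car ?T. g' x = g x)"
 using un[OF c] by blast
 show ?thesis
 using g[OF bdd_linear_comp[OF w u]] g[OF bdd_linear_id] x by (simp add: u2 w2)
 qed
 have "presentation (tensor_born V W) ?T (bilin_rels V W) (%c. u (kp c))"
 by (rule presentation_transport[where u=u and w=w, OF P c(1) u w wu uw])
 hence "ctensor_presentation V W ?T (%c. u (kp c))" by (rule ctensor_presentation.intro[OF cb_pair_axioms])
 moreover have "ALL v:car V. ALL w:car W. u (kp (delta (v, w))) = ?e v w"
 using u2 unfolding C.gen_def .
 ultimately show ?thesis by blast
qed

lemma ctensor_complete: "complete_bvs (ctensor V W)"
proof -
 obtain kp where "ctensor_presentation V W (ctensor V W) kp" using ctensor_presentation_exists by blast
 then interpret ctensor_presentation V W "ctensor V W" kp .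
 show ?thesis by (rule complete_bvs_axioms)
qed

lemma elem_tensor_bilinear: "bdd_bilinear V W (ctensor V W) (elem_tensor V W)"
proof -
 obtain kp where P: "ctensor_presentation V W (ctensor V W) kp"
 and d: "ALL v:car V. ALL w:car W. kp (delta (v, w)) = elem_tensor V W v w" using ctensor_presentation_exists by blast
 interpret ctensor_presentation V W "ctensor V W" kp by fact
 have g: "gen (v, w) = elem_tensor V W v w" if "v : car V" "w : car W" for v w using d that by (simp add: gen_def)
 have "{elem_tensor V W x y | x y. x : S & y : S'} = {gen (x, y) | x y. x : S & y : S'}"
 if "S : small V" "S' : small W" for S S'
 proof -
 have "x : S ==> y : S' ==> elem_tensor V W x y = gen (x, y)" for x y
 using g V.small_subset_carrier[OF that(1)] W.small_subset_carrier[OF that(2)] by (simp add: subset_iff)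
 thus ?thesis by metis
 qed
 moreover have "linear_on W (ctensor V W) (elem_tensor V W x)" if "x : car V" for x
 proof (rule linear_on_cong[OF W.cvs_axioms g[OF that]])
 show "linear_on W (ctensor V W) (%w. gen (x, w))" using gen_bdd_bilinear that unfolding bdd_bilinear_def by simp
 qed
 moreover have "linear_on V (ctensor V W) (%x. elem_tensor V W x y)" if "y : car W" for y
 proof (rule linear_on_cong[OF V.cvs_axioms g[OF _ that]])
 show "linear_on V (ctensor V W) (%v. gen (v, y))" using gen_bdd_bilinear that unfolding bdd_bilinear_def by simp
 qed
 ultimately show ?thesis using gen_bdd_bilinear unfolding bdd_bilinear_def by simp
qed

lemma ctensor_lift:
 assumes X: "complete_bvs X" and f: "bdd_bilinear V W X f"
 shows "bdd_linear (ctensor V W) X (ctensor_lift V W X f)"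
 "v : car V ==> w : car W ==> ctensor_lift V W X f (elem_tensor V W v w) = f v w"
proof -
 obtain kp where P: "ctensor_presentation V W (ctensor V W) kp"
 and d: "ALL v:car V. ALL w:car W. kp (delta (v, w)) = elem_tensor V W v w" using ctensor_presentation_exists by blast
 interpret ctensor_presentation V W "ctensor V W" kp by fact
 obtain g where "bdd_linear (ctensor V W) X g" "ALL v:car V. ALL w:car W. g (gen (v, w)) = f v w"
 using lift_exists[OF X f] by blast
 hence "EX g. bdd_linear (ctensor V W) X g & (ALL v:car V. ALL w:car W. g (elem_tensor V W v w) = f v w)"
 using d by (auto simp: gen_def)
 from someI_ex[OF this]
 show "bdd_linear (ctensor V W) X (ctensor_lift V W X f)"
 "v : car V ==> w : car W ==> ctensor_lift V W X f (elem_tensor V W v w) = f v w"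
 unfolding ctensor_lift_def by blast+
qed

lemma ctensor_unique:
 assumes "complete_bvs X" "bdd_linear (ctensor V W) X g" "bdd_linear (ctensor V W) X h"
 "!!v w. v : car V ==> w : car W ==> g (elem_tensor V W v w) = h (elem_tensor V W v w)"
 "x : car (ctensor V W)"
 shows "g x = h x"
proof -
 obtain kp where P: "ctensor_presentation V W (ctensor V W) kp"
 and d: "ALL v:car V. ALL w:car W. kp (delta (v, w)) = elem_tensor V W v w" using ctensor_presentation_exists by blast
 interpret ctensor_presentation V W "ctensor V W" kp by fact
 show ?thesis by (rule lift_unique[OF assms(1-3) _ assms(5)]) (use assms(4) d in "simp add: gen_def")
qed

text \<open>One constant \<open>r\<close> and two small sets serve all \<open>h\<close> at once. The
  nilpotence of path algebras applies this to infinitely many maps, with scalings chosen from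
  \<open>r\<close> beforehand.\<close>

lemma ctensor_small_bound:
 assumes Y: "Y : small (ctensor V W)"
 obtains S S' r where "S : small V" "S' : small W" "0 < r"
 "!!X h D s y. complete_bvs (X :: 'x bvs) ==> bdd_linear (ctensor V W) X h ==> D : small X ==> ccdisk X D ==> 0 < s
      ==> (!!v w. v : S ==> w : S' ==> h (elem_tensor V W v w) : cvs.sc X s D) ==> y : Y ==> h y : cvs.sc X (2 * r * s) D"
proof -
 obtain kp where P: "ctensor_presentation V W (ctensor V W) kp"
 and d: "ALL v:car V. ALL w:car W. kp (delta (v, w)) = elem_tensor V W v w" using ctensor_presentation_exists by blast
 interpret ctensor_presentation V W "ctensor V W" kp by fact
 obtain U r where U: "U : tensor_born V W" "Y <= kp ` l1ball U r" using Y unfolding small_eq by blast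
 obtain S S' where S: "S : small V" "S' : small W" "U <= S \<times> S'" using U(1) unfolding tensor_born_def by blast
 show thesis
 proof (rule that[OF S(1,2), of "max r 1"])
 fix X :: "'x bvs" and h D s y
 assume X: "complete_bvs X" and h: "bdd_linear (ctensor V W) X h" and D: "D : small X" "ccdisk X D" and s: "0 < s"
 and hs: "!!v w. v : S ==> w : S' ==> h (elem_tensor V W v w) : cvs.sc X s D" and y: "y : Y"
 obtain c where c: "c : l1ball U r" "y = kp c" using U(2) y by blast
 have c1: "c : l1ball U (max r 1)" using c(1) by (rule l1ball_mono) auto
 show "h y : cvs.sc X (2 * max r 1 * s) D"
 unfolding c(2)
 proof (rule ball_bound[OF X h U(1) c1 D _ s])
 fix p assume "p : U"
 then obtain v w where p: "p = (v, w)" "v : S" "w : S'" using S(3) by blast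
 hence "gen p = elem_tensor V W v w"
 using d V.small_subset_carrier[OF S(1)] W.small_subset_carrier[OF S(2)] by (simp add: gen_def subset_iff)
 thus "h (gen p) : cvs.sc X s D" using hs p by simp
 qed simp
 qed simp
qed

end

text \<open>The four-variable form in which a multiplication of elementary tensors is given.\<close>

lemma ctensor_bilinear:
 assumes "cb_pair V W" "cb_pair V' W'" and X: "complete_bvs X"
 and lin: "!!v w v' w'. v : car V ==> w : car W ==> v' : car V' ==> w' : car W' ==>
      linear_on V X (%v. f v w v' w') & linear_on W X (%w. f v w v' w') & linear_on V' X (%v'. f v w v' w') & linear_on W' X (%w'. f v w v' w')"
 and bd: "!!S T S' T'. S : small V ==> T : small W ==> S' : small V' ==> T' : small W' ==>
      {f v w v' w' | v w v' w'. v : S & w : T & v' : S' & w' : T'} : small X"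
 shows "EX m. bdd_bilinear (ctensor V W) (ctensor V' W') X m
    & (ALL v:car V. ALL w:car W. ALL v':car V'. ALL w':car W'.
        m (elem_tensor V W v w) (elem_tensor V' W' v' w') = f v w v' w')"
proof -
 interpret c: cb_pair V W by fact
 interpret c': cb_pair V' W' by fact
 interpret X: complete_bvs X by fact
 obtain kp where P: "ctensor_presentation V W (ctensor V W) kp"
 and d: "ALL v:car V. ALL w:car W. kp (delta (v, w)) = elem_tensor V W v w"
 using c.ctensor_presentation_exists by blast
 obtain kp' where P': "ctensor_presentation V' W' (ctensor V' W') kp'"
 and d': "ALL v:car V'. ALL w:car W'. kp' (delta (v, w)) = elem_tensor V' W' v w"
 using c'.ctensor_presentation_exists by blast
 interpret A: ctensor_presentation V W "ctensor V W" kp by fact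
 interpret A': ctensor_presentation V' W' "ctensor V' W'" kp' by fact
 interpret presentation2 "tensor_born V W" "ctensor V W" "bilin_rels V W" kp "tensor_born V' W'" "ctensor V' W'" "bilin_rels V' W'" kp'
 by unfold_locales
 let ?f = "%(v, w) (v', w'). f v w v' w'"
 have "EX m. bdd_bilinear (ctensor V W) (ctensor V' W') X m
      & (ALL p:\<Union>(tensor_born V W). ALL q:\<Union>(tensor_born V' W'). m (A.gen p) (A'.gen q) = ?f p q)"
 proof (rule bilinear_extension[OF X])
 fix U U' assume "U : tensor_born V W" "U' : tensor_born V' W'"
 then obtain S T S' T' where S: "S : small V" "T : small W" "U <= S \<times> T" "S' : small V'" "T' : small W'" "U' <= S' \<times> T'"
 unfolding tensor_born_def by blast
 show "{?f p q | p q. p : U & q : U'} : small X"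
 proof (rule X.small_subset[OF bd[OF S(1,2,4,5)]], rule subsetI)
 fix z assume "z : {?f p q | p q. p : U & q : U'}"
 then obtain v w v' w' where "(v, w) : U" "(v', w') : U'" "z = f v w v' w'" by auto
 thus "z : {f v w v' w' | v w v' w'. v : S & w : T & v' : S' & w' : T'}" using S(3,6) by blast
 qed
 next
 fix q r assume q: "q : \<Union>(tensor_born V' W')" and r: "r : bilin_rels V W"
 then obtain v' w' where q': "q = (v', w')" "v' : car V'" "w' : car W'" unfolding c'.Union_tensor_born by blast
 have "pmsum X (%(v, w). f v w v' w') r = \<zero>[X]"
 by (rule c.kills_bilin_rels[OF X.cvs_axioms _ _ r]) (use lin q' c.V.M.zero_closed c.W.M.zero_closed in blast)+
 moreover have "(%p. ?f p q) = (%(v, w). f v w v' w')" unfolding q'(1) by auto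
 ultimately show "pmsum X (%p. ?f p q) r = \<zero>[X]" by simp
 next
 fix p r assume p: "p : \<Union>(tensor_born V W)" and r: "r : bilin_rels V' W'"
 then obtain v w where p': "p = (v, w)" "v : car V" "w : car W" unfolding c.Union_tensor_born by blast
 have "pmsum X (%(v', w'). f v w v' w') r = \<zero>[X]"
 by (rule c'.kills_bilin_rels[OF X.cvs_axioms _ _ r]) (use lin p' c'.V.M.zero_closed c'.W.M.zero_closed in blast)+
 thus "pmsum X (?f p) r = \<zero>[X]" using p'(1) by simp
 qed
 then obtain m where m: "bdd_bilinear (ctensor V W) (ctensor V' W') X m"
 "!!p q. p : car V \<times> car W ==> q : car V' \<times> car W' ==> m (A.gen p) (A'.gen q) = ?f p q"
 unfolding c.Union_tensor_born c'.Union_tensor_born by blast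
 have "m (elem_tensor V W v w) (elem_tensor V' W' v' w') = f v w v' w'"
 if "v : car V" "w : car W" "v' : car V'" "w' : car W'" for v w v' w'
 using m(2)[of "(v, w)" "(v', w')"] that d d' by (simp add: A.gen_def A'.gen_def)
 thus ?thesis using m(1) by blast
qed

section \<open>Differential forms\<close>

context cvs begin

lemma submoduleI':
 assumes "W <= car V" "\<zero> : W" "!!x y. x : W ==> y : W ==> x \<oplus> y : W" "!!c x. x : W ==> c \<odot> x : W"
 shows "submodule W complex_ring V"
proof (rule module.module_incl_imp_submodule[OF module_axioms assms(1)])
 let ?W = "V\<lparr>carrier := W\<rparr>"
 have c: "!!x. x : W ==> x : car V" using assms(1) by blast
 show "Module.module complex_ring ?W"
 proof (rule moduleI[OF cring_complex_ring])
 show "abelian_group ?W"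
 proof (rule abelian_groupI)
 fix x y z assume "x : car ?W" "y : car ?W" "z : car ?W"
 hence xc: "x : car V" "y : car V" "z : car V" using c by auto
 thus "x +[?W] y +[?W] z = x +[?W] (y +[?W] z)" by (simp add: M.a_assoc)
 show "x +[?W] y = y +[?W] x" using xc by (simp add: M.a_comm)
 next
 fix x assume "x : car ?W"
 thus "EX z:car ?W. z +[?W] x = \<zero>[?W]"
 by (intro bexI[of _ "\<ominus> x"]) (use assms(4)[of x "-1"] c in "auto simp: M.l_neg smult_m1")
 qed (use c assms in auto)
 qed (use c assms in "auto simp: smult_ladd smult_radd smult_smult")
qed

lemma lin_span_induct:
 assumes "x : lin_span V S" "S <= car V" "!!x. x : S ==> Q x" "Q \<zero>"
 "!!x y. x : car V ==> y : car V ==> Q x ==> Q y ==> Q (x \<oplus> y)" "!!c x. x : car V ==> Q x ==> Q (c \<odot> x)"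
 shows "Q x" "x : car V"
proof -
 have "submodule {x : car V. Q x} complex_ring V"
 by (rule submoduleI') (use assms(4-6) in auto)
 hence "x : {x : car V. Q x}"
 using assms(1-3) unfolding lin_span_def by blast
 thus "Q x" "x : car V" by auto
qed

lemma submodule_lin_span: assumes "S <= car V"
 shows "lin_span V S <= car V" "\<zero> : lin_span V S"
 "x : lin_span V S ==> y : lin_span V S ==> x \<oplus> y : lin_span V S"
 "x : lin_span V S ==> c \<odot> x : lin_span V S" "S <= lin_span V S"
proof -
 have "submodule (car V) complex_ring V" by (rule submoduleI') auto
 thus "lin_span V S <= car V" unfolding lin_span_def using assms by blast
 have z: "\<zero> : W" and a: "x : W ==> y : W ==> x \<oplus> y : W" and s: "x : W ==> c \<odot> x : W"
 if "submodule W complex_ring V" for W x y c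
 using that subgroup.one_closed[of W "add_monoid V"] subgroup.m_closed[of W "add_monoid V"]
 by (auto simp: submodule_def submodule_axioms_def)
 show "\<zero> : lin_span V S" unfolding lin_span_def using z by blast
 show "x : lin_span V S ==> y : lin_span V S ==> x \<oplus> y : lin_span V S" unfolding lin_span_def using a by blast
 show "x : lin_span V S ==> c \<odot> x : lin_span V S" unfolding lin_span_def using s by blast
 show "S <= lin_span V S" unfolding lin_span_def by blast
qed

end

lemma cvs_image:
 assumes V: "cvs V" and carr: "car W = q ` car V"
 and add: "!!x y. x : car V ==> y : car V ==> q x +[W] q y = q (x +[V] y)"
 and smult: "!!c x. x : car V ==> c .[W] q x = q (c .[V] x)"
 and zero: "\<zero>[W] = q \<zero>[V]"
 shows "cvs W"
proof -
 interpret V: cvs V by fact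
 have "abelian_group W"
 proof (rule abelian_groupI)
 show "\<zero>[W] : car W" using zero carr by simp
 next
 fix x y z assume "x : car W" "y : car W" "z : car W"
 then obtain a b c where *: "x = q a" "y = q b" "z = q c" "a : car V" "b : car V" "c : car V"
 unfolding carr by blast
 show "x +[W] y +[W] z = x +[W] (y +[W] z)" using * by (simp add: add V.M.a_assoc)
 next
 fix x y assume "x : car W" "y : car W"
 then obtain a b where *: "x = q a" "y = q b" "a : car V" "b : car V" unfolding carr by blast
 show "x +[W] y = y +[W] x" using * by (simp add: add V.M.a_comm)
 show "x +[W] y : car W" using * carr by (simp add: add)
 show "\<zero>[W] +[W] x = x" using * zero by (simp add: add)
 show "EX y:car W. y +[W] x = \<zero>[W]"
 using * carr zero by (intro bexI[of _ "q (\<ominus>\<^bsub>V\<^esub> a)"]) (auto simp: add V.M.l_neg)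
 qed
 hence "Module.module complex_ring W"
 proof (rule moduleI[OF cring_complex_ring])
 fix a b :: complex and x assume "x : car W"
 then obtain v where *: "x = q v" "v : car V" unfolding carr by blast
 show "a .[W] x : car W" using * carr by (simp add: smult)
 show "(a +[complex_ring] b) .[W] x = a .[W] x +[W] b .[W] x"
 using * by (simp add: smult add V.smult_ladd)
 show "(a *[complex_ring] b) .[W] x = a .[W] (b .[W] x)"
 using * by (simp add: smult V.smult_smult)
 show "\<one>\<^bsub>complex_ring\<^esub> .[W] x = x" using * by (simp add: smult)
 fix y assume "y : car W"
 then obtain w where **: "y = q w" "w : car V" unfolding carr by blast
 show "a .[W] (x +[W] y) = a .[W] x +[W] a .[W] y"
 using * ** by (simp add: smult add V.smult_radd)
 qed
 thus ?thesis by (simp add: cvs_def)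
qed

section \<open>Generated bornologies\<close>

lemma cvs_small_update: "cvs V ==> cvs (V\<lparr>small := B\<rparr>)"
 by (rule cvs_image[where q="%x. x" and V=V]) auto

lemma disk_hull_small_update [simp]: "disk_hull (V\<lparr>small := B\<rparr>) S = disk_hull V S"
 by (simp add: disk_hull_def disk_def)

lemma set_add_small_update [simp]: "S <+>\<^bsub>V\<lparr>small := B\<rparr>\<^esub> T = S <+>\<^bsub>V\<^esub> T"
 unfolding set_add_def' by simp

lemma convex_bornology_small_update_iff:
 "convex_bornology (V\<lparr>small := B\<rparr>) \<longleftrightarrow> cvs (V\<lparr>small := B\<rparr>) & B <= Pow (car V) & (ALL x:car V. {x} : B)
    & (ALL S:B. ALL T. T <= S --> T : B) & (ALL S:B. ALL T:B. S <+>\<^bsub>V\<^esub> T : B) & (ALL S:B. disk_hull V S : B)"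
 unfolding convex_bornology_def convex_bornology_axioms_def cvs_def by auto

lemma generated_bornology:
 assumes V: "cvs V" and G: "G <= Pow (car V)"
 shows "convex_bornology (V\<lparr>small := bornology_generated V G\<rparr>)" "G <= bornology_generated V G"
 and generated_least: "!!B. convex_bornology (V\<lparr>small := B\<rparr>) ==> G <= B ==> bornology_generated V G <= B"
proof -
 interpret cvs V by fact
 have "convex_bornology (V\<lparr>small := Pow (car V)\<rparr>)"
 unfolding convex_bornology_small_update_iff
 proof (intro conjI ballI allI impI)
 show "cvs (V\<lparr>small := Pow (car V)\<rparr>)" by (rule cvs_small_update[OF V])
 show "disk_hull V S : Pow (car V)" if "S : Pow (car V)" for S
 using disk_hull_least[OF disk_carrier, of S] that by blast
 show "S <+>\<^bsub>V\<^esub> T : Pow (car V)" if "S : Pow (car V)" "T : Pow (car V)" for S T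
 using that unfolding set_add_def' by auto
 qed auto
 hence ne: "Pow (car V) : {B. convex_bornology (V\<lparr>small := B\<rparr>) & G <= B}" using G by simp
 show "convex_bornology (V\<lparr>small := bornology_generated V G\<rparr>)"
 unfolding convex_bornology_small_update_iff
 proof (intro conjI ballI allI impI)
 show "cvs (V\<lparr>small := bornology_generated V G\<rparr>)" by (rule cvs_small_update[OF V])
 show "bornology_generated V G <= Pow (car V)" unfolding bornology_generated_def using ne by (rule Inter_lower)
 qed (unfold bornology_generated_def convex_bornology_small_update_iff, blast+)
 show "G <= bornology_generated V G" unfolding bornology_generated_def by blast
 show "!!B. convex_bornology (V\<lparr>small := B\<rparr>) ==> G <= B ==> bornology_generated V G <= B"
 unfolding bornology_generated_def by blast
qed

text \<open>The preimage of a disk under a linear map is a disk.\<close>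

lemma linear_disk_hull:
 assumes V: "cvs V" and X: "cvs X" and f: "linear_on V X f" and S: "S <= car V"
 shows "f ` disk_hull V S <= disk_hull X (f ` S)"
proof -
 interpret V: cvs V by fact
 interpret X: cvs X by fact
 note f = linear_onD[OF assms(3)]
 have fS: "f ` S <= car X" using S f(1) by blast
 let ?D = "{x : car V. f x : disk_hull X (f ` S)}"
 have D: "disk X (disk_hull X (f ` S))" by (rule X.disk_hull_disk[OF fS])
 have "disk V ?D"
 unfolding disk_def
 proof (intro conjI ballI allI impI)
 fix x y and t :: real assume "x : ?D" "y : ?D" "t : {0..1}"
 thus "cplx t .[V] x +[V] cplx (1 - t) .[V] y : ?D"
 using D f unfolding disk_def by simp
 next
 fix c x assume "x : ?D" "cmod c <= 1"
 thus "c .[V] x : ?D" using D f unfolding disk_def by simp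
 qed auto
 moreover have "S <= ?D" using S X.disk_hull_subset[of "f ` S"] by blast
 ultimately show ?thesis using V.disk_hull_least by blast
qed

lemma preimage_bornology:
 assumes V: "cvs V" and X: "convex_bornology X" and f: "!!i. i : I ==> linear_on V X (f i)"
 and pt: "!!x. x : car V ==> {f i x | i. i : I} : small X"
 shows "convex_bornology (V\<lparr>small := {Y. Y <= car V & {f i y | i y. i : I & y : Y} : small X}\<rparr>)"
proof -
 interpret V: cvs V by fact
 interpret X: convex_bornology X by fact
 show ?thesis
 unfolding convex_bornology_small_update_iff
 proof (intro conjI ballI allI impI)
 show "cvs (V\<lparr>small := {Y. Y <= car V & {f i y | i y. i : I & y : Y} : small X}\<rparr>)" by (rule cvs_small_update[OF V])
 next
 fix x assume x: "x : car V"
 have "{f i y | i y. i : I & y : {x}} = {f i x | i. i : I}" by blast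
 thus "{x} : {Y. Y <= car V & {f i y | i y. i : I & y : Y} : small X}" using pt[OF x] x by simp
 next
 fix S T assume S: "S : {Y. Y <= car V & {f i y | i y. i : I & y : Y} : small X}" and "T <= S"
 hence "{f i y | i y. i : I & y : T} <= {f i y | i y. i : I & y : S}" by blast
 hence "{f i y | i y. i : I & y : T} : small X" using X.small_subset S by blast
 thus "T : {Y. Y <= car V & {f i y | i y. i : I & y : Y} : small X}" using S \<open>T \<subseteq> S\<close> by blast
 next
 fix S T assume S: "S : {Y. Y <= car V & {f i y | i y. i : I & y : Y} : small X}"
 and T: "T : {Y. Y <= car V & {f i y | i y. i : I & y : Y} : small X}"
 have "{f i y | i y. i : I & y : S <+>\<^bsub>V\<^esub> T} <= {f i y | i y. i : I & y : S} <+>\<^bsub>X\<^esub> {f i y | i y. i : I & y : T}"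
 proof
 fix z assume "z : {f i y | i y. i : I & y : S <+>\<^bsub>V\<^esub> T}"
 then obtain i s t where i: "i : I" "s : S" "t : T" "z = f i (s +[V] t)" unfolding set_add_def' by blast
 hence "s : car V" "t : car V" using S T by auto
 hence "z = f i s +[X] f i t" using i linear_onD(2)[OF f[OF i(1)]] by simp
 thus "z : {f i y | i y. i : I & y : S} <+>\<^bsub>X\<^esub> {f i y | i y. i : I & y : T}"
 unfolding set_add_def' using i by blast
 qed
 moreover have "{f i y | i y. i : I & y : S} <+>\<^bsub>X\<^esub> {f i y | i y. i : I & y : T} : small X"
 using X.small_sum S T by blast
 ultimately have 1: "{f i y | i y. i : I & y : S <+>\<^bsub>V\<^esub> T} : small X" using X.small_subset by blast
 have "S <+>\<^bsub>V\<^esub> T <= car V" using S T unfolding set_add_def' by auto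
 thus "S <+>\<^bsub>V\<^esub> T : {Y. Y <= car V & {f i y | i y. i : I & y : Y} : small X}" using 1 by simp
 next
 fix S assume S: "S : {Y. Y <= car V & {f i y | i y. i : I & y : Y} : small X}"
 let ?T = "{f i y | i y. i : I & y : S}"
 have Sc: "S <= car V" using S by simp
 have Tc: "?T <= car X" using S X.small_subset_carrier by blast
 have "{f i y | i y. i : I & y : disk_hull V S} <= disk_hull X ?T"
 proof
 fix z assume "z : {f i y | i y. i : I & y : disk_hull V S}"
 then obtain i y where i: "i : I" "y : disk_hull V S" "z = f i y" by blast
 hence "z : disk_hull X (f i ` S)" using linear_disk_hull[OF V X.cvs_axioms f[OF i(1)] Sc] by blast
 moreover have "f i ` S <= disk_hull X ?T" using i(1) X.disk_hull_subset[of ?T] by blast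
 ultimately show "z : disk_hull X ?T" using X.disk_hull_least[OF X.disk_hull_disk[OF Tc]] by blast
 qed
 moreover have "disk_hull X ?T : small X" using S X.small_disk_hull by simp
 moreover have "disk_hull V S <= car V" by (rule V.disk_hull_least[OF V.disk_carrier Sc])
 ultimately show "disk_hull V S : {Y. Y <= car V & {f i y | i y. i : I & y : Y} : small X}"
 using X.small_subset by simp
 qed auto
qed

section \<open>Linear extension of maps on words\<close>

lemma pm_diff_eq: "r - s = r + pm_scale (- 1) s"
 by (rule poly_mapping_eqI) (simp add: lookup_minus lookup_add)

lemma pm_scale_add: "pm_scale c (f + g) = pm_scale c f + pm_scale c g"
 by (rule poly_mapping_eqI) (simp add: lookup_add algebra_simps)

lemma pm_scale_scale: "pm_scale c (pm_scale d f) = pm_scale (c * d) f"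
 by (rule poly_mapping_eqI) simp

lemma pm_scale_add_left: "pm_scale (c + d) f = pm_scale c f + pm_scale d f"
 by (rule poly_mapping_eqI) (simp add: lookup_add algebra_simps)

lemma pm_scale_1 [simp]: "pm_scale 1 f = f"
 by (rule poly_mapping_eqI) simp

lemma pm_scale_zero [simp]: "pm_scale c 0 = 0" "pm_scale 0 f = 0"
 by (rule poly_mapping_eqI, simp)+

lemma pm_scale_single: "pm_scale c (Poly_Mapping.single w d) = Poly_Mapping.single w (c * d)"
 by (rule poly_mapping_eqI) (simp add: lookup_single when_def)

lemma pm_induct:
 assumes "supp f <= W" "Q 0" "!!w. w : W ==> Q (Poly_Mapping.single w 1)"
 "!!f g. supp f <= W ==> supp g <= W ==> Q f ==> Q g ==> Q (f + g)"
 "!!c f. supp f <= W ==> Q f ==> Q (pm_scale c f)"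
 shows "Q (f :: 'p \<Rightarrow>\<^sub>0 complex)"
proof -
 have *: "Q (SUM w:F. Poly_Mapping.single w (coef f w)) &
      supp (SUM w:F. Poly_Mapping.single w (coef f w)) <= W"
 if "finite F" "F <= W" for F
 using that
 proof (induction F rule: finite_induct)
 case (insert w F)
 have "Q (pm_scale (coef f w) (Poly_Mapping.single w 1))"
 using insert.prems assms(3) by (intro assms(5)) auto
 hence q: "Q (Poly_Mapping.single w (coef f w))" by (simp add: pm_scale_single)
 have k: "supp (Poly_Mapping.single w (coef f w)) <= W"
 using insert.prems by auto
 have ih: "Q (SUM w:F. Poly_Mapping.single w (coef f w))"
 "supp (SUM w:F. Poly_Mapping.single w (coef f w)) <= W" using insert by auto
 have "supp (Poly_Mapping.single w (coef f w) + (SUM w:F. Poly_Mapping.single w (coef f w))) <= W"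
 by (rule order_trans[OF Poly_Mapping.keys_add]) (use k ih in blast)
 thus ?case using assms(4)[OF k ih(2) q ih(1)] insert.hyps by simp
 qed (use assms(2) in simp)
 have "f = (SUM w:supp f. Poly_Mapping.single w (coef f w))"
 by (rule poly_mapping_eqI) (simp add: lookup_sum lookup_single when_def in_keys_iff if_distrib cong: if_cong)
 thus ?thesis using *[of "supp f"] assms(1) by simp
qed

lemma pm_extend_superset:
 assumes "finite A" "supp f <= A"
 shows "pm_extend h f = (SUM w:A. pm_scale (coef f w) (h w))"
 unfolding pm_extend_def using assms by (intro sum.mono_neutral_left) (auto simp: in_keys_iff)

lemma pm_extend_add: "pm_extend h (f + g) = pm_extend h f + pm_extend h g"
proof -
 let ?A = "supp f Un supp g"
 have "pm_extend h (f + g) = (SUM w:?A. pm_scale (coef (f + g) w) (h w))"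
 by (rule pm_extend_superset) (use Poly_Mapping.keys_add[of f g] in auto)
 also have "... = (SUM w:?A. pm_scale (coef f w) (h w)) + (SUM w:?A. pm_scale (coef g w) (h w))"
 by (simp add: lookup_add pm_scale_add_left sum.distrib)
 also have "... = pm_extend h f + pm_extend h g"
 using pm_extend_superset[of ?A f h] pm_extend_superset[of ?A g h] by simp
 finally show ?thesis .
qed

lemma pm_scale_sum: "pm_scale c (SUM w:A. f w) = (SUM w:A. pm_scale c (f w))"
 by (induction A rule: infinite_finite_induct) (auto simp: pm_scale_add)

lemma pm_extend_scale: "pm_extend h (pm_scale c f) = pm_scale c (pm_extend h f)"
proof -
 have "pm_extend h (pm_scale c f) = (SUM w:supp f. pm_scale (coef (pm_scale c f) w) (h w))"
 by (rule pm_extend_superset) (use keys_pm_scale[of c f] in auto)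
 thus ?thesis by (simp add: pm_extend_def pm_scale_sum pm_scale_scale)
qed

lemma pm_extend_single [simp]: "pm_extend h (Poly_Mapping.single w 1) = h w"
 by (simp add: pm_extend_def)

lemma pm_extend_zero [simp]: "pm_extend h 0 = 0"
 by (simp add: pm_extend_def)

lemma pm_extend_diff: "pm_extend h (f - g) = pm_extend h f - pm_extend h g"
 unfolding pm_diff_eq by (simp add: pm_extend_add pm_extend_scale)

section \<open>Forms as classes of formal linear combinations of words\<close>

locale balg = convex_bornology A for A :: "'a bvs" (structure) +
 assumes bdd_mult: "bdd_bilinear A A A (mult A)"
 and mult_assoc: "[|x : car A; y : car A; z : car A|] ==> (x \<otimes> y) \<otimes> z = x \<otimes> (y \<otimes> z)"

sublocale complete_balg \<subseteq> balg
 by unfold_locales (use bdd_mult mult_assoc in auto)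

context balg begin

lemma mult_closed [simp]: "x : car A ==> y : car A ==> x \<otimes> y : car A"
 using bdd_mult linear_onD(1)[of A A "%y. x \<otimes> y" y] unfolding bdd_bilinear_def by simp

lemma mult_linear_right: "x : car A ==> linear_on A A (%y. x \<otimes> y)"
 using bdd_mult unfolding bdd_bilinear_def by blast

lemma mult_linear_left: "y : car A ==> linear_on A A (%x. x \<otimes> y)"
 using bdd_mult unfolding bdd_bilinear_def by blast

lemma mult_small: "S : small A ==> T : small A ==> {x \<otimes> y | x y. x : S & y : T} : small A"
 using bdd_mult unfolding bdd_bilinear_def by blast

abbreviation "FF \<equiv> car (free_forms A)"
abbreviation "cls \<equiv> form_class A"

lemma FF_eq: "FF = {f. supp f <= fwords (car A)}"
 by (simp add: free_forms_def)

lemma free_forms_simps [simp]: "add (free_forms A) = (+)" "zero (free_forms A) = 0" "smult (free_forms A) = pm_scale"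
 by (simp_all add: free_forms_def)

lemma FF_zero [simp]: "0 : FF" by (simp add: FF_eq)

lemma FF_add [simp]: "f : FF ==> g : FF ==> f + g : FF"
 using Poly_Mapping.keys_add[of f g] by (auto simp: FF_eq)

lemma FF_scale [simp]: "f : FF ==> pm_scale c f : FF"
 using keys_pm_scale[of c f] by (auto simp: FF_eq)

lemma FF_diff [simp]: "f : FF ==> g : FF ==> f - g : FF"
 using keys_diff[of f g] by (auto simp: FF_eq)

lemma FF_fmono: "w : fwords (car A) ==> fmono w : FF"
 by (simp add: FF_eq)

lemma FF_sum: "(!!w. w : F ==> h w : FF) ==> (SUM w:F. h w) : FF"
 by (induction F rule: infinite_finite_induct) auto

lemma FF_pm_extend: "(!!w. w : supp f ==> h w : FF) ==> pm_extend h f : FF"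
 unfolding pm_extend_def by (rule FF_sum) simp

lemma FF_induct:
 assumes "f : FF" "Q 0" "!!w. w : fwords (car A) ==> Q (fmono w)"
 "!!f g. f : FF ==> g : FF ==> Q f ==> Q g ==> Q (f + g)" "!!c f. f : FF ==> Q f ==> Q (pm_scale c f)"
 shows "Q f"
 using pm_induct[of f "fwords (car A)" Q] assms by (simp add: FF_eq)

lemma cvs_free_forms: "cvs (free_forms A)"
proof -
 have "abelian_group (free_forms A)"
 proof (rule abelian_groupI)
 show "EX g:FF. g +[free_forms A] f = \<zero>[free_forms A]" if "f : FF" for f
 using FF_diff[OF FF_zero that] by (intro bexI[of _ "0 - f"]) auto
 qed (auto simp: add.assoc add.commute)
 hence "Module.module complex_ring (free_forms A)"
 by (intro moduleI[OF cring_complex_ring]) (auto simp: pm_scale_add pm_scale_add_left pm_scale_scale)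
 thus ?thesis by (simp add: cvs_def)
qed

lemma fwords_carrier_simps [simp]:
 "(Some x, as) : fwords S \<longleftrightarrow> x : S & set as <= S"
 "(None, as) : fwords S \<longleftrightarrow> as ~= [] & set as <= S"
 by (auto simp: fwords_def)

lemma fwords_iff: "(z, as) : fwords S \<longleftrightarrow> set_option z <= S & set as <= S & (z = None --> as ~= [])"
 by (auto simp: fwords_def)

lemma multilinear_relations_FF: "multilinear_relations A <= FF"
 unfolding multilinear_relations_def by (auto intro!: FF_diff FF_scale FF_fmono simp: fwords_iff)

abbreviation "RR \<equiv> relation_space A"

lemma RR_subset: "RR <= FF" and RR_zero: "0 : RR"
 and RR_add: "f : RR ==> g : RR ==> f + g : RR" and RR_scale: "f : RR ==> pm_scale c f : RR"
 and RR_rel: "multilinear_relations A <= RR"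
 unfolding relation_space_def
 using cvs.submodule_lin_span[OF cvs_free_forms multilinear_relations_FF] by auto

lemma RR_diff: "f : RR ==> g : RR ==> f - g : RR"
 unfolding pm_diff_eq by (intro RR_add RR_scale)

lemma cls_eq_set: "cls f = (%r. r + f) ` RR"
 unfolding form_class_def a_r_coset_def r_coset_def by (auto simp: image_def)

lemma cls_eq_iff: "cls f = cls g \<longleftrightarrow> f - g : RR"
proof
 assume "cls f = cls g"
 moreover have "f : cls f" unfolding cls_eq_set using RR_zero by force
 ultimately obtain r where "r : RR" "f = r + g" unfolding cls_eq_set by blast
 thus "f - g : RR" by simp
next
 assume fg: "f - g : RR"
 show "cls f = cls g"
 proof (rule equalityI; rule subsetI)
 fix h assume "h : cls f"
 then obtain r where "r : RR" "h = r + f" unfolding cls_eq_set by blast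
 hence "h = (r + (f - g)) + g" "r + (f - g) : RR" using RR_add[OF _ fg] by auto
 thus "h : cls g" unfolding cls_eq_set by blast
 next
 fix h assume "h : cls g"
 then obtain r where "r : RR" "h = r + g" unfolding cls_eq_set by blast
 hence "h = (r - (f - g)) + f" "r - (f - g) : RR" using RR_diff[OF _ fg] by auto
 thus "h : cls f" unfolding cls_eq_set by blast
 qed
qed

lemma cls_self: "f : cls f"
 unfolding cls_eq_set using RR_zero by force

lemma cls_mem: "g : cls f ==> cls g = cls f"
proof -
 assume "g : cls f"
 then obtain r where "r : RR" "g = r + f" unfolding cls_eq_set by blast
 thus "cls g = cls f" unfolding cls_eq_iff by simp
qed

lemma cls_mem_FF: "f : FF ==> g : cls f ==> g : FF"
 unfolding cls_eq_set using RR_subset by auto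

lemma forms_carrier: "car (forms A) = cls ` FF"
 unfolding forms_def forms_plain_def A_RCOSETS_def RCOSETS_def form_class_def a_r_coset_def by auto

lemma forms_plain_carrier: "car (forms_plain A) = cls ` FF"
 using forms_carrier by (simp add: forms_def)

lemma cls_zero: "\<zero>[forms A] = cls 0"
 by (simp add: forms_def forms_plain_def cls_eq_set)

lemma cls_add: "cls f +[forms A] cls g = cls (f + g)"
proof -
 have "cls f +[forms A] cls g = {h + k | h k. h : cls f & k : cls g}"
 by (auto simp: forms_def forms_plain_def set_add_def')
 also have "... = cls (f + g)"
 proof (rule equalityI; rule subsetI)
 fix x assume "x : {h + k | h k. h : cls f & k : cls g}"
 then obtain r s where "r : RR" "s : RR" "x = (r + f) + (s + g)" unfolding cls_eq_set by blast
 hence "x = (r + s) + (f + g)" "r + s : RR" using RR_add by (simp_all add: algebra_simps)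
 thus "x : cls (f + g)" unfolding cls_eq_set by blast
 next
 fix x assume "x : cls (f + g)"
 then obtain r where "r : RR" "x = r + (f + g)" unfolding cls_eq_set by blast
 hence "x = (r + f) + g" "r + f : cls f" by (auto simp: cls_eq_set add.assoc)
 thus "x : {h + k | h k. h : cls f & k : cls g}" using cls_self by blast
 qed
 finally show ?thesis .
qed

lemma cls_smult: "c .[forms A] cls f = cls (pm_scale c f)"
proof -
 have "cls (pm_scale c g) = cls (pm_scale c f)" if "g : cls f" for g
 proof -
 have "g - f : RR" using cls_mem[OF that] cls_eq_iff by blast
 hence "pm_scale c (g - f) : RR" by (rule RR_scale)
 moreover have "pm_scale c (g - f) = pm_scale c g - pm_scale c f"
 by (rule poly_mapping_eqI) (simp add: lookup_minus algebra_simps)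
 ultimately show ?thesis unfolding cls_eq_iff by simp
 qed
 hence "(UN g:cls f. cls (pm_scale c g)) = cls (pm_scale c f)" using cls_self by blast
 thus ?thesis by (simp add: forms_def forms_plain_def)
qed

lemma cvs_forms_plain: "cvs (forms_plain A)"
proof (rule cvs_image[OF cvs_free_forms, where q = cls])
 show "car (forms_plain A) = cls ` FF" by (rule forms_plain_carrier)
 show "cls x +[forms_plain A] cls y = cls (x +[free_forms A] y)" for x y
 using cls_add by (simp add: forms_def)
 show "c .[forms_plain A] cls x = cls (c .[free_forms A] x)" for c x
 using cls_smult by (simp add: forms_def)
 show "\<zero>[forms_plain A] = cls \<zero>[free_forms A]" using cls_zero by (simp add: forms_def)
qed

lemma word_sets_carrier:
 "{(%w. cls (fmono w)) ` fwords S | S. S : small A} <= Pow (car (forms_plain A))"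
proof clarify
 fix S and z :: "'a option" and as assume "S : small A" "(z, as) : fwords S"
 hence "fmono (z, as) : FF" using small_subset_carrier[of S] by (intro FF_fmono) (auto simp: fwords_iff)
 thus "cls (fmono (z, as)) : car (forms_plain A)" unfolding forms_plain_carrier by blast
qed

lemma convex_bornology_forms: "convex_bornology (forms A)"
 unfolding forms_def by (rule generated_bornology(1)[OF cvs_forms_plain word_sets_carrier])

sublocale forms: convex_bornology "forms A"
 by (rule convex_bornology_forms)

lemma cls_FF [simp]: "f : FF ==> cls f : car (forms A)"
 unfolding forms_carrier by blast

lemma cls_diff: assumes "f : FF" "g : FF" shows "cls (f - g) = cls f -[forms A] cls g"
proof -
 have "cls (f - g) = cls f +[forms A] ((-1) .[forms A] cls g)"
 unfolding pm_diff_eq by (simp add: cls_add cls_smult)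
 thus ?thesis using assms by (simp add: forms.smult_m1 a_minus_def)
qed

lemma word_sets_small: "S : small A ==> (%w. cls (fmono w)) ` fwords S : small (forms A)"
 using generated_bornology(2)[OF cvs_forms_plain word_sets_carrier] unfolding forms_def by auto

lemma forms_small_least:
 assumes "convex_bornology ((forms_plain A)\<lparr>small := B\<rparr>)" "!!S. S : small A ==> (%w. cls (fmono w)) ` fwords S : B"
 shows "small (forms A) <= B"
proof -
 have "bornology_generated (forms_plain A) {(%w. cls (fmono w)) ` fwords S | S. S : small A} <= B"
 by (rule generated_least[OF cvs_forms_plain word_sets_carrier assms(1)]) (use assms(2) in blast)
 thus ?thesis by (simp add: forms_def)
qed

lemma linear_on_forms_plain: "linear_on (forms_plain A) X f \<longleftrightarrow> linear_on (forms A) X f"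
 by (simp add: linear_on_def forms_def)

lemma forms_induct:
 assumes "C : car (forms A)" "!!w. w : fwords (car A) ==> Q (cls (fmono w))"
 "!!x y. x : car (forms A) ==> y : car (forms A) ==> Q x ==> Q y ==> Q (x +[forms A] y)"
 "!!c x. x : car (forms A) ==> Q x ==> Q (c .[forms A] x)" "Q \<zero>[forms A]"
 shows "Q C"
proof -
 obtain f where f: "f : FF" "C = cls f" using assms(1) unfolding forms_carrier by blast
 have "Q (cls f)"
 using f(1)
 proof (rule FF_induct)
 show "Q (cls 0)" using assms(5) cls_zero by simp
 show "Q (cls (f + g))" if "f : FF" "g : FF" "Q (cls f)" "Q (cls g)" for f g
 using assms(3)[of "cls f" "cls g"] that cls_add by simp
 show "Q (cls (pm_scale c f))" if "f : FF" "Q (cls f)" for c f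
 using assms(4)[of "cls f" c] that cls_smult by simp
 qed (rule assms(2))
 thus ?thesis using f(2) by simp
qed

text \<open>The map is viewed as a family with the single index \<open>()\<close>, for which
  \<open>preimage_bornology\<close> reduces boundedness to words.\<close>

lemma forms_bdd_linear:
 assumes X: "convex_bornology X" and f: "linear_on (forms A) X f"
 and bd: "!!S. S : small A ==> (%w. f (cls (fmono w))) ` fwords S : small X"
 shows "bdd_linear (forms A) X f"
proof -
 interpret X: convex_bornology X by fact
 let ?B = "{Y. Y <= car (forms_plain A) & {f y | i y. i : {()} & y : Y} : small X}"
 have "small (forms A) <= ?B"
 proof (rule forms_small_least)
 show "convex_bornology ((forms_plain A)\<lparr>small := ?B\<rparr>)"
 proof (rule preimage_bornology[OF cvs_forms_plain X, where f = "%i. f"])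
 show "linear_on (forms_plain A) X f" using f linear_on_forms_plain by blast
 show "{f x | i. i : {()}} : small X" if "x : car (forms_plain A)" for x
 using X.small_point linear_onD(1)[OF f] that forms_carrier forms_plain_carrier by simp
 qed
 fix S assume S: "S : small A"
 have "{f y | i y. i : {()} & y : (%w. cls (fmono w)) ` fwords S} = (%w. f (cls (fmono w))) ` fwords S" by auto
 thus "(%w. cls (fmono w)) ` fwords S : ?B" using bd[OF S] word_sets_carrier S by auto
 qed
 moreover have "{f y | i y. i : {()} & y : Y} = f ` Y" for Y by auto
 ultimately show ?thesis using f unfolding bdd_linear_def by auto
qed

end

lemma linear_on_comp: "linear_on V W f ==> linear_on W X g ==> linear_on V X (%x. g (f x))"
 by (auto simp: linear_on_def Pi_iff)

lemma linear_on_zero: assumes "cvs W" shows "linear_on V W (%x. \<zero>[W])"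
proof -
 interpret W: cvs W by fact
 show ?thesis by (auto simp: linear_on_def)
qed

lemma linear_on_add:
 assumes "cvs W" "linear_on V W f" "linear_on V W g" shows "linear_on V W (%x. f x +[W] g x)"
proof -
 interpret W: cvs W by fact
 show ?thesis using assms(2,3) by (auto simp: linear_on_def Pi_iff W.M.a_ac W.smult_radd)
qed

lemma linear_on_smult:
 assumes "cvs W" "linear_on V W f" shows "linear_on V W (%x. a .[W] f x)"
proof -
 interpret W: cvs W by fact
 show ?thesis using assms(2) by (auto simp: linear_on_def Pi_iff W.smult_radd W.smult_smult mult.commute)
qed

lemma linear_on_minus:
 assumes "cvs V" "cvs W" "linear_on V W f" "linear_on V W g" shows "linear_on V W (%x. f x -[W] g x)"
proof (rule linear_on_cong[OF assms(1)])
 interpret W: cvs W by fact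
 show "linear_on V W (%x. f x +[W] ((-1) .[W] g x))"
 by (rule linear_on_add[OF assms(2,3) linear_on_smult[OF assms(2,4)]])
 show "f x +[W] ((-1) .[W] g x) = f x -[W] g x" if "x : car V" for x
 using linear_onD(1)[OF assms(4) that] by (simp add: W.smult_m1 a_minus_def)
qed

context convex_bornology begin

lemma small_finite: "finite F ==> F <= car V ==> F : small V"
 by (induction rule: finite_induct) (auto simp: small_empty small_insert)

end

text \<open>\<open>None\<close> marks the adjoined unit and is not an argument: the first clause
  varies a genuine leading coefficient, the second an entry under \<open>d\<close>.\<close>

definition multilin :: "'a bvs => 'x bvs => ('a fword => 'x) => bool" where
 "multilin A X G \<longleftrightarrow> (ALL as. set as <= car A --> linear_on A X (%x. G (Some x, as)))
    & (ALL z as bs. set_option z <= car A & set as <= car A & set bs <= car A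
        --> linear_on A X (%x. G (z, as @ x # bs)))"

lemma multilinI:
 assumes "!!as. set as <= car A ==> linear_on A X (%x. G (Some x, as))"
 "!!z as bs. set_option z <= car A ==> set as <= car A ==> set bs <= car A ==> linear_on A X (%x. G (z, as @ x # bs))"
 shows "multilin A X G"
 using assms unfolding multilin_def by blast

lemma multilinD:
 assumes "multilin A X G"
 shows "set as <= car A ==> linear_on A X (%x. G (Some x, as))"
 "set_option z <= car A ==> set as <= car A ==> set bs <= car A ==> linear_on A X (%x. G (z, as @ x # bs))"
 using assms unfolding multilin_def by blast+

lemma multilin_carrier:
 assumes "multilin A X G" "w : fwords (car A)" shows "G w : car X"
proof -
 obtain z as where w: "w = (z, as)" by (cases w)
 show ?thesis
 proof (cases z)
 case (Some x)
 thus ?thesis using linear_onD(1)[OF multilinD(1)[OF assms(1), of as], of x] assms(2) w by (auto simp: fwords_def)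
 next
 case None
 then obtain a bs where "as = a # bs" using assms(2) w by (cases as) (auto simp: fwords_def)
 thus ?thesis using linear_onD(1)[OF multilinD(2)[OF assms(1), of None "[]" bs], of a] assms(2) w None
 by (auto simp: fwords_def)
 qed
qed

lemma multilin_zero: "cvs X ==> multilin A X (%w. \<zero>[X])"
 by (intro multilinI linear_on_zero)

lemma multilin_add: "cvs X ==> multilin A X G ==> multilin A X H ==> multilin A X (%w. G w +[X] H w)"
 by (intro multilinI linear_on_add) (auto dest: multilinD)

lemma multilin_smult: "cvs X ==> multilin A X G ==> multilin A X (%w. c .[X] G w)"
 by (intro multilinI linear_on_smult) (auto dest: multilinD)

context balg begin

lemma multilinear_relations_cases:
 assumes "r : multilinear_relations A"
 obtains (head) c x y as where "r = lin_rel (Some (c \<odot> x \<oplus> y), as) c (Some x, as) (Some y, as)"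
 "x : car A" "y : car A" "set as <= car A"
 | (entry) c x y z as bs where "r = lin_rel (z, as @ (c \<odot> x \<oplus> y) # bs) c (z, as @ x # bs) (z, as @ y # bs)"
 "x : car A" "y : car A" "set_option z <= car A" "set as <= car A" "set bs <= car A"
 using assms unfolding multilinear_relations_def lin_rel_def by blast

lemma forms_lift:
 assumes X: "cvs X" and G: "multilin A X G"
 shows "EX g. linear_on (forms A) X g & (ALL f:FF. g (cls f) = pmsum X G f)"
proof -
 interpret X: cvs X by fact
 have Gc: "G w : car X" if "w : fwords (car A)" for w using multilin_carrier[OF G that] .
 have keys: "w : fwords (car A)" if "f : FF" "w : supp f" for f w using that by (auto simp: FF_eq)
 have add: "pmsum X G (f + g) = pmsum X G f +[X] pmsum X G g" if "f : FF" "g : FF" for f g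
 by (rule X.pmsum_add) (use Gc keys that in blast)
 have scale: "pmsum X G (pm_scale c f) = c .[X] pmsum X G f" if "f : FF" for f c
 by (rule X.pmsum_scale) (use Gc keys that in blast)
 have pc: "pmsum X G f : car X" if "f : FF" for f
 by (rule X.pmsum_closed) (use Gc keys that in blast)
 have rel: "pmsum X G r = \<zero>[X]" if "r : multilinear_relations A" for r
 using that
 proof (cases rule: multilinear_relations_cases)
 case (head c x y as)
 note l = linear_onD[OF multilinD(1)[OF G head(4)]]
 show ?thesis unfolding head(1) by (subst X.pmsum_lin_rel_zero) (use l head in auto)
 next
 case (entry c x y z as bs)
 note l = linear_onD[OF multilinD(2)[OF G entry(4-6)]]
 show ?thesis unfolding entry(1) by (subst X.pmsum_lin_rel_zero) (use l entry in auto)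
 qed
 have ker: "pmsum X G r = \<zero>[X]" if "r : RR" for r
 by (rule cvs.lin_span_induct(1)[OF cvs_free_forms that[unfolded relation_space_def] multilinear_relations_FF])
 (use rel add scale in auto)
 define g where "g C = pmsum X G (SOME f. f : C)" for C
 have g: "g (cls f) = pmsum X G f" if f: "f : FF" for f
 proof -
 let ?h = "SOME h. h : cls f"
 have h: "?h : cls f" by (rule someI[of "%h. h : cls f", OF cls_self])
 hence hF: "?h : FF" and hR: "?h - f : RR" using cls_mem_FF[OF f] cls_mem cls_eq_iff by blast+
 have "pmsum X G ?h = pmsum X G (?h - f) +[X] pmsum X G f"
 using add[OF FF_diff[OF hF f] f] by simp
 thus ?thesis using ker[OF hR] pc[OF f] by (simp add: g_def)
 qed
 have "linear_on (forms A) X g"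
 unfolding linear_on_def
 proof (intro conjI ballI allI)
 show "g : car (forms A) \<rightarrow> car X" using g pc unfolding forms_carrier by auto
 next
 fix C D assume "C : car (forms A)" "D : car (forms A)"
 then obtain f h where *: "f : FF" "C = cls f" "h : FF" "D = cls h" unfolding forms_carrier by blast
 show "g (C +[forms A] D) = g C +[X] g D" using * by (simp add: cls_add g add)
 next
 fix c C assume "C : car (forms A)"
 then obtain f where *: "f : FF" "C = cls f" unfolding forms_carrier by blast
 show "g (c .[forms A] C) = c .[X] g C" using * by (simp add: cls_smult g scale)
 qed
 thus ?thesis using g by blast
qed

lemma cls_pm_extend:
 assumes "f : FF" "!!w. w : fwords (car A) ==> h w : FF"
 shows "cls (pm_extend h f) = pmsum (forms A) (%w. cls (h w)) f"
proof -
 have hc: "cls (h w) : car (forms A)" if "w : fwords (car A)" for w using assms(2)[OF that] by simp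
 have keys: "w : fwords (car A)" if "f : FF" "w : supp f" for f w using that by (auto simp: FF_eq)
 show ?thesis
 using assms(1)
 proof (rule FF_induct)
 show "cls (pm_extend h 0) = pmsum (forms A) (%w. cls (h w)) 0" by (simp add: cls_zero)
 show "cls (pm_extend h (fmono w)) = pmsum (forms A) (%w. cls (h w)) (fmono w)" if "w : fwords (car A)" for w
 using hc[OF that] by (simp add: forms.pmsum_single)
 show "cls (pm_extend h (f + g)) = pmsum (forms A) (%w. cls (h w)) (f + g)"
 if "f : FF" "g : FF" "cls (pm_extend h f) = pmsum (forms A) (%w. cls (h w)) f"
 "cls (pm_extend h g) = pmsum (forms A) (%w. cls (h w)) g" for f g
 proof -
 have "pmsum (forms A) (%w. cls (h w)) (f + g) = pmsum (forms A) (%w. cls (h w)) f +[forms A] pmsum (forms A) (%w. cls (h w)) g"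
 by (rule forms.pmsum_add) (use hc keys that in blast)
 thus ?thesis using that by (simp add: pm_extend_add cls_add[symmetric])
 qed
 show "cls (pm_extend h (pm_scale c f)) = pmsum (forms A) (%w. cls (h w)) (pm_scale c f)"
 if "f : FF" "cls (pm_extend h f) = pmsum (forms A) (%w. cls (h w)) f" for c f
 proof -
 have "pmsum (forms A) (%w. cls (h w)) (pm_scale c f) = c .[forms A] pmsum (forms A) (%w. cls (h w)) f"
 by (rule forms.pmsum_scale) (use hc keys that in blast)
 thus ?thesis using that by (simp add: pm_extend_scale cls_smult[symmetric])
 qed
 qed
qed

lemma induced_map:
 assumes "!!w. w : fwords (car A) ==> h w : FF" "multilin A (forms A) (%w. cls (h w))"
 shows "EX g. linear_on (forms A) (forms A) g & (ALL f:FF. g (cls f) = cls (pm_extend h f))"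
 using forms_lift[OF forms.cvs_axioms assms(2)] cls_pm_extend[OF _ assms(1)] by simp

abbreviation "L h \<equiv> linear_on A (forms A) (%a. cls (h a))"

lemma L_head: assumes "set as <= car A" shows "L (%a. fmono (Some a, as))"
proof (rule linear_onI'[OF cvs_axioms forms.cvs_axioms])
 show "cls (fmono (Some x, as)) : car (forms A)" if "x : car A" for x
 using that assms by (intro cls_FF FF_fmono) simp
 fix c x y assume "x : car A" "y : car A"
 hence "lin_rel (Some (c \<odot> x \<oplus> y), as) c (Some x, as) (Some y, as) : multilinear_relations A"
 unfolding multilinear_relations_def lin_rel_def using assms by (intro UnI1) blast
 hence "lin_rel (Some (c \<odot> x \<oplus> y), as) c (Some x, as) (Some y, as) : RR" using RR_rel by blast
 thus "cls (fmono (Some (c \<odot> x \<oplus> y), as)) = c .[forms A] cls (fmono (Some x, as)) +[forms A] cls (fmono (Some y, as))"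
 unfolding cls_smult cls_add cls_eq_iff lin_rel_def by (simp add: diff_diff_add)
qed

lemma L_entry:
 assumes "set_option z <= car A" "set as <= car A" "set bs <= car A"
 shows "L (%a. fmono (z, as @ a # bs))"
proof (rule linear_onI'[OF cvs_axioms forms.cvs_axioms])
 show "cls (fmono (z, as @ x # bs)) : car (forms A)" if "x : car A" for x
 using that assms by (intro cls_FF FF_fmono) (simp add: fwords_iff)
 fix c x y assume "x : car A" "y : car A"
 hence "lin_rel (z, as @ (c \<odot> x \<oplus> y) # bs) c (z, as @ x # bs) (z, as @ y # bs) : RR"
 using RR_rel assms unfolding multilinear_relations_def lin_rel_def by blast
 thus "cls (fmono (z, as @ (c \<odot> x \<oplus> y) # bs)) = c .[forms A] cls (fmono (z, as @ x # bs)) +[forms A] cls (fmono (z, as @ y # bs))"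
 unfolding cls_smult cls_add cls_eq_iff lin_rel_def by (simp add: diff_diff_add)
qed

section \<open>The product of forms\<close>

lemma append_d_simps [simp]:
 "append_d bs 0 = 0" "append_d bs (fmono (z, as)) = fmono (z, as @ bs)"
 "append_d bs (f + g) = append_d bs f + append_d bs g" "append_d bs (f - g) = append_d bs f - append_d bs g"
 "append_d bs (pm_scale c f) = pm_scale c (append_d bs f)"
 by (simp_all add: append_d_def pm_extend_add pm_extend_diff pm_extend_scale)

lemma append_d_FF: "f : FF ==> set bs <= car A ==> append_d bs f : FF"
 unfolding append_d_def by (rule FF_pm_extend) (force simp: FF_eq fwords_iff)

lemma append_d_append: "append_d bs (append_d as f) = append_d (as @ bs) f"
 by (rule pm_induct[of f UNIV]) auto

lemma append_d_linear:
 assumes "set bs <= car A"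
 shows "EX g. linear_on (forms A) (forms A) g & (ALL f:FF. g (cls f) = cls (append_d bs f))"
 unfolding append_d_def
proof (rule induced_map)
 show "(case w of (x, as) => fmono (x, as @ bs)) : FF" if "w : fwords (car A)" for w
 using that assms by (cases w) (auto intro!: FF_fmono simp: fwords_iff)
 show "multilin A (forms A) (%w. cls (case w of (x, as) => fmono (x, as @ bs)))"
 proof (rule multilinI)
 show "L (%x. case (Some x, as) of (x, as) => fmono (x, as @ bs))" if "set as <= car A" for as
 using L_head[of "as @ bs"] that assms by simp
 show "L (%x. case (z, as @ x # cs) of (x, as) => fmono (x, as @ bs))"
 if "set_option z <= car A" "set as <= car A" "set cs <= car A" for z as cs
 using L_entry[of z as "cs @ bs"] that assms by simp
 qed
qed

lemma L_append:
 assumes "L h" "!!a. a : car A ==> h a : FF" "set bs <= car A"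
 shows "L (%a. append_d bs (h a))"
proof -
 obtain g where g: "linear_on (forms A) (forms A) g" "ALL f:FF. g (cls f) = cls (append_d bs f)"
 using append_d_linear[OF assms(3)] by blast
 show ?thesis
 by (rule linear_on_cong[OF cvs_axioms _ linear_on_comp[OF assms(1) g(1)]]) (use g(2) assms(2) in simp)
qed

lemma L_minus:
 assumes "L h" "L k" "!!a. a : car A ==> h a : FF" "!!a. a : car A ==> k a : FF"
 shows "L (%a. h a - k a)"
 by (rule linear_on_cong[OF cvs_axioms _ linear_on_minus[OF cvs_axioms forms.cvs_axioms assms(1,2)]])
 (use assms(3,4) in "simp add: cls_diff")

lemma L_append_entry:
 assumes "f : FF" "set as <= car A" "set bs <= car A"
 shows "L (%a. append_d (as @ a # bs) f)"
 using assms(1)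
proof (rule FF_induct)
 show "L (%a. append_d (as @ a # bs) 0)" using linear_on_zero[OF forms.cvs_axioms] by (simp add: cls_zero)
 show "L (%a. append_d (as @ a # bs) (fmono w))" if "w : fwords (car A)" for w
 proof -
 obtain z cs where w: "w = (z, cs)" by (cases w)
 thus ?thesis using L_entry[of z "cs @ as" bs] that assms(2,3) by (simp add: fwords_iff)
 qed
 show "L (%a. append_d (as @ a # bs) (f + g))"
 if "L (%a. append_d (as @ a # bs) f)" "L (%a. append_d (as @ a # bs) g)" for f g
 using linear_on_add[OF forms.cvs_axioms that] by (simp add: cls_add)
 show "L (%a. append_d (as @ a # bs) (pm_scale c f))" if "L (%a. append_d (as @ a # bs) f)" for c f
 using linear_on_smult[OF forms.cvs_axioms that] by (simp add: cls_smult)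
qed

lemma form_rmult_FF:
 assumes "set_option x <= car A" "set as <= car A" "b : car A"
 shows "form_rmult A x as b : FF"
 using assms(2,3)
proof (induction as arbitrary: b)
 case Nil
 thus ?case using assms(1) by (cases x) (auto intro!: FF_fmono)
next
 case (Cons a as)
 thus ?case using assms(1) by (auto intro!: FF_diff FF_fmono append_d_FF simp: fwords_iff)
qed

lemma L_mult: "L h ==> b : car A ==> L (%a. h (a \<otimes> b))" "L h ==> b : car A ==> L (%a. h (b \<otimes> a))"
 by (rule linear_on_comp[OF mult_linear_left], assumption+) (rule linear_on_comp[OF mult_linear_right], assumption+)

text \<open>Together with the next two lemmas this makes the Leibniz recursion respect the relations
  in each slot: the right factor, the leading coefficient and the entries under
  \<open>d\<close>.\<close>

lemma L_rmult_right:
 assumes x: "set_option x <= car A" and as: "set as <= car A"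
 shows "L (%b. form_rmult A x as b)"
proof (cases as)
 case Nil
 show ?thesis
 proof (cases x)
 case None
 thus ?thesis using Nil L_head[of "[]"] by simp
 next
 case (Some y)
 thus ?thesis using Nil x L_mult(2)[OF L_head[of "[]"], of y] by simp
 qed
next
 case (Cons a cs)
 hence c: "a : car A" "set cs <= car A" using as by auto
 have "L (%b. fmono (x, rev cs @ [a \<otimes> b]) - append_d ([] @ b # []) (form_rmult A x cs a))"
 proof (rule L_minus)
 show "L (%b. fmono (x, rev cs @ [a \<otimes> b]))" using L_mult(2)[OF L_entry[OF x, of "rev cs" "[]"], of a] c by simp
 show "L (%b. append_d ([] @ b # []) (form_rmult A x cs a))"
 by (rule L_append_entry) (use form_rmult_FF[OF x c(2,1)] in auto)
 qed (use c x form_rmult_FF[OF x c(2,1)] in "auto intro!: FF_fmono append_d_FF simp: fwords_iff")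
 thus ?thesis using Cons by simp
qed

lemma L_rmult_head:
 assumes "set as <= car A" "b : car A"
 shows "L (%x. form_rmult A (Some x) as b)"
 using assms
proof (induction as arbitrary: b)
 case Nil
 thus ?case using L_mult(1)[OF L_head[of "[]"], of b] by simp
next
 case (Cons a as)
 have "L (%x. fmono (Some x, rev as @ [a \<otimes> b]) - append_d [b] (form_rmult A (Some x) as a))"
 proof (rule L_minus)
 show "L (%x. fmono (Some x, rev as @ [a \<otimes> b]))" by (rule L_head) (use Cons.prems in auto)
 show "L (%x. append_d [b] (form_rmult A (Some x) as a))"
 by (rule L_append[OF Cons.IH]) (use Cons.prems in "auto intro!: form_rmult_FF")
 qed (use Cons.prems in "auto intro!: FF_fmono append_d_FF form_rmult_FF simp: fwords_iff")
 thus ?case by simp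
qed

text \<open>The entry nearest to \<open>b\<close> becomes the right factor of the recursive call,
  which is where linearity in the right factor comes in; the other entries pass through the
  recursion.\<close>

lemma L_rmult_entry:
 assumes "set_option x <= car A" "set as <= car A" "set cs <= car A" "b : car A"
 shows "L (%e. form_rmult A x (as @ e # cs) b)"
 using assms(2,4)
proof (induction as arbitrary: b)
 case Nil
 have "L (%e. fmono (x, rev cs @ [e \<otimes> b]) - append_d [b] (form_rmult A x cs e))"
 proof (rule L_minus)
 show "L (%e. fmono (x, rev cs @ [e \<otimes> b]))"
 using L_mult(1)[OF L_entry[OF assms(1), of "rev cs" "[]"], of b] Nil assms by simp
 show "L (%e. append_d [b] (form_rmult A x cs e))"
 by (rule L_append[OF L_rmult_right[OF assms(1,3)]]) (use Nil assms in "auto intro!: form_rmult_FF")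
 qed (use Nil assms in "auto intro!: FF_fmono append_d_FF form_rmult_FF simp: fwords_iff")
 thus ?case by simp
next
 case (Cons a as)
 have "L (%e. fmono (x, rev cs @ e # (rev as @ [a \<otimes> b])) - append_d [b] (form_rmult A x (as @ e # cs) a))"
 proof (rule L_minus)
 show "L (%e. fmono (x, rev cs @ e # (rev as @ [a \<otimes> b])))"
 by (rule L_entry) (use Cons.prems assms in auto)
 show "L (%e. append_d [b] (form_rmult A x (as @ e # cs) a))"
 by (rule L_append[OF Cons.IH]) (use Cons.prems assms in "auto intro!: form_rmult_FF")
 qed (use Cons.prems assms in "auto intro!: FF_fmono append_d_FF form_rmult_FF simp: fwords_iff")
 thus ?case by simp
qed

lemma word_mult_FF:
 assumes "v : fwords (car A)" "w : fwords (car A)" shows "word_mult A v w : FF"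
proof -
 obtain x as y bs where "v = (x, as)" "w = (y, bs)" by (cases v, cases w)
 thus ?thesis using assms
 by (cases y) (auto intro!: FF_fmono append_d_FF form_rmult_FF simp: fwords_iff)
qed

lemma multilin_word_mult_right:
 assumes "v : fwords (car A)" shows "multilin A (forms A) (%w. cls (word_mult A v w))"
proof -
 obtain x as where v: "v = (x, as)" by (cases v)
 have x: "set_option x <= car A" "set as <= car A" using assms v by (auto simp: fwords_iff)
 show ?thesis
 proof (rule multilinI)
 show "L (%b. word_mult A v (Some b, bs))" if "set bs <= car A" for bs
 using L_append[OF L_rmult_right[OF x(1), of "rev as"] _ that] x v by (simp add: form_rmult_FF)
 show "L (%e. word_mult A v (z, bs @ e # cs))"
 if "set_option z <= car A" "set bs <= car A" "set cs <= car A" for z bs cs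
 proof (cases z)
 case None
 thus ?thesis using L_entry[of x "as @ bs" cs] x v that by simp
 next
 case (Some b)
 thus ?thesis using L_append_entry[of "form_rmult A x (rev as) b" bs cs] x v that by (simp add: form_rmult_FF)
 qed
 qed
qed

lemma multilin_word_mult_left:
 assumes "w : fwords (car A)" shows "multilin A (forms A) (%v. cls (word_mult A v w))"
proof -
 obtain y bs where w: "w = (y, bs)" by (cases w)
 have y: "set_option y <= car A" "set bs <= car A" using assms w by (auto simp: fwords_iff)
 show ?thesis
 proof (rule multilinI)
 show "L (%x. word_mult A (Some x, as) w)" if "set as <= car A" for as
 proof (cases y)
 case None
 thus ?thesis using L_head[of "as @ bs"] that y w by simp
 next
 case (Some b)
 thus ?thesis using L_append[OF L_rmult_head[of "rev as" b] _ y(2)] that y w by (simp add: form_rmult_FF)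
 qed
 show "L (%e. word_mult A (z, as @ e # cs) w)"
 if "set_option z <= car A" "set as <= car A" "set cs <= car A" for z as cs
 proof (cases y)
 case None
 thus ?thesis using L_entry[of z as "cs @ bs"] that y w by simp
 next
 case (Some b)
 thus ?thesis using L_append[OF L_rmult_entry[of z "rev cs" "rev as" b] _ y(2)] that y w by (simp add: form_rmult_FF)
 qed
 qed
qed

lemma word_free_mult_FF: "v : fwords (car A) ==> g : FF ==> pm_extend (word_mult A v) g : FF"
 by (rule FF_pm_extend) (auto simp: FF_eq[symmetric] intro!: word_mult_FF, auto simp: FF_eq)

lemma free_mult_FF: "f : FF ==> g : FF ==> free_mult A f g : FF"
 unfolding free_mult_def by (rule FF_pm_extend) (auto intro!: word_free_mult_FF, auto simp: FF_eq)

lemma free_mult_simps [simp]: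
 "free_mult A 0 g = 0" "free_mult A (f + f') g = free_mult A f g + free_mult A f' g"
 "free_mult A (pm_scale c f) g = pm_scale c (free_mult A f g)"
 "free_mult A (fmono v) g = pm_extend (word_mult A v) g"
 by (simp_all add: free_mult_def pm_extend_add pm_extend_scale)

lemma free_mult_left_linear:
 assumes g: "g : FF"
 shows "EX h. linear_on (forms A) (forms A) h & (ALL f:FF. h (cls f) = cls (free_mult A f g))"
 unfolding free_mult_def
proof (rule induced_map)
 show "pm_extend (word_mult A v) g : FF" if "v : fwords (car A)" for v
 using word_free_mult_FF that g by blast
 show "multilin A (forms A) (%v. cls (pm_extend (word_mult A v) g))"
 using g
 proof (rule FF_induct)
 show "multilin A (forms A) (%v. cls (pm_extend (word_mult A v) 0))"
 using multilin_zero[OF forms.cvs_axioms] by (simp add: cls_zero)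
 show "multilin A (forms A) (%v. cls (pm_extend (word_mult A v) (f + g)))"
 if "multilin A (forms A) (%v. cls (pm_extend (word_mult A v) f))" "multilin A (forms A) (%v. cls (pm_extend (word_mult A v) g))" for f g
 using multilin_add[OF forms.cvs_axioms that] by (simp add: cls_add pm_extend_add)
 show "multilin A (forms A) (%v. cls (pm_extend (word_mult A v) (pm_scale c f)))"
 if "multilin A (forms A) (%v. cls (pm_extend (word_mult A v) f))" for c f
 using multilin_smult[OF forms.cvs_axioms that] by (simp add: cls_smult pm_extend_scale)
 qed (simp add: multilin_word_mult_left)
qed

lemma free_mult_right_linear:
 assumes "f : FF"
 shows "EX h. linear_on (forms A) (forms A) h & (ALL g:FF. h (cls g) = cls (free_mult A f g))"
 using assms
proof (rule FF_induct)
 show "EX h. linear_on (forms A) (forms A) h & (ALL g:FF. h (cls g) = cls (free_mult A 0 g))"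
 using linear_on_zero[OF forms.cvs_axioms] cls_zero by (intro exI[of _ "%x. \<zero>[forms A]"]) simp
 show "EX h. linear_on (forms A) (forms A) h & (ALL g:FF. h (cls g) = cls (free_mult A (fmono v) g))"
 if "v : fwords (car A)" for v
 using induced_map[OF word_mult_FF[OF that] multilin_word_mult_right[OF that]] by simp
 show "EX h. linear_on (forms A) (forms A) h & (ALL g:FF. h (cls g) = cls (free_mult A (f + f') g))"
 if H: "EX h. linear_on (forms A) (forms A) h & (ALL g:FF. h (cls g) = cls (free_mult A f g))"
 "EX h. linear_on (forms A) (forms A) h & (ALL g:FF. h (cls g) = cls (free_mult A f' g))" for f f'
 proof -
 obtain h where h: "linear_on (forms A) (forms A) h" "ALL g:FF. h (cls g) = cls (free_mult A f g)" using H(1) by blast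
 obtain h' where h': "linear_on (forms A) (forms A) h'" "ALL g:FF. h' (cls g) = cls (free_mult A f' g)" using H(2) by blast
 show ?thesis using linear_on_add[OF forms.cvs_axioms h(1) h'(1)] h(2) h'(2)
 by (intro exI[of _ "%x. h x +[forms A] h' x"]) (simp add: cls_add)
 qed
 show "EX h. linear_on (forms A) (forms A) h & (ALL g:FF. h (cls g) = cls (free_mult A (pm_scale c f) g))"
 if H: "EX h. linear_on (forms A) (forms A) h & (ALL g:FF. h (cls g) = cls (free_mult A f g))" for c f
 proof -
 obtain h where "linear_on (forms A) (forms A) h" "ALL g:FF. h (cls g) = cls (free_mult A f g)" using H by blast
 thus ?thesis using linear_on_smult[OF forms.cvs_axioms, of "forms A" h c]
 by (intro exI[of _ "%x. c .[forms A] h x"]) (simp add: cls_smult)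
 qed
qed

text \<open>The product of cosets is a union over all representatives. It is a single class because
  representatives can be exchanged one factor at a time, each time under a linear map that is
  defined on classes.\<close>

lemma cls_mult:
 assumes f: "f : FF" and g: "g : FF" shows "cls f *[forms A] cls g = cls (free_mult A f g)"
proof -
 have "cls (free_mult A f' g') = cls (free_mult A f g)" if f': "f' : cls f" and g': "g' : cls g" for f' g'
 proof -
 have F: "f' : FF" "g' : FF" using cls_mem_FF f g f' g' by blast+
 obtain h where h: "ALL f:FF. h (cls f) = cls (free_mult A f g')" using free_mult_left_linear[OF F(2)] by blast
 obtain k where k: "ALL g:FF. k (cls g) = cls (free_mult A f g)" using free_mult_right_linear[OF f] by blast
 have "cls (free_mult A f' g') = cls (free_mult A f g')" using h F(1) f cls_mem[OF f'] by metis
 also have "... = cls (free_mult A f g)" using k F(2) g cls_mem[OF g'] by metis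
 finally show ?thesis .
 qed
 hence "(\<Union>f'\<in>cls f. \<Union>g'\<in>cls g. cls (free_mult A f' g')) = cls (free_mult A f g)"
 using cls_self[of f] cls_self[of g] by blast
 thus ?thesis by (simp add: forms_def forms_plain_def)
qed

lemma forms_mult_linear_left:
 assumes "D : car (forms A)" shows "linear_on (forms A) (forms A) (%C. C *[forms A] D)"
proof -
 obtain g where g: "g : FF" "D = cls g" using assms unfolding forms_carrier by blast
 obtain h where h: "linear_on (forms A) (forms A) h" "ALL f:FF. h (cls f) = cls (free_mult A f g)"
 using free_mult_left_linear[OF g(1)] by blast
 show ?thesis
 by (rule linear_on_cong[OF forms.cvs_axioms _ h(1)]) (use h(2) g cls_mult in "auto simp: forms_carrier")
qed

lemma forms_mult_linear_right:
 assumes "C : car (forms A)" shows "linear_on (forms A) (forms A) (%D. C *[forms A] D)"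
proof -
 obtain g where g: "g : FF" "C = cls g" using assms unfolding forms_carrier by blast
 obtain h where h: "linear_on (forms A) (forms A) h" "ALL f:FF. h (cls f) = cls (free_mult A g f)"
 using free_mult_right_linear[OF g(1)] by blast
 show ?thesis
 by (rule linear_on_cong[OF forms.cvs_axioms _ h(1)]) (use h(2) g cls_mult in "auto simp: forms_carrier")
qed

lemma fwords_mono: "S <= T ==> fwords S <= fwords T"
 by (auto simp: fwords_def)

text \<open>Doubling the entry that the Leibniz rule moves to the end turns the number of summands of
 \<open>\<langle>x\<rangle>da\<^sub>1 \<dots> da\<^sub>n \<cdot> b\<close> into a geometric series.\<close>

lemma form_rmult_bounded:
 assumes D: "cdisk (forms A) D" and S: "S <= car A" and T: "T <= car A" and ST: "S <= T"
 and SS: "!!x y. x : S ==> y : S ==> x \<otimes> y : T" and S2: "!!x. x : S ==> 2 \<odot> x : T"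
 and TD: "(%w. cls (fmono w)) ` fwords T <= D" and x: "set_option x <= S"
 and "set as <= S" "b : S" "set bs <= T"
 shows "cls (append_d bs (form_rmult A x as b)) : forms.sc 2 D"
 using assms(9-11)
proof (induction as arbitrary: b bs)
 interpret D: cdisk "forms A" D by fact
 have w1: "cls (fmono w) : forms.sc 2 D" if "w : fwords T" for w
 using TD that D.sc_mono[of "cls (fmono w)" 1 2] by auto
 case Nil
 show ?case
 proof (cases x)
 case None
 thus ?thesis using Nil ST w1[of "(Some b, bs)"] by (simp add: subset_iff)
 next
 case (Some y)
 thus ?thesis using Nil SS x w1[of "(Some (y \<otimes> b), bs)"] by simp
 qed
next
 interpret D: cdisk "forms A" D by fact
 case (Cons a as)
 let ?F = "form_rmult A x as a"
 have as: "set as <= S" "a : S" "b : S" "set bs <= T" using Cons.prems by auto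
 have c: "set_option x <= car A" "set as <= car A" "a : car A" "b : car A" "set bs <= car A"
 using as x S T by blast+
 have FFF: "?F : FF" using form_rmult_FF c by blast
 have w: "cls (fmono (x, rev as @ (a \<otimes> b) # bs)) : forms.sc 1 D"
 proof -
 have "(x, rev as @ (a \<otimes> b) # bs) : fwords T" using as x ST SS by (auto simp: fwords_iff)
 thus ?thesis using TD by auto
 qed
 have two: "cls (append_d ((2 \<odot> b) # bs) ?F) : forms.sc 2 D"
 by (rule Cons.IH) (use as S2 in auto)
 have "cls (append_d ((2 \<odot> b) # bs) ?F) = 2 .[forms A] cls (append_d (b # bs) ?F)"
 using linear_onD(3)[OF L_append_entry[OF FFF, of "[]" bs] c(4), of 2] c by simp
 hence "(1/2) .[forms A] cls (append_d ((2 \<odot> b) # bs) ?F) = cls (append_d (b # bs) ?F)"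
 using append_d_FF[OF FFF, of "b # bs"] c by (simp add: forms.smult_smult)
 hence half: "cls (append_d (b # bs) ?F) : forms.sc 1 D"
 using D.sc_smult[OF two, of "1/2" 1] by (simp add: norm_divide)
 have "append_d bs (form_rmult A x (a # as) b) = fmono (x, rev as @ (a \<otimes> b) # bs) - append_d (b # bs) ?F"
 by (simp add: append_d_append)
 hence "cls (append_d bs (form_rmult A x (a # as) b)) = cls (fmono (x, rev as @ (a \<otimes> b) # bs)) -[forms A] cls (append_d (b # bs) ?F)"
 using cls_diff[OF _ append_d_FF[OF FFF]] c by (simp add: FF_fmono fwords_iff)
 thus ?case using D.sc_minus[OF w half] by simp
qed

lemma word_products_small:
 assumes S: "S : small A" and S': "S' : small A"
 shows "{cls (fmono v) *[forms A] cls (fmono w) | v w. v : fwords S & w : fwords S'} : small (forms A)"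
proof -
 let ?S = "S Un S'"
 \<comment> \<open>\<open>?T\<close> has to hold the entries themselves, the products created by the
   Leibniz rule and the doubled entries behind the geometric series.\<close>
 let ?T = "?S Un {x \<otimes> y | x y. x : ?S & y : ?S} Un (%x. 2 \<odot> x) ` ?S"
 have Sm: "?S : small A" using small_Un[OF S S'] .
 have Tm: "?T : small A" using small_Un[OF small_Un[OF Sm mult_small[OF Sm Sm]] small_scale[OF Sm]] .
 have Sc: "?S <= car A" and Tc: "?T <= car A" using small_subset_carrier[OF Sm] small_subset_carrier[OF Tm] by auto
 obtain D where D: "D : small (forms A)" "cdisk (forms A) D" "(%w. cls (fmono w)) ` fwords ?T <= D"
 using forms.small_disk[OF word_sets_small[OF Tm]] by blast
 interpret D: cdisk "forms A" D by fact
 have "cls (fmono v) *[forms A] cls (fmono w) : forms.sc 2 D" if v: "v : fwords S" and w: "w : fwords S'" for v w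
 proof -
 have vc: "v : fwords ?S" "w : fwords ?S" using v w fwords_mono[of S ?S] fwords_mono[of S' ?S] by blast+
 hence vC: "v : fwords (car A)" "w : fwords (car A)" using fwords_mono[OF Sc] by blast+
 obtain x as y bs where e: "v = (x, as)" "w = (y, bs)" by (cases v, cases w)
 have "cls (word_mult A v w) : forms.sc 2 D"
 proof (cases y)
 case None
 hence "(x, as @ bs) : fwords ?T" using vc e by (auto simp: fwords_iff)
 hence "cls (fmono (x, as @ bs)) : D" using D(3) by blast
 hence "cls (fmono (x, as @ bs)) : forms.sc 2 D" using D.sc_mono[of _ 1 2] by simp
 thus ?thesis using e None by simp
 next
 case (Some b)
 have "cls (append_d bs (form_rmult A x (rev as) b)) : forms.sc 2 D"
 by (rule form_rmult_bounded[OF D(2) Sc Tc _ _ _ D(3)]) (use vc e Some in "auto simp: fwords_iff")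
 thus ?thesis using e Some by simp
 qed
 thus ?thesis using cls_mult[OF FF_fmono[OF vC(1)] FF_fmono[OF vC(2)]] by simp
 qed
 hence "{cls (fmono v) *[forms A] cls (fmono w) | v w. v : fwords S & w : fwords S'} <= forms.sc 2 D" by blast
 thus ?thesis using forms.small_subset[OF forms.small_sc[OF D(1)]] by blast
qed

lemma word_in_small:
 assumes "w : fwords (car A)" obtains S where "S : small A" "w : fwords S"
proof -
 obtain z as where w: "w = (z, as)" by (cases w)
 have "set_option z Un set as : small A" by (rule small_finite) (use assms w in "auto simp: fwords_iff")
 thus thesis using that[of "set_option z Un set as"] assms w by (auto simp: fwords_iff)
qed

text \<open>Supplies the condition on single points in \<open>preimage_bornology\<close>: an element
  is a finite combination of words, and sums and multiples of small sets are small.\<close>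

lemma forms_pointwise_small:
 assumes lin: "!!i. i : I ==> linear_on (forms A) (forms A) (f i)"
 and word: "!!w. w : fwords (car A) ==> {f i (cls (fmono w)) | i. i : I} : small (forms A)"
 and x: "x : car (forms A)"
 shows "{f i x | i. i : I} : small (forms A)"
 using x
proof (rule forms_induct)
 fix x y assume x: "x : car (forms A)" "y : car (forms A)"
 and s: "{f i x | i. i : I} : small (forms A)" "{f i y | i. i : I} : small (forms A)"
 have "{f i (x +[forms A] y) | i. i : I} <= {f i x | i. i : I} <+>\<^bsub>forms A\<^esub> {f i y | i. i : I}"
 proof
 fix z assume "z : {f i (x +[forms A] y) | i. i : I}"
 then obtain i where i: "i : I" "z = f i (x +[forms A] y)" by blast
 hence "z = f i x +[forms A] f i y" using linear_onD(2)[OF lin[OF i(1)] x] by simp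
 thus "z : {f i x | i. i : I} <+>\<^bsub>forms A\<^esub> {f i y | i. i : I}" unfolding set_add_def' using i(1) by blast
 qed
 thus "{f i (x +[forms A] y) | i. i : I} : small (forms A)"
 using forms.small_subset[OF forms.small_sum[OF s]] by blast
next
 fix c x assume x: "x : car (forms A)" and s: "{f i x | i. i : I} : small (forms A)"
 have "{f i (c .[forms A] x) | i. i : I} <= (%y. c .[forms A] y) ` {f i x | i. i : I}"
 using linear_onD(3)[OF lin x] by blast
 thus "{f i (c .[forms A] x) | i. i : I} : small (forms A)"
 using forms.small_subset[OF forms.small_scale[OF s]] by blast
next
 interpret cvs_pair "forms A" "forms A" by unfold_locales
 have "{f i \<zero>[forms A] | i. i : I} <= {\<zero>[forms A]}" using lin_zero[OF lin] by blast
 thus "{f i \<zero>[forms A] | i. i : I} : small (forms A)"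
 using forms.small_subset[OF forms.small_point[OF forms.M.zero_closed]] by blast
qed (rule word)

text \<open>Products of words with words are bounded already. With words on the left the right
  factor is passed to an arbitrary small set, and then the left factor as well, each time by
  minimality of the generated bornology.\<close>

lemma forms_mult_bdd: "bdd_bilinear (forms A) (forms A) (forms A) (mult (forms A))"
 unfolding bdd_bilinear_def
proof (intro conjI ballI)
 fix Y Z assume Y: "Y : small (forms A)" and Z: "Z : small (forms A)"
 let ?w = "%w. cls (fmono w)"
 have wc: "?w v : car (forms A)" if "v : fwords S" "S : small A" for v S
 using that fwords_mono[OF small_subset_carrier[OF that(2)]] by (intro cls_FF FF_fmono) blast
 have linl: "linear_on (forms_plain A) (forms A) (%C. C *[forms A] D)" if "D : car (forms A)" for D
 using forms_mult_linear_left[OF that] linear_on_forms_plain by blast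
 have linr: "linear_on (forms_plain A) (forms A) (%D. C *[forms A] D)" if "C : car (forms A)" for C
 using forms_mult_linear_right[OF that] linear_on_forms_plain by blast
 have step1: "{?w v *[forms A] z | v z. v : fwords S & z : Z} : small (forms A)" if S: "S : small A" and Z: "Z : small (forms A)" for S Z
 proof -
 let ?B = "{Z. Z <= car (forms_plain A) & {?w v *[forms A] z | v z. v : fwords S & z : Z} : small (forms A)}"
 have "small (forms A) <= ?B"
 proof (rule forms_small_least)
 show "convex_bornology ((forms_plain A)\<lparr>small := ?B\<rparr>)"
 proof (rule preimage_bornology[OF cvs_forms_plain convex_bornology_forms linr])
 show "?w v : car (forms A)" if "v : fwords S" for v using wc[OF that S] .
 fix x assume "x : car (forms_plain A)"
 hence x: "x : car (forms A)" using forms_carrier forms_plain_carrier by simp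
 show "{?w i *[forms A] x | i. i : fwords S} : small (forms A)"
 using _ _ x
 proof (rule forms_pointwise_small)
 show "linear_on (forms A) (forms A) (%x. ?w i *[forms A] x)" if "i : fwords S" for i
 using forms_mult_linear_right wc[OF that S] by blast
 fix w assume "w : fwords (car A)"
 then obtain S' where S': "S' : small A" "w : fwords S'" using word_in_small by blast
 show "{?w i *[forms A] ?w w | i. i : fwords S} : small (forms A)"
 by (rule forms.small_subset[OF word_products_small[OF S S'(1)]]) (use S'(2) in blast)
 qed
 qed
 fix S' assume S': "S' : small A"
 have "{?w v *[forms A] z | v z. v : fwords S & z : ?w ` fwords S'} : small (forms A)"
 by (rule forms.small_subset[OF word_products_small[OF S S']]) blast
 thus "?w ` fwords S' : ?B" using word_sets_carrier S' by blast
 qed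
 thus ?thesis using Z by blast
 qed
 let ?B = "{Y. Y <= car (forms_plain A) & {y *[forms A] z | z y. z : Z & y : Y} : small (forms A)}"
 have "small (forms A) <= ?B"
 proof (rule forms_small_least)
 have zc: "z : car (forms A)" if "z : Z" for z using forms.small_subset_carrier[OF Z] that by blast
 show "convex_bornology ((forms_plain A)\<lparr>small := ?B\<rparr>)"
 proof (rule preimage_bornology[OF cvs_forms_plain convex_bornology_forms linl[OF zc]])
 fix x assume "x : car (forms_plain A)"
 hence x: "x : car (forms A)" using forms_carrier forms_plain_carrier by simp
 show "{x *[forms A] i | i. i : Z} : small (forms A)"
 using _ _ x
 proof (rule forms_pointwise_small)
 show "linear_on (forms A) (forms A) (%x. x *[forms A] i)" if "i : Z" for i
 using forms_mult_linear_left zc[OF that] by blast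
 fix w assume "w : fwords (car A)"
 then obtain S' where S': "S' : small A" "w : fwords S'" using word_in_small by blast
 show "{?w w *[forms A] i | i. i : Z} : small (forms A)"
 by (rule forms.small_subset[OF step1[OF S'(1) Z]]) (use S'(2) in blast)
 qed
 qed
 fix S' assume S': "S' : small A"
 have "{y *[forms A] z | z y. z : Z & y : ?w ` fwords S'} : small (forms A)"
 by (rule forms.small_subset[OF step1[OF S' Z]]) blast
 thus "?w ` fwords S' : ?B" using word_sets_carrier S' by blast
 qed
 hence "{y *[forms A] z | z y. z : Z & y : Y} : small (forms A)" using Y by blast
 thus "{x *[forms A] y | x y. x : Y & y : Z} : small (forms A)"
 by (rule forms.small_subset) blast
qed (use forms_mult_linear_left forms_mult_linear_right in auto)

section \<open>Differential, grading and part of degree zero\<close>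

lemma class_union: "(!!g. g : cls f ==> cls (k g) = cls (k f)) ==> (UN g:cls f. cls (k g)) = cls (k f)"
 using cls_self by blast

lemma forms_d:
 shows "bdd_linear (forms A) (forms A) (forms_d A)" "f : FF ==> forms_d A (cls f) = cls (free_d f)"
proof -
 let ?h = "%(x, as). case x of None => 0 | Some a => fmono (None, a # as)"
 have hF: "?h w : FF" if "w : fwords (car A)" for w
 using that by (cases w) (auto intro!: FF_fmono split: option.splits)
 have "multilin A (forms A) (%w. cls (?h w))"
 proof (rule multilinI)
 show "L (%x. ?h (Some x, as))" if "set as <= car A" for as
 using L_entry[of None "[]" as] that by simp
 show "L (%x. ?h (z, as @ x # bs))" if "set_option z <= car A" "set as <= car A" "set bs <= car A" for z as bs
 proof (cases z)
 case None
 thus ?thesis using linear_on_zero[OF forms.cvs_axioms] by (simp add: cls_zero)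
 next
 case (Some a)
 thus ?thesis using L_entry[of None "a # as" bs] that by simp
 qed
 qed
 from induced_map[OF hF this] obtain g where g: "linear_on (forms A) (forms A) g" "ALL f:FF. g (cls f) = cls (free_d f)"
 unfolding free_d_def by blast
 show d: "forms_d A (cls f) = cls (free_d f)" if f: "f : FF" for f
 unfolding forms_d_def by (rule class_union) (use g(2) f cls_mem cls_mem_FF in metis)
 have l: "linear_on (forms A) (forms A) (forms_d A)"
 by (rule linear_on_cong[OF forms.cvs_axioms _ g(1)]) (use g(2) d in "auto simp: forms_carrier")
 show "bdd_linear (forms A) (forms A) (forms_d A)"
 proof (rule forms_bdd_linear[OF convex_bornology_forms l])
 fix S assume S: "S : small A"
 have "(%w. forms_d A (cls (fmono w))) ` fwords S <= insert \<zero>[forms A] ((%w. cls (fmono w)) ` fwords S)"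
 proof clarify
 fix x as assume w: "(x, as) : fwords S" and n: "forms_d A (cls (fmono (x, as))) \<notin> (%w. cls (fmono w)) ` fwords S"
 have "fmono (x, as) : FF" using w fwords_mono[OF small_subset_carrier[OF S]] by (intro FF_fmono) blast
 hence e: "forms_d A (cls (fmono (x, as))) = cls (free_d (fmono (x, as)))" by (rule d)
 show "forms_d A (cls (fmono (x, as))) = \<zero>[forms A]"
 proof (cases x)
 case None
 thus ?thesis using e by (simp add: free_d_def cls_zero)
 next
 case (Some a)
 hence "(None, a # as) : fwords S" using w by simp
 moreover have "forms_d A (cls (fmono (x, as))) = cls (fmono (None, a # as))" using e Some by (simp add: free_d_def)
 ultimately show ?thesis using n by blast
 qed
 qed
 thus "(%w. forms_d A (cls (fmono w))) ` fwords S : small (forms A)"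
 using forms.small_subset[OF forms.small_insert[OF forms.M.zero_closed word_sets_small[OF S]]] by blast
 qed
qed

lemma forms_grading:
 shows "bdd_linear (forms A) (forms A) (forms_grading A)" "f : FF ==> forms_grading A (cls f) = cls (free_grading f)"
proof -
 let ?h = "%(x, as). pm_scale ((-1) ^ length as) (fmono (x, as)) :: 'a fform"
 have hF: "?h w : FF" if "w : fwords (car A)" for w
 using that FF_fmono by (cases w) auto
 have "multilin A (forms A) (%w. cls (?h w))"
 proof (rule multilinI)
 show "L (%x. ?h (Some x, as))" if "set as <= car A" for as
 using linear_on_smult[OF forms.cvs_axioms L_head[OF that]] by (simp add: cls_smult)
 show "L (%x. ?h (z, as @ x # bs))" if "set_option z <= car A" "set as <= car A" "set bs <= car A" for z as bs
 using linear_on_smult[OF forms.cvs_axioms L_entry[OF that]] by (simp add: cls_smult)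
 qed
 from induced_map[OF hF this] obtain g where g: "linear_on (forms A) (forms A) g" "ALL f:FF. g (cls f) = cls (free_grading f)"
 unfolding free_grading_def by blast
 show d: "forms_grading A (cls f) = cls (free_grading f)" if f: "f : FF" for f
 unfolding forms_grading_def by (rule class_union) (use g(2) f cls_mem cls_mem_FF in metis)
 have l: "linear_on (forms A) (forms A) (forms_grading A)"
 by (rule linear_on_cong[OF forms.cvs_axioms _ g(1)]) (use g(2) d in "auto simp: forms_carrier")
 show "bdd_linear (forms A) (forms A) (forms_grading A)"
 proof (rule forms_bdd_linear[OF convex_bornology_forms l])
 fix S assume S: "S : small A"
 let ?W = "(%w. cls (fmono w)) ` fwords S"
 have "(%w. forms_grading A (cls (fmono w))) ` fwords S <= (%x. 1 .[forms A] x) ` ?W Un (%x. (-1) .[forms A] x) ` ?W"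
 proof clarify
 fix x as assume w: "(x, as) : fwords S" and n: "forms_grading A (cls (fmono (x, as))) \<notin> (%x. (-1) .[forms A] x) ` ?W"
 have "fmono (x, as) : FF" using w fwords_mono[OF small_subset_carrier[OF S]] by (intro FF_fmono) blast
 hence "forms_grading A (cls (fmono (x, as))) = cls (free_grading (fmono (x, as)))" by (rule d)
 hence e: "forms_grading A (cls (fmono (x, as))) = ((-1) ^ length as) .[forms A] cls (fmono (x, as))"
 by (simp add: free_grading_def cls_smult)
 have "(-1) ^ length as = (1::complex) \<or> (-1) ^ length as = (-1::complex)" by (cases "even (length as)") auto
 thus "forms_grading A (cls (fmono (x, as))) : (%x. 1 .[forms A] x) ` ?W" using e w n by auto
 qed
 thus "(%w. forms_grading A (cls (fmono w))) ` fwords S : small (forms A)"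
 using forms.small_subset[OF forms.small_Un[OF forms.small_scale[OF word_sets_small[OF S]] forms.small_scale[OF word_sets_small[OF S]]]] by blast
 qed
qed

definition deg0 :: "'a fword => 'a" where
 "deg0 w = (case w of (Some a, []) => a | _ => \<zero>)"

lemma deg0_simps [simp]: "deg0 (Some a, []) = a" "deg0 (None, as) = \<zero>" "deg0 (z, a # as) = \<zero>" "deg0 (z, as @ a # bs) = \<zero>"
 by (auto simp: deg0_def split: option.splits list.splits)

text \<open>\<open>the_elem\<close> is meaningful here because \<open>free_degree0\<close> evaluates
  a multilinear function of words and is therefore constant on each class.\<close>

lemma forms_degree0:
 shows "bdd_linear (forms A) A (forms_degree0 A)" "w : fwords (car A) ==> forms_degree0 A (cls (fmono w)) = deg0 w"
proof -
 have ml: "multilin A A deg0"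
 proof (rule multilinI)
 show "linear_on A A (%x. deg0 (Some x, as))" for as
 by (cases as) (use linear_on_zero[OF cvs_axioms] in "auto simp: linear_on_def")
 show "linear_on A A (%x. deg0 (z, as @ x # bs))" for z as bs
 using linear_on_zero[OF cvs_axioms] by simp
 qed
 from forms_lift[OF cvs_axioms ml] obtain g where g: "linear_on (forms A) A g" "ALL f:FF. g (cls f) = pmsum A deg0 f" by blast
 have free: "free_degree0 A f = pmsum A deg0 f" if f: "f : FF" for f
 proof -
 let ?K = "supp f" and ?Z = "{a. (Some a, []) : supp f}"
 have inj: "inj_on (%a. (Some a, [])) ?Z" by (auto simp: inj_on_def)
 have sub: "(%a. (Some a, [])) ` ?Z <= ?K" by auto
 have Kc: "w : fwords (car A)" if "w : ?K" for w using f that by (auto simp: FF_eq)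
 have "pmsum A deg0 f = (\<Oplus>w\<in>(%a. (Some a, [])) ` ?Z. coef f w \<odot> deg0 w)"
 unfolding pmsum_def
 proof (rule M.add.finprod_mono_neutral_cong_right[OF _ sub])
 fix w assume w: "w : ?K - (%a. (Some a, [])) ` ?Z"
 obtain z as where "w = (z, as)" by (cases w)
 hence "deg0 w = \<zero>" using w by (cases z; cases as) auto
 thus "coef f w \<odot> deg0 w = \<zero>" by simp
 qed (use multilin_carrier[OF ml Kc] in auto)
 also have "... = (\<Oplus>a\<in>?Z. coef f (Some a, []) \<odot> deg0 (Some a, []))"
 by (rule M.add.finprod_reindex[OF _ inj]) (use Kc in force)
 also have "... = free_degree0 A f" unfolding free_degree0_def by simp
 finally show ?thesis by simp
 qed
 have d: "forms_degree0 A (cls f) = pmsum A deg0 f" if f: "f : FF" for f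
 proof -
 have "free_degree0 A h = free_degree0 A f" if "h : cls f" for h
 using free[OF cls_mem_FF[OF f that]] free[OF f] g(2) cls_mem_FF[OF f that] f cls_mem[OF that] by metis
 hence "free_degree0 A ` cls f = {free_degree0 A f}" using cls_self by blast
 thus ?thesis using free[OF f] by (simp add: forms_degree0_def)
 qed
 have l: "linear_on (forms A) A (forms_degree0 A)"
 by (rule linear_on_cong[OF forms.cvs_axioms _ g(1)]) (use g(2) d in "auto simp: forms_carrier")
 show w: "forms_degree0 A (cls (fmono w)) = deg0 w" if "w : fwords (car A)" for w
 using d[OF FF_fmono[OF that]] multilin_carrier[OF ml that] by (simp add: pmsum_single)
 show "bdd_linear (forms A) A (forms_degree0 A)"
 proof (rule forms_bdd_linear[OF born l])
 fix S assume S: "S : small A"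
 have "(%w. forms_degree0 A (cls (fmono w))) ` fwords S <= insert \<zero> S"
 proof clarify
 fix x as assume w': "(x, as) : fwords S" and n: "forms_degree0 A (cls (fmono (x, as))) \<notin> S"
 have "(x, as) : fwords (car A)" using w' fwords_mono[OF small_subset_carrier[OF S]] by blast
 thus "forms_degree0 A (cls (fmono (x, as))) = \<zero>" using w[of "(x, as)"] n w' by (cases x; cases as) auto
 qed
 thus "(%w. forms_degree0 A (cls (fmono w))) ` fwords S : small A"
 using small_subset[OF small_insert[OF M.zero_closed S]] by blast
 qed
qed

end

section \<open>Homomorphisms out of the analytic tensor algebra\<close>

lemma bdd_bilinearD:
 assumes "bdd_bilinear V W X f"
 shows "x : car V ==> linear_on W X (f x)" "y : car W ==> linear_on V X (%x. f x y)"
 "S : small V ==> T : small W ==> {f x y | x y. x : S & y : T} : small X"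
 "x : car V ==> y : car W ==> f x y : car X"
 using assms linear_onD(1)[of W X "f x" y] unfolding bdd_bilinear_def by blast+

lemma bdd_bilinear_comp:
 assumes f: "bdd_bilinear V W X f" and g: "bdd_linear X Y g"
 shows "bdd_bilinear V W Y (%x y. g (f x y))"
 unfolding bdd_bilinear_def
proof (intro conjI ballI)
 note g' = bdd_linearD[OF g]
 show "linear_on W Y (%y. g (f x y))" if "x : car V" for x
 using linear_on_comp[OF bdd_bilinearD(1)[OF f that] g'(1)] .
 show "linear_on V Y (%x. g (f x y))" if "y : car W" for y
 using linear_on_comp[OF bdd_bilinearD(2)[OF f that] g'(1)] .
 show "{g (f x y) | x y. x : S & y : T} : small Y" if "S : small V" "T : small W" for S T
 proof -
 have "{g (f x y) | x y. x : S & y : T} = g ` {f x y | x y. x : S & y : T}" by blast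
 thus ?thesis using g'(5)[OF bdd_bilinearD(3)[OF f that]] by simp
 qed
qed

lemma bdd_bilinear_right:
 assumes W: "convex_bornology V" "convex_bornology X" and f: "bdd_bilinear V W X f" and x: "x : car V"
 shows "bdd_linear W X (f x)"
proof -
 interpret V: convex_bornology V by fact
 have "f x ` T : small X" if "T : small W" for T
 proof -
 have "f x ` T = {f y z | y z. y : {x} & z : T}" by blast
 thus ?thesis using bdd_bilinearD(3)[OF f V.small_point[OF x] that] by simp
 qed
 thus ?thesis using bdd_bilinearD(1)[OF f x] by (simp add: bdd_linear_def)
qed

lemma bdd_bilinear_left:
 assumes W: "convex_bornology W" "convex_bornology X" and f: "bdd_bilinear V W X f" and y: "y : car W"
 shows "bdd_linear V X (%x. f x y)"
proof -
 interpret W: convex_bornology W by fact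
 have "(%x. f x y) ` T : small X" if "T : small V" for T
 proof -
 have "(%x. f x y) ` T = {f x z | x z. x : T & z : {y}}" by blast
 thus ?thesis using bdd_bilinearD(3)[OF f that W.small_point[OF y]] by simp
 qed
 thus ?thesis using bdd_bilinearD(2)[OF f y] by (simp add: bdd_linear_def)
qed

section \<open>The algebra of analytic forms\<close>

context balg begin

abbreviation "CC \<equiv> completion (forms A)"
abbreviation "eta \<equiv> completion_map (forms A)"
abbreviation "wgen w \<equiv> eta (cls (fmono w))"

lemma CC_complete: "complete_bvs CC"
 by (rule completion_complete[OF convex_bornology_forms])

sublocale CC: complete_bvs CC
 by (rule CC_complete)

lemma eta_linear: "bdd_linear (forms A) CC eta"
 by (rule completion_map_bdd_linear[OF convex_bornology_forms])

lemma wgen_carrier: "w : fwords (car A) ==> wgen w : car CC"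
 using bdd_linearD(2)[OF eta_linear] FF_fmono by simp

lemma CC_unique:
 assumes X: "complete_bvs X" and g: "bdd_linear CC X g" and h: "bdd_linear CC X h"
 and eq: "!!w. w : fwords (car A) ==> g (wgen w) = h (wgen w)" and x: "x : car CC"
 shows "g x = h x"
proof (rule completion_unique[OF convex_bornology_forms X g h _ x])
 interpret X: complete_bvs X by fact
 interpret cvs_pair "forms A" X by unfold_locales
 have lg: "linear_on (forms A) X (%v. g (eta v))" and lh: "linear_on (forms A) X (%v. h (eta v))"
 using bdd_linearD(1)[OF bdd_linear_comp[OF eta_linear g]] bdd_linearD(1)[OF bdd_linear_comp[OF eta_linear h]] by auto
 show "g (eta v) = h (eta v)" if "v : car (forms A)" for v
 using that
 proof (rule forms_induct)
 show "g (eta (c .[forms A] x)) = h (eta (c .[forms A] x))"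
 if "x : car (forms A)" "g (eta x) = h (eta x)" for c x
 using linear_onD(3)[OF lg that(1)] linear_onD(3)[OF lh that(1)] that(2) by simp
 show "g (eta (x +[forms A] y)) = h (eta (x +[forms A] y))"
 if "x : car (forms A)" "y : car (forms A)" "g (eta x) = h (eta x)" "g (eta y) = h (eta y)" for x y
 using linear_onD(2)[OF lg that(1,2)] linear_onD(2)[OF lh that(1,2)] that(3,4) by simp
 show "g (eta \<zero>[forms A]) = h (eta \<zero>[forms A])" using lin_zero[OF lg] lin_zero[OF lh] by simp
 qed (rule eq)
qed

lemma CC_lift:
 assumes X: "complete_bvs X" and G: "multilin A X G" and b: "!!S. S : small A ==> G ` fwords S : small X"
 shows "EX g. bdd_linear CC X g & (ALL f:FF. g (eta (cls f)) = pmsum X G f)"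
proof -
 interpret X: complete_bvs X by fact
 obtain g where g: "linear_on (forms A) X g" "ALL f:FF. g (cls f) = pmsum X G f"
 using forms_lift[OF X.cvs_axioms G] by blast
 have "bdd_linear (forms A) X g"
 proof (rule forms_bdd_linear[OF X.born g(1)])
 fix S assume S: "S : small A"
 have "g (cls (fmono w)) = G w" if "w : fwords S" for w
 proof -
 have w: "w : fwords (car A)" using that fwords_mono[OF small_subset_carrier[OF S]] by blast
 thus ?thesis using g(2) FF_fmono[OF w] multilin_carrier[OF G w] by (simp add: X.pmsum_single)
 qed
 hence "(%w. g (cls (fmono w))) ` fwords S = G ` fwords S" by simp
 thus "(%w. g (cls (fmono w))) ` fwords S : small X" using b[OF S] by simp
 qed
 thus ?thesis
 using completion_lift[OF convex_bornology_forms X] g(2) cls_FF by (metis (no_types, lifting))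
qed

lemma an_forms_simps [simp]:
 "car (an_forms A) = car CC" "add (an_forms A) = add CC" "zero (an_forms A) = zero CC"
 "smult (an_forms A) = smult CC" "small (an_forms A) = small CC"
 by (simp_all add: an_forms_def Let_def)

lemma an_minus [simp]: "x -[an_forms A] y = x -[CC] y"
 by (simp add: a_minus_def a_inv_def)

lemma an_mult:
 "bdd_bilinear CC CC CC (mult (an_forms A))"
 "x : car (forms A) ==> y : car (forms A) ==> eta x *[an_forms A] eta y = eta (x *[forms A] y)"
proof -
 have "EX m. bdd_bilinear CC CC CC m & (ALL x:car (forms A). ALL y:car (forms A). m (eta x) (eta y) = eta (x *[forms A] y))"
 by (rule completion_bilinear[OF convex_bornology_forms convex_bornology_forms CC_complete bdd_bilinear_comp[OF forms_mult_bdd eta_linear]])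
 from someI_ex[OF this]
 show "bdd_bilinear CC CC CC (mult (an_forms A))"
 "x : car (forms A) ==> y : car (forms A) ==> eta x *[an_forms A] eta y = eta (x *[forms A] y)"
 unfolding an_forms_def Let_def by auto
qed

lemma an_d: "bdd_linear CC CC (an_d A)" "f : FF ==> an_d A (eta (cls f)) = eta (cls (free_d f))"
 using completion_lift[OF convex_bornology_forms CC_complete bdd_linear_comp[OF forms_d(1) eta_linear]]
 forms_d(2) cls_FF unfolding an_d_def by auto

lemma an_grading: "bdd_linear CC CC (an_grading A)" "f : FF ==> an_grading A (eta (cls f)) = eta (cls (free_grading f))"
 using completion_lift[OF convex_bornology_forms CC_complete bdd_linear_comp[OF forms_grading(1) eta_linear]]
 forms_grading(2) cls_FF unfolding an_grading_def by auto

text \<open>Even forms are a subspace without generators of their own. Composition with this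
  projection turns an identity for even forms into one for all analytic forms, where words
  decide.\<close>

definition even_proj :: "'a anform => 'a anform" where
 "even_proj x = (1/2) .[CC] (x +[CC] an_grading A x)"

lemma even_proj_linear: "bdd_linear CC CC even_proj"
 unfolding even_proj_def
 by (rule bdd_linear_smult[OF CC.cvs_axioms CC.born
 bdd_linear_add[OF CC.cvs_axioms _ CC.born bdd_linear_id an_grading(1)]])
 (use CC.small_subset_carrier in blast)

lemma even_proj_even: assumes "x : even_an_forms A" shows "even_proj x = x"
proof -
 have x: "x : car CC" "an_grading A x = x" using assms by (auto simp: even_an_forms_def)
 have "x +[CC] x = 2 .[CC] x" using CC.smult_ladd[OF x(1), of 1 1] x(1) by simp
 thus ?thesis using x by (simp add: even_proj_def CC.smult_smult)
qed

lemma even_proj_word: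
 assumes "(x, as) : fwords (car A)"
 shows "even_proj (wgen (x, as)) = (if even (length as) then wgen (x, as) else \<zero>[CC])"
proof -
 let ?w = "wgen (x, as)"
 have F: "fmono (x, as) : FF" by (rule FF_fmono[OF assms])
 have c: "?w : car CC" by (rule wgen_carrier[OF assms])
 have "an_grading A ?w = eta (((-1) ^ length as) .[forms A] cls (fmono (x, as)))"
 using an_grading(2)[OF F] by (simp add: free_grading_def cls_smult)
 hence g: "an_grading A ?w = ((-1) ^ length as) .[CC] ?w"
 using bdd_linearD(4)[OF eta_linear cls_FF[OF F]] by simp
 show ?thesis
 proof (cases "even (length as)")
 case True
 have "?w +[CC] ?w = 2 .[CC] ?w" using CC.smult_ladd[OF c, of 1 1] c by simp
 thus ?thesis using g c True by (simp add: even_proj_def CC.smult_smult)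
 next
 case False
 thus ?thesis using g c by (simp add: even_proj_def CC.smult_m1 CC.M.r_neg)
 qed
qed

end

lemma (in balg) set_power_closed: "S <= car A ==> set_power A S n <= car A"
 by (induction n) (auto simp: set_mult_def intro!: mult_closed)

text \<open>Powers are built by multiplying on the right, while curvatures will be split off on the
  left.\<close>

lemma (in balg) set_power_left:
 assumes S: "S <= car A" and s: "s : S" and x: "x : set_power A S n"
 shows "s \<otimes> x : set_power A S (Suc n)"
 using x
proof (induction n arbitrary: x)
 case 0
 thus ?case using s by (auto simp: set_mult_def)
next
 case (Suc n)
 then obtain y t where y: "y : set_power A S n" "t : S" "x = y \<otimes> t" by (auto simp: set_mult_def)
 have c: "s : car A" "y : car A" "t : car A" using S s y set_power_closed[OF S] by auto
 have "s \<otimes> y : set_power A S (Suc n)" by (rule Suc.IH[OF y(1)])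
 hence "(s \<otimes> y) \<otimes> t : set_power A S (Suc (Suc n))" using y(2) unfolding set_power.simps(2)[of A S "Suc n"] set_mult_def by blast
 thus ?case using y(3) mult_assoc[OF c] by simp
qed

section \<open>Curvature and the evaluation of words\<close>

locale linear_lift = R: complete_balg R + E: complete_balg E for R :: "'r bvs" and E :: "'e bvs" +
 fixes l :: "'r => 'e"
 assumes l: "bdd_linear R E l"
begin

definition curv :: "'r => 'r => 'e" where
 "curv x y = l (x *[R] y) -[E] (l x *[E] l y)"

lemmas lD = bdd_linearD[OF l]

lemma curv_closed [simp]: "x : car R ==> y : car R ==> curv x y : car E"
 unfolding curv_def using lD by simp

lemma curv_linear_left: assumes "y : car R" shows "linear_on R E (%x. curv x y)"
 unfolding curv_def
 by (rule linear_on_minus[OF R.cvs_axioms E.cvs_axioms linear_on_comp[OF R.mult_linear_left[OF assms] lD(1)]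
 linear_on_comp[OF lD(1) E.mult_linear_left[OF lD(2)[OF assms]]]])

lemma curv_linear_right: assumes "x : car R" shows "linear_on R E (%y. curv x y)"
 unfolding curv_def
 by (rule linear_on_minus[OF R.cvs_axioms E.cvs_axioms linear_on_comp[OF R.mult_linear_right[OF assms] lD(1)]
 linear_on_comp[OF lD(1) E.mult_linear_right[OF lD(2)[OF assms]]]])

text \<open>By associativity in both algebras each side equals
  \<open>l(xy) l(z) - l(x) l(y) l(z)\<close>. This identity is what turns the Leibniz rule into
  multiplicativity.\<close>

lemma curv_cocycle:
 assumes "x : car R" "y : car R" "z : car R"
 shows "curv x (y *[R] z) -[E] curv (x *[R] y) z +[E] (l x *[E] curv y z) = curv x y *[E] l z"
proof -
 have v: "(p -[E] q) -[E] (p -[E] r) +[E] (q -[E] s) = r -[E] s"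
 if "p : car E" "q : car E" "r : car E" "s : car E" for p q r s
 using that by algebra
 interpret EE: cvs_pair E E by unfold_locales
 have "l x *[E] curv y z = l x *[E] l (y *[R] z) -[E] l x *[E] (l y *[E] l z)"
 unfolding curv_def using EE.lin_minus[OF E.mult_linear_right[OF lD(2)[OF assms(1)]]] assms lD(2) by simp
 moreover have "curv x y *[E] l z = l (x *[R] y) *[E] l z -[E] l x *[E] l y *[E] l z"
 unfolding curv_def using EE.lin_minus[OF E.mult_linear_left[OF lD(2)[OF assms(3)]]] assms lD(2) by simp
 ultimately show ?thesis
 unfolding curv_def[of x "y *[R] z"] curv_def[of "x *[R] y" z]
 using assms lD(2) R.mult_assoc[OF assms] E.mult_assoc[of "l x" "l y" "l z"] by (simp add: v)
qed

text \<open>The value 0 on lists of odd length extends the intended map from even forms to all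
  forms, so that it is defined where words generate.\<close>

fun gacc :: "'e => 'r list => 'e" where
 "gacc e [] = e"
| "gacc e [a] = \<zero>[E]"
| "gacc e (a # b # as) = gacc (e *[E] curv a b) as"

fun gw :: "'r fword => 'e" where
 "gw (Some x, as) = gacc (l x) as"
| "gw (None, a # b # as) = gacc (curv a b) as"
| "gw (None, as) = \<zero>[E]"

lemma gacc_closed [simp]: "e : car E ==> set as <= car R ==> gacc e as : car E"
 by (induction e as rule: gacc.induct) auto

lemma gacc_linear: "set as <= car R ==> linear_on E E (%e. gacc e as)"
proof (induction as rule: induct_list012)
 case 1
 show ?case by (simp add: linear_on_def)
next
 case (2 a)
 show ?case using linear_on_zero[OF E.cvs_axioms] by simp
next
 case (3 a b as)
 have "linear_on E E (%e. gacc e as)" using 3 by simp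
 thus ?case using linear_on_comp[OF E.mult_linear_left[of "curv a b"]] 3(3) by simp
qed

lemma gacc_entry:
 "e : car E ==> set as <= car R ==> set bs <= car R ==> linear_on R E (%x. gacc e (as @ x # bs))"
proof (induction e as rule: gacc.induct)
 case (1 e)
 show ?case
 proof (cases bs)
 case Nil
 thus ?thesis using linear_on_zero[OF E.cvs_axioms] by simp
 next
 case (Cons b cs)
 hence "linear_on R E (%x. gacc (e *[E] curv x b) cs)"
 using linear_on_comp[OF linear_on_comp[OF curv_linear_left[of b] E.mult_linear_right[OF 1(1)]] gacc_linear[of cs]] 1 by simp
 thus ?thesis using Cons by simp
 qed
next
 case (2 e a)
 have "linear_on R E (%x. gacc (e *[E] curv a x) bs)"
 using linear_on_comp[OF linear_on_comp[OF curv_linear_right[of a] E.mult_linear_right[OF 2(1)]] gacc_linear[of bs]] 2 by simp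
 thus ?case by simp
next
 case (3 e a b as)
 thus ?case by simp
qed

lemma gw_multilin: "multilin R E gw"
proof (rule multilinI)
 show "linear_on R E (%x. gw (Some x, as))" if "set as <= car R" for as
 using linear_on_comp[OF lD(1) gacc_linear[OF that]] by simp
 fix z as bs assume s: "set_option z <= car R" "set as <= car R" "set bs <= car R"
 show "linear_on R E (%x. gw (z, as @ x # bs))"
 proof (cases z)
 case (Some y)
 thus ?thesis using gacc_entry[of "l y" as bs] s lD(2) by simp
 next
 case None
 consider "as = []" "bs = []" | b cs where "as = []" "bs = b # cs" | a where "as = [a]" | a b cs where "as = a # b # cs"
 by (metis list.exhaust)
 thus ?thesis
 proof cases
 case 1
 thus ?thesis using linear_on_zero[OF E.cvs_axioms] None by simp
 next
 case (2 b cs)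
 thus ?thesis using linear_on_comp[OF curv_linear_left[of b] gacc_linear[of cs]] None s by simp
 next
 case (3 a)
 thus ?thesis using linear_on_comp[OF curv_linear_right[of a] gacc_linear[of bs]] None s by simp
 next
 case (4 a b cs)
 thus ?thesis using gacc_entry[of "curv a b" cs bs] None s by simp
 qed
 qed
qed

lemma gacc_odd: "odd (length as) ==> gacc e as = \<zero>[E]"
 by (induction e as rule: gacc.induct) auto

lemma gacc_append: "even (length as) ==> gacc e (as @ bs) = gacc (gacc e as) bs"
 by (induction e as rule: gacc.induct) auto

lemma gacc_mult:
 "e : car E ==> f : car E ==> set as <= car R ==> gacc (e *[E] f) as = e *[E] gacc f as"
proof (induction f as rule: gacc.induct)
 case (2 f a)
 interpret EE: cvs_pair E E by unfold_locales
 show ?case using EE.lin_zero[OF E.mult_linear_right[OF 2(1)]] by simp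
next
 case (3 f a b as)
 thus ?case by (simp add: E.mult_assoc)
qed simp

lemma gw_odd: assumes "odd (length as)" shows "gw (z, as) = \<zero>[E]"
proof (cases z)
 case None
 thus ?thesis using assms gacc_odd by (cases as; cases "tl as") auto
qed (simp add: gacc_odd assms)

lemma gw_append:
 assumes "(z, as) : fwords (car R)" "even (length bs)" "set bs <= car R"
 shows "gw (z, as @ bs) = gacc (gw (z, as)) bs"
proof (cases "even (length as)")
 case True
 show ?thesis
 proof (cases z)
 case (Some x)
 thus ?thesis using gacc_append[OF True] by simp
 next
 case None
 then obtain a b cs where as: "as = a # b # cs" using assms(1) True by (cases as; cases "tl as") auto
 hence "even (length cs)" using True by simp
 thus ?thesis using gacc_append[of cs "curv a b" bs] None as by simp
 qed
next
 case False
 interpret EE: cvs_pair E E by unfold_locales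
 have "gw (z, as @ bs) = \<zero>[E]" using False assms(2) by (intro gw_odd) simp
 thus ?thesis using gw_odd[of as z] False EE.lin_zero[OF gacc_linear[OF assms(3)]] by simp
qed

abbreviation "PP \<equiv> pmsum E gw"

lemma gw_closed: "w : fwords (car R) ==> gw w : car E"
 using multilin_carrier[OF gw_multilin] .

lemma PP_simps:
 "w : fwords (car R) ==> PP (fmono w) = gw w"
 "f : R.FF ==> g : R.FF ==> PP (f + g) = PP f +[E] PP g"
 "f : R.FF ==> g : R.FF ==> PP (f - g) = PP f -[E] PP g"
 "f : R.FF ==> PP (pm_scale c f) = c .[E] PP f"
 "f : R.FF ==> PP f : car E"
proof -
 have k: "p : supp f ==> f : R.FF ==> gw p : car E" for f p
 using gw_closed[of p] by (auto simp: R.FF_eq simp del: gw.simps)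
 show "w : fwords (car R) ==> PP (fmono w) = gw w" using gw_closed by (simp add: E.pmsum_single)
 show "f : R.FF ==> g : R.FF ==> PP (f + g) = PP f +[E] PP g" using k by (intro E.pmsum_add) auto
 show "f : R.FF ==> g : R.FF ==> PP (f - g) = PP f -[E] PP g" using k by (intro E.pmsum_diff) auto
 show "f : R.FF ==> PP (pm_scale c f) = c .[E] PP f" using k by (intro E.pmsum_scale) auto
 show "f : R.FF ==> PP f : car E" using k by (intro E.pmsum_closed) auto
qed

lemma PP_append:
 assumes "f : R.FF" "even (length bs)" "set bs <= car R"
 shows "PP (append_d bs f) = gacc (PP f) bs"
proof -
 interpret EE: cvs_pair E E by unfold_locales
 note gl = gacc_linear[OF assms(3)]
 show ?thesis
 using assms(1)
 proof (rule R.FF_induct)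
 show "PP (append_d bs 0) = gacc (PP 0) bs" using EE.lin_zero[OF gl] by simp
 show "PP (append_d bs (fmono w)) = gacc (PP (fmono w)) bs" if "w : fwords (car R)" for w
 proof -
 obtain z as where w: "w = (z, as)" by (cases w)
 have "(z, as @ bs) : fwords (car R)" using that w assms(3) by (auto simp: R.fwords_iff)
 thus ?thesis using that w gw_append[of z as bs] assms(2,3) by (simp add: PP_simps)
 qed
 show "PP (append_d bs (f + g)) = gacc (PP (f + g)) bs"
 if "f : R.FF" "g : R.FF" "PP (append_d bs f) = gacc (PP f) bs" "PP (append_d bs g) = gacc (PP g) bs" for f g
 using that R.append_d_FF[OF _ assms(3)] linear_onD(2)[OF gl] by (simp add: PP_simps)
 show "PP (append_d bs (pm_scale c f)) = gacc (PP (pm_scale c f)) bs"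
 if "f : R.FF" "PP (append_d bs f) = gacc (PP f) bs" for c f
 using that R.append_d_FF[OF _ assms(3)] linear_onD(3)[OF gl] by (simp add: PP_simps)
 qed
qed

text \<open>Two rounds of the Leibniz recursion at once, so that the remaining list keeps its
  parity; a single round would lead to odd forms, whose values all vanish.\<close>

lemma PP_rmult_step:
 assumes x: "set_option x <= car R" and as: "set as <= car R" and a: "a1 : car R" "a2 : car R" "b : car R"
 shows "PP (form_rmult R x (a2 # a1 # as) b) =
    gw (x, rev as @ [a1, a2 *[R] b]) -[E] (gw (x, rev as @ [a1 *[R] a2, b]) -[E] PP (form_rmult R x as a1) *[E] curv a2 b)"
proof -
 let ?F = "form_rmult R x as a1"
 have F: "?F : R.FF" using R.form_rmult_FF[OF x as a(1)] .
 have w: "(x, rev as @ [a1, a2 *[R] b]) : fwords (car R)" "(x, rev as @ [a1 *[R] a2, b]) : fwords (car R)"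
 using x as a by (auto simp: R.fwords_iff)
 have e: "form_rmult R x (a2 # a1 # as) b = fmono (x, rev as @ [a1, a2 *[R] b])
      - (fmono (x, rev as @ [a1 *[R] a2, b]) - append_d [a2, b] ?F)"
 by (simp add: R.append_d_append)
 have aF: "append_d [a2, b] ?F : R.FF" using R.append_d_FF[OF F] a by simp
 have "PP (append_d [a2, b] ?F) = PP ?F *[E] curv a2 b" using PP_append[OF F, of "[a2, b]"] a by simp
 thus ?thesis
 unfolding e using w aF R.FF_fmono by (simp add: PP_simps)
qed

text \<open>The induction consumes two entries and closes by \<open>curv_cocycle\<close>. The extra
  summand is the value on \<open>d\<close> of the form followed by \<open>db\<close>, and it is
  exactly what the product of the tensor algebra subtracts.\<close>

lemma PP_rmult_Some:
 assumes "y : car R"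
 shows "even (length as) ==> set as <= car R ==> b : car R ==>
    PP (form_rmult R (Some y) as b) = gw (Some y, rev as) *[E] l b +[E] gw (None, y # rev as @ [b])"
proof (induction as arbitrary: b rule: induct_list012)
 case 1
 have "p = q +[E] (p -[E] q)" if "p : car E" "q : car E" for p q using that by algebra
 thus ?case using 1 assms lD(2) by (simp add: PP_simps curv_def)
next
 case (3 a2 a1 as)
 have a: "a1 : car R" "a2 : car R" "b : car R" "set as <= car R" "even (length as)" using "3.prems" by auto
 have IH: "PP (form_rmult R (Some y) as a1) = gw (Some y, rev as) *[E] l a1 +[E] gw (None, y # rev as @ [a1])"
 using "3.IH"(1) a by simp
 let ?u = "gacc (l y) (rev as)" and ?t = "gw (None, y # rev as @ [a1])"
 have u: "?u : car E" using a assms lD(2) by simp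
 have t: "?t : car E" using a assms by (intro gw_closed) simp
 have g1: "gw (Some y, rev as @ [a1, a2 *[R] b]) = ?u *[E] curv a1 (a2 *[R] b)"
 "gw (Some y, rev as @ [a1 *[R] a2, b]) = ?u *[E] curv (a1 *[R] a2) b"
 using a by (simp_all add: gacc_append)
 have g2: "gw (None, y # rev as @ [a1, a2, b]) = ?t *[E] curv a2 b"
 using gw_append[of None "y # rev as @ [a1]" "[a2, b]"] a assms by simp
 have g3: "gw (Some y, rev as @ [a1, a2]) = ?u *[E] curv a1 a2" using a by (simp add: gacc_append)
 interpret EE: cvs_pair E E by unfold_locales
 note ul = linear_onD[OF E.mult_linear_right[OF u]]
 have "(?u *[E] l a1 +[E] ?t) *[E] curv a2 b = ?u *[E] (l a1 *[E] curv a2 b) +[E] ?t *[E] curv a2 b"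
 using linear_onD(2)[OF E.mult_linear_left[of "curv a2 b"]] u t a lD(2) E.mult_assoc by simp
 moreover have "?u *[E] curv a1 (a2 *[R] b) -[E] ?u *[E] curv (a1 *[R] a2) b +[E] ?u *[E] (l a1 *[E] curv a2 b)
      = ?u *[E] (curv a1 a2 *[E] l b)"
 using curv_cocycle[OF a(1-3)] ul(2) EE.lin_minus[OF E.mult_linear_right[OF u]] a lD(2) by (metis E.M.minus_closed E.mult_closed R.mult_closed curv_closed)
 moreover have "p -[E] (q -[E] (r +[E] s)) = (p -[E] q +[E] r) +[E] s"
 if "p : car E" "q : car E" "r : car E" "s : car E" for p q r s using that by algebra
 ultimately have "?u *[E] curv a1 (a2 *[R] b) -[E] (?u *[E] curv (a1 *[R] a2) b -[E] (?u *[E] l a1 +[E] ?t) *[E] curv a2 b)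
      = ?u *[E] (curv a1 a2 *[E] l b) +[E] ?t *[E] curv a2 b"
 using u t a lD(2) by simp
 moreover have "PP (form_rmult R (Some y) (a2 # a1 # as) b) =
      ?u *[E] curv a1 (a2 *[R] b) -[E] (?u *[E] curv (a1 *[R] a2) b -[E] (?u *[E] l a1 +[E] ?t) *[E] curv a2 b)"
 using PP_rmult_step[of "Some y" as a1 a2 b] a assms by (simp only: g1 IH) simp
 moreover have "?u *[E] (curv a1 a2 *[E] l b) = gw (Some y, rev as @ [a1, a2]) *[E] l b"
 unfolding g3 using E.mult_assoc u a lD(2) by simp
 ultimately show ?case using g2 by simp
qed simp

text \<open>The extra summand is absent, in accordance with \<open>d\<close> killing a form without
  leading coefficient. For two entries the claim is \<open>curv_cocycle\<close> itself.\<close>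

lemma PP_rmult_None:
 "even (length as) ==> set as <= car R ==> as ~= [] ==> b : car R ==>
    PP (form_rmult R None as b) = gw (None, rev as) *[E] l b"
proof (induction as arbitrary: b rule: induct_list012)
 case (3 a2 a1 as)
 have a: "a1 : car R" "a2 : car R" "b : car R" "set as <= car R" "even (length as)" using "3.prems" by auto
 interpret EE: cvs_pair E E by unfold_locales
 have v: "p -[E] (q -[E] r) = p -[E] q +[E] r"
 if "p : car E" "q : car E" "r : car E" for p q r using that by algebra
 have step: "PP (form_rmult R None (a2 # a1 # as) b) =
    gw (None, rev as @ [a1, a2 *[R] b]) -[E] (gw (None, rev as @ [a1 *[R] a2, b]) -[E] PP (form_rmult R None as a1) *[E] curv a2 b)"
 using PP_rmult_step[of None as a1 a2 b] a by simp
 show ?case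
 proof (cases "as = []")
 case True
 have "PP (form_rmult R None [] a1) = l a1" using a by (simp add: PP_simps)
 thus ?thesis using step True a curv_cocycle[OF a(1-3)] lD(2) by (simp add: v)
 next
 case False
 have IH: "PP (form_rmult R None as a1) = gw (None, rev as) *[E] l a1" using "3.IH"(1) a False by simp
 let ?u = "gw (None, rev as)"
 have w: "(None, rev as) : fwords (car R)" using a False by simp
 have u: "?u : car E" by (rule gw_closed[OF w])
 have g: "gw (None, rev as @ [p, q]) = ?u *[E] curv p q" if "p : car R" "q : car R" for p q
 using gw_append[OF w, of "[p, q]"] that by simp
 have "?u *[E] curv a1 (a2 *[R] b) -[E] ?u *[E] curv (a1 *[R] a2) b +[E] ?u *[E] (l a1 *[E] curv a2 b)
      = ?u *[E] (curv a1 a2 *[E] l b)"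
 using curv_cocycle[OF a(1-3)] linear_onD(2)[OF E.mult_linear_right[OF u]] EE.lin_minus[OF E.mult_linear_right[OF u]] a lD(2)
 by (metis E.M.minus_closed E.mult_closed R.mult_closed curv_closed)
 thus ?thesis using step IH a u lD(2) by (simp add: g v E.mult_assoc)
 qed
qed simp_all

text \<open>The correction \<open>dx dy\<close> is nonzero only if both forms have a leading
  coefficient, and then it cancels the extra summand of \<open>PP_rmult_Some\<close>. If the right
  factor has none, the product is mere concatenation; if only the left factor has none,
  \<open>PP_rmult_None\<close> applies.\<close>

lemma PP_fedosov:
 assumes v: "(x, as) : fwords (car R)" "even (length as)" and w: "(y, bs) : fwords (car R)" "even (length bs)"
 shows "PP (free_mult R (fmono (x, as)) (fmono (y, bs)))
    -[E] PP (free_mult R (free_d (fmono (x, as))) (free_d (fmono (y, bs)))) = gw (x, as) *[E] gw (y, bs)"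
proof -
 have vx: "set_option x <= car R" "set as <= car R" and wy: "set_option y <= car R" "set bs <= car R"
 using v(1) w(1) by (auto simp: R.fwords_iff)
 have gv: "gw (x, as) : car E" and gw': "gw (y, bs) : car E" using gw_closed v(1) w(1) by blast+
 have ms: "p -[E] \<zero>[E] = p" if "p : car E" for p using that by algebra
 show ?thesis
 proof (cases y)
 case None
 then obtain b1 b2 cs where bs: "bs = b1 # b2 # cs" using w by (cases bs; cases "tl bs") auto
 have wd: "(x, as @ bs) : fwords (car R)" using v(1) wy by (auto simp: R.fwords_iff)
 have "free_mult R (free_d (fmono (x, as))) (free_d (fmono (y, bs))) = 0"
 using None by (simp add: free_d_def free_mult_def pm_extend_def)
 moreover have "PP (free_mult R (fmono (x, as)) (fmono (y, bs))) = gw (x, as @ bs)"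
 using None wd by (simp add: PP_simps)
 moreover have "gw (x, as @ bs) = gw (x, as) *[E] gw (y, bs)"
 using gw_append[OF v(1) w(2) wy(2)] gacc_mult[OF gv, of "curv b1 b2" cs] wy None bs by simp
 ultimately show ?thesis using ms gv gw' by simp
 next
 case (Some b)
 have b: "b : car R" using wy Some by simp
 let ?F = "form_rmult R x (rev as) b"
 have F: "?F : R.FF" using R.form_rmult_FF[OF vx(1) _ b] vx(2) by simp
 have m: "PP (free_mult R (fmono (x, as)) (fmono (y, bs))) = gacc (PP ?F) bs"
 using Some PP_append[OF F w(2) wy(2)] by simp
 show ?thesis
 proof (cases x)
 case None
 have "PP ?F = gw (None, as) *[E] l b"
 using PP_rmult_None[of "rev as" b] v vx b None by simp
 hence "gacc (PP ?F) bs = gw (x, as) *[E] gw (y, bs)"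
 using gacc_mult[OF gv, of "l b" bs] None Some lD(2)[OF b] wy by simp
 moreover have "free_mult R (free_d (fmono (x, as))) (free_d (fmono (y, bs))) = 0"
 using None by (simp add: free_d_def free_mult_def pm_extend_def)
 ultimately show ?thesis using m ms gv gw' by simp
 next
 case (Some z)
 hence z: "z : car R" using vx by simp
 let ?t = "gw (None, z # as @ [b])"
 have tw: "(None, z # as @ [b]) : fwords (car R)" using z vx b by simp
 have t: "?t : car E" by (rule gw_closed[OF tw])
 have "PP ?F = gw (x, as) *[E] l b +[E] ?t"
 using PP_rmult_Some[OF z, of "rev as" b] v vx b Some by simp
 hence "gacc (PP ?F) bs = gacc (gw (x, as) *[E] l b) bs +[E] gacc ?t bs"
 using linear_onD(2)[OF gacc_linear[OF wy(2)]] gv t lD(2)[OF b] by simp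
 moreover have "gacc (gw (x, as) *[E] l b) bs = gw (x, as) *[E] gw (y, bs)"
 using gacc_mult[OF gv lD(2)[OF b] wy(2)] \<open>y = Some b\<close> by simp
 moreover have "PP (free_mult R (free_d (fmono (x, as))) (free_d (fmono (y, bs)))) = gacc ?t bs"
 proof -
 have "free_mult R (free_d (fmono (x, as))) (free_d (fmono (y, bs))) = fmono (None, (z # as @ [b]) @ bs)"
 using Some \<open>y = Some b\<close> by (simp add: free_d_def)
 moreover have "(None, (z # as @ [b]) @ bs) : fwords (car R)" using z vx b wy by simp
 ultimately show ?thesis using gw_append[OF tw w(2) wy(2)] by (simp only: PP_simps(1))
 qed
 moreover have "(p +[E] q) -[E] q = p" if "p : car E" "q : car E" for p q using that by algebra
 ultimately show ?thesis using m gv gw' t wy by simp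
 qed
 qed
qed

end

section \<open>The bounded homomorphism given by a map of small curvature\<close>

locale small_curvature = linear_lift R E l for R :: "'r bvs" and E :: "'e bvs" and l +
 assumes small_curv: "S : small R ==> (\<Union>n. set_power E {curv x y | x y. x : S & y : S} n) : small E"
begin

text \<open>However long the word, its value is 0, some \<open>l x\<close>, a product of curvatures,
  or \<open>l x\<close> times such a product; all of these fit into \<open>?X\<close>, which uses
  one small set of products for all lengths.\<close>

lemma gw_small: assumes S: "S : small R" shows "gw ` fwords S : small E"
proof -
 let ?\<Omega> = "{curv x y | x y. x : S & y : S}"
 let ?W = "\<Union>n. set_power E ?\<Omega> n"
 have Sc: "S <= car R" using R.small_subset_carrier[OF S] .
 have \<Omega>c: "?\<Omega> <= car E" using curv_closed Sc by blast
 have W: "?W : small E" by (rule small_curv[OF S])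
 have Wc: "?W <= car E" using E.small_subset_carrier[OF W] .
 have \<Omega>W: "p : ?W" if "p : ?\<Omega>" for p using that by (intro UN_I[of 0]) auto
 have left: "p *[E] q : ?W" if "p : ?\<Omega>" "q : ?W" for p q
 using E.set_power_left[OF \<Omega>c that(1)] that(2) by blast
 \<comment> \<open>The factor \<open>e\<close> is split off on the left because the recursion
   replaces it by \<open>e *[E] curv a b\<close>, whose second factor must then be returned to the
   set of products.\<close>
 have acc: "gacc e as : {\<zero>[E], e} Un {e *[E] p | p. p : ?W}" if "e : car E" "set as <= S" for e as
 using that
 proof (induction e as rule: gacc.induct)
 case (3 e a b as)
 have c: "curv a b : ?\<Omega>" using 3(3) by auto
 hence cc: "curv a b : car E" using \<Omega>c by blast
 have "gacc (e *[E] curv a b) as : {\<zero>[E], e *[E] curv a b} Un {(e *[E] curv a b) *[E] p | p. p : ?W}"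
 using 3 cc by simp
 then consider "gacc e (a # b # as) = \<zero>[E]" | "gacc e (a # b # as) = e *[E] curv a b"
 | p where "p : ?W" "gacc e (a # b # as) = (e *[E] curv a b) *[E] p" by auto
 thus ?case
 proof cases
 case 2
 thus ?thesis using \<Omega>W[OF c] by blast
 next
 case (3 p)
 hence "gacc e (a # b # as) = e *[E] (curv a b *[E] p)" using E.mult_assoc[OF \<open>e \<in> carrier E\<close> cc] Wc by auto
 thus ?thesis using left[OF c 3(1)] by blast
 qed simp
 qed auto
 have lS: "l ` S : small E" using lD(5)[OF S] .
 let ?X = "insert \<zero>[E] (l ` S Un {x *[E] y | x y. x : l ` S & y : ?W} Un ?W)"
 have "?X : small E"
 by (intro E.small_insert E.small_Un E.mult_small lS W) simp
 moreover have "gw ` fwords S <= ?X"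
 proof
 fix u assume "u : gw ` fwords S"
 then obtain z as where w: "(z, as) : fwords S" and u: "u = gw (z, as)" by auto
 show "u : ?X"
 proof (rule ccontr)
 assume N: "u \<notin> ?X"
 hence n: "gw (z, as) \<notin> ?W" "gw (z, as) \<notin> {x *[E] y | x y. x : l ` S & y : ?W}"
 "gw (z, as) \<notin> l ` S" unfolding u by blast+
 have "gw (z, as) = \<zero>[E]"
 proof (cases z)
 case (Some x)
 hence "x : S" "set as <= S" using w by (auto simp: fwords_def)
 hence s: "x : S" "set as <= S" "l x : car E" "l x : l ` S" using lD(2)[of x] Sc by auto
 have "gw (z, as) : {\<zero>[E], l x} Un {l x *[E] p | p. p : ?W}" using acc[OF s(3,2)] Some by simp
 then consider "gw (z, as) = \<zero>[E]" | "gw (z, as) = l x" | p where "p : ?W" "gw (z, as) = l x *[E] p" by blast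
 thus ?thesis
 proof cases
 case 2
 thus ?thesis using n(3) s(4) by simp
 next
 case (3 p)
 have "EX u v. gw (z, as) = u *[E] v & u : l ` S & v : ?W"
 by (intro exI conjI) (rule 3(2), rule s(4), rule 3(1))
 thus ?thesis using n(2) by (simp only: mem_Collect_eq) blast
 qed
 next
 case None
 show ?thesis
 proof (rule ccontr)
 assume nz: "gw (z, as) ~= \<zero>[E]"
 then obtain a b cs where as: "as = a # b # cs" using None by (cases as; cases "tl as") auto
 hence s: "a : S" "b : S" "set cs <= S" using w by (auto simp: fwords_def)
 hence c: "curv a b : ?\<Omega>" by blast
 hence "gacc (curv a b) cs : {\<zero>[E], curv a b} Un {curv a b *[E] p | p. p : ?W}"
 using acc[OF _ s(3)] \<Omega>c by blast
 then consider "gacc (curv a b) cs = \<zero>[E]" | "gacc (curv a b) cs = curv a b"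
 | p where "p : ?W" "gacc (curv a b) cs = curv a b *[E] p" by blast
 hence "gacc (curv a b) cs : insert \<zero>[E] ?W"
 proof cases
 case 2
 show ?thesis unfolding 2 by (rule insertI2, rule \<Omega>W[OF c])
 next
 case (3 p)
 show ?thesis unfolding 3(2) by (rule insertI2, rule left[OF c 3(1)])
 qed simp
 thus False using nz n(1) None as by simp
 qed
 qed
 thus False using N u by simp
 qed
 qed
 ultimately show ?thesis using E.small_subset by blast
qed

definition gmap :: "'r anform => 'e" where
 "gmap = (SOME g. bdd_linear R.CC E g & (ALL f:R.FF. g (R.eta (R.cls f)) = PP f))"

lemma gmap: "bdd_linear R.CC E gmap" "f : R.FF ==> gmap (R.eta (R.cls f)) = PP f"
 using someI_ex[OF R.CC_lift[OF E.complete_bvs_axioms gw_multilin gw_small]] unfolding gmap_def by blast+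

lemma gmap_word: "w : fwords (car R) ==> gmap (R.wgen w) = gw w"
 using gmap(2)[OF R.FF_fmono] PP_simps(1) by simp

text \<open>The product of \<open>tensor_alg\<close>, with its formula for even forms kept on all
  analytic forms, so that bilinear identities can be compared on words.\<close>

definition fedosov :: "'r anform => 'r anform => 'r anform" where
 "fedosov x y = (x *[an_forms R] y) -[R.CC] (an_d R x *[an_forms R] an_d R y)"

lemma fedosov_left: assumes "y : car R.CC" shows "bdd_linear R.CC R.CC (%x. fedosov x y)"
 unfolding fedosov_def
proof (rule bdd_linear_minus[OF R.CC.cvs_axioms _ R.CC.born])
 show "small R.CC <= Pow (car R.CC)" using R.CC.small_subset_carrier by blast
 show "bdd_linear R.CC R.CC (%x. x *[an_forms R] y)"
 by (rule bdd_bilinear_left[OF R.CC.born R.CC.born R.an_mult(1) assms])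
 show "bdd_linear R.CC R.CC (%x. an_d R x *[an_forms R] an_d R y)"
 by (rule bdd_linear_comp[OF R.an_d(1) bdd_bilinear_left[OF R.CC.born R.CC.born R.an_mult(1)
 bdd_linearD(2)[OF R.an_d(1) assms]]])
qed

lemma fedosov_right: assumes "x : car R.CC" shows "bdd_linear R.CC R.CC (%y. fedosov x y)"
 unfolding fedosov_def
proof (rule bdd_linear_minus[OF R.CC.cvs_axioms _ R.CC.born])
 show "small R.CC <= Pow (car R.CC)" using R.CC.small_subset_carrier by blast
 show "bdd_linear R.CC R.CC (%y. x *[an_forms R] y)"
 by (rule bdd_bilinear_right[OF R.CC.born R.CC.born R.an_mult(1) assms])
 show "bdd_linear R.CC R.CC (%y. an_d R x *[an_forms R] an_d R y)"
 by (rule bdd_linear_comp[OF R.an_d(1) bdd_bilinear_right[OF R.CC.born R.CC.born R.an_mult(1)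
 bdd_linearD(2)[OF R.an_d(1) assms]]])
qed

lemma gmap_mult_words:
 assumes v: "(x, as) : fwords (car R)" and w: "(y, bs) : fwords (car R)"
 shows "gmap (fedosov (R.even_proj (R.wgen (x, as))) (R.even_proj (R.wgen (y, bs)))) = gw (x, as) *[E] gw (y, bs)"
proof -
 interpret CE: cvs_pair R.CC E by unfold_locales
 interpret CCC: cvs_pair R.CC R.CC by unfold_locales
 interpret EE: cvs_pair E E by unfold_locales
 have c: "R.wgen (x, as) : car R.CC" "R.wgen (y, bs) : car R.CC" using R.wgen_carrier v w by blast+
 have e: "gw (x, as) : car E" "gw (y, bs) : car E" using gw_closed v w by blast+
 consider "odd (length as)" | "odd (length bs)" "even (length as)" | "even (length as)" "even (length bs)" by blast
 thus ?thesis
 proof cases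
 case 1
 have p: "R.even_proj (R.wgen (y, bs)) : car R.CC" using bdd_linearD(2)[OF R.even_proj_linear c(2)] .
 have "fedosov (R.even_proj (R.wgen (x, as))) (R.even_proj (R.wgen (y, bs))) = \<zero>[R.CC]"
 using R.even_proj_word[OF v] 1 CCC.lin_zero[OF bdd_linearD(1)[OF fedosov_left[OF p]]] by simp
 moreover have "gw (x, as) *[E] gw (y, bs) = \<zero>[E]"
 using gw_odd[OF 1] EE.lin_zero[OF E.mult_linear_left[OF e(2)]] by simp
 ultimately show ?thesis using CE.lin_zero[OF bdd_linearD(1)[OF gmap(1)]] by simp
 next
 case 2
 have p: "R.even_proj (R.wgen (x, as)) : car R.CC" using bdd_linearD(2)[OF R.even_proj_linear c(1)] .
 have "fedosov (R.even_proj (R.wgen (x, as))) (R.even_proj (R.wgen (y, bs))) = \<zero>[R.CC]"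
 using R.even_proj_word[OF w] 2 CCC.lin_zero[OF bdd_linearD(1)[OF fedosov_right[OF p]]] by simp
 moreover have "gw (x, as) *[E] gw (y, bs) = \<zero>[E]"
 using gw_odd[OF 2(1)] EE.lin_zero[OF E.mult_linear_right[OF e(1)]] by simp
 ultimately show ?thesis using CE.lin_zero[OF bdd_linearD(1)[OF gmap(1)]] by simp
 next
 case 3
 have F: "fmono (x, as) : R.FF" "fmono (y, bs) : R.FF" using R.FF_fmono v w by blast+
 have dF: "free_d (fmono (z, cs)) : R.FF" if "(z, cs) : fwords (car R)" for z cs
 using that by (cases z) (auto simp: free_d_def intro!: R.FF_fmono)
 have m1: "R.wgen (x, as) *[an_forms R] R.wgen (y, bs) = R.eta (R.cls (free_mult R (fmono (x, as)) (fmono (y, bs))))"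
 using R.an_mult(2) R.cls_mult F by simp
 have m2: "an_d R (R.wgen (x, as)) *[an_forms R] an_d R (R.wgen (y, bs))
        = R.eta (R.cls (free_mult R (free_d (fmono (x, as))) (free_d (fmono (y, bs)))))"
 using R.an_mult(2) R.cls_mult R.an_d(2) F dF[OF v] dF[OF w] by simp
 have mF: "free_mult R (fmono (x, as)) (fmono (y, bs)) : R.FF"
 "free_mult R (free_d (fmono (x, as))) (free_d (fmono (y, bs))) : R.FF"
 using R.free_mult_FF F dF[OF v] dF[OF w] by blast+
 have "fedosov (R.even_proj (R.wgen (x, as))) (R.even_proj (R.wgen (y, bs))) =
        R.eta (R.cls (free_mult R (fmono (x, as)) (fmono (y, bs))))
        -[R.CC] R.eta (R.cls (free_mult R (free_d (fmono (x, as))) (free_d (fmono (y, bs)))))"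
 unfolding R.even_proj_word[OF v] R.even_proj_word[OF w] fedosov_def using 3 m1 m2 by simp
 hence "gmap (fedosov (R.even_proj (R.wgen (x, as))) (R.even_proj (R.wgen (y, bs)))) =
       PP (free_mult R (fmono (x, as)) (fmono (y, bs))) -[E] PP (free_mult R (free_d (fmono (x, as))) (free_d (fmono (y, bs))))"
 using CE.lin_minus[OF bdd_linearD(1)[OF gmap(1)]] gmap(2)[OF mF(1)] gmap(2)[OF mF(2)]
 bdd_linearD(2)[OF R.eta_linear R.cls_FF[OF mF(1)]] bdd_linearD(2)[OF R.eta_linear R.cls_FF[OF mF(2)]] by simp
 thus ?thesis using PP_fedosov[OF v 3(1) w 3(2)] by simp
 qed
qed

text \<open>Both sides are bounded and linear in each variable, so their values on words decide: the
  left factor is freed first, then the right one.\<close>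

lemma gmap_mult:
 assumes x: "x : car R.CC" and y: "y : car R.CC"
 shows "gmap (fedosov (R.even_proj x) (R.even_proj y)) = gmap x *[E] gmap y"
proof -
 note pl = R.even_proj_linear and ec = E.complete_bvs_axioms
 have ml: "bdd_linear E E (%u. u *[E] e)" "bdd_linear E E (%u. e *[E] u)" if "e : car E" for e
 using bdd_bilinear_left[OF E.born E.born E.bdd_mult that]
 bdd_bilinear_right[OF E.born E.born E.bdd_mult that] by auto
 have step: "gmap (fedosov (R.even_proj x) (R.even_proj (R.wgen w))) = gmap x *[E] gmap (R.wgen w)"
 if w: "w : fwords (car R)" and x: "x : car R.CC" for w x
 proof (rule R.CC_unique[OF ec _ _ _ x, where g = "%x. gmap (fedosov (R.even_proj x) (R.even_proj (R.wgen w)))" and h = "%x. gmap x *[E] gmap (R.wgen w)"])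
 have p: "R.even_proj (R.wgen w) : car R.CC" using bdd_linearD(2)[OF pl R.wgen_carrier[OF w]] .
 show "bdd_linear R.CC E (%x. gmap (fedosov (R.even_proj x) (R.even_proj (R.wgen w))))"
 by (rule bdd_linear_comp[OF bdd_linear_comp[OF pl fedosov_left[OF p]] gmap(1)])
 show "bdd_linear R.CC E (%x. gmap x *[E] gmap (R.wgen w))"
 by (rule bdd_linear_comp[OF gmap(1) ml(1)[OF bdd_linearD(2)[OF gmap(1) R.wgen_carrier[OF w]]]])
 fix v assume v: "v : fwords (car R)"
 show "gmap (fedosov (R.even_proj (R.wgen v)) (R.even_proj (R.wgen w))) = gmap (R.wgen v) *[E] gmap (R.wgen w)"
 using gmap_mult_words[of "fst v" "snd v" "fst w" "snd w"] gmap_word[OF v] gmap_word[OF w] v w by simp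
 qed
 show ?thesis
 proof (rule R.CC_unique[OF ec _ _ _ y, where g = "%y. gmap (fedosov (R.even_proj x) (R.even_proj y))" and h = "%y. gmap x *[E] gmap y"])
 show "bdd_linear R.CC E (%y. gmap (fedosov (R.even_proj x) (R.even_proj y)))"
 by (rule bdd_linear_comp[OF bdd_linear_comp[OF pl fedosov_right[OF bdd_linearD(2)[OF pl x]]] gmap(1)])
 show "bdd_linear R.CC E (%y. gmap x *[E] gmap y)"
 by (rule bdd_linear_comp[OF gmap(1) ml(2)[OF bdd_linearD(2)[OF gmap(1) x]]])
 qed (rule step[OF _ x])
qed

lemma lift_hom:
 assumes "bdd_hom R (tensor_alg R) \<upsilon>"
 shows "bdd_hom R E (%r. gmap (\<upsilon> r))"
proof -
 have u: "bdd_linear R (tensor_alg R) \<upsilon>" and um: "!!x y. x : car R ==> y : car R ==> \<upsilon> (x *[R] y) = \<upsilon> x *[tensor_alg R] \<upsilon> y"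
 using assms by (auto simp: bdd_hom_def)
 have ev: "\<upsilon> x : even_an_forms R" if "x : car R" for x
 using bdd_linearD(2)[OF u that] by (simp add: tensor_alg_def)
 have uc: "\<upsilon> x : car R.CC" if "x : car R" for x using ev[OF that] by (simp add: even_an_forms_def)
 have ul: "bdd_linear R R.CC \<upsilon>"
 using bdd_linearD[OF u] uc by (intro bdd_linearI) (auto simp: tensor_alg_def)
 have "gmap (\<upsilon> (x *[R] y)) = gmap (\<upsilon> x) *[E] gmap (\<upsilon> y)" if "x : car R" "y : car R" for x y
 proof -
 have "\<upsilon> (x *[R] y) = fedosov (R.even_proj (\<upsilon> x)) (R.even_proj (\<upsilon> y))"
 using um[OF that] R.even_proj_even[OF ev[OF that(1)]] R.even_proj_even[OF ev[OF that(2)]]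
 by (simp add: tensor_alg_def fedosov_def)
 thus ?thesis using gmap_mult[OF uc[OF that(1)] uc[OF that(2)]] by simp
 qed
 thus ?thesis using bdd_linear_comp[OF ul gmap(1)] by (simp add: bdd_hom_def)
qed

text \<open>\<open>q\<close> kills all curvatures, so after \<open>q\<close> only zero-forms
  survive, and the homomorphism agrees with \<open>l\<close> composed with the projection that
  \<open>\<upsilon>\<close> splits. With \<open>q\<close> the projection of an extension this gives
  the lifting property; with \<open>q\<close> an evaluation it gives the endpoints of a
  homotopy.\<close>

lemma lift_over:
 assumes u: "bdd_hom R (tensor_alg R) \<upsilon>" "ALL r:car R. tensor_alg_proj R (\<upsilon> r) = r"
 and Q: "complete_balg Q" and q: "bdd_hom E Q q"
 and ql: "!!x y. x : car R ==> y : car R ==> q (l (x *[R] y)) = q (l x) *[Q] q (l y)"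
 and r: "r : car R"
 shows "q (gmap (\<upsilon> r)) = q (l r)"
proof -
 interpret Q: complete_balg Q by fact
 interpret EQ: cvs_pair E Q by unfold_locales
 interpret QQ: cvs_pair Q Q by unfold_locales
 interpret RE: cvs_pair R E by unfold_locales
 have qb: "bdd_linear E Q q" and qm: "!!x y. x : car E ==> y : car E ==> q (x *[E] y) = q x *[Q] q y"
 using q by (auto simp: bdd_hom_def)
 note qD = bdd_linearD[OF qb]
 have qcurv: "q (curv x y) = \<zero>[Q]" if "x : car R" "y : car R" for x y
 unfolding curv_def using EQ.lin_minus[OF qD(1)] that lD(2) ql qm qD(2) by (simp add: a_minus_def Q.M.r_neg)
 \<comment> \<open>The alternative covers both kinds of words: with a leading coefficient
   \<open>as\<close> is nonempty, without one \<open>e\<close> is itself a curvature.\<close>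
 have qz: "q (gacc e as) = \<zero>[Q]" if "e : car E" "set as <= car R" "as ~= [] \<or> q e = \<zero>[Q]" for e as
 using that
 proof (induction e as rule: gacc.induct)
 case (2 e a)
 thus ?case using EQ.lin_zero[OF qD(1)] by simp
 next
 case (3 e a b as)
 have "q (e *[E] curv a b) = q e *[Q] \<zero>[Q]" using 3 qm qcurv by simp
 also have "... = \<zero>[Q]" using QQ.lin_zero[OF Q.mult_linear_right[OF qD(2)[OF 3(2)]]] .
 finally show ?case using 3 by simp
 qed simp
 have tau: "bdd_linear R.CC R (tensor_alg_proj R)" "f : R.FF ==> tensor_alg_proj R (R.eta (R.cls f)) = forms_degree0 R (R.cls f)" for f
 unfolding tensor_alg_proj_def using completion_lift[OF R.convex_bornology_forms R.complete_bvs_axioms R.forms_degree0(1)] by auto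
 have "\<upsilon> r : even_an_forms R"
 using bdd_linearD(2)[of R "tensor_alg R" \<upsilon> r] u(1) r by (simp add: bdd_hom_def tensor_alg_def)
 hence uc: "\<upsilon> r : car R.CC" by (simp add: even_an_forms_def)
 have "q (gmap (\<upsilon> r)) = q (l (tensor_alg_proj R (\<upsilon> r)))"
 proof (rule R.CC_unique[OF Q.complete_bvs_axioms bdd_linear_comp[OF gmap(1) qb]
 bdd_linear_comp[OF tau(1) bdd_linear_comp[OF l qb]] _ uc])
 fix w assume w: "w : fwords (car R)"
 obtain z as where zw: "w = (z, as)" by (cases w)
 have t: "tensor_alg_proj R (R.wgen w) = R.deg0 w"
 using tau(2)[OF R.FF_fmono[OF w]] R.forms_degree0(2)[OF w] by simp
 have l0: "q (l \<zero>[R]) = \<zero>[Q]" using RE.lin_zero[OF lD(1)] EQ.lin_zero[OF qD(1)] by simp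
 have "q (gw w) = q (l (R.deg0 w))"
 proof (cases z)
 case (Some x)
 show ?thesis
 proof (cases "as = []")
 case False
 hence "R.deg0 w = \<zero>[R]" using zw by (cases as) auto
 thus ?thesis using qz[of "l x" as] False zw Some w lD(2) l0 by (simp add: fwords_def)
 qed (use zw Some in simp)
 next
 case None
 show ?thesis
 proof (cases "EX a b cs. as = a # b # cs")
 case True
 then obtain a b cs where "as = a # b # cs" by blast
 thus ?thesis using qz[of "curv a b" cs] qcurv[of a b] zw None w l0 by (simp add: fwords_def)
 next
 case False
 hence "gw w = \<zero>[E]" using zw None by (cases as; cases "tl as") auto
 thus ?thesis using zw None l0 EQ.lin_zero[OF qD(1)] by simp
 qed
 qed
 thus "q (gmap (R.wgen w)) = q (l (tensor_alg_proj R (R.wgen w)))" using gmap_word[OF w] t by simp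
 qed
 thus ?thesis using u(2) r by simp
qed

end

section \<open>Algebras of paths\<close>

lemma cvs_mult_update: "cvs V ==> cvs (V\<lparr>mult := m\<rparr>)"
 by (rule cvs_image[where q="%x. x" and V=V]) auto

lemma complete_bvs_mult_update:
 assumes "complete_bvs V" shows "complete_bvs (V\<lparr>mult := m\<rparr>)"
proof -
 interpret V: complete_bvs V by fact
 let ?V = "V\<lparr>mult := m\<rparr>"
 have cd: "complete_disk ?V D = complete_disk V D" for D
 by (simp add: complete_disk_def disk_def lin_span_def disk_gauge_def submodule_def submodule_axioms_def a_minus_def a_inv_def)
 have hull: "disk_hull ?V S = disk_hull V S" for S by (simp add: disk_hull_def disk_def)
 have sa: "S <+>\<^bsub>?V\<^esub> T = S <+>\<^bsub>V\<^esub> T" for S T unfolding set_add_def' by simp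
 interpret cvs ?V by (rule cvs_mult_update[OF V.cvs_axioms])
 show ?thesis
 by unfold_locales (simp_all add: cd hull sa V.small_subset_carrier V.small_point V.small_sum V.small_disk_hull V.small_complete
 V.small_subset[rotated])
qed

lemma linear_on_mult_update [simp]:
 "linear_on (V\<lparr>mult := m\<rparr>) X f = linear_on V X f" "linear_on X (V\<lparr>mult := m\<rparr>) f = linear_on X V f"
 by (simp_all add: linear_on_def)

lemma bdd_linear_mult_update [simp]:
 "bdd_linear (V\<lparr>mult := m\<rparr>) X f = bdd_linear V X f" "bdd_linear X (V\<lparr>mult := m\<rparr>) f = bdd_linear X V f"
 by (simp_all add: bdd_linear_def)

lemma bdd_bilinear_mult_update [simp]:
 "bdd_bilinear (V\<lparr>mult := m\<rparr>) W X f = bdd_bilinear V W X f" "bdd_bilinear V (W\<lparr>mult := m\<rparr>) X f = bdd_bilinear V W X f"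
 "bdd_bilinear V W (X\<lparr>mult := m\<rparr>) f = bdd_bilinear V W X f"
 by (simp_all add: bdd_bilinear_def)

lemma bdd_homD:
 assumes "bdd_hom A B f"
 shows "bdd_linear A B f" "x : car A ==> y : car A ==> f (x *[A] y) = f x *[B] f y"
 using assms by (auto simp: bdd_hom_def)

lemma bdd_hom_comp:
 assumes "bdd_hom A B f" "bdd_hom B C g" shows "bdd_hom A C (%x. g (f x))"
 using bdd_linear_comp[OF bdd_homD(1)[OF assms(1)] bdd_homD(1)[OF assms(2)]] bdd_homD(2)[OF assms(1)] bdd_homD(2)[OF assms(2)]
 bdd_linearD(2)[OF bdd_homD(1)[OF assms(1)]] by (simp add: bdd_hom_def)

lemma ctensor_bilinear_unique:
 assumes "cb_pair V W" "cb_pair V' W'" and X: "complete_bvs X"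
 and m: "bdd_bilinear (ctensor V W) (ctensor V' W') X m" and m': "bdd_bilinear (ctensor V W) (ctensor V' W') X m'"
 and eq: "!!v w v' w'. v : car V ==> w : car W ==> v' : car V' ==> w' : car W' ==>
      m (elem_tensor V W v w) (elem_tensor V' W' v' w') = m' (elem_tensor V W v w) (elem_tensor V' W' v' w')"
 and x: "x : car (ctensor V W)" and y: "y : car (ctensor V' W')"
 shows "m x y = m' x y"
proof -
 interpret c: cb_pair V W by fact
 interpret c': cb_pair V' W' by fact
 interpret X: complete_bvs X by fact
 interpret T: complete_bvs "ctensor V W" by (rule c.ctensor_complete)
 interpret T': complete_bvs "ctensor V' W'" by (rule c'.ctensor_complete)
 note r = bdd_bilinear_right[OF T.born X.born]
 and l = bdd_bilinear_left[OF T'.born X.born]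
 have step: "m x (elem_tensor V' W' v' w') = m' x (elem_tensor V' W' v' w')"
 if v: "v' : car V'" and w: "w' : car W'" for v' w'
 proof -
 have e: "elem_tensor V' W' v' w' : car (ctensor V' W')"
 using bdd_bilinearD(4)[OF c'.elem_tensor_bilinear v w] .
 show ?thesis
 by (rule c.ctensor_unique[OF X l[OF m e] l[OF m' e] _ x]) (use eq v w in blast)
 qed
 show ?thesis
 by (rule c'.ctensor_unique[OF X r[OF m x] r[OF m' x] _ y]) (use step in blast)
qed

section \<open>Multiplication on a completed tensor product\<close>

locale balg_pair = A: balg A + B: balg B for A :: "'a bvs" and B :: "'b bvs"
begin

sublocale cb_pair A B by unfold_locales

abbreviation "T \<equiv> ctensor A B"
abbreviation "TA \<equiv> ctensor_alg A B"
abbreviation "\<theta> \<equiv> elem_tensor A B"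

sublocale T: complete_bvs T by (rule ctensor_complete)

lemma theta_closed [simp]: "a : car A ==> b : car B ==> \<theta> a b : car T"
 using bdd_bilinearD(4)[OF elem_tensor_bilinear] .

lemma theta_linear:
 "a : car A ==> linear_on B T (\<theta> a)" "b : car B ==> linear_on A T (%a. \<theta> a b)"
 using bdd_bilinearD(1,2)[OF elem_tensor_bilinear] by auto

lemma TA_simps [simp]:
 "car TA = car T" "add TA = add T" "zero TA = zero T" "smult TA = smult T" "small TA = small T"
 by (simp_all add: ctensor_alg_def)

lemma TA_linear [simp]:
 "linear_on TA X f = linear_on T X f" "linear_on X TA f' = linear_on X T f'"
 "bdd_linear TA X f = bdd_linear T X f" "bdd_linear X TA f' = bdd_linear X T f'"
 by (simp_all add: linear_on_def bdd_linear_def)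

lemma TA_mult:
 "bdd_bilinear T T T (mult TA)"
 "a : car A ==> b : car B ==> a' : car A ==> b' : car B ==>
    \<theta> a b *[TA] \<theta> a' b' = \<theta> (a *[A] a') (b *[B] b')"
proof -
 have "EX m. bdd_bilinear T T T m
    & (ALL v:car A. ALL w:car B. ALL v':car A. ALL w':car B.
        m (\<theta> v w) (\<theta> v' w') = \<theta> (v *[A] v') (w *[B] w'))"
 proof (rule ctensor_bilinear[OF cb_pair_axioms cb_pair_axioms ctensor_complete])
 fix v w v' w' assume c: "v : car A" "w : car B" "v' : car A" "w' : car B"
 show "linear_on A T (%v. \<theta> (v *[A] v') (w *[B] w')) & linear_on B T (%w. \<theta> (v *[A] v') (w *[B] w'))
      & linear_on A T (%v'. \<theta> (v *[A] v') (w *[B] w')) & linear_on B T (%w'. \<theta> (v *[A] v') (w *[B] w'))"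
 proof (intro conjI)
 have vv: "v *[A] v' : car A" and ww: "w *[B] w' : car B" using c by auto
 show "linear_on A T (%v. \<theta> (v *[A] v') (w *[B] w'))"
 by (rule linear_on_comp[OF A.mult_linear_left[OF c(3)] theta_linear(2)[OF ww]])
 show "linear_on B T (%w. \<theta> (v *[A] v') (w *[B] w'))"
 by (rule linear_on_comp[OF B.mult_linear_left[OF c(4)] theta_linear(1)[OF vv]])
 show "linear_on A T (%v'. \<theta> (v *[A] v') (w *[B] w'))"
 by (rule linear_on_comp[OF A.mult_linear_right[OF c(1)] theta_linear(2)[OF ww]])
 show "linear_on B T (%w'. \<theta> (v *[A] v') (w *[B] w'))"
 by (rule linear_on_comp[OF B.mult_linear_right[OF c(2)] theta_linear(1)[OF vv]])
 qed
 next
 fix S U S' U' assume s: "S : small A" "U : small B" "S' : small A" "U' : small B"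
 show "{\<theta> (v *[A] v') (w *[B] w') | v w v' w'. v : S & w : U & v' : S' & w' : U'} : small T"
 by (rule T.small_subset[OF bdd_bilinearD(3)[OF elem_tensor_bilinear A.mult_small[OF s(1,3)] B.mult_small[OF s(2,4)]]]) blast
 qed
 from someI_ex[OF this]
 show "bdd_bilinear T T T (mult TA)"
 "a : car A ==> b : car B ==> a' : car A ==> b' : car B ==>
      \<theta> a b *[TA] \<theta> a' b' = \<theta> (a *[A] a') (b *[B] b')"
 unfolding ctensor_alg_def by auto
qed

lemma TA_closed [simp]: "x : car T ==> y : car T ==> x *[TA] y : car T"
 using bdd_bilinearD(4)[OF TA_mult(1)] .

lemma TA_left: "y : car T ==> bdd_linear T T (%x. x *[TA] y)"
 and TA_right: "x : car T ==> bdd_linear T T (%y. x *[TA] y)"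
 using bdd_bilinear_left[OF T.born T.born TA_mult(1)]
 bdd_bilinear_right[OF T.born T.born TA_mult(1)] by auto

text \<open>Elementary tensors decide, for the third factor first and then for the other two
  jointly.\<close>

lemma TA_assoc:
 assumes x: "x : car T" and y: "y : car T" and z: "z : car T"
 shows "(x *[TA] y) *[TA] z = x *[TA] (y *[TA] z)"
proof -
 have 1: "(\<theta> a b *[TA] \<theta> a' b') *[TA] z = \<theta> a b *[TA] (\<theta> a' b' *[TA] z)"
 if c: "a : car A" "b : car B" "a' : car A" "b' : car B" for a b a' b'
 by (rule ctensor_unique[OF ctensor_complete TA_right bdd_linear_comp[OF TA_right TA_right] _ z])
 (use c in "simp_all add: TA_mult(2) A.mult_assoc B.mult_assoc")
 show ?thesis
 proof (rule ctensor_bilinear_unique[where m="%x y. (x *[TA] y) *[TA] z" and m'="%x y. x *[TA] (y *[TA] z)",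
 OF cb_pair_axioms cb_pair_axioms ctensor_complete _ _ 1 x y])
 show "bdd_bilinear T T T (%x y. (x *[TA] y) *[TA] z)" by (rule bdd_bilinear_comp[OF TA_mult(1) TA_left[OF z]])
 show "bdd_bilinear T T T (%x y. x *[TA] (y *[TA] z))"
 unfolding bdd_bilinear_def
 proof (intro conjI ballI)
 fix x assume "x : car T"
 thus "linear_on T T (%y. x *[TA] (y *[TA] z))"
 using linear_on_comp[OF bdd_linearD(1)[OF TA_left[OF z]] bdd_linearD(1)[OF TA_right]] by simp
 next
 fix y assume "y : car T"
 thus "linear_on T T (%x. x *[TA] (y *[TA] z))"
 using bdd_linearD(1)[OF TA_left[of "y *[TA] z"]] z by simp
 next
 fix S S' assume s: "S : small T" "S' : small T"
 show "{x *[TA] (y *[TA] z) | x y. x : S & y : S'} : small T"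
 by (rule T.small_subset[OF bdd_bilinearD(3)[OF TA_mult(1) s(1) bdd_linearD(5)[OF TA_left[OF z] s(2)]]]) blast
 qed
 qed
qed

lemma TA_complete_balg: "complete_balg TA"
proof -
 interpret X: complete_bvs TA unfolding ctensor_alg_def by (rule complete_bvs_mult_update[OF ctensor_complete])
 show ?thesis
 proof
 show "bdd_bilinear TA TA TA (mult TA)" using TA_mult(1) by (simp add: bdd_bilinear_def)
 qed (use TA_assoc in auto)
qed

end

lemma path_map_linear:
 assumes F: "convex_bornology F" and B: "convex_bornology B" and C: "convex_bornology C" and h: "bdd_linear B C h"
 shows "bdd_linear (ctensor F B) (ctensor F C) (path_map F B C h)"
 "f : car F ==> b : car B ==> path_map F B C h (elem_tensor F B f b) = elem_tensor F C f (h b)"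
proof -
 interpret F: convex_bornology F by fact
 interpret B: convex_bornology B by fact
 interpret C: convex_bornology C by fact
 interpret FB: cb_pair F B by unfold_locales
 interpret FC: cb_pair F C by unfold_locales
 note h' = bdd_linearD[OF h]
 have "bdd_bilinear F B (ctensor F C) (%f b. elem_tensor F C f (h b))"
 unfolding bdd_bilinear_def
 proof (intro conjI ballI)
 show "linear_on B (ctensor F C) (%b. elem_tensor F C x (h b))" if "x : car F" for x
 using linear_on_comp[OF h'(1) bdd_bilinearD(1)[OF FC.elem_tensor_bilinear that]] .
 show "linear_on F (ctensor F C) (%f. elem_tensor F C f (h y))" if "y : car B" for y
 using bdd_bilinearD(2)[OF FC.elem_tensor_bilinear h'(2)[OF that]] .
 interpret T: complete_bvs "ctensor F C" by (rule FC.ctensor_complete)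
 fix S S' assume s: "S : small F" "S' : small B"
 show "{elem_tensor F C x (h y) | x y. x : S & y : S'} : small (ctensor F C)"
 by (rule T.small_subset[OF bdd_bilinearD(3)[OF FC.elem_tensor_bilinear s(1) h'(5)[OF s(2)]]]) blast
 qed
 from FB.ctensor_lift[OF FC.ctensor_complete this]
 show "bdd_linear (ctensor F B) (ctensor F C) (path_map F B C h)"
 "f : car F ==> b : car B ==> path_map F B C h (elem_tensor F B f b) = elem_tensor F C f (h b)"
 unfolding path_map_def by auto
qed

lemma path_map_hom:
 assumes F: "balg F" and B: "balg B" and C: "balg C" and h: "bdd_hom B C h"
 shows "bdd_hom (ctensor_alg F B) (ctensor_alg F C) (path_map F B C h)"
proof -
 interpret F: balg F by fact
 interpret B: balg B by fact
 interpret C: balg C by fact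
 interpret FB: balg_pair F B by unfold_locales
 interpret FC: balg_pair F C by unfold_locales
 note pm = path_map_linear[OF F.born B.born C.born bdd_homD(1)[OF h]]
 have hc: "b : car B ==> h b : car C" for b using bdd_linearD(2)[OF bdd_homD(1)[OF h]] .
 let ?p = "path_map F B C h"
 have "?p (x *[FB.TA] y) = ?p x *[FC.TA] ?p y" if x: "x : car FB.T" and y: "y : car FB.T" for x y
 proof (rule ctensor_bilinear_unique[where m="%x y. ?p (x *[FB.TA] y)" and m'="%x y. ?p x *[FC.TA] ?p y",
 OF FB.cb_pair_axioms FB.cb_pair_axioms FC.ctensor_complete _ _ _ x y])
 show "bdd_bilinear FB.T FB.T FC.T (%x y. ?p (x *[FB.TA] y))" by (rule bdd_bilinear_comp[OF FB.TA_mult(1) pm(1)])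
 show "bdd_bilinear FB.T FB.T FC.T (%x y. ?p x *[FC.TA] ?p y)"
 unfolding bdd_bilinear_def
 proof (intro conjI ballI)
 show "linear_on FB.T FC.T (%y. ?p x *[FC.TA] ?p y)" if "x : car FB.T" for x
 using linear_on_comp[OF bdd_linearD(1)[OF pm(1)] bdd_linearD(1)[OF FC.TA_right[OF bdd_linearD(2)[OF pm(1) that]]]] .
 show "linear_on FB.T FC.T (%x. ?p x *[FC.TA] ?p y)" if "y : car FB.T" for y
 using linear_on_comp[OF bdd_linearD(1)[OF pm(1)] bdd_linearD(1)[OF FC.TA_left[OF bdd_linearD(2)[OF pm(1) that]]]] .
 fix S S' assume s: "S : small FB.T" "S' : small FB.T"
 show "{?p x *[FC.TA] ?p y | x y. x : S & y : S'} : small FC.T"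
 by (rule FC.T.small_subset[OF bdd_bilinearD(3)[OF FC.TA_mult(1) bdd_linearD(5)[OF pm(1) s(1)] bdd_linearD(5)[OF pm(1) s(2)]]]) blast
 qed
 qed (use hc in "simp add: FB.TA_mult(2) FC.TA_mult(2) pm(2) bdd_homD(2)[OF h]")
 thus ?thesis using pm(1) by (simp add: bdd_hom_def)
qed

text \<open>What both kinds of homotopy have in common. Powers of a small set of functions are
  unbounded in general, as the constant 2 shows; \<open>power_bdd\<close> asks only that a suitable
  multiple behaves. \<open>unit_path\<close> serves constant homotopies, \<open>id_path\<close> the
  straight line between two maps.\<close>

locale path_alg = balg F for F :: "(real => complex) bvs" +
 fixes unit_path id_path
 assumes ev_bdd: "t : {0..1} ==> S : small F ==> EX M. ALL f:S. cmod (f t) <= M"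
 and ev_add: "t : {0..1} ==> f : car F ==> g : car F ==> (f +[F] g) t = f t + g t"
 and ev_smult: "t : {0..1} ==> f : car F ==> (c .[F] f) t = c * f t"
 and ev_mult: "t : {0..1} ==> f : car F ==> g : car F ==> (f *[F] g) t = f t * g t"
 and unit_path: "unit_path : car F" "unit_path *[F] unit_path = unit_path" "t : {0..1} ==> unit_path t = 1"
 and id_path: "id_path : car F" "t : {0..1} ==> id_path t = cplx t"
 and power_bdd: "S : small F ==> EX c>0. (\<Union>n. set_power F (sc c S) n) : small F"
begin

lemma path_ev_hom:
 assumes B: "complete_balg B" and t: "t : {0..1}"
 shows "bdd_hom (ctensor_alg F B) B (path_ev F B t)"
 "f : car F ==> b : car B ==> path_ev F B t (elem_tensor F B f b) = f t .[B] b"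
proof -
 interpret B: complete_balg B by fact
 interpret FB: balg_pair F B by unfold_locales
 have "bdd_bilinear F B B (%f b. f t .[B] b)"
 unfolding bdd_bilinear_def
 proof (intro conjI ballI)
 show "linear_on B B (%b. x t .[B] b)" if "x : car F" for x
 by (auto simp: linear_on_def B.smult_radd B.smult_smult mult.commute)
 show "linear_on F B (%f. f t .[B] y)" if "y : car B" for y
 using that by (auto simp: linear_on_def ev_add[OF t] ev_smult[OF t] B.smult_ladd B.smult_smult)
 fix S S' assume s: "S : small F" "S' : small B"
 obtain M where M: "ALL f:S. cmod (f t) <= M" using ev_bdd[OF t s(1)] by blast
 obtain D where D: "D : small B" "cdisk B D" "S' <= D" using B.small_disk[OF s(2)] by blast
 interpret D: cdisk B D by fact
 have "{x t .[B] y | x y. x : S & y : S'} <= B.sc (max M 0) D"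
 proof clarify
 fix x y assume xy: "x : S" "y : S'"
 have "y : B.sc 1 D" "cmod (x t) * 1 <= max M 0" using xy D(3) M D.sc_one by (auto simp: le_max_iff_disj)
 thus "x t .[B] y : B.sc (max M 0) D" by (rule D.sc_smult) simp
 qed
 thus "{x t .[B] y | x y. x : S & y : S'} : small B"
 using B.small_subset[OF B.small_sc[OF D(1)]] by blast
 qed
 note ev = FB.ctensor_lift[OF B.complete_bvs_axioms this, folded path_ev_def]
 show e: "f : car F ==> b : car B ==> path_ev F B t (elem_tensor F B f b) = f t .[B] b" for f b
 by (rule ev(2))
 let ?e = "path_ev F B t"
 have "?e (x *[FB.TA] y) = ?e x *[B] ?e y" if x: "x : car FB.T" and y: "y : car FB.T" for x y
 proof (rule ctensor_bilinear_unique[where m="%x y. ?e (x *[FB.TA] y)" and m'="%x y. ?e x *[B] ?e y",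
 OF FB.cb_pair_axioms FB.cb_pair_axioms B.complete_bvs_axioms _ _ _ x y])
 show "bdd_bilinear FB.T FB.T B (%x y. ?e (x *[FB.TA] y))" by (rule bdd_bilinear_comp[OF FB.TA_mult(1) ev(1)])
 show "bdd_bilinear FB.T FB.T B (%x y. ?e x *[B] ?e y)"
 unfolding bdd_bilinear_def
 proof (intro conjI ballI)
 show "linear_on FB.T B (%y. ?e x *[B] ?e y)" if "x : car FB.T" for x
 using linear_on_comp[OF bdd_linearD(1)[OF ev(1)] B.mult_linear_right[OF bdd_linearD(2)[OF ev(1) that]]] .
 show "linear_on FB.T B (%x. ?e x *[B] ?e y)" if "y : car FB.T" for y
 using linear_on_comp[OF bdd_linearD(1)[OF ev(1)] B.mult_linear_left[OF bdd_linearD(2)[OF ev(1) that]]] .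
 fix S S' assume s: "S : small FB.T" "S' : small FB.T"
 show "{?e x *[B] ?e y | x y. x : S & y : S'} : small B"
 by (rule B.small_subset[OF B.mult_small[OF bdd_linearD(5)[OF ev(1) s(1)] bdd_linearD(5)[OF ev(1) s(2)]]]) blast
 qed
 fix f b g b' assume c: "f : car F" "b : car B" "g : car F" "b' : car B"
 have "(f t .[B] b) *[B] (g t .[B] b') = (f t * g t) .[B] (b *[B] b')"
 using linear_onD(3)[OF B.mult_linear_left[of "g t .[B] b'"] c(2)] linear_onD(3)[OF B.mult_linear_right[OF c(2)] c(4)] c
 by (simp add: B.smult_smult)
 thus "?e (FB.\<theta> f b *[FB.TA] FB.\<theta> g b') = ?e (FB.\<theta> f b) *[B] ?e (FB.\<theta> g b')"
 using c by (simp add: FB.TA_mult(2) ev(2) ev_mult[OF t])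
 qed
 thus "bdd_hom (ctensor_alg F B) B (path_ev F B t)" using ev(1) by (simp add: bdd_hom_def)
qed

lemma path_ev_map:
 assumes B: "complete_balg B" and C: "complete_balg C" and h: "bdd_linear B C h" and t: "t : {0..1}"
 and x: "x : car (ctensor F B)"
 shows "path_ev F C t (path_map F B C h x) = h (path_ev F B t x)"
proof -
 interpret B: complete_balg B by fact
 interpret C: complete_balg C by fact
 interpret FB: balg_pair F B by unfold_locales
 interpret FC: balg_pair F C by unfold_locales
 note pm = path_map_linear[OF born B.born C.born h]
 note eB = path_ev_hom[OF B t] and eC = path_ev_hom[OF C t]
 have l: "bdd_linear FB.T B (path_ev F B t)" "bdd_linear FC.T C (path_ev F C t)"
 using bdd_homD(1)[OF eB(1)] bdd_homD(1)[OF eC(1)] by simp_all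
 show ?thesis
 by (rule FB.ctensor_unique[where g="%x. path_ev F C t (path_map F B C h x)" and h="%x. h (path_ev F B t x)",
 OF C.complete_bvs_axioms bdd_linear_comp[OF pm(1) l(2)] bdd_linear_comp[OF l(1) h] _ x])
 (use pm(2) eB(2) eC(2) bdd_linearD(2,4)[OF h] in simp)
qed

text \<open>Elements of a small set of paths need not be finite sums of elementary tensors, so in a
  product one factor after the other, from the right, is replaced by an elementary tensor. Each
  replacement costs the factor \<open>2 * r\<close> of \<open>ctensor_small_bound\<close>, and the
  scalings of \<open>S\<close> and \<open>S'\<close> are chosen to win it back. Nilpotence of
  \<open>K\<close> permits any scaling of \<open>S'\<close>, which also compensates the one that
  \<open>S\<close> requires.\<close>

lemma path_nilpotent:
 assumes K: "analytically_nilpotent K" shows "analytically_nilpotent (ctensor_alg F K)"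
proof -
 interpret K: complete_balg K using K by (simp add: analytically_nilpotent_def)
 interpret FK: balg_pair F K by unfold_locales
 interpret TA: complete_balg FK.TA by (rule FK.TA_complete_balg)
 have "(\<Union>n. set_power FK.TA Y n) : small FK.TA" if Y: "Y : small FK.TA" for Y
 proof -
 have Y': "Y : small FK.T" using Y by simp
 have Yc: "Y <= car FK.T" using FK.T.small_subset_carrier[OF Y'] .
 from Y' show ?thesis
 proof (rule FK.ctensor_small_bound)
 fix S S' and r :: real assume S: "S : small F" and S': "S' : small K" and r: "0 < r"
 and bound: "!!X h D s y. complete_bvs (X :: (nat => (real => complex) \<times> 'a) bvs) ==> bdd_linear FK.T X h ==> D : small X ==> ccdisk X D ==> 0 < s
          ==> (!!v w. v : S ==> w : S' ==> h (FK.\<theta> v w) : cvs.sc X s D) ==> y : Y ==> h y : cvs.sc X (2 * r * s) D"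
 obtain c where c: "c > 0" and W1: "(\<Union>n. set_power F (sc c S) n) : small F" using power_bdd[OF S] by blast
 \<comment> \<open>\<open>c\<close> times \<open>?d\<close> is \<open>2 * r\<close>, so an
   elementary tensor is \<open>1 / (2 * r)\<close> times the one with rescaled entries.\<close>
 let ?d = "2 * r / c"
 let ?P1 = "set_power F (sc c S)" and ?P2 = "set_power K (K.sc ?d S')"
 have W2: "(\<Union>n. ?P2 n) : small K" using K K.small_sc[OF S'] by (simp add: analytically_nilpotent_def)
 have Sc: "sc c S <= car F" and S'c: "K.sc ?d S' <= car K"
 using small_subset_carrier[OF small_sc[OF S]] K.small_subset_carrier[OF K.small_sc[OF S']] by auto
 obtain D where D: "D : small FK.T" "ccdisk FK.T D"
 "{FK.\<theta> f k | f k. f : (\<Union>n. ?P1 n) & k : (\<Union>n. ?P2 n)} <= D"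
 using FK.T.small_ccdisk[OF bdd_bilinearD(3)[OF FK.elem_tensor_bilinear W1 W2]] by blast
 interpret D: ccdisk FK.T D by fact
 \<comment> \<open>\<open>G m\<close> holds the tensors of products of \<open>m + 1\<close> rescaled
   factors on each side, owing to the shifted exponents of \<open>set_power\<close>; one disk
   contains them for all \<open>m\<close>.\<close>
 define G where "G m = {FK.\<theta> f k | f k. f : ?P1 m & k : ?P2 m}" for m
 have GD: "g : D" if "g : G m" for g m using D(3) that unfolding G_def by blast
 have Gc: "g : car FK.T" if "g : G m" for g m using GD[OF that] D.D_carrier by blast
 let ?q = "cplx (1 / (2 * r))"
 have half: "FK.\<theta> s k = ?q .[FK.T] FK.\<theta> (cplx c .[F] s) (cplx ?d .[K] k)"
 if "s : car F" "k : car K" for s k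
 proof -
 have "FK.\<theta> (cplx c .[F] s) (cplx ?d .[K] k) = (cplx c * cplx ?d) .[FK.T] FK.\<theta> s k"
 using linear_onD(3)[OF FK.theta_linear(1)[of "cplx c .[F] s"] that(2), of "cplx ?d"]
 linear_onD(3)[OF FK.theta_linear(2)[OF that(2)] that(1), of "cplx c"] that
 by (simp add: FK.T.smult_smult mult.commute)
 moreover have "?q * (cplx c * cplx ?d) = 1"
 using c r unfolding of_real_mult[symmetric] by simp
 ultimately show ?thesis using that by (simp add: FK.T.smult_smult)
 qed
 have scl: "cplx c .[F] s : sc c S" if "s : S" for s using that by (auto simp: sc_def)
 have scl': "cplx ?d .[K] s : K.sc ?d S'" if "s : S'" for s using that by (auto simp: K.sc_def)
 have elt: "EX g:G 0. FK.\<theta> s k = ?q .[FK.T] g" if "s : S" "k : S'" for s k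
 using half[of s k] scl[OF that(1)] scl'[OF that(2)] that small_subset_carrier[OF S] K.small_subset_carrier[OF S']
 unfolding G_def by fastforce
 have eltm: "EX g':G (Suc m). FK.\<theta> s k *[FK.TA] g = ?q .[FK.T] g'" if H: "s : S" "k : S'" "g : G m" for s k g m
 proof -
 obtain f k' where g: "g = FK.\<theta> f k'" "f : ?P1 m" "k' : ?P2 m" using H(3) unfolding G_def by blast
 have cc: "s : car F" "k : car K" "f : car F" "k' : car K"
 using H small_subset_carrier[OF S] K.small_subset_carrier[OF S'] g set_power_closed[OF Sc] K.set_power_closed[OF S'c] by blast+
 let ?s = "cplx c .[F] s" and ?k = "cplx ?d .[K] k"
 have "FK.\<theta> s k *[FK.TA] g = ?q .[FK.T] (FK.\<theta> ?s ?k *[FK.TA] g)"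
 unfolding half[OF cc(1,2)] using bdd_linearD(4)[OF FK.TA_left[OF Gc[OF H(3)]]] cc by simp
 moreover have "FK.\<theta> ?s ?k *[FK.TA] g = FK.\<theta> (?s *[F] f) (?k *[K] k')"
 unfolding g(1) using FK.TA_mult(2) cc by simp
 moreover have "?s *[F] f : ?P1 (Suc m)" "?k *[K] k' : ?P2 (Suc m)"
 using set_power_left[OF Sc scl[OF H(1)] g(2)] K.set_power_left[OF S'c scl'[OF H(2)] g(3)] by blast+
 ultimately show ?thesis unfolding G_def by blast
 qed
 have q: "cmod ?q * 1 <= 1 / (2 * r)" and r1: "2 * r * (1 / (2 * r)) = 1" and r2: "0 < 1 / (2 * r)" using r by (auto simp: norm_divide)
 \<comment> \<open>The gain \<open>?q\<close> on elementary tensors cancels the loss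
   \<open>2 * r\<close> exactly, so the disk \<open>D\<close> itself is reproduced and no constant
   accumulates.\<close>
 have sub: "h y : D" if h: "bdd_linear FK.T FK.T h" and y: "y : Y"
 and hs: "!!s k. s : S ==> k : S' ==> EX g:D. h (FK.\<theta> s k) = ?q .[FK.T] g" for h y
 proof -
 have "h (FK.\<theta> s k) : FK.T.sc (1 / (2 * r)) D" if "s : S" "k : S'" for s k
 using hs[OF that] D.sc_smult[OF _ q] by auto
 from bound[OF FK.ctensor_complete h D(1,2) r2 this y] show ?thesis unfolding r1 by simp
 qed
 \<comment> \<open>\<open>m\<close> stays general because each factor replaced by an elementary
   tensor is absorbed into \<open>g\<close>, which moves on to \<open>G (Suc m)\<close>.\<close>
 have A: "x *[FK.TA] g : D" if "x : set_power FK.TA Y n" "g : G m" for x n g m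
 using that
 proof (induction n arbitrary: x g m)
 case 0
 show ?case
 proof (rule sub[OF FK.TA_left[OF Gc[OF 0(2)]]])
 show "x : Y" using 0 by simp
 show "EX g':D. FK.\<theta> s k *[FK.TA] g = ?q .[FK.T] g'" if "s : S" "k : S'" for s k
 using eltm[OF that 0(2)] GD by blast
 qed
 next
 case (Suc n)
 obtain x' y where x': "x' : set_power FK.TA Y n" "y : Y" "x = x' *[FK.TA] y"
 using Suc.prems(1) by (auto simp: set_mult_def)
 have xc: "x' : car FK.T" using x'(1) TA.set_power_closed[of Y n] Yc by auto
 have gc: "g : car FK.T" using Gc[OF Suc.prems(2)] .
 have "x' *[FK.TA] (y *[FK.TA] g) : D"
 proof (rule sub[OF bdd_linear_comp[OF FK.TA_left[OF gc] FK.TA_right[OF xc]] x'(2)])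
 fix s k assume sk: "s : S" "k : S'"
 obtain g' where g': "g' : G (Suc m)" "FK.\<theta> s k *[FK.TA] g = ?q .[FK.T] g'" using eltm[OF sk Suc.prems(2)] by blast
 have "x' *[FK.TA] (FK.\<theta> s k *[FK.TA] g) = ?q .[FK.T] (x' *[FK.TA] g')"
 unfolding g'(2) using bdd_linearD(4)[OF FK.TA_right[OF xc] Gc[OF g'(1)]] .
 thus "EX ga:D. x' *[FK.TA] (FK.\<theta> s k *[FK.TA] g) = ?q .[FK.T] ga" using Suc.IH[OF x'(1) g'(1)] by blast
 qed
 thus ?case unfolding x'(3) using FK.TA_assoc[OF xc _ gc] x'(2) Yc by auto
 qed
 have B: "x : D" if H: "x : set_power FK.TA Y n" for x n
 proof (cases n)
 case 0
 show ?thesis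
 by (rule sub[OF bdd_linear_id]) (use H 0 elt GD in "simp, blast")
 next
 case (Suc n')
 obtain x' y where x': "x' : set_power FK.TA Y n'" "y : Y" "x = x' *[FK.TA] y"
 using H Suc by (auto simp: set_mult_def)
 have xc: "x' : car FK.T" using x'(1) TA.set_power_closed[of Y n'] Yc by auto
 show ?thesis unfolding x'(3)
 proof (rule sub[OF FK.TA_right[OF xc] x'(2)])
 fix s k assume sk: "s : S" "k : S'"
 obtain g where g: "g : G 0" "FK.\<theta> s k = ?q .[FK.T] g" using elt[OF sk] by blast
 have "x' *[FK.TA] FK.\<theta> s k = ?q .[FK.T] (x' *[FK.TA] g)"
 unfolding g(2) using bdd_linearD(4)[OF FK.TA_right[OF xc] Gc[OF g(1)]] .
 thus "EX g:D. x' *[FK.TA] FK.\<theta> s k = ?q .[FK.T] g" using A[OF x'(1) g(1)] by blast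
 qed
 qed
 have "(\<Union>n. set_power FK.TA Y n) <= D" using B by blast
 thus ?thesis using FK.T.small_subset[OF D(1)] by simp
 qed
 qed
 thus ?thesis using FK.TA_complete_balg by (simp add: analytically_nilpotent_def)
qed

end

section \<open>Lifting in extensions\<close>

lemma ctensor_alg_simps [simp]:
 "car (ctensor_alg A B) = car (ctensor A B)" "add (ctensor_alg A B) = add (ctensor A B)"
 "zero (ctensor_alg A B) = zero (ctensor A B)" "smult (ctensor_alg A B) = smult (ctensor A B)"
 "small (ctensor_alg A B) = small (ctensor A B)"
 by (simp_all add: ctensor_alg_def)

lemma bdd_linear_ctensor_alg [simp]:
 "bdd_linear (ctensor_alg A B) X f = bdd_linear (ctensor A B) X f"
 "bdd_linear X (ctensor_alg A B) g = bdd_linear X (ctensor A B) g"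
 by (simp_all add: linear_on_def bdd_linear_def)

lemma bdd_linear_sum:
 assumes V: "convex_bornology V" and W: "convex_bornology W" and g: "bdd_linear V W g" "bdd_linear V W h"
 shows "bdd_linear V W (%x. g x +[W] h x)" "bdd_linear V W (%x. g x -[W] h x)"
proof -
 interpret V: convex_bornology V by fact
 have "small V <= Pow (car V)" using V.small_subset_carrier by blast
 thus "bdd_linear V W (%x. g x +[W] h x)" "bdd_linear V W (%x. g x -[W] h x)"
 using bdd_linear_add[OF V.cvs_axioms _ W g] bdd_linear_minus[OF V.cvs_axioms _ W g] by auto
qed

text \<open>The equations of a linear splitting replace exactness. Being equations between bounded
  linear maps, they pass to path algebras by a check on elementary tensors, whereas the kernel of an
  induced map would have to be determined.\<close>

locale split_extension = K: complete_balg K + E: complete_balg E + Q: complete_balg Q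
 for K :: "'k bvs" and E :: "'e bvs" and Q :: "'q bvs" +
 fixes j p \<rho> s
 assumes j: "bdd_hom K E j" and p: "bdd_hom E Q p" and rho: "bdd_linear E K \<rho>" and s: "bdd_linear Q E s"
 and split: "e : car E ==> j (\<rho> e) +[E] s (p e) = e"
 and rho_j: "k : car K ==> \<rho> (j k) = k"
 and p_s: "q : car Q ==> p (s q) = q"
 and nil: "analytically_nilpotent K"
begin

lemmas jD = bdd_linearD[OF bdd_homD(1)[OF j]] and pD = bdd_linearD[OF bdd_homD(1)[OF p]]
 and rhoD = bdd_linearD[OF rho] and sD = bdd_linearD[OF s]

sublocale QE: cvs_pair Q E by unfold_locales
sublocale EQ: cvs_pair E Q by unfold_locales

lemma j_rho: "e : car E ==> p e = \<zero>[Q] ==> j (\<rho> e) = e"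
 using split[of e] QE.lin_zero[OF sD(1)] jD(2)[OF rhoD(2)] by simp

text \<open>A map into the kernel of \<open>p\<close> factors through \<open>j\<close> by means of
  \<open>\<rho>\<close>. Multiplicativity is read off after applying \<open>j\<close>, which has the
  left inverse \<open>\<rho>\<close>.\<close>

lemma kernel_hom:
 assumes N: "complete_balg N" and kp: "bdd_hom N E kp" and z: "!!n. n : car N ==> p (kp n) = \<zero>[Q]"
 shows "bdd_hom N K (%n. \<rho> (kp n))" "n : car N ==> j (\<rho> (kp n)) = kp n"
proof -
 interpret N: complete_balg N by fact
 note kpD = bdd_linearD[OF bdd_homD(1)[OF kp]]
 show jr: "j (\<rho> (kp n)) = kp n" if "n : car N" for n using j_rho[OF kpD(2) z] that by simp
 have "\<rho> (kp (x *[N] y)) = \<rho> (kp x) *[K] \<rho> (kp y)" if xy: "x : car N" "y : car N" for x y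
 proof -
 have "kp (x *[N] y) = j (\<rho> (kp x)) *[E] j (\<rho> (kp y))" using bdd_homD(2)[OF kp xy] jr xy by simp
 also have "... = j (\<rho> (kp x) *[K] \<rho> (kp y))" using bdd_homD(2)[OF j] xy rhoD(2) kpD(2) by simp
 finally show ?thesis using rho_j xy rhoD(2) kpD(2) by simp
 qed
 thus "bdd_hom N K (%n. \<rho> (kp n))"
 using bdd_linear_comp[OF bdd_homD(1)[OF kp] rho] by (simp add: bdd_hom_def)
qed

text \<open>\<open>p\<close> kills the curvature, so curvatures are \<open>j\<close> of elements of
  \<open>K\<close>, and their products in \<open>E\<close> are \<open>j\<close> of products in
  \<open>K\<close>, where nilpotence makes the union of all powers small.\<close>

lemma small_curvature:
 assumes R: "complete_balg R" and l: "bdd_linear R E l"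
 and mult: "!!x y. x : car R ==> y : car R ==> p (l (x *[R] y)) = p (l x) *[Q] p (l y)"
 shows "small_curvature R E l"
proof -
 interpret linear_lift R E l using R l by (simp add: linear_lift_def linear_lift_axioms_def E.complete_balg_axioms)
 show ?thesis
 proof
 fix S assume S: "S : small R"
 have Sc: "S <= car R" using R.small_subset_carrier[OF S] .
 let ?\<Omega> = "{curv x y | x y. x : S & y : S}"
 have 1: "l ` {x *[R] y | x y. x : S & y : S} : small E" using lD(5)[OF R.mult_small[OF S S]] .
 have "{x *[E] y | x y. x : l ` S & y : l ` S} : small E" using E.mult_small[OF lD(5)[OF S] lD(5)[OF S]] .
 from E.small_sum[OF 1 E.small_scale[OF this, of "-1"]]
 have "?\<Omega> : small E"
 proof (rule E.small_subset)
 show "?\<Omega> <= l ` {x *[R] y | x y. x : S & y : S} <+>\<^bsub>E\<^esub> (%x. - 1 .[E] x) ` {x *[E] y | x y. x : l ` S & y : l ` S}"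
 proof clarify
 fix x y assume xy: "x : S" "y : S"
 have "curv x y = l (x *[R] y) +[E] (- 1 .[E] (l x *[E] l y))"
 using xy Sc lD(2) by (simp add: curv_def a_minus_def E.smult_m1 subset_iff)
 thus "curv x y : l ` {x *[R] y | x y. x : S & y : S} <+>\<^bsub>E\<^esub> (%x. - 1 .[E] x) ` {x *[E] y | x y. x : l ` S & y : l ` S}"
 unfolding set_add_def' by (intro UN_I[of "l (x *[R] y)"] UN_I[of "- 1 .[E] (l x *[E] l y)"]) (use xy in auto)
 qed
 qed
 hence \<rho>: "\<rho> ` ?\<Omega> : small K" by (rule rhoD(5))
 have z: "p (curv x y) = \<zero>[Q]" if "x : car R" "y : car R" for x y
 using EQ.lin_minus[OF pD(1)] mult[OF that] that lD(2) bdd_homD(2)[OF p] pD(2) Q.minus_eq_zero by (simp add: curv_def)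
 have j\<Omega>: "j (\<rho> w) = w" if "w : ?\<Omega>" for w using that j_rho[OF curv_closed z] Sc by blast
 have c: "\<rho> ` ?\<Omega> <= car K" using K.small_subset_carrier[OF \<rho>] .
 have "set_power E ?\<Omega> n = j ` set_power K (\<rho> ` ?\<Omega>) n" for n
 proof (induction n)
 case 0 thus ?case using j\<Omega> by (simp add: image_image)
 next
 case (Suc n)
 have "j (x *[K] \<rho> w) = j x *[E] w" if H: "x : set_power K (\<rho> ` ?\<Omega>) n" "w : ?\<Omega>" for x w
 using bdd_homD(2)[OF j subsetD[OF K.set_power_closed[OF c] H(1)] subsetD[OF c imageI[OF H(2)]]] j\<Omega>[OF H(2)] by simp
 note mult = this
 have image: "j ` (X <#>\<^bsub>K\<^esub> \<rho> ` \<Omega>) = j ` X <#>\<^bsub>E\<^esub> \<Omega>"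
 if "!!x w. x : X ==> w : \<Omega> ==> j (x *[K] \<rho> w) = j x *[E] w" for X \<Omega>
 unfolding set_mult_def using that by (fastforce simp: image_iff)
 show ?case unfolding set_power.simps Suc.IH by (rule image[symmetric, OF mult])
 qed
 hence "(\<Union>n. set_power E ?\<Omega> n) = j ` (\<Union>n. set_power K (\<rho> ` ?\<Omega>) n)" by blast
 thus "(\<Union>n. set_power E ?\<Omega> n) : small E"
 using jD(5)[of "\<Union>n. set_power K (\<rho> ` ?\<Omega>) n"] nil \<rho> by (simp add: analytically_nilpotent_def)
 qed
qed

end

text \<open>\<open>e - s (p e)\<close> lies in the kernel and hence in the image of
  \<open>j\<close>; its preimage defines \<open>\<rho>\<close>, which is bounded because
  \<open>j\<close> is a bornological isomorphism onto the kernel.\<close>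

lemma split_extension_of_extn:
 assumes X: "an_nilpotent_extension X"
 obtains \<rho> s where "split_extension (ker X) (mid X) (quo X) (inc X) (prj X) \<rho> s"
proof -
 let ?K = "ker X" and ?E = "mid X" and ?Q = "quo X" and ?j = "inc X" and ?p = "prj X"
 have x: "complete_balg ?K" "complete_balg ?E" "complete_balg ?Q" "bdd_hom ?K ?E ?j" "bdd_hom ?E ?Q ?p"
 "bij_betw ?j (car ?K) (a_kernel ?E ?Q ?p)" "!!S. S <= car ?K ==> ?j ` S : small ?E ==> S : small ?K"
 and nil: "analytically_nilpotent ?K"
 using X by (auto simp: an_nilpotent_extension_def allowable_extension_def)
 obtain s where s: "bdd_linear ?Q ?E s" "ALL q:car ?Q. ?p (s q) = q"
 using X by (auto simp: an_nilpotent_extension_def allowable_extension_def)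
 interpret K: complete_balg ?K by fact
 interpret E: complete_balg ?E by fact
 interpret Q: complete_balg ?Q by fact
 interpret EQ: cvs_pair ?E ?Q by unfold_locales
 interpret KE: cvs_pair ?K ?E by unfold_locales
 note jD = bdd_linearD[OF bdd_homD(1)[OF x(4)]] and pD = bdd_linearD[OF bdd_homD(1)[OF x(5)]] and sD = bdd_linearD[OF s(1)]
 have ker: "a_kernel ?E ?Q ?p = {e : car ?E. ?p e = \<zero>[?Q]}" by (simp add: a_kernel_def kernel_def)
 have inj: "inj_on ?j (car ?K)" and img: "?j ` car ?K = {e : car ?E. ?p e = \<zero>[?Q]}"
 using x(6) ker by (auto simp: bij_betw_def)
 define r where "r e = e -[?E] s (?p e)" for e
 have r: "bdd_linear ?E ?E r" unfolding r_def
 by (rule bdd_linear_sum(2)[OF E.born E.born bdd_linear_id bdd_linear_comp[OF bdd_homD(1)[OF x(5)] s(1)]])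
 note rD = bdd_linearD[OF r]
 define \<rho> where "\<rho> e = inv_into (car ?K) ?j (r e)" for e
 have "?p (r e) = \<zero>[?Q]" if "e : car ?E" for e
 using EQ.lin_minus[OF pD(1), of e "s (?p e)"] that sD(2) pD(2) s(2) Q.minus_eq_zero by (simp add: r_def)
 hence mem: "r e : ?j ` car ?K" if "e : car ?E" for e using that rD(2) img by auto
 have \<rho>: "\<rho> e : car ?K" "?j (\<rho> e) = r e" if "e : car ?E" for e
 unfolding \<rho>_def using inv_into_into[OF mem[OF that]] f_inv_into_f[OF mem[OF that]] by auto
 have eqI: "k = k'" if "k : car ?K" "k' : car ?K" "?j k = ?j k'" for k k' using inj_onD[OF inj] that by blast
 have split: "?j (\<rho> e) +[?E] s (?p e) = e" if e: "e : car ?E" for e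
 proof -
 have "(a -[?E] b) +[?E] b = a" if "a : car ?E" "b : car ?E" for a b using that by algebra
 thus ?thesis unfolding \<rho>(2)[OF e] r_def using e sD(2) pD(2) by simp
 qed
 have pj: "?p (?j k) = \<zero>[?Q]" if "k : car ?K" for k using img that by blast
 have rj: "\<rho> (?j k) = k" if k: "k : car ?K" for k
 proof (rule eqI[OF \<rho>(1)[OF jD(2)[OF k]] k])
 interpret QE: cvs_pair ?Q ?E by unfold_locales
 show "?j (\<rho> (?j k)) = ?j k"
 using split[OF jD(2)[OF k]] pj[OF k] QE.lin_zero[OF sD(1)] jD(2)[OF \<rho>(1)[OF jD(2)[OF k]]] by simp
 qed
 have "bdd_linear ?E ?K \<rho>"
 proof (rule bdd_linearI)
 show "\<rho> (x +[?E] y) = \<rho> x +[?K] \<rho> y" if "x : car ?E" "y : car ?E" for x y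
 by (rule eqI) (use that \<rho> rD jD in auto)
 show "\<rho> (c .[?E] x) = c .[?K] \<rho> x" if "x : car ?E" for x c
 by (rule eqI) (use that \<rho> rD jD in auto)
 show "\<rho> ` S : small ?K" if S: "S : small ?E" for S
 proof (rule x(7))
 have "?j ` \<rho> ` S = r ` S" unfolding image_image using E.small_subset_carrier[OF S] \<rho>(2) by (intro image_cong) auto
 thus "?j ` \<rho> ` S : small ?E" using rD(5)[OF S] by simp
 show "\<rho> ` S <= car ?K" using E.small_subset_carrier[OF S] \<rho>(1) by blast
 qed
 qed (use \<rho> in auto)
 hence "split_extension ?K ?E ?Q ?j ?p \<rho> s"
 by unfold_locales (use x s split rj nil in auto)
 thus thesis by (rule that)
qed

context path_alg begin

text \<open>Each equation holds on elementary tensors, and these determine bounded linear maps on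
  the completed tensor product.\<close>

lemma path_split_extension:
 assumes "split_extension K E Q j p \<rho> s"
 shows "split_extension (ctensor_alg F K) (ctensor_alg F E) (ctensor_alg F Q)
    (path_map F K E j) (path_map F E Q p) (path_map F E K \<rho>) (path_map F Q E s)"
proof -
 interpret split_extension K E Q j p \<rho> s by fact
 interpret FK: balg_pair F K by unfold_locales
 interpret FE: balg_pair F E by unfold_locales
 interpret FQ: balg_pair F Q by unfold_locales
 note bF = born and bK = K.born and bE = E.born
 and bQ = Q.born
 note J = path_map_linear[OF bF bK bE bdd_homD(1)[OF j]] and P = path_map_linear[OF bF bE bQ bdd_homD(1)[OF p]]
 and Rh = path_map_linear[OF bF bE bK rho] and Ss = path_map_linear[OF bF bQ bE s]
 let ?j = "path_map F K E j" and ?p = "path_map F E Q p" and ?r = "path_map F E K \<rho>" and ?s = "path_map F Q E s"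
 interpret KA: complete_balg FK.TA by (rule FK.TA_complete_balg)
 interpret EA: complete_balg FE.TA by (rule FE.TA_complete_balg)
 interpret QA: complete_balg FQ.TA by (rule FQ.TA_complete_balg)
 show ?thesis
 proof
 show "bdd_hom FK.TA FE.TA ?j" by (rule path_map_hom[OF balg_axioms K.balg_axioms E.balg_axioms j])
 show "bdd_hom FE.TA FQ.TA ?p" by (rule path_map_hom[OF balg_axioms E.balg_axioms Q.balg_axioms p])
 show "bdd_linear FE.TA FK.TA ?r" "bdd_linear FQ.TA FE.TA ?s" using Rh(1) Ss(1) by simp_all
 show "analytically_nilpotent FK.TA" by (rule path_nilpotent[OF nil])
 next
 fix e assume "e : car FE.TA"
 hence e: "e : car FE.T" by simp
 note L = bdd_linear_sum(1)[OF FE.T.born FE.T.born bdd_linear_comp[OF Rh(1) J(1)] bdd_linear_comp[OF P(1) Ss(1)]]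
 have "?j (?r e) +[FE.T] ?s (?p e) = e"
 proof (rule FE.ctensor_unique[OF FE.ctensor_complete L bdd_linear_id _ e])
 fix f b assume fb: "f : car F" "b : car E"
 have "FE.\<theta> f (j (\<rho> b)) +[FE.T] FE.\<theta> f (s (p b)) = FE.\<theta> f (j (\<rho> b) +[E] s (p b))"
 using linear_onD(2)[OF FE.theta_linear(1)[OF fb(1)]] fb jD(2) rhoD(2) sD(2) pD(2) by simp
 thus "?j (?r (FE.\<theta> f b)) +[FE.T] ?s (?p (FE.\<theta> f b)) = FE.\<theta> f b"
 using J(2) Rh(2) Ss(2) P(2) fb rhoD(2) pD(2) split[OF fb(2)] by simp
 qed
 thus "?j (?r e) +[FE.TA] ?s (?p e) = e" by simp
 next
 fix k assume "k : car FK.TA"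
 hence k: "k : car FK.T" by simp
 show "?r (?j k) = k"
 by (rule FK.ctensor_unique[OF FK.ctensor_complete bdd_linear_comp[OF J(1) Rh(1)] bdd_linear_id _ k])
 (use J(2) Rh(2) jD(2) rho_j in simp)
 next
 fix q assume "q : car FQ.TA"
 hence q: "q : car FQ.T" by simp
 show "?p (?s q) = q"
 by (rule FQ.ctensor_unique[OF FQ.ctensor_complete bdd_linear_comp[OF Ss(1) P(1)] bdd_linear_id _ q])
 (use Ss(2) P(2) sD(2) p_s in simp)
 qed
qed

text \<open>\<open>unit_path\<close> is idempotent, so tensoring with it is multiplicative.\<close>

lemma constant_homotopy:
 assumes A: "complete_balg A" and B: "complete_balg B" and \<phi>: "bdd_hom A B \<phi>"
 defines "\<Phi> \<equiv> %a. elem_tensor F B unit_path (\<phi> a)"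
 shows "bdd_hom A (ctensor_alg F B) \<Phi>" "t : {0..1} ==> a : car A ==> path_ev F B t (\<Phi> a) = \<phi> a"
proof -
 interpret B: complete_balg B by fact
 interpret FB: balg_pair F B by unfold_locales
 note \<phi>D = bdd_linearD[OF bdd_homD(1)[OF \<phi>]]
 have "bdd_linear B FB.T (FB.\<theta> unit_path)"
 by (rule bdd_bilinear_right[OF born FB.T.born FB.elem_tensor_bilinear unit_path(1)])
 from bdd_linear_comp[OF bdd_homD(1)[OF \<phi>] this]
 show "bdd_hom A (ctensor_alg F B) \<Phi>"
 using FB.TA_mult(2)[OF unit_path(1) _ unit_path(1)] \<phi>D(2) bdd_homD(2)[OF \<phi>] unit_path(2) by (simp add: bdd_hom_def \<Phi>_def)
 show "path_ev F B t (\<Phi> a) = \<phi> a" if "t : {0..1}" "a : car A"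
 unfolding \<Phi>_def using path_ev_hom(2)[OF B that(1) unit_path(1) \<phi>D(2)[OF that(2)]] unit_path(3)[OF that(1)] \<phi>D(2) that(2) by simp
qed

end

lemma quasi_free_extnD:
 assumes U: "universal_an_nilpotent_extension U"
 shows "complete_balg (ker U)" "complete_balg (mid U)" "complete_balg (quo U)"
 "bdd_hom (ker U) (mid U) (inc U)" "bdd_hom (mid U) (quo U) (prj U)"
 "n : car (ker U) ==> prj U (inc U n) = \<zero>[quo U]"
 "EX \<upsilon>. bdd_hom (mid U) (tensor_alg (mid U)) \<upsilon> & (ALL r:car (mid U). tensor_alg_proj (mid U) (\<upsilon> r) = r)"
proof -
 have a: "allowable_extension U" "analytically_quasi_free (mid U)"
 using U by (auto simp: universal_an_nilpotent_extension_def an_nilpotent_extension_def)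
 thus "complete_balg (ker U)" "complete_balg (mid U)" "complete_balg (quo U)"
 "bdd_hom (ker U) (mid U) (inc U)" "bdd_hom (mid U) (quo U) (prj U)"
 "EX \<upsilon>. bdd_hom (mid U) (tensor_alg (mid U)) \<upsilon> & (ALL r:car (mid U). tensor_alg_proj (mid U) (\<upsilon> r) = r)"
 by (auto simp: allowable_extension_def analytically_quasi_free_def)
 have "bij_betw (inc U) (car (ker U)) (a_kernel (mid U) (quo U) (prj U))" using a by (simp add: allowable_extension_def)
 thus "n : car (ker U) ==> prj U (inc U n) = \<zero>[quo U]"
 by (auto simp: bij_betw_def a_kernel_def kernel_def)
qed

lemma lifting_exists:
 assumes U: "universal_an_nilpotent_extension U" and X: "an_nilpotent_extension X"
 and \<phi>: "bdd_hom (quo U) (quo X) \<phi>"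
 shows "EX \<xi> \<psi>. extn_morphism U X \<xi> \<psi> \<phi>"
proof -
 note u = quasi_free_extnD[OF U]
 obtain \<upsilon> where v: "bdd_hom (mid U) (tensor_alg (mid U)) \<upsilon>" "ALL r:car (mid U). tensor_alg_proj (mid U) (\<upsilon> r) = r" using u(7) by blast
 obtain \<rho> s where "split_extension (ker X) (mid X) (quo X) (inc X) (prj X) \<rho> s" using split_extension_of_extn[OF X] .
 then interpret split_extension "ker X" "mid X" "quo X" "inc X" "prj X" \<rho> s .
 interpret A: complete_balg "quo U" by (rule u(3))
 interpret AQ: cvs_pair "quo U" "quo X" by unfold_locales
 note \<pi>D = bdd_linearD[OF bdd_homD(1)[OF u(5)]] and \<phi>D = bdd_linearD[OF bdd_homD(1)[OF \<phi>]] and \<iota>D = bdd_linearD[OF bdd_homD(1)[OF u(4)]]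
 define l where "l r = s (\<phi> (prj U r))" for r
 have l: "bdd_linear (mid U) (mid X) l"
 unfolding l_def by (rule bdd_linear_comp[OF bdd_homD(1)[OF bdd_hom_comp[OF u(5) \<phi>]] s])
 have pl: "prj X (l r) = \<phi> (prj U r)" if "r : car (mid U)" for r using that p_s \<phi>D(2) \<pi>D(2) by (simp add: l_def)
 interpret R: complete_balg "mid U" by (rule u(2))
 have m: "prj X (l (x *[mid U] y)) = prj X (l x) *[quo X] prj X (l y)" if "x : car (mid U)" "y : car (mid U)" for x y
 using that pl bdd_homD(2)[OF bdd_hom_comp[OF u(5) \<phi>] that] by simp
 interpret small_curvature "mid U" "mid X" l by (rule small_curvature[OF u(2) l m])
 define \<psi> where "\<psi> r = gmap (\<upsilon> r)" for r
 have \<psi>: "bdd_hom (mid U) (mid X) \<psi>" unfolding \<psi>_def by (rule lift_hom[OF v(1)])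
 have p\<psi>: "prj X (\<psi> r) = \<phi> (prj U r)" if "r : car (mid U)" for r
 unfolding \<psi>_def using lift_over[OF v Q.complete_balg_axioms p m that] pl[OF that] by simp
 have z: "prj X (\<psi> (inc U n)) = \<zero>[quo X]" if "n : car (ker U)" for n
 using p\<psi>[OF \<iota>D(2)[OF that]] u(6)[OF that] AQ.lin_zero[OF \<phi>D(1)] by simp
 note k = kernel_hom[OF u(1) bdd_hom_comp[OF u(4) \<psi>] z]
 have "extn_morphism U X (%n. \<rho> (\<psi> (inc U n))) \<psi> \<phi>"
 unfolding extn_morphism_def using k \<psi> \<phi> p\<psi> by simp
 thus ?thesis by blast
qed

text \<open>The linear homotopy \<open>l\<close> takes the values \<open>\<psi>0\<close> and
  \<open>\<psi>1\<close> at the endpoints. These are multiplicative already, so by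
  \<open>lift_over\<close> they survive the correction of \<open>l\<close> to a homomorphism. The
  maps on kernels follow because \<open>j\<close> is injective.\<close>

lemma (in path_alg) homotopy_lifting:
 assumes U: "universal_an_nilpotent_extension U" and X: "an_nilpotent_extension X"
 and m0: "extn_morphism U X \<xi>0 \<psi>0 \<phi>0" and m1: "extn_morphism U X \<xi>1 \<psi>1 \<phi>1"
 and \<Phi>: "homotopy_between F (quo U) (quo X) \<Phi> \<phi>0 \<phi>1"
 shows "EX \<Xi> \<Psi>. extn_homotopy_between F U X \<Xi> \<Psi> \<Phi> \<xi>0 \<psi>0 \<phi>0 \<xi>1 \<psi>1 \<phi>1"
proof -
 note u = quasi_free_extnD[OF U]
 obtain \<upsilon> where v: "bdd_hom (mid U) (tensor_alg (mid U)) \<upsilon>" "ALL r:car (mid U). tensor_alg_proj (mid U) (\<upsilon> r) = r" using u(7) by blast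
 obtain \<rho> s where se: "split_extension (ker X) (mid X) (quo X) (inc X) (prj X) \<rho> s" using split_extension_of_extn[OF X] .
 let ?K = "ker X" and ?E = "mid X" and ?Q = "quo X" and ?j = "inc X" and ?p = "prj X"
 and ?N = "ker U" and ?R = "mid U" and ?A = "quo U" and ?\<iota> = "inc U" and ?\<pi> = "prj U"
 interpret X: split_extension ?K ?E ?Q ?j ?p \<rho> s by (rule se)
 interpret FK: balg_pair F ?K by unfold_locales
 interpret FE: balg_pair F ?E by unfold_locales
 interpret FQ: balg_pair F ?Q by unfold_locales
 interpret N: complete_balg ?N by (rule u(1))
 interpret R: complete_balg ?R by (rule u(2))
 interpret A: complete_balg ?A by (rule u(3))
 let ?jp = "path_map F ?K ?E ?j" and ?pp = "path_map F ?E ?Q ?p" and ?rp = "path_map F ?E ?K \<rho>" and ?sp = "path_map F ?Q ?E s"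
 interpret P: split_extension FK.TA FE.TA FQ.TA ?jp ?pp ?rp ?sp by (rule path_split_extension[OF se])
 note bE = X.E.born and bQ = X.Q.born and bR = R.born
 and bT = FE.T.born
 have h: "bdd_hom ?N ?K \<xi>0" "bdd_hom ?R ?E \<psi>0" "bdd_hom ?A ?Q \<phi>0" "bdd_hom ?N ?K \<xi>1" "bdd_hom ?R ?E \<psi>1" "bdd_hom ?A ?Q \<phi>1"
 and ms: "!!n. n : car ?N ==> \<psi>0 (?\<iota> n) = ?j (\<xi>0 n)" "!!n. n : car ?N ==> \<psi>1 (?\<iota> n) = ?j (\<xi>1 n)"
 "!!r. r : car ?R ==> ?p (\<psi>0 r) = \<phi>0 (?\<pi> r)" "!!r. r : car ?R ==> ?p (\<psi>1 r) = \<phi>1 (?\<pi> r)"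
 using m0 m1 by (auto simp: extn_morphism_def)
 have H: "bdd_hom ?A FQ.TA \<Phi>" "!!a. a : car ?A ==> path_ev F ?Q 0 (\<Phi> a) = \<phi>0 a" "!!a. a : car ?A ==> path_ev F ?Q 1 (\<Phi> a) = \<phi>1 a"
 using \<Phi> by (auto simp: homotopy_between_def)
 have \<pi>c: "?\<pi> r : car ?A" if "r : car ?R" for r using bdd_linearD(2)[OF bdd_homD(1)[OF u(5)] that] .
 have \<iota>c: "?\<iota> n : car ?R" if "n : car ?N" for n using bdd_linearD(2)[OF bdd_homD(1)[OF u(4)] that] .
 have \<Phi>l: "bdd_linear ?A FQ.T \<Phi>" using bdd_homD(1)[OF H(1)] by simp
 have \<Phi>\<pi>: "bdd_linear ?R FQ.T (%r. \<Phi> (?\<pi> r))" by (rule bdd_linear_comp[OF bdd_homD(1)[OF u(5)] \<Phi>l])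
 have pp: "bdd_linear FE.T FQ.T ?pp" "!!f e. f : car F ==> e : car ?E ==> ?pp (FE.\<theta> f e) = FQ.\<theta> f (?p e)"
 using path_map_linear[OF born bE bQ bdd_homD(1)[OF X.p]] by auto
 have sp: "bdd_linear FQ.T FE.T ?sp" "!!f q. f : car F ==> q : car ?Q ==> ?sp (FQ.\<theta> f q) = FE.\<theta> f (s q)"
 using path_map_linear[OF born bQ bE X.s] by auto
 \<comment> \<open>\<open>d0\<close> and \<open>d1\<close> take values in the kernel of the
   projection, so interpolating between them leaves the image of \<open>l\<close> in the quotient
   equal to \<open>\<Phi>\<close> composed with the projection of \<open>U\<close>.\<close>
 define d0 where "d0 r = \<psi>0 r -[?E] s (\<phi>0 (?\<pi> r))" for r
 define d1 where "d1 r = \<psi>1 r -[?E] s (\<phi>1 (?\<pi> r))" for r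
 have d0: "bdd_linear ?R ?E d0" unfolding d0_def
 by (rule bdd_linear_sum(2)[OF bR bE bdd_homD(1)[OF h(2)] bdd_linear_comp[OF bdd_homD(1)[OF bdd_hom_comp[OF u(5) h(3)]] X.s]])
 have d1: "bdd_linear ?R ?E d1" unfolding d1_def
 by (rule bdd_linear_sum(2)[OF bR bE bdd_homD(1)[OF h(5)] bdd_linear_comp[OF bdd_homD(1)[OF bdd_hom_comp[OF u(5) h(6)]] X.s]])
 have s\<phi>c: "s (\<phi>0 (?\<pi> r)) : car ?E" "s (\<phi>1 (?\<pi> r)) : car ?E" "\<psi>0 r : car ?E" "\<psi>1 r : car ?E"
 "\<phi>0 (?\<pi> r) : car ?Q" "\<phi>1 (?\<pi> r) : car ?Q"
 if "r : car ?R" for r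
 using bdd_linearD(2)[OF bdd_homD(1)[OF h(2)]] bdd_linearD(2)[OF bdd_homD(1)[OF h(5)]] bdd_linearD(2)[OF bdd_homD(1)[OF h(3)]]
 bdd_linearD(2)[OF bdd_homD(1)[OF h(6)]] X.sD(2) \<pi>c[OF that] that by auto
 have pd: "?p (d0 r) = \<zero>[?Q]" "?p (d1 r) = \<zero>[?Q]" if "r : car ?R" for r
 using X.EQ.lin_minus[OF X.pD(1)] s\<phi>c[OF that] X.p_s ms(3,4)[OF that] X.Q.minus_eq_zero by (simp_all add: d0_def d1_def)
 have dc: "d0 r : car ?E" "d1 r : car ?E" if "r : car ?R" for r using bdd_linearD(2)[OF d0 that] bdd_linearD(2)[OF d1 that] .
 let ?c = "unit_path -[F] id_path"
 have cc: "?c : car F" using unit_path(1) id_path(1) by simp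
 have cev: "?c t = 1 - cplx t" if "t : {0..1}" for t
 proof -
 have "?c = unit_path +[F] (- 1 .[F] id_path)" using smult_m1[OF id_path(1)] by (simp add: a_minus_def)
 thus ?thesis using ev_add[OF that] ev_smult[OF that] unit_path(1,3) id_path that by simp
 qed
 define l where "l r = FE.\<theta> ?c (d0 r) +[FE.T] (FE.\<theta> id_path (d1 r) +[FE.T] ?sp (\<Phi> (?\<pi> r)))" for r
 have \<theta>l: "bdd_linear ?E FE.T (FE.\<theta> f)" if "f : car F" for f
 by (rule bdd_bilinear_right[OF born bT FE.elem_tensor_bilinear that])
 have lT: "bdd_linear ?R FE.T l"
 unfolding l_def by (intro bdd_linear_sum(1)[OF bR bT] bdd_linear_comp[OF d0 \<theta>l[OF cc]] bdd_linear_comp[OF d1 \<theta>l[OF id_path(1)]] bdd_linear_comp[OF \<Phi>\<pi> sp(1)])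
 have mem: "FE.\<theta> ?c (d0 r) : car FE.T" "FE.\<theta> id_path (d1 r) : car FE.T" "?sp (\<Phi> (?\<pi> r)) : car FE.T" "\<Phi> (?\<pi> r) : car FQ.T"
 if "r : car ?R" for r
 using cc id_path(1) dc[OF that] bdd_linearD(2)[OF sp(1)] bdd_linearD(2)[OF \<Phi>\<pi> that] by auto
 have \<theta>0: "FQ.\<theta> f \<zero>[?Q] = \<zero>[FQ.T]" if "f : car F" for f
 proof -
 interpret QT: cvs_pair ?Q FQ.T by unfold_locales
 show ?thesis using QT.lin_zero[OF FQ.theta_linear(1)[OF that]] .
 qed
 have pl: "?pp (l r) = \<Phi> (?\<pi> r)" if r: "r : car ?R" for r
 using P.p_s[of "\<Phi> (?\<pi> r)"] mem[OF r] bdd_linearD(3)[OF pp(1)] pp(2) cc id_path(1) dc[OF r] pd[OF r] \<theta>0 by (simp add: l_def)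
 have evl: "path_ev F ?E t (l r) = (1 - cplx t) .[?E] d0 r +[?E] (cplx t .[?E] d1 r +[?E] s (path_ev F ?Q t (\<Phi> (?\<pi> r))))"
 if t: "t : {0..1}" and r: "r : car ?R" for t r
 proof -
 note e = path_ev_hom[OF X.E.complete_balg_axioms t]
 have el: "bdd_linear FE.T ?E (path_ev F ?E t)" using bdd_homD(1)[OF e(1)] by simp
 show ?thesis
 using bdd_linearD(3)[OF el] e(2) mem[OF r] cc id_path dc[OF r] cev[OF t] id_path(2)[OF t]
 path_ev_map[OF X.Q.complete_balg_axioms X.E.complete_balg_axioms X.s t mem(4)[OF r]] by (simp add: l_def)
 qed
 have cancel: "(a -[?E] b) +[?E] b = a" if "a : car ?E" "b : car ?E" for a b using that by algebra
 have ev0: "path_ev F ?E 0 (l r) = \<psi>0 r" if r: "r : car ?R" for r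
 using evl[of 0, OF _ r] H(2)[OF \<pi>c[OF r]] dc[OF r] s\<phi>c[OF r] cancel by (simp add: d0_def)
 have ev1: "path_ev F ?E 1 (l r) = \<psi>1 r" if r: "r : car ?R" for r
 using evl[of 1, OF _ r] H(3)[OF \<pi>c[OF r]] dc[OF r] s\<phi>c[OF r] cancel by (simp add: d1_def)
 have m: "?pp (l (x *[?R] y)) = ?pp (l x) *[FQ.TA] ?pp (l y)" if "x : car ?R" "y : car ?R" for x y
 using that pl bdd_homD(2)[OF bdd_hom_comp[OF u(5) H(1)] that] by simp
 have lTA: "bdd_linear ?R FE.TA l" using lT by simp
 interpret L: small_curvature ?R FE.TA l by (rule P.small_curvature[OF u(2) lTA m])
 define \<Psi> where "\<Psi> r = L.gmap (\<upsilon> r)" for r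
 have \<Psi>: "bdd_hom ?R FE.TA \<Psi>" unfolding \<Psi>_def by (rule L.lift_hom[OF v(1)])
 have p\<Psi>: "?pp (\<Psi> r) = \<Phi> (?\<pi> r)" if "r : car ?R" for r
 unfolding \<Psi>_def using L.lift_over[OF v P.Q.complete_balg_axioms P.p m that] pl[OF that] by simp
 have t01: "(0::real) : {0..1}" "(1::real) : {0..1}" by auto
 have e0: "path_ev F ?E 0 (\<Psi> r) = \<psi>0 r" if r: "r : car ?R" for r
 unfolding \<Psi>_def using L.lift_over[OF v X.E.complete_balg_axioms path_ev_hom(1)[OF X.E.complete_balg_axioms t01(1)] _ r] ev0 r
 bdd_homD(2)[OF h(2)] by simp
 have e1: "path_ev F ?E 1 (\<Psi> r) = \<psi>1 r" if r: "r : car ?R" for r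
 unfolding \<Psi>_def using L.lift_over[OF v X.E.complete_balg_axioms path_ev_hom(1)[OF X.E.complete_balg_axioms t01(2)] _ r] ev1 r
 bdd_homD(2)[OF h(5)] by simp
 have z: "?pp (\<Psi> (?\<iota> n)) = \<zero>[FQ.TA]" if "n : car ?N" for n
 proof -
 interpret AQ: cvs_pair ?A FQ.T by unfold_locales
 show ?thesis using p\<Psi>[OF \<iota>c[OF that]] u(6)[OF that] AQ.lin_zero[OF bdd_linearD(1)[OF \<Phi>l]] by simp
 qed
 define \<Xi> where "\<Xi> n = ?rp (\<Psi> (?\<iota> n))" for n
 have \<Xi>: "bdd_hom ?N FK.TA \<Xi>" "!!n. n : car ?N ==> ?jp (\<Xi> n) = \<Psi> (?\<iota> n)"
 unfolding \<Xi>_def using P.kernel_hom[OF u(1) bdd_hom_comp[OF u(4) \<Psi>] z] by blast+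
 have \<Xi>c: "\<Xi> n : car FK.T" if "n : car ?N" for n using bdd_linearD(2)[OF bdd_homD(1)[OF \<Xi>(1)] that] by simp
 have \<Xi>ev: "path_ev F ?K t (\<Xi> n) = \<xi> n"
 if t: "t : {0..1}" and n: "n : car ?N" and \<xi>: "\<xi> n : car ?K" and eq: "path_ev F ?E t (\<Psi> (?\<iota> n)) = ?j (\<xi> n)" for t n \<xi>
 proof -
 have "?j (path_ev F ?K t (\<Xi> n)) = ?j (\<xi> n)"
 using path_ev_map[OF X.K.complete_balg_axioms X.E.complete_balg_axioms bdd_homD(1)[OF X.j] t \<Xi>c[OF n]] \<Xi>(2)[OF n] eq by simp
 moreover have "path_ev F ?K t (\<Xi> n) : car ?K"
 using bdd_linearD(2)[OF bdd_homD(1)[OF path_ev_hom(1)[OF X.K.complete_balg_axioms t]]] \<Xi>c[OF n] by simp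
 ultimately show ?thesis using X.rho_j \<xi> by metis
 qed
 have "\<xi>0 n : car ?K" "\<xi>1 n : car ?K" if "n : car ?N" for n
 using bdd_linearD(2)[OF bdd_homD(1)[OF h(1)] that] bdd_linearD(2)[OF bdd_homD(1)[OF h(4)] that] by auto
 hence "homotopy_between F ?N ?K \<Xi> \<xi>0 \<xi>1"
 unfolding homotopy_between_def using \<Xi>(1) \<Xi>ev[OF t01(1)] \<Xi>ev[OF t01(2)] e0[OF \<iota>c] e1[OF \<iota>c] ms(1,2) by simp
 moreover have "homotopy_between F ?R ?E \<Psi> \<psi>0 \<psi>1" unfolding homotopy_between_def using \<Psi> e0 e1 by simp
 moreover have "extn_morphism U (path_extn F X) \<Xi> \<Psi> \<Phi>"
 unfolding extn_morphism_def path_extn_def using \<Xi> \<Psi> H(1) p\<Psi> by simp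
 ultimately show ?thesis using \<Phi> unfolding extn_homotopy_between_def by blast
qed

text \<open>The homotopy that is constant in the quotient is lifted.\<close>

lemma (in path_alg) lifting_unique:
 assumes U: "universal_an_nilpotent_extension U" and X: "an_nilpotent_extension X"
 and m: "extn_morphism U X \<xi>0 \<psi>0 \<phi>" "extn_morphism U X \<xi>1 \<psi>1 \<phi>"
 shows "EX \<Xi> \<Psi> \<Phi>. extn_homotopy_between F U X \<Xi> \<Psi> \<Phi> \<xi>0 \<psi>0 \<phi> \<xi>1 \<psi>1 \<phi> & homotopy_relative_to F (quo U) (quo X) \<Phi> \<phi>"
proof -
 have Q: "complete_balg (quo X)" using X by (simp add: an_nilpotent_extension_def allowable_extension_def)
 have \<phi>: "bdd_hom (quo U) (quo X) \<phi>" using m by (simp add: extn_morphism_def)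
 note c = constant_homotopy[OF quasi_free_extnD(3)[OF U] Q \<phi>]
 have "homotopy_between F (quo U) (quo X) (%a. elem_tensor F (quo X) unit_path (\<phi> a)) \<phi> \<phi>"
 unfolding homotopy_between_def using c by simp
 from homotopy_lifting[OF U X m this] show ?thesis unfolding homotopy_relative_to_def using c(2) by blast
qed

section \<open>Absolutely continuous functions\<close>

text \<open>The condition of \<open>abs_cont01\<close> without extensionality and for any normed
  target, so that it applies to real and imaginary parts.\<close>

definition abs_cont :: "(real => 'a::real_normed_vector) => bool" where
 "abs_cont f \<longleftrightarrow> (ALL e>0. EX d>0. ALL I :: (real \<times> real) set.
    finite I & (ALL (a, b):I. 0 <= a & a <= b & b <= 1)
    & disjoint_family_on (%(a, b). {a<..<b}) I & (SUM (a, b):I. b - a) < d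
    --> (SUM (a, b):I. norm (f b - f a)) < e)"

text \<open>Intervals are taken as sets, as in divisions; for a nonempty compact interval infimum
  and supremum are its endpoints.\<close>

abbreviation incr :: "(real => 'a::real_normed_vector) => real set => 'a" where
 "incr f K \<equiv> f (Sup K) - f (Inf K)"

abbreviation len :: "real set => real" where
 "len K \<equiv> Sup K - Inf K"

lemma real_interval_cases:
 assumes "K = cbox a b" "K ~= {}"
 shows "Inf K = a" "Sup K = (b::real)" "a <= b" "K = {a..b}" "measure lebesgue K = len K" "measure lborel K = len K"
 using assms by auto

lemma division_real:
 assumes "\<D> division_of X" "K : \<D>"
 obtains a b where "a <= b" "K = {a..b::real}" "Inf K = a" "Sup K = b" "measure lebesgue K = len K" "measure lborel K = len K"
proof -
 obtain a b where ab: "K = cbox a b" using division_ofD(4)[OF assms] by blast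
 have ne: "K ~= {}" using division_ofD(3)[OF assms] .
 note r = real_interval_cases[OF ab ne]
 show thesis by (rule that[OF r(3,4,1,2,5,6)])
qed

lemma sum_len_division: "\<D> division_of X ==> sum len \<D> = measure lebesgue X"
 using content_division[of \<D> X] by (metis (no_types, lifting) division_real sum.cong)

lemma sum_incr_interval:
 assumes d: "\<D> division_of {a..b}" and ab: "a <= b"
 shows "(SUM K:\<D>. incr f K) = f b - f a"
proof -
 have "(%K. (Inf K, K)) ` \<D> tagged_division_of {a..b}"
 proof (rule tagged_division_ofI)
 show "finite ((%K. (Inf K, K)) ` \<D>)" using division_ofD(1)[OF d] by simp
 fix x K assume xK: "(x, K) : (%K. (Inf K, K)) ` \<D>"
 hence K: "K : \<D>" "x = Inf K" by auto
 obtain u v where uv: "u <= v" "K = {u..v}" "Inf K = u" by (rule division_real[OF d K(1)])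
 show "x : K" using uv K(2) by simp
 show "K <= {a..b}" "EX a b. K = cbox a b" using division_ofD(2,4)[OF d K(1)] by auto
 fix x' K' assume "(x', K') : (%K. (Inf K, K)) ` \<D>" "(x, K) ~= (x', K')"
 thus "interior K Int interior K' = {}" using division_ofD(5)[OF d K(1), of K'] K by auto
 next
 show "\<Union>{K. EX x. (x, K) : (%K. (Inf K, K)) ` \<D>} = {a..b}" using division_ofD(6)[OF d] by (auto simp: image_iff)
 qed
 from additive_tagged_division_1[OF ab this, of f] show ?thesis
 by (subst (asm) sum.reindex) (auto simp: inj_on_def)
qed

lemma abs_cont_division:
 assumes f: "abs_cont f" and e: "e > 0"
 obtains d where "d > 0" "!!\<D> X. \<D> division_of X ==> X <= {0..1} ==> sum len \<D> < d ==> (SUM K:\<D>. norm (incr f K)) < e"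
proof -
 obtain d where d: "d > 0" and H: "!!I. finite I ==> (ALL (a, b):I. 0 <= a & a <= b & b <= 1)
    ==> disjoint_family_on (%(a, b). {a<..<b}) I ==> (SUM (a, b):I. b - a) < d ==> (SUM (a, b):I. norm (f b - f a)) < e"
 using f e unfolding abs_cont_def by meson
 show thesis
 proof (rule that[OF d])
 fix \<D> X assume D: "\<D> division_of X" and X: "X <= {0..1}" and s: "sum len \<D> < d"
 let ?g = "%K. (Inf K, Sup K) :: real \<times> real"
 have iv: "K = {Inf K..Sup K} & Inf K <= Sup K & K <= {0..1}" if "K : \<D>" for K
 by (rule division_real[OF D that]) (use order_trans[OF division_ofD(2)[OF D that] X] in simp)
 have inj: "inj_on ?g \<D>" by (rule inj_onI) (metis iv prod.inject)
 have "(SUM (a, b):?g ` \<D>. norm (f b - f a)) < e"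
 proof (rule H)
 show "finite (?g ` \<D>)" using division_ofD(1)[OF D] by simp
 show "ALL (a, b):?g ` \<D>. 0 <= a & a <= b & b <= 1"
 proof clarify
 fix K assume K: "K : \<D>"
 from iv[OF K] have "Inf K <= Sup K" "{Inf K..Sup K} <= {0..1}" by auto
 thus "0 <= Inf K & Inf K <= Sup K & Sup K <= 1" by auto
 qed
 show "disjoint_family_on (%(a, b). {a<..<b}) (?g ` \<D>)"
 unfolding disjoint_family_on_def
 proof (intro ballI impI)
 fix m n assume "m : ?g ` \<D>" "n : ?g ` \<D>" "m ~= n"
 then obtain K L where KL: "K : \<D>" "L : \<D>" "m = ?g K" "n = ?g L" "K ~= L" by blast
 have "interior K = {Inf K<..<Sup K}" "interior L = {Inf L<..<Sup L}"
 using iv[OF KL(1)] iv[OF KL(2)] interior_atLeastAtMost_real by metis+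
 thus "(case m of (a, b) => {a<..<b}) Int (case n of (a, b) => {a<..<b}) = {}"
 using division_ofD(5)[OF D KL(1,2,5)] KL(3,4) by simp
 qed
 show "(SUM (a, b):?g ` \<D>. b - a) < d" using s by (subst sum.reindex[OF inj]) simp
 qed
 thus "(SUM K:\<D>. norm (incr f K)) < e" by (subst (asm) sum.reindex[OF inj]) simp
 qed
qed

text \<open>Intervals are balls around their midpoints, so the Vitali covering theorem exhausts
  \<open>S\<close> up to a null set by countably many disjoint ones, and finitely many of these
  exhaust it up to measure \<open>e\<close>. \<open>T\<close> carries along the slope condition of
  the chosen intervals.\<close>

lemma vitali_finite:
 fixes S U :: "real set"
 assumes S: "S : lmeasurable" and U: "open U" "U : lmeasurable" and SU: "S <= U" and e: "e > 0"
 and fine: "!!x d. x : S ==> d > 0 ==> EX a b. a < x & x < b & b - a < d & T a b"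
 obtains \<D> where "\<D> division_of \<Union>\<D>" "\<Union>\<D> <= U" "pairwise disjnt \<D>"
 "!!K. K : \<D> ==> EX a b. a < b & K = {a..b} & T a b" "measure lebesgue S - e < sum len \<D>"
proof -
 let ?K = "{(a, b). a < b & {a..b} <= U & T a b}"
 let ?c = "%(a, b). (a + b) / 2 :: real" and ?r = "%(a, b). (b - a) / 2 :: real"
 have cb: "cball (?c p) (?r p) = {fst p..snd p}" for p
 by (cases p) (auto simp: cball_eq_atLeastAtMost field_simps)
 have "EX i. i : ?K & x : cball (?c i) (?r i) & ?r i < d" if x: "x : S" and d: "0 < d" for x d
 proof -
 obtain r where r: "r > 0" "ball x r <= U" using U(1) SU x open_contains_ball by blast
 obtain a b where ab: "a < x" "x < b" "b - a < min r d" "T a b" using fine[OF x, of "min r d"] r d by auto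
 have "{a..b} <= ball x r" using ab by (auto simp: dist_real_def)
 hence "(a, b) : ?K" using ab r(2) by auto
 moreover have "x : cball (?c (a, b)) (?r (a, b))" unfolding cb using ab by simp
 moreover have "?r (a, b) < d" using ab by simp
 ultimately show ?thesis by blast
 qed
 note cover = this
 have pos: "0 < ?r i" if "i : ?K" for i using that by auto
 obtain C where C: "countable C" "C <= ?K" "pairwise (%i j. disjnt (cball (?c i) (?r i)) (cball (?c j) (?r j))) C"
 "negligible (S - (UN i:C. cball (?c i) (?r i)))"
 by (rule Vitali_covering_theorem_cballs[of ?K ?r S ?c, OF pos cover])
 let ?iv = "%p::real \<times> real. {fst p..snd p}"
 have div: "?iv ` C' division_of \<Union>(?iv ` C')" "pairwise disjnt (?iv ` C')" if C': "C' <= C" "finite C'" for C'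
 proof -
 show dj: "pairwise disjnt (?iv ` C')" using C(3) C'(1) unfolding cb pairwise_def by (metis (no_types, lifting) image_iff subsetD)
 show "?iv ` C' division_of \<Union>(?iv ` C')"
 proof (rule division_ofI)
 show "finite (?iv ` C')" using C' by simp
 show "K ~= {}" "EX a b. K = cbox a b" if "K : ?iv ` C'" for K using that C' C(2) by force+
 show "interior K1 Int interior K2 = {}" if "K1 : ?iv ` C'" "K2 : ?iv ` C'" "K1 ~= K2" for K1 K2
 using pairwiseD[OF dj that] interior_subset unfolding disjnt_def by blast
 qed auto
 qed
 have sub: "\<Union>(?iv ` C') <= U" if "C' <= C" for C' using that C(2) by force
 have m: "measure lebesgue (\<Union>(?iv ` C')) <= measure lebesgue U" if C': "C' <= C" "finite C'" for C'
 by (rule measure_mono_fmeasurable[OF sub[OF C'(1)] _ U(2)]) (use lmeasurable_division[OF div(1)[OF C']] in auto)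
 obtain \<D> where D: "\<D> <= ?iv ` C" "finite \<D>" "measure lebesgue (\<Union>(?iv ` C)) - e < measure lebesgue (\<Union>\<D>)"
 proof (rule measure_countable_Union_approachable[of "?iv ` C" e "measure lebesgue U"])
 show "countable (?iv ` C)" using C(1) by simp
 show "e > 0" by (rule e)
 show "d : lmeasurable" if "d : ?iv ` C" for d using that by auto
 show "measure lebesgue (\<Union>D') <= measure lebesgue U" if D': "D' <= ?iv ` C" "finite D'" for D'
 proof -
 obtain C' where "C' <= C" "finite C'" "D' = ?iv ` C'" using finite_subset_image[OF D'(2,1)] by blast
 thus ?thesis using m by simp
 qed
 qed
 obtain C' where C': "C' <= C" "finite C'" "\<D> = ?iv ` C'" using finite_subset_image[OF D(2,1)] by blast
 have "measure lebesgue S <= measure lebesgue (\<Union>(?iv ` C))"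
 proof -
 have l: "\<Union>(?iv ` C) : lmeasurable"
 proof (rule fmeasurableI2[OF U(2) sub[OF order_refl]])
 show "\<Union>(?iv ` C) : sets lebesgue" using C(1) by (intro sets.countable_Union) auto
 qed
 have n: "S - \<Union>(?iv ` C) : null_sets lebesgue" using C(4) unfolding cb by (simp add: negligible_iff_null_sets)
 have "measure lebesgue S <= measure lebesgue (\<Union>(?iv ` C) Un (S - \<Union>(?iv ` C)))"
 by (rule measure_mono_fmeasurable) (use S l n in "auto simp: fmeasurable.Un null_setsD2 intro!: fmeasurable.Un fmeasurableI_null_sets")
 also have "... = measure lebesgue (\<Union>(?iv ` C))" by (rule measure_Un_null_set) (use l n in auto)
 finally show ?thesis .
 qed
 hence "measure lebesgue S - e < sum len \<D>"
 using D(3) sum_len_division[OF div(1)[OF C'(1,2)]] C'(3) by simp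
 moreover have "EX a b. a < b & K = {a..b} & T a b" if "K : \<D>" for K using that C' C(2) by auto
 ultimately show thesis using that[of \<D>] div[OF C'(1,2)] sub[OF C'(1)] C'(3) by blast
qed

text \<open>The gaps that \<open>P'\<close> leaves inside \<open>P\<close> are filled by further
  intervals; over each member of \<open>P\<close> the increments of the filled division
  telescope.\<close>

lemma division_refine:
 fixes P P' :: "real set set"
 assumes P: "P division_of \<Union>P" "pairwise disjnt P" and P': "P' division_of \<Union>P'" and sub: "!!J. J : P' ==> EX K:P. J <= K"
 obtains r where "r division_of \<Union>P" "P' <= r" "!!f :: real => real. (SUM K:P. incr f K) = (SUM J:r. incr f J)"
proof -
 have "ALL K:P. EX W. {J\<in>P'. J <= K} <= W & W division_of K"
 proof
 fix K assume K: "K : P"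
 obtain a b where ab: "K = cbox a b" using division_ofD(4)[OF P(1) K] by blast
 have "{J\<in>P'. J <= K} division_of \<Union>{J\<in>P'. J <= K}" by (rule division_of_subset[OF P']) auto
 thus "EX W. {J\<in>P'. J <= K} <= W & W division_of K"
 using partial_division_extend_interval[of "{J\<in>P'. J <= K}" a b] ab by (metis (no_types, lifting) Sup_least mem_Collect_eq)
 qed
 from bchoice[OF this] obtain W where W: "ALL K:P. {J\<in>P'. J <= K} <= W K & W K division_of K" by (elim exE) (rule that)
 have WD: "W K division_of K" if "K : P" for K using W that by blast
 have dis: "J ~= J'" "interior J Int interior J' = {}" if "K : P" "K' : P" "K ~= K'" "J : W K" "J' : W K'" for K K' J J'
 proof -
 have "J <= K" "J' <= K'" "J ~= {}" using that division_ofD(2,3)[OF WD] by blast+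
 moreover have "K Int K' = {}" using pairwiseD[OF P(2) that(1-3)] by (simp add: disjnt_def)
 ultimately show "J ~= J'" "interior J Int interior J' = {}" using interior_subset by blast+
 qed
 let ?r = "UN K:P. W K"
 show thesis
 proof (rule that[of ?r])
 show "?r division_of \<Union>P"
 proof (rule division_ofI)
 show "finite ?r" using division_ofD(1)[OF P(1)] division_ofD(1)[OF WD] by blast
 show "\<Union>?r = \<Union>P" using division_ofD(6)[OF WD] by blast
 fix J assume "J : ?r"
 then obtain K where K: "K : P" "J : W K" by blast
 show "J <= \<Union>P" using division_ofD(2)[OF WD[OF K(1)] K(2)] K(1) by blast
 show "J ~= {}" "EX a b. J = cbox a b" using division_ofD(3,4)[OF WD[OF K(1)] K(2)] by auto
 fix J' assume "J' : ?r" and ne: "J ~= J'"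
 then obtain K' where K': "K' : P" "J' : W K'" by blast
 show "interior J Int interior J' = {}"
 using division_ofD(5)[OF WD[OF K(1)] K(2) _ ne] dis(2)[OF K(1) K'(1) _ K(2) K'(2)] K'(2) by (cases "K = K'") auto
 qed
 show "P' <= ?r" using sub W by blast
 fix f :: "real => real"
 have "(SUM J:?r. incr f J) = (SUM K:P. SUM J:W K. incr f J)"
 by (rule sum.UNION_disjoint) (use division_ofD(1)[OF P(1)] division_ofD(1)[OF WD] dis(1) in blast)+
 also have "... = (SUM K:P. incr f K)"
 proof (rule sum.cong[OF refl])
 fix K assume K: "K : P"
 obtain a b where ab: "a <= b" "K = {a..b}" "Inf K = a" "Sup K = b" by (rule division_real[OF P(1) K])
 show "(SUM J:W K. incr f J) = incr f K" using sum_incr_interval[of "W K" a b f] WD[OF K] ab by simp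
 qed
 finally show "(SUM K:P. incr f K) = (SUM J:?r. incr f J)" by simp
 qed
qed

text \<open>With \<open>T\<close> a condition on the slope between \<open>a\<close> and
  \<open>b\<close>, this expresses a bound on a derivate at \<open>x\<close>. Intervals containing
  \<open>x\<close> in their interior, rather than starting or ending there, give both a Vitali cover
  and measurability.\<close>

definition straddled :: "(real => real => bool) => real set" where
 "straddled T = {x. ALL d>0. EX a b. 0 <= a & b <= 1 & a < x & x < b & b - a < d & T a b}"

text \<open>The open intervals in question of length below \<open>1 / (n + 1)\<close> have an open
  union, and the set is the intersection of these unions, hence Borel whatever \<open>T\<close>
  is.\<close>

lemma straddled_sets: "straddled T : sets borel" "straddled T <= {0..1}"
proof -
 let ?U = "%n. \<Union>{{a<..<b} | a b. 0 <= a & b <= 1 & b - a < 1 / real (Suc n) & T a b}"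
 have "straddled T = (\<Inter>n. ?U n)"
 proof (intro equalityI subsetI)
 fix x assume x: "x : (\<Inter>n. ?U n)"
 show "x : straddled T" unfolding straddled_def
 proof (intro CollectI allI impI)
 fix d :: real assume "d > 0"
 then obtain n where n: "1 / real (Suc n) < d" using nat_approx_posE by blast
 have "x : ?U n" using x by blast
 then obtain a b where "0 <= a" "b <= 1" "b - a < 1 / real (Suc n)" "T a b" "a < x" "x < b" by auto
 thus "EX a b. 0 <= a & b <= 1 & a < x & x < b & b - a < d & T a b" using n by (intro exI[of _ a] exI[of _ b]) auto
 qed
 next
 fix x assume x: "x : straddled T"
 show "x : (\<Inter>n. ?U n)"
 proof
 fix n
 have "1 / real (Suc n) > 0" by simp
 then obtain a b where "0 <= a & b <= 1 & a < x & x < b & b - a < 1 / real (Suc n) & T a b"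
 using x unfolding straddled_def by blast
 thus "x : ?U n" by (intro UnionI[of "{a<..<b}"]) auto
 qed
 qed
 moreover have "open (?U n)" for n by (intro open_Union) auto
 ultimately show "straddled T : sets borel" by (simp add: borel_open)
 show "straddled T <= {0..1}" 
 proof
 fix x assume "x : straddled T"
 then obtain a b where "0 <= a & b <= 1 & a < x & x < b" unfolding straddled_def using zero_less_one by blast
 thus "x : {0..1}" by simp
 qed
qed

lemma straddled_fine:
 "x : straddled T ==> d > 0 ==> EX a b. a < x & x < b & b - a < d & (0 <= a & b <= 1 & T a b)"
 unfolding straddled_def by blast

lemma sum_len_mono:
 assumes "\<D> division_of X" "X <= U" "U : lmeasurable" shows "sum len \<D> <= measure lebesgue U"
 using sum_len_division[OF assms(1)] measure_mono_fmeasurable[OF assms(2) _ assms(3)] lmeasurable_division[OF assms(1)] by auto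

lemma division_01:
 fixes P :: "real set set"
 assumes "!!K. K : P ==> EX a b. a < b & K = {a..b} & 0 <= a & b <= 1 & T a b"
 shows "\<Union>P <= {0..1}"
 using assms by fastforce

text \<open>If the set had measure \<open>m > 0\<close>, cover it within a slightly larger open set
  by intervals of slope below \<open>p\<close>, and cover it again, inside these, by intervals of
  slope above \<open>q\<close>. What the second family leaves of the first has small total length,
  hence small total increment by absolute continuity, so over nearly the same length the increments
  would be both below slope \<open>p\<close> and above slope \<open>q\<close>.\<close>

lemma negligible_gap:
 fixes f :: "real => real"
 assumes f: "abs_cont f" and pq: "p < q"
 shows "negligible (straddled (%a b. f b - f a < p * (b - a)) Int straddled (%a b. f b - f a > q * (b - a)))"
proof (rule ccontr)
 let ?E1 = "straddled (%a b. f b - f a < p * (b - a))" and ?E2 = "straddled (%a b. f b - f a > q * (b - a))"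
 let ?E = "?E1 Int ?E2"
 assume neg: "\<not> negligible ?E"
 have sets: "?E : sets lebesgue" using straddled_sets(1) by (intro sets_completionI_sets) simp
 have lm: "?E : lmeasurable" by (rule fmeasurableI2[of "{0..1}"]) (use straddled_sets(2) sets in auto)
 define m where "m = measure lebesgue ?E"
 have "m ~= 0" using neg lm negligible_iff_measure unfolding m_def by blast
 hence m0: "m > 0" using measure_nonneg[of lebesgue] unfolding m_def by (simp add: less_le)
 \<comment> \<open>Chosen so that at the end the upper bound \<open>2 * e\<close> is one half of
   \<open>(q - p) * m\<close>, against a lower bound of three quarters of it.\<close>
 define e where "e = (q - p) * m / 4"
 have e: "e > 0" using pq m0 by (simp add: e_def)
 obtain d where d: "d > 0" and D: "!!\<D> X. \<D> division_of X ==> X <= {0..1} ==> sum len \<D> < d ==> (SUM K:\<D>. norm (incr f K)) < e"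
 using abs_cont_division[OF f e] by blast
 \<comment> \<open>The three bounds keep the second family at length at least
   \<open>3 * m / 4\<close>, the uncovered part at length below \<open>d\<close>, and the error
   \<open>4 * h * \<bar>p\<bar>\<close> at most \<open>e\<close>.\<close>
 define h where "h = min (m / 12) (min (d / 5) (e / (4 * (\<bar>p\<bar> + 1))))"
 have h: "h > 0" "h <= m / 12" "4 * h < d" "4 * h * \<bar>p\<bar> <= e"
 proof -
 show "h > 0" "h <= m / 12" unfolding h_def by (use m0 d e in simp, rule min.cobounded1)
 have "h <= d / 5" unfolding h_def by (rule min.coboundedI2, rule min.cobounded1)
 thus "4 * h < d" using d by simp
 have "h <= e / (4 * (\<bar>p\<bar> + 1))" unfolding h_def by (rule min.coboundedI2, rule min.cobounded2)
 hence "h * (4 * (\<bar>p\<bar> + 1)) <= e" by (simp add: pos_le_divide_eq)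
 thus "4 * h * \<bar>p\<bar> <= e" using \<open>h > 0\<close> by (simp add: algebra_simps)
 qed
 obtain G where G: "open G" "?E <= G" "G - ?E : lmeasurable" "emeasure lebesgue (G - ?E) < ennreal h"
 using sets_lebesgue_outer_open[OF sets h(1)] .
 have Gm: "G : lmeasurable"
 using fmeasurable.Un[OF lm G(3)] G(2) by (simp add: Un_absorb1)
 have GE: "measure lebesgue (G - ?E) < h"
 using G(4) h(1) emeasure_eq_measure2[OF G(3)] by (simp add: ennreal_less_iff)
 have mG: "measure lebesgue G = m + measure lebesgue (G - ?E)"
 using measurable_measure_Diff[OF Gm _ G(2)] lm by (simp add: m_def fmeasurableD)
 obtain P where P: "P division_of \<Union>P" "\<Union>P <= G" "pairwise disjnt P"
 "!!K. K : P ==> EX a b. a < b & K = {a..b} & (0 <= a & b <= 1 & f b - f a < p * (b - a))" "m - h < sum len P"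
 using vitali_finite[OF lm G(1) Gm G(2) h(1), of "%a b. 0 <= a & b <= 1 & f b - f a < p * (b - a)"] straddled_fine
 unfolding m_def by (metis (no_types, lifting) IntD1)
 have Pm: "\<Union>P : lmeasurable" using lmeasurable_division[OF P(1)] .
 \<comment> \<open>The second cover is sought inside the interiors, so that each of its intervals
   falls into a single member of \<open>P\<close>; only finitely many endpoints are lost.\<close>
 define V where "V = (UN K:P. interior K)"
 have V: "open V" "V : lmeasurable" "V <= \<Union>P"
 proof -
 show "open V" unfolding V_def by auto
 show VP: "V <= \<Union>P" unfolding V_def using interior_subset by blast
 show "V : lmeasurable" by (rule fmeasurableI2[OF Pm VP]) (use \<open>open V\<close> in auto)
 qed
 have bd: "negligible (\<Union>P - V)"
 proof (rule negligible_subset)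
 show "negligible (UN K:P. K - interior K)"
 proof (rule negligible_Union)
 show "finite ((%K. K - interior K) ` P)" using division_ofD(1)[OF P(1)] by simp
 fix N assume "N : (%K. K - interior K) ` P"
 then obtain K where K: "K : P" "N = K - interior K" by blast
 obtain a b where "K = {a..b}" by (rule division_real[OF P(1) K(1)])
 hence "N <= {a, b}" unfolding K(2) by auto
 thus "negligible N" using negligible_subset negligible_finite by (metis finite.emptyI finite.insertI)
 qed
 show "\<Union>P - V <= (UN K:P. K - interior K)" unfolding V_def by blast
 qed
 have EV: "?E Int V : lmeasurable" by (rule fmeasurable.Int[OF lm V(2)])
 have mEV: "measure lebesgue (?E Int V) > m - 2 * h"
 proof -
 have "measure lebesgue (\<Union>P) <= measure lebesgue ((?E Int V) Un (G - ?E) Un (\<Union>P - V))"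
 proof (rule measure_mono_fmeasurable)
 show "\<Union>P <= (?E Int V) Un (G - ?E) Un (\<Union>P - V)" using P(2) by blast
 show "\<Union>P : sets lebesgue" using Pm by auto
 show "(?E Int V) Un (G - ?E) Un (\<Union>P - V) : lmeasurable"
 by (intro fmeasurable.Un EV G(3) negligible_imp_measurable bd)
 qed
 also have "... = measure lebesgue ((?E Int V) Un (G - ?E))"
 by (rule measure_Un_null_set) (use EV G(3) bd in "auto simp: negligible_iff_null_sets")
 also have "... <= measure lebesgue (?E Int V) + measure lebesgue (G - ?E)"
 by (rule measure_Un_le) (use EV G(3) in auto)
 finally show ?thesis using P(5) sum_len_division[OF P(1)] GE by simp
 qed
 obtain P' where P': "P' division_of \<Union>P'" "\<Union>P' <= V"
 "!!K. K : P' ==> EX a b. a < b & K = {a..b} & (0 <= a & b <= 1 & f b - f a > q * (b - a))"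
 "measure lebesgue (?E Int V) - h < sum len P'"
 using vitali_finite[OF EV V(1,2) _ h(1), of "%a b. 0 <= a & b <= 1 & f b - f a > q * (b - a)"] straddled_fine
 by (metis (no_types, lifting) IntD1 IntD2 inf_le2)
 \<comment> \<open>\<open>J\<close> is connected and covered by disjoint interiors, so it lies in
   one of them.\<close>
 have sub: "EX K:P. J <= K" if J: "J : P'" for J
 proof -
 obtain a b where ab: "a < b" "J = {a..b}" using P'(3)[OF J] by blast
 have JV: "J <= V" using P'(2) J by blast
 have "a : J" using ab by simp
 then obtain K where K: "K : P" "a : interior K" using JV unfolding V_def by blast
 let ?B = "UN L:P - {K}. interior L"
 have "interior K Int ?B Int J = {}"
 using division_ofD(5)[OF P(1) K(1)] by blast
 moreover have "J <= interior K Un ?B" using JV unfolding V_def by blast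
 moreover have "connected J" using ab by simp
 ultimately have "interior K Int J = {} \<or> ?B Int J = {}"
 using connectedD[of J "interior K" ?B] by (simp add: open_UN)
 hence "J <= interior K" using K(2) \<open>a \<in> J\<close> \<open>J \<subseteq> interior K \<union> ?B\<close> by blast
 thus ?thesis using K(1) interior_subset by blast
 qed
 obtain r where r: "r division_of \<Union>P" "P' <= r" "!!f :: real => real. (SUM K:P. incr f K) = (SUM J:r. incr f J)"
 using division_refine[OF P(1,3) P'(1) sub] by blast
 have fr: "finite r" using division_ofD(1)[OF r(1)] .
 let ?R = "r - P'"
 have RD: "?R division_of \<Union>?R" by (rule division_of_subset[of r]) (use r(1) division_ofD(6)[OF r(1)] in auto)
 have P01: "\<Union>P <= {0..1}" by (rule division_01[OF P(4)])
 have "\<Union>?R <= \<Union>r" by blast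
 hence R01: "\<Union>?R <= {0..1}" using division_ofD(6)[OF r(1)] P01 by simp
 have split: "(SUM J:P. incr g J) = (SUM J:?R. incr g J) + (SUM J:P'. incr g J)" for g :: "real => real"
 using r(3)[of g] sum.subset_diff[OF r(2) fr, of "incr g"] by simp
 \<comment> \<open>\<open>P\<close> has length at most \<open>m + h\<close> and \<open>P'\<close>
   more than \<open>m - 3 * h\<close>.\<close>
 have lR: "sum len ?R <= 4 * h"
 using split[of "%x. x"] sum_len_mono[OF P(1,2) Gm] mG GE mEV P'(4) by simp
 have "(SUM K:?R. norm (incr f K)) < e" by (rule D[OF RD R01]) (use lR h(3) in simp)
 hence R: "(SUM K:?R. incr f K) > - e" using norm_sum[of "incr f" ?R] unfolding real_norm_def by linarith
 have Ple: "(SUM K:P. incr f K) <= p * sum len P" unfolding sum_distrib_left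
 proof (rule sum_mono)
 fix K assume "K : P"
 from P(4)[OF this] show "incr f K <= p * len K" by auto
 qed
 have P'ge: "q * sum len P' <= (SUM K:P'. incr f K)" unfolding sum_distrib_left
 proof (rule sum_mono)
 fix K assume "K : P'"
 from P'(3)[OF this] show "q * len K <= incr f K" by auto
 qed
 define s where "s = sum len P'"
 define t where "t = sum len ?R"
 have Ps: "sum len P = t + s" using split[of "%x. x"] by (simp add: s_def t_def)
 have t0: "t >= 0" unfolding t_def using sum_len_division[OF RD] by simp
 have s3: "s >= m - 3 * h" using mEV P'(4) by (simp add: s_def)
 have "q * s - e < p * (t + s)" using split[of f] R Ple P'ge Ps s_def by simp
 hence "(q - p) * s < p * t + e" by (simp add: algebra_simps)
 also have "p * t <= \<bar>p\<bar> * (4 * h)" using t0 lR t_def by (intro mult_mono) auto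
 finally have "(q - p) * s < 2 * e" using h(4) by (simp add: algebra_simps)
 moreover have "(q - p) * s >= (q - p) * (3 * m / 4)" using s3 h(2) pq by (intro mult_left_mono) auto
 moreover have "(q - p) * m > 0" using pq m0 by simp
 moreover have "2 * e = (q - p) * m / 2" "(q - p) * (3 * m / 4) = 3 / 4 * ((q - p) * m)" by (simp_all add: e_def)
 ultimately show False by linarith
qed

text \<open>Divisions of total length below \<open>d\<close> have increments summing to less than 1,
  whereas on a set of measure \<open>m > 0\<close> slopes above \<open>n > 2 / m\<close> produce
  increments of more than \<open>n * m / 2 > 1\<close>. Restricting to intervals of length
  \<open>d / 2\<close> keeps the total length below \<open>d\<close>.\<close>

lemma negligible_infinite:
 fixes f :: "real => real"
 assumes f: "abs_cont f"
 shows "negligible (\<Inter>n::nat. straddled (%a b. f b - f a > real n * (b - a)))"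
proof -
 let ?E = "\<Inter>n::nat. straddled (%a b. f b - f a > real n * (b - a))"
 have Es: "?E : sets borel" using straddled_sets(1) by blast
 obtain d where d: "d > 0" and D: "!!\<D> X. \<D> division_of X ==> X <= {0..1} ==> sum len \<D> < d ==> (SUM K:\<D>. norm (incr f K)) < 1"
 using abs_cont_division[OF f zero_less_one] by blast
 have loc: "negligible (?E Int {c<..<c+d/2})" for c
 proof (rule ccontr)
 let ?S = "?E Int {c<..<c+d/2}"
 assume neg: "\<not> negligible ?S"
 have lm: "?S : lmeasurable" by (rule fmeasurableI2[of "{c<..<c+d/2}"]) (use Es in "auto intro: sets_completionI_sets")
 define m where "m = measure lebesgue ?S"
 have "m ~= 0" using neg lm negligible_iff_measure unfolding m_def by blast
 hence m0: "m > 0" using measure_nonneg[of lebesgue] unfolding m_def by (simp add: less_le)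
 obtain n where n: "2 / m < real n" using reals_Archimedean2 by blast
 obtain P where P: "P division_of \<Union>P" "\<Union>P <= {c<..<c+d/2}"
 "!!K. K : P ==> EX a b. a < b & K = {a..b} & (0 <= a & b <= 1 & f b - f a > real n * (b - a))" "m - m / 2 < sum len P"
 proof (rule vitali_finite[of ?S "{c<..<c+d/2}" "m/2" "%a b. 0 <= a & b <= 1 & f b - f a > real n * (b - a)"])
 show "EX a b. a < x & x < b & b - a < d' & (0 <= a & b <= 1 & f b - f a > real n * (b - a))" if x: "x : ?S" "d' > 0" for x d'
 proof (rule straddled_fine[OF _ x(2)])
 show "x : straddled (%a b. f b - f a > real n * (b - a))" using x(1) by blast
 qed
 qed (use lm m0 in "auto simp: m_def")
 have "sum len P <= measure lebesgue {c<..<c+d/2}" by (rule sum_len_mono[OF P(1,2)]) simp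
 hence "sum len P < d" using d by simp
 from D[OF P(1) division_01[OF P(3)] this] have 1: "(SUM K:P. norm (incr f K)) < 1" .
 have "real n * sum len P <= (SUM K:P. norm (incr f K))" unfolding sum_distrib_left
 proof (rule sum_mono)
 fix K assume "K : P"
 from P(3)[OF this] show "real n * len K <= norm (incr f K)" by auto
 qed
 moreover have "real n * sum len P >= real n * (m / 2)" using P(4) by (intro mult_left_mono) auto
 moreover have "real n * (m / 2) > 1" using n m0 by (simp add: field_simps)
 ultimately show False using 1 by simp
 qed
 have "?E <= (UN c:\<rat>. ?E Int {c<..<c+d/2})"
 proof
 fix x assume "x : ?E"
 moreover obtain c where "c : \<rat>" "x - d/2 < c" "c < x" using Rats_dense_in_real[of "x - d/2" x] d by auto
 ultimately show "x : (UN c:\<rat>. ?E Int {c<..<c+d/2})" by (intro UN_I[of c]) auto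
 qed
 moreover have "negligible (UN c:\<rat>. ?E Int {c<..<c+d/2})"
 by (rule negligible_countable_Union) (use loc countable_rat in auto)
 ultimately show ?thesis using negligible_subset by blast
qed

lemma abs_cont_combine:
 assumes f: "abs_cont f" and g: "abs_cont g" and C: "C >= 0"
 and le: "!!a b. 0 <= a ==> a <= b ==> b <= 1 ==> norm (h b - h a) <= C * (norm (f b - f a) + norm (g b - g a))"
 shows "abs_cont h"
 unfolding abs_cont_def
proof (intro allI impI)
 fix e :: real assume e: "e > 0"
 let ?e = "e / (C + 1) / 2"
 have e': "?e > 0" using e C by simp
 obtain d1 where d1: "d1 > 0" "!!I. finite I ==> (ALL (a, b):I. 0 <= a & a <= b & b <= 1)
    ==> disjoint_family_on (%(a, b). {a<..<b}) I ==> (SUM (a, b):I. b - a) < d1 ==> (SUM (a, b):I. norm (f b - f a)) < ?e"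
 using f e' unfolding abs_cont_def by meson
 obtain d2 where d2: "d2 > 0" "!!I. finite I ==> (ALL (a, b):I. 0 <= a & a <= b & b <= 1)
    ==> disjoint_family_on (%(a, b). {a<..<b}) I ==> (SUM (a, b):I. b - a) < d2 ==> (SUM (a, b):I. norm (g b - g a)) < ?e"
 using g e' unfolding abs_cont_def by meson
 show "EX d>0. ALL I :: (real \<times> real) set. finite I & (ALL (a, b):I. 0 <= a & a <= b & b <= 1)
    & disjoint_family_on (%(a, b). {a<..<b}) I & (SUM (a, b):I. b - a) < d --> (SUM (a, b):I. norm (h b - h a)) < e"
 proof (intro exI[of _ "min d1 d2"] conjI allI impI)
 show "min d1 d2 > 0" using d1(1) d2(1) by simp
 fix I :: "(real \<times> real) set"
 assume I: "finite I & (ALL (a, b):I. 0 <= a & a <= b & b <= 1)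
      & disjoint_family_on (%(a, b). {a<..<b}) I & (SUM (a, b):I. b - a) < min d1 d2"
 let ?f = "SUM (a, b):I. norm (f b - f a)" and ?g = "SUM (a, b):I. norm (g b - g a)"
 have "(SUM (a, b):I. norm (h b - h a)) <= (SUM p:I. C * ((case p of (a, b) => norm (f b - f a)) + (case p of (a, b) => norm (g b - g a))))"
 by (rule sum_mono) (use le I in auto)
 also have "... = C * (?f + ?g)" by (simp only: sum_distrib_left[symmetric] sum.distrib)
 also have "... <= C * (?e + ?e)" using d1(2)[of I] d2(2)[of I] I C by (intro mult_left_mono add_mono) auto
 also have "?e + ?e = e / (C + 1)" by (rule field_sum_of_halves)
 also have "C * (e / (C + 1)) = C * e / (C + 1)" by simp
 also have "... < e" using C e by (simp add: pos_divide_less_eq algebra_simps)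
 finally show "(SUM (a, b):I. norm (h b - h a)) < e" .
 qed
qed

lemma abs_cont_uniform:
 assumes f: "abs_cont f" and e: "e > 0"
 obtains d where "d > 0" "!!x y. x : {0..1} ==> y : {0..1} ==> \<bar>x - y\<bar> < d ==> norm (f x - f y) < e"
proof -
 obtain d where d: "d > 0" "!!I. finite I ==> (ALL (a, b):I. 0 <= a & a <= b & b <= 1)
    ==> disjoint_family_on (%(a, b). {a<..<b}) I ==> (SUM (a, b):I. b - a) < d ==> (SUM (a, b):I. norm (f b - f a)) < e"
 using f e unfolding abs_cont_def by meson
 have le: "norm (f b - f a) < e" if "0 <= a" "a <= b" "b <= 1" "b - a < d" for a b
 using d(2)[of "{(a, b)}"] that by (simp add: disjoint_family_on_def)
 show thesis
 proof (rule that[OF d(1)])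
 show "norm (f x - f y) < e" if "x : {0..1}" "y : {0..1}" "\<bar>x - y\<bar> < d" for x y
 using le[of x y] le[of y x] that by (cases "x <= y") (auto simp: norm_minus_commute)
 qed
qed

lemma abs_cont_continuous: "abs_cont f ==> continuous_on {0..1} f"
 unfolding continuous_on_iff dist_norm real_norm_def by (metis abs_cont_uniform)

text \<open>The estimate for intervals with \<open>x\<close> inside extends to intervals ending at
  \<open>x\<close>: the endpoint on the other side tends to \<open>x\<close>, and continuity permits
  the passage to the limit.\<close>

lemma straddle_derivative:
 fixes f :: "real => real"
 assumes f: "continuous_on {0..1} f" and x: "0 < x" "x < 1"
 and s: "!!e. e > 0 ==> EX d>0. ALL a b. 0 <= a & b <= 1 & a < x & x < b & b - a < d --> \<bar>f b - f a - (b - a) * L\<bar> <= e * (b - a)"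
 shows "(f has_real_derivative L) (at x)"
proof -
 have c: "isCont f x" using f x by (simp add: continuous_on_interior)
 have "EX d>0. ALL y. \<bar>y - x\<bar> < d --> \<bar>f y - f x - L * (y - x)\<bar> <= e * \<bar>y - x\<bar>" if e: "e > 0" for e
 proof -
 obtain d where d: "d > 0" and D: "!!a b. 0 <= a ==> b <= 1 ==> a < x ==> x < b ==> b - a < d ==> \<bar>f b - f a - (b - a) * L\<bar> <= e * (b - a)"
 using s[OF e] by blast
 have near: "\<forall>\<^sub>F h in at_right 0. h < min (d / 2) (min x (1 - x)) & h > 0"
 using eventually_at_right_real[of 0 "min (d / 2) (min x (1 - x))"] d x by (auto elim: eventually_mono)
 show ?thesis
 proof (intro exI[of _ "min (d / 2) (min x (1 - x))"] conjI allI impI)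
 show "min (d / 2) (min x (1 - x)) > 0" using d x by simp
 fix y assume y: "\<bar>y - x\<bar> < min (d / 2) (min x (1 - x))"
 have lim: "(f \<longlongrightarrow> f x) (at x)" using c by (simp add: isCont_def)
 consider "y = x" | "y > x" | "y < x" by linarith
 thus "\<bar>f y - f x - L * (y - x)\<bar> <= e * \<bar>y - x\<bar>"
 proof cases
 case 2
 have l: "((%h. f (x - h)) \<longlongrightarrow> f x) (at_right 0)"
 by (rule isCont_tendsto_compose[OF c]) (auto intro!: tendsto_eq_intros)
 have "\<bar>f y - f x - (y - (x - 0)) * L\<bar> <= e * (y - (x - 0))"
 proof (rule tendsto_le)
 show "((%h. \<bar>f y - f (x - h) - (y - (x - h)) * L\<bar>) \<longlongrightarrow> \<bar>f y - f x - (y - (x - 0)) * L\<bar>) (at_right 0)"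
 by (intro tendsto_intros l)
 show "((%h. e * (y - (x - h))) \<longlongrightarrow> e * (y - (x - 0))) (at_right 0)" by (intro tendsto_intros)
 show "\<forall>\<^sub>F h in at_right 0. \<bar>f y - f (x - h) - (y - (x - h)) * L\<bar> <= e * (y - (x - h))"
 using near by eventually_elim (rule D, use y 2 in auto)
 qed simp
 thus ?thesis using 2 by (simp add: mult.commute)
 next
 case 3
 have l: "((%h. f (x + h)) \<longlongrightarrow> f x) (at_right 0)"
 by (rule isCont_tendsto_compose[OF c]) (auto intro!: tendsto_eq_intros)
 have "\<bar>f x - f y - ((x + 0) - y) * L\<bar> <= e * ((x + 0) - y)"
 proof (rule tendsto_le)
 show "((%h. \<bar>f (x + h) - f y - ((x + h) - y) * L\<bar>) \<longlongrightarrow> \<bar>f x - f y - ((x + 0) - y) * L\<bar>) (at_right 0)"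
 by (intro tendsto_intros l)
 show "((%h. e * ((x + h) - y)) \<longlongrightarrow> e * ((x + 0) - y)) (at_right 0)" by (intro tendsto_intros)
 show "\<forall>\<^sub>F h in at_right 0. \<bar>f (x + h) - f y - ((x + h) - y) * L\<bar> <= e * ((x + h) - y)"
 using near by eventually_elim (rule D, use y 3 in auto)
 qed simp
 moreover have "f x - f y - (x - y) * L = - (f y - f x - L * (y - x))" by (simp add: algebra_simps)
 ultimately show ?thesis using 3 by (simp add: abs_minus_commute)
 qed simp
 qed
 qed
 thus ?thesis
 unfolding has_field_derivative_def has_derivative_at_alt by (simp add: bounded_linear_mult_right)
qed

text \<open>Off the null sets of infinite slopes and of rational gaps, the slopes of short
  straddling intervals approach one number \<open>L\<close>, the supremum of the slopes that are
  exceeded arbitrarily close to \<open>x\<close>.\<close>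

lemma abs_cont_differentiable_real:
 fixes f :: "real => real"
 assumes f: "abs_cont f"
 obtains N where "negligible N" "!!x. x : {0<..<1} - N ==> EX L. (f has_real_derivative L) (at x)"
proof -
 let ?lt = "%p. straddled (%a b. f b - f a < p * (b - a))" and ?gt = "%q. straddled (%a b. f b - f a > q * (b - a))"
 have mf: "abs_cont (%x. - f x)"
 by (rule abs_cont_combine[OF f f zero_le_one]) (simp add: abs_minus_commute)
 have eqm: "straddled (%a b. - f b - - f a > real n * (b - a)) = ?lt (- real n)" for n
 by (rule arg_cong[where f=straddled]) (auto simp: fun_eq_iff)
 let ?N = "(UN p:\<rat>. UN q:{q\<in>\<rat>. p < q}. ?lt p Int ?gt q) Un (\<Inter>n::nat. ?gt (real n)) Un (\<Inter>n::nat. ?lt (- real n))"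
 have "negligible (UN q:{q\<in>\<rat>. p < q}. ?lt p Int ?gt q)" for p
 by (rule negligible_countable_Union) (use negligible_gap[OF f] countable_subset[OF _ countable_rat, of "{q\<in>\<rat>. p < q}"] in auto)
 hence "negligible (UN p:\<rat>. UN q:{q\<in>\<rat>. p < q}. ?lt p Int ?gt q)"
 by (intro negligible_countable_Union) (use countable_rat in auto)
 hence N: "negligible ?N" using negligible_infinite[OF f] negligible_infinite[OF mf, unfolded eqm] by simp
 show thesis
 proof (rule that[OF N])
 fix x assume x: "x : {0<..<1} - ?N"
 \<comment> \<open>A down-set of slopes, whose supremum is the upper derivate along straddling
   intervals.\<close>
 define A where "A = {q. x : ?gt q}"
 have up: "q < q'" if "q : A" "q' \<notin> A" for q q'
 proof (rule ccontr)
 assume "\<not> q < q'"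
 hence le: "q' * (b - a) <= q * (b - a)" if "a < x" "x < b" for a b using that by (intro mult_right_mono) auto
 have "x : ?gt q'" unfolding straddled_def
 proof (intro CollectI allI impI)
 fix d :: real assume "d > 0"
 then obtain a b where "0 <= a" "b <= 1" "a < x" "x < b" "b - a < d" "f b - f a > q * (b - a)"
 using \<open>q \<in> A\<close> unfolding A_def straddled_def by blast
 thus "EX a b. 0 <= a & b <= 1 & a < x & x < b & b - a < d & f b - f a > q' * (b - a)"
 using le[of a b] by (intro exI[of _ a] exI[of _ b] conjI) linarith+
 qed
 thus False using that(2) unfolding A_def by blast
 qed
 obtain n where n: "real n \<notin> A" using x unfolding A_def by blast
 obtain k where k: "x \<notin> ?lt (- real k)" using x by blast
 have notgt: "EX d>0. ALL a b. 0 <= a & b <= 1 & a < x & x < b & b - a < d --> f b - f a <= q * (b - a)" if "q \<notin> A" for q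
 using that unfolding A_def straddled_def mem_Collect_eq not_less[symmetric] by blast
 have notlt: "EX d>0. ALL a b. 0 <= a & b <= 1 & a < x & x < b & b - a < d --> f b - f a >= p * (b - a)" if "x \<notin> ?lt p" for p
 using that unfolding straddled_def mem_Collect_eq not_less[symmetric] by blast
 \<comment> \<open>Otherwise the upper bound \<open>- k - 1\<close> and the lower bound
   \<open>- k\<close> on slopes contradict each other on a short interval symmetric about
   \<open>x\<close>.\<close>
 have ne: "- real k - 1 : A"
 proof (rule ccontr)
 assume "- real k - 1 \<notin> A"
 from notgt[OF this] obtain d1 where d1: "d1 > 0" "!!a b. 0 <= a ==> b <= 1 ==> a < x ==> x < b ==> b - a < d1 ==> f b - f a <= (- real k - 1) * (b - a)" by blast
 from notlt[OF k] obtain d2 where d2: "d2 > 0" "!!a b. 0 <= a ==> b <= 1 ==> a < x ==> x < b ==> b - a < d2 ==> f b - f a >= - real k * (b - a)" by blast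
 define h where "h = min (min d1 d2 / 3) (min x (1 - x))"
 have h: "h > 0" "h <= x" "h <= 1 - x" "2 * h < d1" "2 * h < d2"
 proof -
 have h3: "h <= min d1 d2 / 3" unfolding h_def by (rule min.cobounded1)
 have hx: "h <= min x (1 - x)" unfolding h_def by (rule min.cobounded2)
 show "h > 0" unfolding h_def using d1(1) d2(1) x by auto
 thus "h <= x" "h <= 1 - x" "2 * h < d1" "2 * h < d2" using h3 hx by linarith+
 qed
 have "- real k * ((x + h) - (x - h)) <= (- real k - 1) * ((x + h) - (x - h))"
 by (rule order_trans[OF d2(2) d1(2)]) (use h in auto)
 hence "2 * h <= 0" by (simp add: algebra_simps)
 thus False using h(1) by simp
 qed
 define L where "L = Sup A"
 have bA: "bdd_above A" using up[OF _ n] by (intro bdd_aboveI[of _ "real n"]) (auto intro: less_imp_le)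
 have "(f has_real_derivative L) (at x)"
 proof (rule straddle_derivative[OF abs_cont_continuous[OF f]])
 show "0 < x" "x < 1" using x by auto
 fix e :: real assume e: "e > 0"
 have "L + e \<notin> A" using cSup_upper[OF _ bA, of "L + e"] e unfolding L_def by auto
 from notgt[OF this] obtain d1 where d1: "d1 > 0" "!!a b. 0 <= a ==> b <= 1 ==> a < x ==> x < b ==> b - a < d1 ==> f b - f a <= (L + e) * (b - a)" by blast
 \<comment> \<open>Two rationals are placed between \<open>L - e\<close> and \<open>L\<close>: the
   slope \<open>q\<close> is exceeded near \<open>x\<close>, and since \<open>x\<close> avoids the
   gap between \<open>p\<close> and \<open>q\<close>, short intervals have slope at least
   \<open>p\<close>.\<close>
 obtain p where p: "p : \<rat>" "L - e < p" "p < L" using Rats_dense_in_real[of "L - e" L] e by auto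
 obtain q where q: "q : \<rat>" "p < q" "q < L" using Rats_dense_in_real[OF p(3)] by auto
 have "q : A"
 proof (rule ccontr)
 assume "q \<notin> A"
 hence "L <= q" unfolding L_def using up ne by (intro cSup_least) (auto intro: less_imp_le)
 thus False using q(3) by simp
 qed
 hence "x \<notin> ?lt p" using x p(1) q(1,2) unfolding A_def by blast
 from notlt[OF this] obtain d2 where d2: "d2 > 0" "!!a b. 0 <= a ==> b <= 1 ==> a < x ==> x < b ==> b - a < d2 ==> f b - f a >= p * (b - a)" by blast
 show "EX d>0. ALL a b. 0 <= a & b <= 1 & a < x & x < b & b - a < d --> \<bar>f b - f a - (b - a) * L\<bar> <= e * (b - a)"
 proof (intro exI[of _ "min d1 d2"] conjI allI impI)
 show "min d1 d2 > 0" using d1 d2 by simp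
 fix a b assume ab: "0 <= a & b <= 1 & a < x & x < b & b - a < min d1 d2"
 have 1: "f b - f a <= (L + e) * (b - a)" using d1(2)[of a b] ab by simp
 have 2: "f b - f a >= p * (b - a)" using d2(2)[of a b] ab by simp
 have 3: "(L - e) * (b - a) <= p * (b - a)" using ab p(2) by (intro mult_right_mono) auto
 show "\<bar>f b - f a - (b - a) * L\<bar> <= e * (b - a)"
 using 1 2 3 by (simp add: algebra_simps abs_le_iff)
 qed
 qed
 thus "EX L. (f has_real_derivative L) (at x)" by blast
 qed
qed

text \<open>Real and imaginary parts are treated separately; the endpoints 0 and 1 admit no
  straddling intervals and join the null set.\<close>

lemma abs_cont_differentiable:
 fixes f :: "real => complex"
 assumes f: "abs_cont f"
 obtains N where "negligible N" "!!x. x : {0..1} - N ==> (f has_vector_derivative deriv01 f x) (at x within {0..1})"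
proof -
 have re: "abs_cont (%t. Re (f t))" and im: "abs_cont (%t. Im (f t))"
 by (rule abs_cont_combine[OF f f zero_le_one], metis abs_Re_le_cmod add_increasing2 minus_complex.simps(1) mult_1 norm_ge_zero real_norm_def)
 (rule abs_cont_combine[OF f f zero_le_one], metis abs_Im_le_cmod add_increasing2 minus_complex.simps(2) mult_1 norm_ge_zero real_norm_def)
 obtain N1 where N1: "negligible N1" "!!x. x : {0<..<1} - N1 ==> EX L. ((%t. Re (f t)) has_real_derivative L) (at x)"
 using abs_cont_differentiable_real[OF re] by blast
 obtain N2 where N2: "negligible N2" "!!x. x : {0<..<1} - N2 ==> EX L. ((%t. Im (f t)) has_real_derivative L) (at x)"
 using abs_cont_differentiable_real[OF im] by blast
 show thesis
 proof (rule that[of "N1 Un N2 Un {0, 1}"])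
 show "negligible (N1 Un N2 Un {0, 1})" using N1(1) N2(1) by simp
 fix x assume x: "x : {0..1} - (N1 Un N2 Un {0, 1})"
 obtain L1 where L1: "((%t. Re (f t)) has_real_derivative L1) (at x)" using N1(2)[of x] x by auto
 obtain L2 where L2: "((%t. Im (f t)) has_real_derivative L2) (at x)" using N2(2)[of x] x by auto
 have "(f has_vector_derivative Complex L1 L2) (at x)" using L1 L2 by (simp add: has_vector_derivative_complex_iff)
 hence "(f has_vector_derivative Complex L1 L2) (at x within {0..1})" by (rule has_vector_derivative_at_within)
 thus "(f has_vector_derivative deriv01 f x) (at x within {0..1})"
 unfolding deriv01_def by (simp add: vector_derivative_works[symmetric] differentiableI_vector)
 qed
qed

text \<open>The gauge treats two kinds of tags. Outside \<open>N\<close> the derivative controls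
  each increment up to \<open>e1\<close> times the length; tags in \<open>N\<close> are confined to
  an open set of measure below \<open>d\<close>, where absolute continuity makes the total increment
  less than \<open>e1\<close>.\<close>

lemma abs_cont_FTC:
 fixes f :: "real => 'a::euclidean_space"
 assumes f: "abs_cont f" and N: "negligible N"
 and g: "!!x. x : {0..1} - N ==> (f has_vector_derivative g x) (at x within {0..1})"
 and ab: "0 <= a" "a <= b" "b <= 1"
 shows "(g has_integral (f b - f a)) {a..b}"
proof -
 \<comment> \<open>Nothing is known about \<open>g\<close> on \<open>N\<close>; with the value 0
   there, a tag in \<open>N\<close> contributes its increment alone.\<close>
 define g0 where "g0 x = (if x : N then 0 else g x)" for x
 have "(g0 has_integral (f b - f a)) {a..b}"
 unfolding has_integral_real
 proof (intro allI impI)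
 fix e :: real assume e: "e > 0"
 define e1 where "e1 = e / 3"
 have e1: "e1 > 0" using e by (simp add: e1_def)
 obtain d where d: "d > 0" and D: "!!\<D> X. \<D> division_of X ==> X <= {0..1} ==> sum len \<D> < d ==> (SUM K:\<D>. norm (incr f K)) < e1"
 using abs_cont_division[OF f e1] by blast
 have Ns: "N : sets lebesgue" using N by (simp add: negligible_imp_sets)
 obtain G where G: "open G" "N <= G" "G - N : lmeasurable" "emeasure lebesgue (G - N) < ennreal d"
 using sets_lebesgue_outer_open[OF Ns d] .
 have Gl: "G : lmeasurable" and Gm: "measure lebesgue G < d"
 proof -
 have u: "(G - N) Un N = G" using G(2) by blast
 show "G : lmeasurable" using fmeasurable.Un[OF G(3) negligible_imp_measurable[OF N]] u by simp
 have "measure lebesgue G = measure lebesgue (G - N)"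
 using measure_Un_null_set[of "G - N" lebesgue N] G(3) N u by (simp add: negligible_iff_null_sets fmeasurableD)
 also have "... < d" using G(4) d emeasure_eq_measure2[OF G(3)] by (simp add: ennreal_less_iff)
 finally show "measure lebesgue G < d" .
 qed
 have "EX r>0. (x : N --> ball x r <= G) &
      (x : {0..1} - N --> (ALL y:{0..1}. norm (y - x) < r --> norm (f y - f x - (y - x) *\<^sub>R g x) <= e1 * norm (y - x)))" for x
 proof (cases "x : N")
 case True
 then obtain r where "r > 0" "ball x r <= G" using G(1,2) open_contains_ball by blast
 thus ?thesis using True by blast
 next
 case False
 show ?thesis
 proof (cases "x : {0..1}")
 case True
 hence "(f has_vector_derivative g x) (at x within {0..1})" using g False by blast
 then obtain r where "r > 0" "ALL y:{0..1}. norm (y - x) < r --> norm (f y - f x - (y - x) *\<^sub>R g x) <= e1 * norm (y - x)"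
 using e1 unfolding has_vector_derivative_def has_derivative_within_alt by blast
 thus ?thesis using False by blast
 qed (use False zero_less_one in blast)
 qed
 hence "ALL x. EX r>0. (x : N --> ball x r <= G) &
      (x : {0..1} - N --> (ALL y:{0..1}. norm (y - x) < r --> norm (f y - f x - (y - x) *\<^sub>R g x) <= e1 * norm (y - x)))" by (rule allI)
 from choice[OF this] obtain r where r: "ALL x. r x > 0 & (x : N --> ball x (r x) <= G) &
      (x : {0..1} - N --> (ALL y:{0..1}. norm (y - x) < r x --> norm (f y - f x - (y - x) *\<^sub>R g x) <= e1 * norm (y - x)))" by (elim exE) (rule that)
 show "EX \<gamma>. gauge \<gamma> & (ALL \<D>. \<D> tagged_division_of {a..b} & \<gamma> fine \<D> -->
      norm ((SUM (x, K):\<D>. measure lborel K *\<^sub>R g0 x) - (f b - f a)) < e)"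
 proof (intro exI[of _ "%x. ball x (r x)"] conjI allI impI)
 show "gauge (%x. ball x (r x))" using r by (intro gauge_ball_dependent) blast
 fix p assume "p tagged_division_of {a..b} & (%x. ball x (r x)) fine p"
 hence p: "p tagged_division_of {a..b}" and fine: "(%x. ball x (r x)) fine p" by auto
 note pD = tagged_division_ofD[OF p]
 \<comment> \<open>Passing from sums over tags to sums over intervals requires the value 0 on
   degenerate boxes, among them the empty set, which has no endpoints.\<close>
 let ?nf = "%K. if K = {} then 0 else norm (incr f K)"
 have bound: "norm (case q of (x, K) => measure lborel K *\<^sub>R g0 x - incr f K) <= (case q of (x, K) => e1 * len K + (if x : N then ?nf K else 0))"
 if q: "q : p" for q
 proof -
 obtain x K where xK: "q = (x, K)" by (cases q)
 have x: "x : K" and Ks: "K <= {a..b}" using pD(2,3) q xK by auto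
 obtain u v where uv: "K = cbox u v" using pD(4) q xK by blast
 have ne: "K ~= {}" using x by blast
 note K = real_interval_cases[OF uv ne]
 have uvx: "u <= x" "x <= v" "0 <= u" "v <= 1" using x K(4) Ks ab K(3) by auto
 have Kb: "K <= ball x (r x)" using fine q xK unfolding fine_def by blast
 show ?thesis
 proof (cases "x : N")
 case True
 thus ?thesis using xK ne e1 K(3) by (simp add: g0_def K(1,2) norm_minus_commute)
 next
 case False
 have 1: "norm (f y - f x - (y - x) *\<^sub>R g x) <= e1 * norm (y - x)" if "y : K" for y
 proof -
 have "norm (y - x) < r x" using that Kb by (auto simp: dist_norm norm_minus_commute)
 moreover have "y : {0..1}" "x : {0..1}" using that Ks ab x by auto
 ultimately show ?thesis using r False by blast
 qed
 have "measure lborel K *\<^sub>R g x - incr f K = (f u - f x - (u - x) *\<^sub>R g x) - (f v - f x - (v - x) *\<^sub>R g x)"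
 unfolding K(6) unfolding K(1,2) by (simp add: algebra_simps)
 also have "norm ... <= e1 * norm (u - x) + e1 * norm (v - x)"
 by (rule order_trans[OF norm_triangle_ineq4 add_mono[OF 1 1]]) (use K(4) uvx in auto)
 also have "... = e1 * len K" unfolding K(1,2) using uvx by (simp add: algebra_simps)
 finally show ?thesis using xK False by (simp add: g0_def)
 qed
 qed
 have fb: "f b - f a = (SUM (x, K):p. incr f K)" and ba: "b - a = (SUM (x, K):p. len K)"
 using additive_tagged_division_1[OF ab(2) p, of f] additive_tagged_division_1[OF ab(2) p, of "%x. x"] by auto
 let ?pN = "{q : p. fst q : N}"
 have fp: "finite p" using pD(1) .
 have pN: "?pN tagged_division_of \<Union>(snd ` ?pN)"
 by (rule tagged_partial_division_of_Union_self[OF tagged_partial_division_subset]) (use p in "auto simp: tagged_division_of_def")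
 have dN: "snd ` ?pN division_of \<Union>(snd ` ?pN)" by (rule division_of_tagged_division[OF pN])
 have sub01: "\<Union>(snd ` ?pN) <= {0..1}" using pD(3) ab by force
 have "\<Union>(snd ` ?pN) <= G" using fine r unfolding fine_def by fastforce
 from sum_len_mono[OF dN this Gl] have "sum len (snd ` ?pN) < d" using Gm by simp
 from D[OF dN sub01 this] have small: "(SUM K:snd ` ?pN. norm (incr f K)) < e1" .
 have "(SUM (x, K):?pN. ?nf K) = (SUM K:snd ` ?pN. ?nf K)"
 proof (rule sum.over_tagged_division_lemma[OF pN])
 show "?nf (cbox u v) = 0" if "box u v = {}" for u v :: real
 proof (cases "cbox u v = {}")
 case False
 hence "u = v" using that by auto
 thus ?thesis by simp
 qed simp
 qed
 also have "... <= (SUM K:snd ` ?pN. norm (incr f K))" by (rule sum_mono) simp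
 finally have N1: "(SUM (x, K):?pN. ?nf K) < e1" using small by simp
 have "norm ((SUM (x, K):p. measure lborel K *\<^sub>R g0 x) - (f b - f a)) = norm (SUM q:p. case q of (x, K) => measure lborel K *\<^sub>R g0 x - incr f K)"
 unfolding fb by (simp add: sum_subtractf[symmetric] split_def)
 also have "... <= (SUM q:p. case q of (x, K) => e1 * len K + (if x : N then ?nf K else 0))"
 by (rule sum_norm_le[OF bound])
 also have "... = (SUM q:p. e1 * (case q of (x, K) => len K)) + (SUM q:p. if fst q : N then (case q of (x, K) => ?nf K) else 0)"
 unfolding sum.distrib[symmetric] by (rule sum.cong) (auto simp: split_def)
 also have "(SUM q:p. e1 * (case q of (x, K) => len K)) = e1 * (b - a)"
 unfolding ba by (simp add: sum_distrib_left)
 also have "(SUM q:p. if fst q : N then (case q of (x, K) => ?nf K) else 0) = (SUM (x, K):?pN. ?nf K)"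
 by (rule sum.inter_filter[OF fp, symmetric])
 also have "e1 * (b - a) + (SUM (x, K):?pN. ?nf K) < e1 * 1 + e1"
 by (rule add_le_less_mono[OF mult_left_mono N1]) (use ab e1 in auto)
 finally show "norm ((SUM (x, K):p. measure lborel K *\<^sub>R g0 x) - (f b - f a)) < e" using e by (simp add: e1_def)
 qed
 qed
 thus ?thesis by (rule has_integral_spike[OF N, rotated]) (simp add: g0_def)
qed

text \<open>On an interval shorter than \<open>d\<close> the sums of norms of integrals are sums of
  increments and stay below 1; finitely many pieces of length at most \<open>d / 2\<close> make up
  the unit interval.\<close>

lemma abs_cont_absolutely_integrable:
 fixes f :: "real => 'a::euclidean_space"
 assumes f: "abs_cont f" and F: "!!a b. 0 <= a ==> a <= b ==> b <= 1 ==> (g has_integral (f b - f a)) {a..b}"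
 shows "g absolutely_integrable_on {0..1}"
proof -
 obtain d where d: "d > 0" and D: "!!\<D> X. \<D> division_of X ==> X <= {0..1} ==> sum len \<D> < d ==> (SUM K:\<D>. norm (incr f K)) < 1"
 using abs_cont_division[OF f zero_less_one] by blast
 have loc: "g absolutely_integrable_on {a..b}" if ab: "0 <= a" "a <= b" "b <= 1" "b - a < d" for a b
 unfolding box_real(2)[symmetric]
 proof (rule bounded_variation_absolutely_integrable_interval)
 show "g integrable_on cbox a b" using F[OF ab(1-3)] by auto
 fix \<D> assume dv: "\<D> division_of cbox a b"
 have "(SUM K:\<D>. norm (integral K g)) = (SUM K:\<D>. norm (incr f K))"
 proof (rule sum.cong[OF refl])
 fix K assume K: "K : \<D>"
 obtain u v where uv: "u <= v" "K = {u..v}" "Inf K = u" "Sup K = v" by (rule division_real[OF dv K])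
 have "K <= {a..b}" using division_ofD(2)[OF dv K] by simp
 hence "0 <= u" "v <= 1" using uv ab by auto
 thus "norm (integral K g) = norm (incr f K)" using integral_unique[OF F[of u v]] uv by simp
 qed
 also have "... < 1"
 proof (rule D[OF dv])
 show "sum len \<D> < d" using sum_len_division[OF dv] ab by simp
 qed (use ab in auto)
 finally show "(SUM K:\<D>. norm (integral K g)) <= 1" by simp
 qed
 have "g absolutely_integrable_on {0..min 1 (real n * (d / 2))}" for n
 proof (induction n)
 case 0
 thus ?case using loc[of 0 0] d by simp
 next
 case (Suc n)
 show ?case
 by (rule absolutely_integrable_on_combine[OF Suc loc]) (use d in "auto simp: algebra_simps min_def")
 qed
 moreover obtain n where "1 / (d / 2) < real n" using reals_Archimedean2 by blast
 hence "min 1 (real n * (d / 2)) = 1" using d by (simp add: field_simps)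
 ultimately show ?thesis by metis
qed

section \<open>Function algebras on the unit interval\<close>

lemma fun_alg_simps [simp]:
 "car (fun_alg C B) = C" "small (fun_alg C B) = B" "\<zero>[fun_alg C B] = (PATH t. 0)"
 "f *[fun_alg C B] g = (PATH t. f t * g t)" "f +[fun_alg C B] g = (PATH t. f t + g t)"
 "c .[fun_alg C B] f = (PATH t. c * f t)"
 by (simp_all add: fun_alg_def)

text \<open>In \<open>power\<close> the scaling \<open>c\<close> is the same for all
  \<open>k\<close>, while each \<open>p k\<close> may be dominated by its own submultiplicative
  \<open>q\<close> that is at most 1 on the scaled set. Powers of that set then stay in the unit
  ball of every such \<open>q\<close>, so all \<open>p k\<close> are bounded on them.\<close>

locale seminorm_algebra =
 fixes C :: "(real => complex) set" and B and p :: "nat => (real => complex) => real"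
 assumes ext: "f : C ==> f : extensional {0..1}"
 and add: "f : C ==> g : C ==> (PATH t. f t + g t) : C"
 and scale: "f : C ==> (PATH t. c * f t) : C"
 and mult: "f : C ==> g : C ==> (PATH t. f t * g t) : C"
 and one: "(PATH t. 1) : C" and ident: "(PATH t. cplx t) : C"
 and B_iff: "S : B \<longleftrightarrow> S <= C & (ALL k. EX M. ALL f:S. p k f <= M)"
 and p_nonneg: "f : C ==> 0 <= p k f"
 and p_add: "f : C ==> g : C ==> p k (PATH t. f t + g t) <= p k f + p k g"
 and p_scale: "f : C ==> p k (PATH t. c * f t) <= cmod c * p k f"
 and p_mult: "f : C ==> g : C ==> p k (PATH t. f t * g t) <= p k f * p k g"
 and p_ev: "f : C ==> t : {0..1} ==> cmod (f t) <= p 0 f"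
 and power: "S : B ==> EX c>0. ALL k. EX q D. 0 <= D & (ALL f:C. 0 <= q f & p k f <= D * q f)
      & (ALL f:C. ALL g:C. q (PATH t. f t * g t) <= q f * q g)
      & (ALL f:S. q (PATH t. cplx c * f t) <= 1)"
begin

abbreviation "F \<equiv> fun_alg C B"

lemma eqI: "f : C ==> g : C ==> (!!t. t : {0..1} ==> f t = g t) ==> f = g"
 using ext by (metis extensionalityI)

lemma zero_C: "(PATH t. 0) : C"
 using scale[OF one, of 0] by (simp add: restrict_def cong: if_cong)

sublocale F: cvs F
proof (rule cvs.intro, rule moduleI[OF cring_complex_ring])
 show "abelian_group F"
 proof (rule abelian_groupI)
 show "EX g:car F. g +[F] f = \<zero>[F]" if "f : car F" for f
 using scale[of f "-1"] that by (intro bexI[of _ "PATH t. - 1 * f t"]) (auto simp: restrict_def fun_eq_iff)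
 show "\<zero>[F] +[F] f = f" if "f : car F" for f
 proof (rule eqI)
 show "\<zero>[F] +[F] f : C" using add[OF zero_C, of f] that by simp
 qed (use that in auto)
 qed (use add zero_C in "auto simp: restrict_def fun_eq_iff algebra_simps")
 show "\<one>\<^bsub>complex_ring\<^esub> .[F] f = f" if "f : car F" for f
 proof (rule eqI)
 show "\<one>\<^bsub>complex_ring\<^esub> .[F] f : C" using scale[of f 1] that by simp
 qed (use that in auto)
qed (use scale in "auto simp: restrict_def fun_eq_iff algebra_simps")

lemma smallI: "S <= C ==> (!!k. EX M. ALL f:S. p k f <= M) ==> S : B"
 using B_iff by blast

lemma smallD: assumes "S : B" obtains M where "M >= 0" "!!f. f : S ==> p k f <= M"
proof -
 obtain M where "ALL f:S. p k f <= M" using assms B_iff by blast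
 thus thesis using that[of "max M 0"] by (simp add: le_max_iff_disj)
qed

lemma small_C: "S : B ==> S <= C"
 using B_iff by blast

sublocale F: balg F
proof unfold_locales
 show "S <= car F" if "S : small F" for S using small_C that by simp
 show "{x} : small F" if "x : car F" for x using that by (auto intro: smallI)
 show "T : small F" if "S : small F" "T <= S" for S T using that B_iff[of S] B_iff[of T] by (simp, meson subset_iff)
 show "S <+>\<^bsub>F\<^esub> T : small F" if s: "S : small F" "T : small F" for S T
 proof -
 have s': "S : B" "T : B" using s by auto
 have sum: "S <+>\<^bsub>F\<^esub> T = {(PATH t. f t + g t) | f g. f : S & g : T}" unfolding set_add_def' by auto
 have "S <+>\<^bsub>F\<^esub> T : B"
 proof (rule smallI)
 show "S <+>\<^bsub>F\<^esub> T <= C" unfolding sum using add small_C[OF s'(1)] small_C[OF s'(2)] by blast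
 fix k
 obtain M where M: "!!f. f : S ==> p k f <= M" using smallD[OF s'(1)] by blast
 obtain M' where M': "!!f. f : T ==> p k f <= M'" using smallD[OF s'(2)] by blast
 show "EX M. ALL f:S <+>\<^bsub>F\<^esub> T. p k f <= M"
 proof (intro exI[of _ "M + M'"] ballI)
 fix h assume "h : S <+>\<^bsub>F\<^esub> T"
 then obtain f g where h: "h = (PATH t. f t + g t)" "f : S" "g : T" unfolding sum by blast
 show "p k h <= M + M'"
 unfolding h(1) by (rule order_trans[OF p_add add_mono[OF M[OF h(2)] M'[OF h(3)]]]) (use h small_C s' in auto)
 qed
 qed
 thus ?thesis by simp
 qed
 show "disk_hull F S : small F" if s: "S : small F" for S
 proof -
 have s': "S : B" using s by simp
 have "ALL k. EX M. ALL f:S. p k f <= M" using s' B_iff by blast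
 from choice[OF this] obtain M where M: "ALL k. ALL f:S. p k f <= M k" by (elim exE) (rule that)
 let ?D = "{f : C. ALL k. p k f <= M k}"
 have "disk F ?D"
 unfolding disk_def
 proof (intro conjI allI ballI impI)
 show "?D <= car F" by auto
 fix c :: complex and f assume f: "f : ?D" and c: "cmod c <= 1"
 have "p k (PATH t. c * f t) <= M k" for k
 proof -
 have "p k (PATH t. c * f t) <= cmod c * p k f" using p_scale f by blast
 also have "... <= 1 * p k f" using c p_nonneg f by (intro mult_right_mono) auto
 finally show ?thesis using f order_trans by fastforce
 qed
 thus "c .[F] f : ?D" using f scale by auto
 next
 fix f g and t :: real assume f: "f : ?D" and g: "g : ?D" and t: "t : {0..1}"
 let ?f = "PATH x. cplx t * f x" and ?g = "PATH x. cplx (1 - t) * g x"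
 have fg: "?f : C" "?g : C" using f g scale by blast+
 have "p k (PATH x. ?f x + ?g x) <= M k" for k
 proof -
 have "p k (PATH x. ?f x + ?g x) <= p k ?f + p k ?g" by (rule p_add[OF fg])
 also have "... <= cmod (cplx t) * p k f + cmod (cplx (1 - t)) * p k g"
 using p_scale f g by (intro add_mono) blast+
 also have "... = t * p k f + (1 - t) * p k g" using t by (simp only: norm_of_real) simp
 also have "... <= t * M k + (1 - t) * M k" using f g t by (intro add_mono mult_left_mono) auto
 finally show ?thesis by (simp add: algebra_simps)
 qed
 thus "(cplx t .[F] f) +[F] (cplx (1 - t) .[F] g) : ?D" using add[OF fg] by simp
 qed
 hence "disk_hull F S <= ?D" by (rule F.disk_hull_least) (use M small_C[OF s'] in auto)
 hence "disk_hull F S : B" by (intro smallI) blast+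
 thus ?thesis by simp
 qed
 show "bdd_bilinear F F F (mult F)"
 unfolding bdd_bilinear_def
 proof (intro conjI ballI)
 show "linear_on F F (%g. f *[F] g)" if "f : car F" for f
 using that mult by (auto simp: linear_on_def restrict_def fun_eq_iff algebra_simps)
 show "linear_on F F (%f. f *[F] g)" if "g : car F" for g
 using that mult by (auto simp: linear_on_def restrict_def fun_eq_iff algebra_simps)
 fix S T assume "S : small F" "T : small F"
 hence s: "S : B" "T : B" by auto
 have "{(PATH t. f t * g t) | f g. f : S & g : T} : B"
 proof (rule smallI)
 show "{(PATH t. f t * g t) | f g. f : S & g : T} <= C" using mult small_C[OF s(1)] small_C[OF s(2)] by blast
 fix k
 obtain M where M: "M >= 0" "!!f. f : S ==> p k f <= M" using smallD[OF s(1)] by blast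
 obtain M' where M': "!!f. f : T ==> p k f <= M'" using smallD[OF s(2)] by blast
 have "p k (PATH t. f t * g t) <= M * M'" if "f : S" "g : T" for f g
 by (rule order_trans[OF p_mult mult_mono[OF M(2)[OF that(1)] M'[OF that(2)]]]) (use that small_C s M(1) p_nonneg in auto)
 thus "EX M. ALL f:{(PATH t. f t * g t) | f g. f : S & g : T}. p k f <= M" by blast
 qed
 thus "{f *[F] g | f g. f : S & g : T} : small F" by simp
 qed
qed (auto simp: restrict_def fun_eq_iff algebra_simps)

lemma path_alg: "path_alg F (PATH t. 1) (PATH t. cplx t)"
proof
 show "EX M. ALL f:S. cmod (f t) <= M" if t: "t : {0..1}" and S: "S : small F" for t S
 proof -
 have s: "S : B" using S by simp
 obtain M where M: "!!f. f : S ==> p 0 f <= M" using smallD[OF s] by blast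
 show ?thesis using order_trans[OF p_ev[OF _ t] M] small_C[OF s] by blast
 qed
 show "EX c>0. (\<Union>n. set_power F (F.sc c S) n) : small F" if S: "S : small F" for S
 proof -
 have s: "S : B" using S by simp
 obtain c where c: "c > 0" and P: "ALL k. EX q D. 0 <= D & (ALL f:C. 0 <= q f & p k f <= D * q f)
      & (ALL f:C. ALL g:C. q (PATH t. f t * g t) <= q f * q g)
      & (ALL f:S. q (PATH t. cplx c * f t) <= 1)" using power[OF s] by blast
 have Sc: "F.sc c S <= C" using small_C[OF s] scale by (auto simp: F.sc_def)
 have powC: "set_power F (F.sc c S) n <= C" for n using F.set_power_closed[of "F.sc c S" n] Sc by simp
 have "(\<Union>n. set_power F (F.sc c S) n) : B"
 proof (rule smallI)
 show "(\<Union>n. set_power F (F.sc c S) n) <= C" using powC by blast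
 fix k
 from spec[OF P, of k] obtain q D where D: "0 <= D" and q: "ALL f:C. 0 <= q f & p k f <= D * q f"
 and qm: "ALL f:C. ALL g:C. q (PATH t. f t * g t) <= q f * q g"
 and q1: "ALL f:S. q (PATH t. cplx c * f t) <= 1" by (elim exE conjE) (rule that)
 have sc1: "q f <= 1" if "f : F.sc c S" for f using q1 that by (auto simp: F.sc_def)
 have "ALL f:set_power F (F.sc c S) n. q f <= 1" for n
 proof (induction n)
 case (Suc n)
 show ?case
 proof
 fix h assume "h : set_power F (F.sc c S) (Suc n)"
 then obtain f g where h: "f : set_power F (F.sc c S) n" "g : F.sc c S" "h = (PATH t. f t * g t)"
 by (auto simp: set_mult_def)
 have fg: "f : C" "g : C" using h powC Sc by blast+
 have "q h <= q f * q g" using qm fg h(3) by blast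
 also have "... <= 1 * 1" using Suc.IH h(1) sc1[OF h(2)] q fg by (intro mult_mono) auto
 finally show "q h <= 1" by simp
 qed
 qed (use sc1 in simp)
 hence "p k f <= D * 1" if "f : (\<Union>n. set_power F (F.sc c S) n)" for f
 using that q powC D by (metis (no_types, lifting) UN_E mult_left_mono order_trans subsetD)
 thus "EX M. ALL f:\<Union>n. set_power F (F.sc c S) n. p k f <= M" by blast
 qed
 thus ?thesis using c by auto
 qed
qed (use one ident in "auto simp: restrict_def fun_eq_iff")

end

section \<open>The algebra of absolutely continuous functions\<close>

definition variation :: "(real => complex) => real" where
 "variation f = integral {0..1} (%t. cmod (deriv01 f t))"

lemma abs_cont01_iff: "f : abs_cont01 \<longleftrightarrow> f : extensional {0..1} & abs_cont f"
 by (simp add: abs_cont01_def abs_cont_def)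

text \<open>The Lebesgue integral in \<open>ac_norm\<close> agrees with the gauge integral because
  the derivative is absolutely integrable; the latter is used from here on.\<close>

lemma abs_cont_deriv:
 fixes f :: "real => complex"
 assumes f: "abs_cont f"
 shows "0 <= a ==> a <= b ==> b <= 1 ==> (deriv01 f has_integral (f b - f a)) {a..b}"
 "deriv01 f integrable_on {0..1}" "(%t. cmod (deriv01 f t)) integrable_on {0..1}"
 "ac_norm f = cmod (f 0) + variation f" "0 <= variation f"
proof -
 obtain N where N: "negligible N" "!!x. x : {0..1} - N ==> (f has_vector_derivative deriv01 f x) (at x within {0..1})"
 using abs_cont_differentiable[OF f] by blast
 note F = abs_cont_FTC[OF f N]
 thus "0 <= a ==> a <= b ==> b <= 1 ==> (deriv01 f has_integral (f b - f a)) {a..b}" by blast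
 have a: "deriv01 f absolutely_integrable_on {0..1}" by (rule abs_cont_absolutely_integrable[OF f F])
 thus "deriv01 f integrable_on {0..1}" "(%t. cmod (deriv01 f t)) integrable_on {0..1}" by (auto simp: absolutely_integrable_on_def)
 have "integrable (lebesgue_on {0..1}) (%t. cmod (deriv01 f t))"
 by (rule integrable_norm[OF absolutely_integrable_imp_integrable[OF a]]) simp
 thus "ac_norm f = cmod (f 0) + variation f"
 unfolding ac_norm_def variation_def by (simp add: lebesgue_integral_eq_integral)
 show "0 <= variation f" unfolding variation_def by (rule Henstock_Kurzweil_Integration.integral_nonneg) (use a in "auto simp: absolutely_integrable_on_def")
qed

text \<open>\<open>f t - f 0\<close> is the integral of the derivative over \<open>[0, t]\<close>,
  hence bounded by the variation.\<close>

lemma cmod_le_ac_norm: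
 assumes f: "abs_cont f" and t: "t : {0..1}"
 shows "cmod (f t) <= ac_norm f"
proof -
 note d = abs_cont_deriv[OF f]
 have i: "(deriv01 f has_integral (f t - f 0)) {0..t}" using d(1) t by simp
 have s: "{0..t} <= {0..1}" using t by simp
 have "cmod (f t - f 0) = cmod (integral {0..t} (deriv01 f))" using integral_unique[OF i] by simp
 also have "... <= integral {0..t} (%t. cmod (deriv01 f t))"
 by (rule integral_norm_bound_integral) (use i integrable_on_subinterval[OF d(3) s] in auto)
 also have "... <= variation f" unfolding variation_def
 by (rule integral_subset_le[OF s integrable_on_subinterval[OF d(3) s] d(3)]) simp
 finally have "cmod (f t - f 0) <= variation f" .
 thus ?thesis using norm_triangle_sub[of "f t" "f 0"] d(4) by simp
qed

text \<open>A pointwise bound on derivatives is integrated. Where \<open>f\<close> or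
  \<open>g\<close> may fail to be differentiable, on a null set, both integrands are replaced by
  0.\<close>

lemma variation_le:
 assumes fgh: "abs_cont f" "abs_cont g" "abs_cont h"
 and le: "!!x f' g'. x : {0..1} ==> (f has_vector_derivative f') (at x within {0..1}) ==> (g has_vector_derivative g') (at x within {0..1})
      ==> EX h'. (h has_vector_derivative h') (at x within {0..1}) & cmod h' <= a * cmod f' + b * cmod g'"
 shows "variation h <= a * variation f + b * variation g"
proof -
 obtain N1 where N1: "negligible N1" "!!x. x : {0..1} - N1 ==> (f has_vector_derivative deriv01 f x) (at x within {0..1})"
 using abs_cont_differentiable[OF fgh(1)] by blast
 obtain N2 where N2: "negligible N2" "!!x. x : {0..1} - N2 ==> (g has_vector_derivative deriv01 g x) (at x within {0..1})"
 using abs_cont_differentiable[OF fgh(2)] by blast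
 have n: "negligible (N1 Un N2)" using N1 N2 by simp
 let ?i = "%k x. if x : N1 Un N2 then 0 else k x :: real"
 let ?h = "%t. cmod (deriv01 h t)" and ?k = "%t. a * cmod (deriv01 f t) + b * cmod (deriv01 g t)"
 have k: "?k integrable_on {0..1}"
 by (intro integrable_add integrable_on_mult_right abs_cont_deriv(3) fgh)
 have ih: "?i ?h integrable_on {0..1}" by (rule integrable_spike[OF abs_cont_deriv(3)[OF fgh(3)] n]) auto
 have ik: "?i ?k integrable_on {0..1}" by (rule integrable_spike[OF k n]) auto
 have "variation h = integral {0..1} (?i ?h)" unfolding variation_def by (rule integral_spike[OF n]) auto
 also have "... <= integral {0..1} (?i ?k)"
 proof (rule integral_le[OF ih ik])
 fix x :: real assume x: "x : {0..1}"
 have "?h x <= ?k x" if H: "x \<notin> N1 Un N2"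
 proof -
 obtain h' where h': "(h has_vector_derivative h') (at x within {0..1})" "cmod h' <= ?k x"
 using le[OF x N1(2) N2(2)] x H by auto
 have "deriv01 h x = h'" unfolding deriv01_def
 using vector_derivative_within_cbox[of 0 1 x h h'] h'(1) x by simp
 thus ?thesis using h'(2) by simp
 qed
 thus "?i ?h x <= ?i ?k x" by simp
 qed
 also have "... = integral {0..1} ?k" by (rule integral_spike[OF n]) auto
 also have "... = a * variation f + b * variation g" unfolding variation_def
 by (subst Henstock_Kurzweil_Integration.integral_add) (auto intro!: integrable_on_mult_right abs_cont_deriv(3) fgh)
 finally show ?thesis .
qed

lemma restrict_has_vector_derivative:
 "x : {0..1} ==> (f has_vector_derivative f') (at x within {0..1}) ==> ((PATH t. f t) has_vector_derivative f') (at x within {0..1})"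
 by (rule has_vector_derivative_transform[of _ _ _ f]) auto

lemma abs_cont_add:
 assumes "abs_cont f" "abs_cont g" shows "abs_cont (PATH t. f t + g t :: complex)"
proof (rule abs_cont_combine[OF assms zero_le_one])
 fix a b :: real assume ab: "0 <= a" "a <= b" "b <= 1"
 show "cmod ((PATH t. f t + g t) b - (PATH t. f t + g t) a) <= 1 * (cmod (f b - f a) + cmod (g b - g a))"
 using ab norm_diff_triangle_ineq[of "f b" "g b" "f a" "g a"] by simp
qed

lemma abs_cont_scale:
 assumes "abs_cont f" shows "abs_cont (PATH t. c * f t :: complex)"
proof (rule abs_cont_combine[OF assms assms norm_ge_zero[of c]])
 fix a b :: real assume ab: "0 <= a" "a <= b" "b <= 1"
 have "cmod (c * f b - c * f a) = cmod c * cmod (f b - f a)" by (metis norm_mult right_diff_distrib)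
 also have "... <= cmod c * (cmod (f b - f a) + cmod (f b - f a))" by (intro mult_left_mono) auto
 finally show "cmod ((PATH t. c * f t) b - (PATH t. c * f t) a) <= cmod c * (cmod (f b - f a) + cmod (f b - f a))"
 using ab by simp
qed

lemma abs_cont_mult:
 assumes f: "abs_cont f" and g: "abs_cont g" shows "abs_cont (PATH t. f t * g t :: complex)"
proof (rule abs_cont_combine[OF f g])
 let ?M = "ac_norm f + ac_norm g"
 have pos: "0 <= ac_norm f" "0 <= ac_norm g" using abs_cont_deriv(4,5)[OF f] abs_cont_deriv(4,5)[OF g] by auto
 thus "0 <= ?M" by simp
 fix a b :: real assume ab: "0 <= a" "a <= b" "b <= 1"
 have "f b * g b - f a * g a = f b * (g b - g a) + g a * (f b - f a)" by (simp add: algebra_simps)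
 hence "cmod (f b * g b - f a * g a) <= cmod (f b) * cmod (g b - g a) + cmod (g a) * cmod (f b - f a)"
 by (metis norm_mult norm_triangle_ineq)
 also have "... <= ?M * cmod (g b - g a) + ?M * cmod (f b - f a)"
 using cmod_le_ac_norm[OF f, of b] cmod_le_ac_norm[OF g, of a] pos ab by (intro add_mono mult_right_mono) auto
 finally show "cmod ((PATH t. f t * g t) b - (PATH t. f t * g t) a) <= ?M * (cmod (f b - f a) + cmod (g b - g a))"
 using ab by (simp add: algebra_simps)
qed

lemma abs_cont_const: "abs_cont (%t. c)"
 unfolding abs_cont_def by (auto intro!: exI[of _ 1])

lemma abs_cont_ident: "abs_cont (PATH t. cplx t)"
 unfolding abs_cont_def
proof (intro allI impI)
 fix e :: real assume e: "e > 0"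
 show "EX d>0. ALL I :: (real \<times> real) set. finite I & (ALL (a, b):I. 0 <= a & a <= b & b <= 1)
    & disjoint_family_on (%(a, b). {a<..<b}) I & (SUM (a, b):I. b - a) < d
    --> (SUM (a, b):I. cmod ((PATH t. cplx t) b - (PATH t. cplx t) a)) < e"
 proof (intro exI[of _ e] conjI allI impI e)
 fix I :: "(real \<times> real) set"
 assume I: "finite I & (ALL (a, b):I. 0 <= a & a <= b & b <= 1)
      & disjoint_family_on (%(a, b). {a<..<b}) I & (SUM (a, b):I. b - a) < e"
 have "(SUM (a, b):I. cmod ((PATH t. cplx t) b - (PATH t. cplx t) a)) = (SUM (a, b):I. b - a)"
 proof (rule sum.cong[OF refl])
 fix q assume "q : I"
 then obtain a b where q: "q = (a, b)" "0 <= a" "a <= b" "b <= 1" using I by (cases q) auto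
 have "cmod (cplx b - cplx a) = b - a" using q by (metis abs_of_nonneg diff_ge_0_iff_ge norm_of_real of_real_diff)
 thus "(case q of (a, b) => cmod ((PATH t. cplx t) b - (PATH t. cplx t) a)) = (case q of (a, b) => b - a)"
 using q by simp
 qed
 thus "(SUM (a, b):I. cmod ((PATH t. cplx t) b - (PATH t. cplx t) a)) < e" using I by simp
 qed
qed

lemma ac_norm_add:
 assumes f: "abs_cont f" and g: "abs_cont g" shows "ac_norm (PATH t. f t + g t) <= ac_norm f + ac_norm g"
proof -
 have "variation (PATH t. f t + g t) <= 1 * variation f + 1 * variation g"
 proof (rule variation_le[OF f g abs_cont_add[OF f g]])
 fix x :: real and f' g' assume x: "x : {0..1}" and d: "(f has_vector_derivative f') (at x within {0..1})" "(g has_vector_derivative g') (at x within {0..1})"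
 show "EX h'. ((PATH t. f t + g t) has_vector_derivative h') (at x within {0..1}) & cmod h' <= 1 * cmod f' + 1 * cmod g'"
 using restrict_has_vector_derivative[OF x has_vector_derivative_add[OF d]] norm_triangle_ineq[of f' g'] by auto
 qed
 thus ?thesis using norm_triangle_ineq[of "f 0" "g 0"]
 by (simp add: abs_cont_deriv(4)[OF f] abs_cont_deriv(4)[OF g] abs_cont_deriv(4)[OF abs_cont_add[OF f g]])
qed

lemma ac_norm_scale:
 assumes f: "abs_cont f" shows "ac_norm (PATH t. c * f t) <= cmod c * ac_norm f"
proof -
 have "variation (PATH t. c * f t) <= cmod c * variation f + 0 * variation f"
 proof (rule variation_le[OF f f abs_cont_scale[OF f]])
 fix x :: real and f' g' assume x: "x : {0..1}" and d: "(f has_vector_derivative f') (at x within {0..1})"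
 show "EX h'. ((PATH t. c * f t) has_vector_derivative h') (at x within {0..1}) & cmod h' <= cmod c * cmod f' + 0 * cmod g'"
 using restrict_has_vector_derivative[OF x has_vector_derivative_mult_right[OF d, of c]] by (auto simp: norm_mult)
 qed
 thus ?thesis
 by (simp add: abs_cont_deriv(4)[OF f] abs_cont_deriv(4)[OF abs_cont_scale[OF f]] norm_mult algebra_simps)
qed

text \<open>The Leibniz rule contributes 2 and the value at 0 contributes 1 to the constant 3;
  consequently \<open>3 * ac_norm f\<close> is submultiplicative.\<close>

lemma ac_norm_mult:
 assumes f: "abs_cont f" and g: "abs_cont g" shows "ac_norm (PATH t. f t * g t) <= 3 * (ac_norm f * ac_norm g)"
proof -
 let ?F = "ac_norm f" and ?G = "ac_norm g"
 have "variation (PATH t. f t * g t) <= ?G * variation f + ?F * variation g"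
 proof (rule variation_le[OF f g abs_cont_mult[OF f g]])
 fix x :: real and f' g' assume x: "x : {0..1}" and d: "(f has_vector_derivative f') (at x within {0..1})" "(g has_vector_derivative g') (at x within {0..1})"
 have "cmod (f x * g' + f' * g x) <= cmod (f x) * cmod g' + cmod f' * cmod (g x)" by (metis norm_mult norm_triangle_ineq)
 also have "... <= ?F * cmod g' + cmod f' * ?G"
 using cmod_le_ac_norm[OF f x] cmod_le_ac_norm[OF g x] by (intro add_mono mult_right_mono mult_left_mono) auto
 finally show "EX h'. ((PATH t. f t * g t) has_vector_derivative h') (at x within {0..1}) & cmod h' <= ?G * cmod f' + ?F * cmod g'"
 using restrict_has_vector_derivative[OF x has_vector_derivative_mult[OF d]] by (auto simp: algebra_simps)
 qed
 also have "... <= ?G * ?F + ?F * ?G"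
 using abs_cont_deriv(4,5)[OF f] abs_cont_deriv(4,5)[OF g] by (intro add_mono mult_left_mono) auto
 finally have 1: "variation (PATH t. f t * g t) <= 2 * (?F * ?G)" by simp
 have "cmod (f 0) * cmod (g 0) <= ?F * ?G"
 using cmod_le_ac_norm[OF f, of 0] cmod_le_ac_norm[OF g, of 0] by (intro mult_mono) (auto intro: order_trans[OF norm_ge_zero])
 thus ?thesis using 1 by (simp add: abs_cont_deriv(4)[OF abs_cont_mult[OF f g]] norm_mult)
qed

lemma ac_seminorm_algebra:
 "seminorm_algebra abs_cont01 {S. S <= abs_cont01 & (EX M. ALL f:S. ac_norm f <= M)} (%k f. 3 * ac_norm f)"
proof
 let ?B = "{S. S <= abs_cont01 & (EX M. ALL f:S. ac_norm f <= M)}"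
 have c: "abs_cont f" if "f : abs_cont01" for f using that by (simp add: abs_cont01_iff)
 have pos: "0 <= ac_norm f" if "f : abs_cont01" for f using abs_cont_deriv(4,5)[OF c[OF that]] by simp
 have sub: "3 * ac_norm (PATH t. f t * g t) <= 3 * ac_norm f * (3 * ac_norm g)" if "f : abs_cont01" "g : abs_cont01" for f g
 using ac_norm_mult[OF c[OF that(1)] c[OF that(2)]] by simp
 show "f : extensional {0..1}" if "f : abs_cont01" for f using that by (simp add: abs_cont01_iff)
 show "(PATH t. f t + g t) : abs_cont01" "(PATH t. f t * g t) : abs_cont01"
 "3 * ac_norm (PATH t. f t + g t) <= 3 * ac_norm f + 3 * ac_norm g"
 "3 * ac_norm (PATH t. f t * g t) <= 3 * ac_norm f * (3 * ac_norm g)" if "f : abs_cont01" "g : abs_cont01" for f g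
 using abs_cont_add[OF c[OF that(1)] c[OF that(2)]] abs_cont_mult[OF c[OF that(1)] c[OF that(2)]] ac_norm_add[OF c[OF that(1)] c[OF that(2)]]
 sub[OF that] by (auto simp: abs_cont01_iff)
 show "(PATH t. c * f t) : abs_cont01" "3 * ac_norm (PATH t. c * f t) <= cmod c * (3 * ac_norm f)"
 if "f : abs_cont01" for f c
 using abs_cont_scale[OF c[OF that], of c] ac_norm_scale[OF c[OF that], of c] by (auto simp: abs_cont01_iff)
 show "(PATH t. 1) : abs_cont01"
 using abs_cont_scale[OF abs_cont_const[of 1], of 1] by (simp add: abs_cont01_iff)
 show "(PATH t. cplx t) : abs_cont01" using abs_cont_ident by (simp add: abs_cont01_iff)
 show "0 <= 3 * ac_norm f" if "f : abs_cont01" for f using pos[OF that] by simp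
 show "cmod (f t) <= 3 * ac_norm f" if "f : abs_cont01" "t : {0..1}" for f t
 using cmod_le_ac_norm[OF c[OF that(1)] that(2)] pos[OF that(1)] by simp
 have "(EX M. ALL f:S. 3 * ac_norm f <= M) \<longleftrightarrow> (EX M. ALL f:S. ac_norm f <= M)" for S
 proof
 assume "EX M. ALL f:S. 3 * ac_norm f <= M"
 then obtain M where "ALL f:S. 3 * ac_norm f <= M" by blast
 thus "EX M. ALL f:S. ac_norm f <= M" by (intro exI[of _ "M / 3"]) auto
 next
 assume "EX M. ALL f:S. ac_norm f <= M"
 then obtain M where "ALL f:S. ac_norm f <= M" by blast
 thus "EX M. ALL f:S. 3 * ac_norm f <= M" by (intro exI[of _ "3 * M"]) auto
 qed
 thus "S : ?B \<longleftrightarrow> S <= abs_cont01 & (ALL k::nat. EX M. ALL f:S. 3 * ac_norm f <= M)" for S by simp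
 fix S assume S: "S : ?B"
 then obtain M where M: "ALL f:S. ac_norm f <= M" "S <= abs_cont01" by blast
 \<comment> \<open>This scaling brings the submultiplicative norm \<open>3 * ac_norm\<close> to at
   most 1 on \<open>S\<close>; the maximum keeps the denominator positive.\<close>
 define d where "d = 1 / (3 * max M 1)"
 have d: "d > 0" by (simp add: d_def)
 have 1: "3 * ac_norm (PATH t. cplx d * f t) <= 1" if f: "f : S" for f
 proof -
 have "3 * ac_norm (PATH t. cplx d * f t) <= 3 * (d * ac_norm f)"
 using ac_norm_scale[OF c, of f "cplx d"] M(2) f d by auto
 also have "... <= 3 * (d * max M 1)" using M(1) f d by (intro mult_left_mono) (auto simp: le_max_iff_disj)
 also have "... = 1" by (simp add: d_def)
 finally show ?thesis .
 qed
 show "EX c>0. ALL k::nat. EX q D. 0 <= D & (ALL f:abs_cont01. 0 <= q f & 3 * ac_norm f <= D * q f)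
    & (ALL f:abs_cont01. ALL g:abs_cont01. q (PATH t. f t * g t) <= q f * q g)
    & (ALL f:S. q (PATH t. cplx c * f t) <= (1::real))"
 by (intro exI[of _ d] conjI d allI exI[of _ "%f. 3 * ac_norm f"] exI[of _ 1]) (use pos sub 1 in auto)
qed

text \<open>At level \<open>k\<close> the derivatives of order up to \<open>k\<close> are themselves
  differentiable, which matches the quantifier in \<open>smooth01\<close>. Passing to
  \<open>deriv01 f\<close> first suits induction over products, where the Leibniz rule is applied
  once per step.\<close>

primrec smooth_upto :: "nat => (real => complex) => bool" where
 "smooth_upto 0 f \<longleftrightarrow> (ALL t:{0..1}. f differentiable (at t within {0..1}))"
| "smooth_upto (Suc k) f \<longleftrightarrow> (ALL t:{0..1}. f differentiable (at t within {0..1})) & smooth_upto k (deriv01 f)"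

lemma smooth_upto_diff: "smooth_upto k f ==> t : {0..1} ==> f differentiable (at t within {0..1})"
 by (cases k) auto

lemma deriv01_works: "f differentiable (at t within {0..1}) ==> (f has_vector_derivative deriv01 f t) (at t within {0..1})"
 unfolding deriv01_def by (simp add: vector_derivative_works[symmetric])

lemma deriv01_eq: "t : {0..1} ==> (f has_vector_derivative f') (at t within {0..1}) ==> deriv01 f t = f'"
 unfolding deriv01_def using vector_derivative_within_cbox[of 0 1 t f f'] by simp

lemma differentiableI_vector': "(f has_vector_derivative f') (at t within S) ==> f differentiable (at t within S)"
 by (rule differentiableI_vector)

text \<open>Derivatives within \<open>[0, 1]\<close> depend only on values there, so extensional
  functions and their unrestricted formulas are interchangeable.\<close>

lemma deriv01_cong:
 assumes eq: "!!t. t : {0..1} ==> f t = g t" and t: "t : {0..1}"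
 shows "deriv01 f t = deriv01 g t" "f differentiable (at t within {0..1}) \<longleftrightarrow> g differentiable (at t within {0..1})"
proof -
 have iff: "(f has_vector_derivative d) (at t within {0..1}) \<longleftrightarrow> (g has_vector_derivative d) (at t within {0..1})" for d
 using has_vector_derivative_transform[OF t, of f g d] has_vector_derivative_transform[OF t, of g f d] eq by auto
 thus "deriv01 f t = deriv01 g t" unfolding deriv01_def vector_derivative_def by simp
 show "f differentiable (at t within {0..1}) \<longleftrightarrow> g differentiable (at t within {0..1})"
 using iff unfolding vector_derivative_works by (metis differentiableI_vector vector_derivative_works)
qed

lemma smooth_upto_cong: "(!!t. t : {0..1} ==> f t = g t) ==> smooth_upto k f \<longleftrightarrow> smooth_upto k g"
proof (induction k arbitrary: f g)
 case 0
 show ?case using deriv01_cong(2)[of f g] 0 by simp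
next
 case (Suc k)
 have "smooth_upto k (deriv01 f) \<longleftrightarrow> smooth_upto k (deriv01 g)"
 by (rule Suc.IH) (rule deriv01_cong(1)[OF Suc.prems])
 thus ?case using deriv01_cong(2)[of f g] Suc.prems by simp
qed

lemma smooth_upto_Suc: "smooth_upto (Suc k) f ==> smooth_upto k f"
 by (induction k arbitrary: f) auto

lemma deriv01_ops:
 assumes "f differentiable (at t within {0..1})" "g differentiable (at t within {0..1})" "t : {0..1}"
 shows "deriv01 (%t. f t + g t) t = deriv01 f t + deriv01 g t" "(%t. f t + g t) differentiable (at t within {0..1})"
 "deriv01 (%t. f t * g t) t = f t * deriv01 g t + deriv01 f t * g t" "(%t. f t * g t) differentiable (at t within {0..1})"
 "deriv01 (%t. c * f t) t = c * deriv01 f t" "(%t. c * f t) differentiable (at t within {0..1})"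
 using has_vector_derivative_add[OF deriv01_works[OF assms(1)] deriv01_works[OF assms(2)]]
 has_vector_derivative_mult[OF deriv01_works[OF assms(1)] deriv01_works[OF assms(2)]]
 has_vector_derivative_mult_right[OF deriv01_works[OF assms(1)], of c]
 deriv01_eq[OF assms(3)] differentiableI_vector' by blast+

lemma smooth_upto_add: "smooth_upto k f ==> smooth_upto k g ==> smooth_upto k (%t. f t + g t)"
proof (induction k arbitrary: f g)
 case (Suc k)
 have "smooth_upto k (deriv01 (%t. f t + g t)) \<longleftrightarrow> smooth_upto k (%t. deriv01 f t + deriv01 g t)"
 by (rule smooth_upto_cong) (use deriv01_ops(1) Suc.prems in simp)
 thus ?case using Suc deriv01_ops(2) by simp
qed (use deriv01_ops(2) in simp)

lemma smooth_upto_mult: "smooth_upto k f ==> smooth_upto k g ==> smooth_upto k (%t. f t * g t)"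
proof (induction k arbitrary: f g)
 case (Suc k)
 have "smooth_upto k (deriv01 (%t. f t * g t)) \<longleftrightarrow> smooth_upto k (%t. f t * deriv01 g t + deriv01 f t * g t)"
 by (rule smooth_upto_cong) (use deriv01_ops(3) Suc.prems in simp)
 moreover have "smooth_upto k (%t. f t * deriv01 g t + deriv01 f t * g t)"
 by (intro smooth_upto_add Suc.IH smooth_upto_Suc[OF Suc.prems(1)] smooth_upto_Suc[OF Suc.prems(2)]) (use Suc.prems in auto)
 ultimately show ?case using Suc.prems deriv01_ops(4) by simp
qed (use deriv01_ops(4) in simp)

lemma smooth_upto_const: "smooth_upto k (%t. c)"
proof (induction k arbitrary: c)
 case (Suc k)
 have "smooth_upto k (deriv01 (%t. c)) \<longleftrightarrow> smooth_upto k (%t. 0)"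
 by (rule smooth_upto_cong) (rule deriv01_eq, auto)
 thus ?case using Suc by simp
qed simp

lemma smooth_upto_ident: "smooth_upto k cplx"
proof -
 have d: "(cplx has_vector_derivative 1) (at t within {0..1})" for t
 using has_vector_derivative_of_real[OF DERIV_ident] by simp
 show ?thesis
 proof (cases k)
 case (Suc k')
 have "smooth_upto k' (deriv01 cplx) \<longleftrightarrow> smooth_upto k' (%t. 1)"
 by (rule smooth_upto_cong) (rule deriv01_eq[OF _ d])
 thus ?thesis using Suc smooth_upto_const differentiableI_vector[OF d] by simp
 qed (use differentiableI_vector[OF d] in simp)
qed

lemma smooth01_iff: "f : smooth01 \<longleftrightarrow> f : extensional {0..1} & (ALL k. smooth_upto k f)"
proof -
 have "(deriv01 ^^ k) f differentiable (at t within {0..1})" if "smooth_upto k f" "t : {0..1}" for k t f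
 using that by (induction k arbitrary: f) (auto simp: funpow_swap1)
 moreover have "smooth_upto k f" if "!!k t. t : {0..1} ==> (deriv01 ^^ k) f differentiable (at t within {0..1})" for k f
 using that
 proof (induction k arbitrary: f)
 case 0
 thus ?case using "0"[of _ 0] by simp
 next
 case (Suc k)
 have "smooth_upto k (deriv01 f)" by (rule Suc.IH) (use Suc.prems[of _ "Suc _"] in "simp add: funpow_swap1")
 thus ?case using Suc.prems[of _ 0] by simp
 qed
 ultimately show ?thesis unfolding smooth01_def by blast
qed

definition sup01 :: "(real => complex) => real" where
 "sup01 f = (SUP t\<in>{0..1}. cmod (f t))"

lemma sup01_upper:
 assumes "smooth_upto k f" "t : {0..1}" shows "cmod (f t) <= sup01 f"
proof -
 have "continuous_on {0..1} f"
 using smooth_upto_diff[OF assms(1)] differentiable_imp_continuous_within continuous_on_eq_continuous_within by blast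
 hence "compact ((%t. cmod (f t)) ` {0..1})" by (intro compact_continuous_image continuous_intros) auto
 hence "bdd_above ((%t. cmod (f t)) ` {0..1})" by (intro bounded_imp_bdd_above compact_imp_bounded)
 thus ?thesis unfolding sup01_def using assms(2) by (rule cSUP_upper[rotated])
qed

lemma sup01_least: "(!!t. t : {0..1} ==> cmod (f t) <= M) ==> sup01 f <= M"
 unfolding sup01_def by (rule cSUP_least) auto

text \<open>With \<open>l ^ k\<close> weighting the \<open>k\<close>-th derivative, the Leibniz rule makes these norms submultiplicative by an
 induction that avoids binomial coefficients, and for small \<open>l\<close> the sup norm dominates.\<close>

primrec smooth_norm :: "real => nat => (real => complex) => real" where
 "smooth_norm l 0 f = sup01 f"
| "smooth_norm l (Suc k) f = smooth_norm l k f + l * smooth_norm l k (deriv01 f)"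

lemma smooth_norm_cong:
 "(!!t. t : {0..1} ==> f t = g t) ==> smooth_norm l k f = smooth_norm l k g"
proof (induction k arbitrary: f g)
 case 0
 thus ?case by (simp add: sup01_def)
next
 case (Suc k)
 have "smooth_norm l k (deriv01 f) = smooth_norm l k (deriv01 g)"
 by (rule Suc.IH) (rule deriv01_cong(1)[OF Suc.prems])
 thus ?case using Suc.IH[OF Suc.prems] by simp
qed

lemma smooth_norm_nonneg: "0 <= l ==> smooth_upto k f ==> 0 <= smooth_norm l k f"
proof (induction k arbitrary: f)
 case 0
 show ?case using order_trans[OF norm_ge_zero sup01_upper[OF 0(2), of 0]] by simp
qed (use smooth_upto_Suc in simp)

lemma smooth_norm_add:
 "0 <= l ==> smooth_upto k f ==> smooth_upto k g ==> smooth_norm l k (%t. f t + g t) <= smooth_norm l k f + smooth_norm l k g"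
proof (induction k arbitrary: f g)
 case 0
 show ?case
 using sup01_upper[OF "0.prems"(2)] sup01_upper[OF "0.prems"(3)] by (auto intro!: sup01_least norm_triangle_le add_mono)
next
 case (Suc k)
 have "smooth_norm l k (deriv01 (%t. f t + g t)) = smooth_norm l k (%t. deriv01 f t + deriv01 g t)"
 by (rule smooth_norm_cong) (use deriv01_ops(1) Suc.prems in simp)
 also have "... <= smooth_norm l k (deriv01 f) + smooth_norm l k (deriv01 g)" using Suc by simp
 finally have "l * smooth_norm l k (deriv01 (%t. f t + g t)) <= l * (smooth_norm l k (deriv01 f) + smooth_norm l k (deriv01 g))"
 using Suc.prems(1) by (rule mult_left_mono)
 thus ?case using Suc.IH[of f g] Suc.prems smooth_upto_Suc by (simp add: algebra_simps)
qed

lemma smooth_norm_scale: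
 "0 <= l ==> smooth_upto k f ==> smooth_norm l k (%t. c * f t) <= cmod c * smooth_norm l k f"
proof (induction k arbitrary: f)
 case 0
 show ?case using sup01_upper[OF "0.prems"(2)] by (auto intro!: sup01_least mult_left_mono simp: norm_mult)
next
 case (Suc k)
 have "smooth_norm l k (deriv01 (%t. c * f t)) = smooth_norm l k (%t. c * deriv01 f t)"
 by (rule smooth_norm_cong) (use deriv01_ops(5)[of f _ f] Suc.prems in auto)
 also have "... <= cmod c * smooth_norm l k (deriv01 f)" using Suc by simp
 finally have "l * smooth_norm l k (deriv01 (%t. c * f t)) <= l * (cmod c * smooth_norm l k (deriv01 f))"
 using Suc.prems(1) by (rule mult_left_mono)
 thus ?case using Suc.IH[of f] Suc.prems smooth_upto_Suc by (simp add: algebra_simps)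
qed

lemma smooth_norm_mult:
 "0 <= l ==> smooth_upto k f ==> smooth_upto k g ==> smooth_norm l k (%t. f t * g t) <= smooth_norm l k f * smooth_norm l k g"
proof (induction k arbitrary: f g)
 case 0
 have "cmod (f t * g t) <= sup01 f * sup01 g" if "t : {0..1}" for t
 unfolding norm_mult using sup01_upper[OF "0.prems"(2) that] sup01_upper[OF "0.prems"(3) that]
 by (intro mult_mono) (auto intro: order_trans[OF norm_ge_zero])
 thus ?case by (auto intro: sup01_least)
next
 case (Suc k)
 have s: "smooth_upto k f" "smooth_upto k g" "smooth_upto k (deriv01 f)" "smooth_upto k (deriv01 g)"
 using Suc.prems smooth_upto_Suc by auto
 let ?N = "smooth_norm l k"
 have "?N (deriv01 (%t. f t * g t)) = ?N (%t. f t * deriv01 g t + deriv01 f t * g t)"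
 by (rule smooth_norm_cong) (use deriv01_ops(3) Suc.prems in simp)
 also have "... <= ?N (%t. f t * deriv01 g t) + ?N (%t. deriv01 f t * g t)"
 by (rule smooth_norm_add[OF Suc.prems(1)]) (intro smooth_upto_mult s)+
 also have "... <= ?N f * ?N (deriv01 g) + ?N (deriv01 f) * ?N g"
 by (intro add_mono Suc.IH Suc.prems(1) s)
 finally have "l * ?N (deriv01 (%t. f t * g t)) <= l * (?N f * ?N (deriv01 g) + ?N (deriv01 f) * ?N g)"
 using Suc.prems(1) by (rule mult_left_mono)
 moreover have "?N (%t. f t * g t) <= ?N f * ?N g" by (intro Suc.IH Suc.prems(1) s)
 \<comment> \<open>This mixed term is what the product of the two norms has in excess of the Leibniz
   estimate.\<close>
 moreover have "0 <= (l * ?N (deriv01 f)) * (l * ?N (deriv01 g))"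
 using smooth_norm_nonneg[OF Suc.prems(1)] s Suc.prems(1) by (intro mult_nonneg_nonneg) auto
 ultimately show ?case by (simp add: algebra_simps)
qed

text \<open>Every derivative costs a factor of at most \<open>D\<close>. With \<open>m = 1\<close>
  and \<open>D = 1 / l\<close> the weighted norm still dominates the unweighted one up to a
  constant.\<close>

lemma smooth_norm_change:
 assumes "0 <= m" "m <= D * l" "1 <= D" "0 <= l"
 shows "smooth_upto k f ==> smooth_norm m k f <= D ^ k * smooth_norm l k f"
proof (induction k arbitrary: f)
 case (Suc k)
 have s: "smooth_upto k f" "smooth_upto k (deriv01 f)" using Suc.prems smooth_upto_Suc by auto
 let ?N = "smooth_norm l k"
 have n: "0 <= ?N f" "0 <= ?N (deriv01 f)" using smooth_norm_nonneg[OF assms(4)] s by auto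
 have "m * smooth_norm m k (deriv01 f) <= (D * l) * (D ^ k * ?N (deriv01 f))"
 using assms n Suc.IH[OF s(2)] smooth_norm_nonneg[OF assms(1) s(2)] by (intro mult_mono) auto
 moreover have "smooth_norm m k f <= D * (D ^ k * ?N f)"
 proof -
 have "0 <= D ^ k * ?N f" using n assms by simp
 hence "1 * (D ^ k * ?N f) <= D * (D ^ k * ?N f)" using assms(3) by (rule mult_right_mono[rotated])
 thus ?thesis using Suc.IH[OF s(1)] by simp
 qed
 ultimately show ?case by (simp add: algebra_simps)
qed simp

text \<open>Every term except the sup norm carries at least one factor \<open>l\<close>.\<close>

lemma smooth_norm_small_weight:
 assumes l: "0 <= l" "l <= 1"
 shows "smooth_upto k f ==> smooth_norm l k f <= sup01 f + l * smooth_norm 1 k f"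
proof (induction k arbitrary: f)
 case 0
 show ?case using smooth_norm_nonneg[OF zero_le_one 0] l by simp
next
 case (Suc k)
 have s: "smooth_upto k f" "smooth_upto k (deriv01 f)" using Suc.prems smooth_upto_Suc by auto
 have "smooth_norm l k (deriv01 f) <= smooth_norm 1 k (deriv01 f)"
 using smooth_norm_change[of l 1 1 k, OF l(1) _ _ _ s(2)] l by simp
 from mult_left_mono[OF this l(1)] show ?case using Suc.IH[OF s(1)] by (simp add: algebra_simps)
qed

lemma deriv_le_smooth_norm: "smooth_upto k f ==> t : {0..1} ==> cmod ((deriv01 ^^ k) f t) <= smooth_norm 1 k f"
proof (induction k arbitrary: f)
 case 0
 show ?case using sup01_upper[OF 0] by simp
next
 case (Suc k)
 have "cmod ((deriv01 ^^ k) (deriv01 f) t) <= smooth_norm 1 k (deriv01 f)" using Suc by simp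
 thus ?case using smooth_norm_nonneg[OF zero_le_one smooth_upto_Suc[OF Suc.prems(1)]] by (simp add: funpow_swap1)
qed

lemma smooth_norm_bounded:
 assumes "!!k. EX M. ALL f:S. ALL t:{0..1}. cmod ((deriv01 ^^ k) f t) <= M"
 shows "EX M. ALL f:S. smooth_norm 1 k f <= M"
 using assms
proof (induction k arbitrary: S)
 case 0
 obtain M where "ALL f:S. ALL t:{0..1}. cmod ((deriv01 ^^ 0) f t) <= M" using 0[of 0] by blast
 thus ?case by (intro exI[of _ M]) (auto intro: sup01_least)
next
 case (Suc k)
 obtain M where M: "ALL f:S. smooth_norm 1 k f <= M" using Suc.IH[OF Suc.prems] by blast
 have "EX M. ALL f:deriv01 ` S. smooth_norm 1 k f <= M"
 proof (rule Suc.IH)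
 show "EX M. ALL f:deriv01 ` S. ALL t:{0..1}. cmod ((deriv01 ^^ j) f t) <= M" for j
 using Suc.prems[of "Suc j"] by (simp add: funpow_swap1)
 qed
 then obtain M' where "ALL f:deriv01 ` S. smooth_norm 1 k f <= M'" by blast
 thus ?case using M by (intro exI[of _ "M + M'"]) (auto intro!: add_mono)
qed

text \<open>The scaling \<open>1 / (2 * m)\<close> depends only on a bound for the sup norms on
  \<open>S\<close>. For each \<open>k\<close> the weight \<open>l\<close> is then taken so small
  that the derivatives contribute at most another \<open>m\<close>, which puts the scaled set into
  the unit ball of \<open>smooth_norm l k\<close>.\<close>

lemma smooth_seminorm_algebra:
 "seminorm_algebra smooth01 {S. S <= smooth01 & (ALL k. EX M. ALL f:S. ALL t:{0..1}. cmod ((deriv01 ^^ k) f t) <= M)} (smooth_norm 1)"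
proof
 let ?B = "{S. S <= smooth01 & (ALL k. EX M. ALL f:S. ALL t:{0..1}. cmod ((deriv01 ^^ k) f t) <= M)}"
 have sm: "smooth_upto k f" if "f : smooth01" for f k using that by (simp add: smooth01_iff)
 have r: "(PATH t. h t) : smooth01" if "!!k. smooth_upto k h" for h
 proof -
 have "smooth_upto k (PATH t. h t)" for k using smooth_upto_cong[of "PATH t. h t" h k] that by simp
 thus ?thesis by (simp add: smooth01_iff)
 qed
 have nr: "smooth_norm l k (PATH t. h t) = smooth_norm l k h" for l k h by (rule smooth_norm_cong) simp
 show "f : extensional {0..1}" if "f : smooth01" for f using that by (simp add: smooth01_iff)
 show "(PATH t. f t + g t) : smooth01" "(PATH t. f t * g t) : smooth01"
 "smooth_norm 1 k (PATH t. f t + g t) <= smooth_norm 1 k f + smooth_norm 1 k g"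
 "smooth_norm 1 k (PATH t. f t * g t) <= smooth_norm 1 k f * smooth_norm 1 k g" if "f : smooth01" "g : smooth01" for f g k
 unfolding nr using that sm by (intro r smooth_upto_add smooth_upto_mult smooth_norm_add smooth_norm_mult; simp)+
 show "(PATH t. c * f t) : smooth01" "smooth_norm 1 k (PATH t. c * f t) <= cmod c * smooth_norm 1 k f"
 if "f : smooth01" for f c k
 unfolding nr using that sm by (intro r smooth_upto_mult smooth_upto_const smooth_norm_scale; simp)+
 show "(PATH t. 1) : smooth01" "(PATH t. cplx t) : smooth01"
 by (intro r smooth_upto_const smooth_upto_ident)+
 show "0 <= smooth_norm 1 k f" if "f : smooth01" for f k using smooth_norm_nonneg[OF zero_le_one sm[OF that]] .
 show "cmod (f t) <= smooth_norm 1 0 f" if "f : smooth01" "t : {0..1}" for f t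
 using sup01_upper[OF sm[OF that(1), of 0] that(2)] by simp
 show B: "S : ?B \<longleftrightarrow> S <= smooth01 & (ALL k. EX M. ALL f:S. smooth_norm 1 k f <= M)" for S
 proof
 assume "S : ?B"
 thus "S <= smooth01 & (ALL k. EX M. ALL f:S. smooth_norm 1 k f <= M)" using smooth_norm_bounded[of S] by blast
 next
 assume S: "S <= smooth01 & (ALL k. EX M. ALL f:S. smooth_norm 1 k f <= M)"
 have "EX M. ALL f:S. ALL t:{0..1}. cmod ((deriv01 ^^ k) f t) <= M" for k
 proof -
 obtain M where M: "ALL f:S. smooth_norm 1 k f <= M" using S by blast
 have "cmod ((deriv01 ^^ k) f t) <= M" if "f : S" "t : {0..1}" for f t
 using deriv_le_smooth_norm[OF sm that(2), of f k] S M that(1) by (meson order_trans subsetD)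
 thus ?thesis by blast
 qed
 thus "S : ?B" using S by blast
 qed
 fix S assume S: "S : ?B"
 hence S01: "S <= smooth01" and bd: "ALL k. EX M. ALL f:S. smooth_norm 1 k f <= M" using B[of S] by blast+
 obtain M where M: "ALL f:S. smooth_norm 1 0 f <= M" using bd by blast
 define m where "m = max M 1"
 have m: "m > 0" "!!f. f : S ==> sup01 f <= m" using M unfolding m_def by (auto simp: le_max_iff_disj)
 show "EX c>0. ALL k. EX q D. 0 <= D & (ALL f:smooth01. 0 <= q f & smooth_norm 1 k f <= D * q f)
    & (ALL f:smooth01. ALL g:smooth01. q (PATH t. f t * g t) <= q f * q g)
    & (ALL f:S. q (PATH t. cplx c * f t) <= 1)"
 proof (intro exI[of _ "1 / (2 * m)"] conjI allI)
 show "1 / (2 * m) > 0" using m(1) by simp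
 fix k
 obtain K where K: "ALL f:S. smooth_norm 1 k f <= K" using bd by blast
 define l where "l = min 1 (m / (max K 1))"
 have l: "0 < l" "l <= 1" "l * max K 1 <= m"
 proof -
 show "0 < l" "l <= 1" using m(1) by (auto simp: l_def)
 have "l <= m / max K 1" unfolding l_def by (rule min.cobounded2)
 thus "l * max K 1 <= m" by (simp add: pos_le_divide_eq)
 qed
 have D: "1 <= D * l" "1 <= D" if "D = 1 / l" for D using l that by auto
 show "EX q D. 0 <= D & (ALL f:smooth01. 0 <= q f & smooth_norm 1 k f <= D * q f)
      & (ALL f:smooth01. ALL g:smooth01. q (PATH t. f t * g t) <= q f * q g)
      & (ALL f:S. q (PATH t. cplx (1 / (2 * m)) * f t) <= 1)"
 proof (intro exI[of _ "smooth_norm l k"] exI[of _ "(1 / l) ^ k"] conjI ballI)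
 show "0 <= (1 / l) ^ k" using l by simp
 show "0 <= smooth_norm l k f" if "f : smooth01" for f using smooth_norm_nonneg[OF _ sm[OF that]] l by simp
 show "smooth_norm 1 k f <= (1 / l) ^ k * smooth_norm l k f" if "f : smooth01" for f
 by (rule smooth_norm_change[OF _ D(1)[OF refl] D(2)[OF refl] _ sm[OF that]]) (use l in auto)
 show "smooth_norm l k (PATH t. f t * g t) <= smooth_norm l k f * smooth_norm l k g" if "f : smooth01" "g : smooth01" for f g
 unfolding nr using smooth_norm_mult[OF _ sm[OF that(1)] sm[OF that(2)]] l by simp
 fix f assume f: "f : S"
 have s: "smooth_upto k f" using sm S01 f by blast
 have "l * smooth_norm 1 k f <= l * max K 1" using K f l by (intro mult_left_mono) (auto simp: le_max_iff_disj)
 hence "smooth_norm l k f <= 2 * m"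
 using smooth_norm_small_weight[OF less_imp_le[OF l(1)] l(2) s] l(3) m(2)[OF f] by linarith
 hence "cmod (cplx (1 / (2 * m))) * smooth_norm l k f <= cmod (cplx (1 / (2 * m))) * (2 * m)"
 by (rule mult_left_mono) simp
 also have "... = 1" unfolding norm_of_real using m(1) by simp
 finally show "smooth_norm l k (PATH t. cplx (1 / (2 * m)) * f t) <= 1"
 unfolding nr using smooth_norm_scale[OF _ s, of l "cplx (1 / (2 * m))"] l by simp
 qed
 qed
qed

theorem theorem3p28:
  fixes U :: "('n, 'r, 'a) extn" and X :: "('k, 'e, 'q) extn" and \<phi> :: "'a \<Rightarrow> 'q"
  assumes "universal_an_nilpotent_extension U"
    and "an_nilpotent_extension X"
    and "bdd_hom (quo U) (quo X) \<phi>"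
  shows "(\<exists>\<xi> \<psi>. extn_morphism U X \<xi> \<psi> \<phi>)
    \<and> (\<forall>\<xi>\<^sub>0 \<psi>\<^sub>0 \<xi>\<^sub>1 \<psi>\<^sub>1.
        extn_morphism U X \<xi>\<^sub>0 \<psi>\<^sub>0 \<phi> \<and> extn_morphism U X \<xi>\<^sub>1 \<psi>\<^sub>1 \<phi> \<longrightarrow>
        (\<exists>\<Xi> \<Psi> \<Phi>. extn_homotopy_between smooth_functions U X \<Xi> \<Psi> \<Phi> \<xi>\<^sub>0 \<psi>\<^sub>0 \<phi> \<xi>\<^sub>1 \<psi>\<^sub>1 \<phi>
          \<and> homotopy_relative_to smooth_functions (quo U) (quo X) \<Phi> \<phi>))
    \<and> (\<forall>F \<in> {smooth_functions, ac_functions}. \<forall>\<xi>\<^sub>0 \<psi>\<^sub>0 \<phi>\<^sub>0 \<xi>\<^sub>1 \<psi>\<^sub>1 \<phi>\<^sub>1 \<Phi>.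
        extn_morphism U X \<xi>\<^sub>0 \<psi>\<^sub>0 \<phi>\<^sub>0 \<and> extn_morphism U X \<xi>\<^sub>1 \<psi>\<^sub>1 \<phi>\<^sub>1
        \<and> homotopy_between F (quo U) (quo X) \<Phi> \<phi>\<^sub>0 \<phi>\<^sub>1 \<longrightarrow>
        (\<exists>\<Xi> \<Psi>. extn_homotopy_between F U X \<Xi> \<Psi> \<Phi> \<xi>\<^sub>0 \<psi>\<^sub>0 \<phi>\<^sub>0 \<xi>\<^sub>1 \<psi>\<^sub>1 \<phi>\<^sub>1))"
proof -
 note smooth = seminorm_algebra.path_alg[OF smooth_seminorm_algebra, folded smooth_functions_def]
 and ac = seminorm_algebra.path_alg[OF ac_seminorm_algebra, folded ac_functions_def]
 have homotopy: "EX \<Xi> \<Psi>. extn_homotopy_between F U X \<Xi> \<Psi> \<Phi> \<xi>0 \<psi>0 \<phi>0 \<xi>1 \<psi>1 \<phi>1"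
 if "F : {smooth_functions, ac_functions}" "extn_morphism U X \<xi>0 \<psi>0 \<phi>0 & extn_morphism U X \<xi>1 \<psi>1 \<phi>1
      & homotopy_between F (quo U) (quo X) \<Phi> \<phi>0 \<phi>1" for F \<xi>0 \<psi>0 \<phi>0 \<xi>1 \<psi>1 \<phi>1 \<Phi>
 using that path_alg.homotopy_lifting[OF smooth assms(1,2)] path_alg.homotopy_lifting[OF ac assms(1,2)] by blast
 show ?thesis
 by (intro conjI ballI allI impI lifting_exists[OF assms]; (elim conjE)?)
 (rule path_alg.lifting_unique[OF smooth assms(1,2)] homotopy; blast)+
qed

end
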